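(* Suppose Assumptions 1 and 2 (stated in the context) hold and let $\hat\mu(x)$ be the Mondrian random forest estimator with lifetime $\lambda=\lambda_n$ and $B=B_n$ trees. Define $$\tilde\Sigma(x)=\frac{n}{\lambda^d}\mathrm{Var}[\hat\mu(x)\mid\mathbf{X},\mathbf{T}],\qquad\Sigma(x)=\frac{\sigma^2(x)}{f(x)}\left(\frac{4-4\log2}{3}\right)^d.$$ Then $$\mathbb{E}\left[\big(\tilde\Sigma(x)-\Sigma(x)\big)^2\right]\lesssim\frac{\lambda^d}{n}+\frac1B+\frac{1}{\lambda^{2(1\wedge\beta_f\wedge\beta_\sigma)}}.$$
   Context: Notation. $\mathbb{N}=\{0,1,2,\dots\}$; $a\wedge b$ and $a\vee b$ are minimum and maximum. For non-negative sequences, $a_n\lesssim b_n$ (equivalently $b_n\gtrsim a_n$) means $a_n/b_n$ is bounded over $n\ge1$ (the bound may depend on fixed quantities such as $d$, $x$, the law of the data and the sequences $\lambda_n,B_n$, but not on $n$). $\mathbb{I}$ denotes an indicator. Hölder classes. For $\beta>0$ let $\underline{\beta}=\lceil\beta-1\rceil$ be the largest integer strictly less than $\beta$. Write $g\in\mathcal{H}^\beta$ if $g:[0,1]^d\to\mathbb{R}$ is $\underline\beta$ times differentiable and, for some $C>0$, $\max_{|\nu|=\underline\beta}|\partial^\nu g(x)-\partial^\nu g(x')|\le C\|x-x'\|_2^{\beta-\underline\beta}$ for all $x,x'\in[0,1]^d$ ($\nu\in\mathbb{N}^d$ a multi-index). Assumption 1 (data). Fix $d\ge1$. $(X_i,Y_i)$,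 $1\le i\le n$, are i.i.d. from a distribution on $\mathbb{R}^d\times\mathbb{R}$; $\mathbf{X}=(X_1,\dots,X_n)$. $X_i$ has a Lebesgue density $f$ on $[0,1]^d$, bounded away from zero, with $f\in\mathcal{H}^{\beta_f}$ for some $\beta_f>0$. $\mathbb{E}[Y_i^2\mid X_i]$ is bounded, $\mu(X_i)=\mathbb{E}[Y_i\mid X_i]$ with $\mu\in\mathcal{H}^{\beta_\mu}$, $\beta_\mu>0$. With $\varepsilon_i=Y_i-\mu(X_i)$, $\sigma^2(X_i)=\mathbb{E}[\varepsilon_i^2\mid X_i]$ is bounded away from zero with $\sigma^2\in\mathcal{H}^{\beta_\sigma}$, $\beta_\sigma>0$. Set $\beta=\beta_\mu\wedge(\beta_f+1)$. Mondrian process $\mathcal{M}([0,1]^d,\lambda)$. For a rectangle $D=\prod_j[a_j,b_j]\subseteq[0,1]^d$ let $|D_j|=b_j-a_j$, $|D|=\prod_j|D_j|$, $|D|_1=\sum_j|D_j|$. Start at time $0$ with the trivial partition of $[0,1]^d$. For each cell $D$, formed at time $t_D$, sample $E_D\sim\mathrm{Exp}(|D|_1)$ (rate $|D|_1$) independently. If $t_D+E_D\le\lambda$, split $D$: choose coordinate $J$ with $\mathbb{P}(J=j)=|D_j|/|D|_1$ and location $S_J\sim\mathrm{Unif}[a_J,b_J]$, producing cells $\{x\in D:x_J\le S_J\}$ and $\{x\in D:x_J>S_J\}$, each formed at time $t_D+E_D$. The output $T$ is the partition consisting of the cells not split (those with $t_D+E_D>\lambda$); $T(x)$ is the cell containing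 $x$. Mondrian random forest. $\mathbf{T}=(T_1,\dots,T_B)$ are i.i.d. $\mathcal{M}([0,1]^d,\lambda)$, independent of the data; $N_b(x)=\sum_{i=1}^n\mathbb{I}\{X_i\in T_b(x)\}$; $\hat\mu(x)=\frac1B\sum_{b=1}^B\frac{\sum_{i=1}^nY_i\,\mathbb{I}\{X_i\in T_b(x)\}}{N_b(x)}$, with $0/0=0$. Assumption 2 (estimator). $x\in(0,1)^d$ is a fixed point; $\lambda=\lambda_n>0$ and $B=B_n\ge1$ satisfy $\lambda\gtrsim(\log n)^3$, $n/\lambda^d\to\infty$, and $B\gtrsim(\log n)^d$. The dimension $d$ does not depend on $n$. *)

theory Defs
  imports "HOL-Probability.Probability"
begin

section \<open>Asymptotic bounds and Hoelder classes\<close>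

text \<open>For \<open>b > 0\<close> this says that \<open>a n / b n\<close> is bounded over \<open>n \<ge> 1\<close>.\<close>
definition lesssim :: "(nat \<Rightarrow> real) \<Rightarrow> (nat \<Rightarrow> real) \<Rightarrow> bool" where
  "lesssim a b \<longleftrightarrow> (\<exists>C. \<forall>n\<ge>1. a n \<le> C * b n)"

abbreviation unit_cube :: "(real ^ 'd::finite) set" where
  "unit_cube \<equiv> cbox 0 1"

text \<open>
  \<open>D \<nu>\<close> is the partial derivative of \<open>g\<close> with multi-index \<open>\<nu>\<close>. Differentiability is taken
  relative to the closed cube, so it is one-sided at the boundary; derivatives within the cube are
  unique, hence \<open>D \<nu>\<close> is determined on the cube for all \<open>\<nu>\<close> of order at most \<open>k\<close>.
\<close>
definition partials_upto ::
    "nat \<Rightarrow> (real ^ 'd \<Rightarrow> real) \<Rightarrow> (('d \<Rightarrow> nat) \<Rightarrow> real ^ 'd \<Rightarrow> real) \<Rightarrow> bool" where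
  "partials_upto k g D \<longleftrightarrow>
     (\<forall>x\<in>unit_cube. D (\<lambda>_. 0) x = g x) \<and>
     (\<forall>\<nu>. (\<Sum>j\<in>UNIV. \<nu> j) < k \<longrightarrow> (\<forall>x\<in>unit_cube.
        (D \<nu> has_derivative (\<lambda>h. \<Sum>j\<in>UNIV. D (\<nu>(j := Suc (\<nu> j))) x * h $ j))
          (at x within unit_cube)))"

definition holder_class :: "real \<Rightarrow> (real ^ 'd \<Rightarrow> real) set" where
  "holder_class \<beta> = {g. \<exists>D C. C > 0 \<and> partials_upto (nat \<lceil>\<beta> - 1\<rceil>) g D \<and>
     (\<forall>\<nu>. (\<Sum>j\<in>UNIV. \<nu> j) = nat \<lceil>\<beta> - 1\<rceil> \<longrightarrow> (\<forall>x\<in>unit_cube. \<forall>y\<in>unit_cube.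
        \<bar>D \<nu> x - D \<nu> y\<bar> \<le> C * norm (x - y) powr (\<beta> - of_int \<lceil>\<beta> - 1\<rceil>)))}"


section \<open>The Mondrian process\<close>

text \<open>The box with lower corner \<open>a\<close> and upper corner \<open>b\<close> is encoded as \<open>(a, b)\<close>.\<close>
type_synonym 'd rect = "(real ^ 'd) \<times> (real ^ 'd)"

text \<open>
  The truncation at \<open>0\<close> has no effect on boxes with \<open>a \<le> b\<close>. It makes the kernels below
  subprobability kernels on the whole type, which the monadic bind requires.
\<close>
definition side :: "'d::finite rect \<Rightarrow> 'd \<Rightarrow> real" where
  "side D j = max 0 (snd D $ j - fst D $ j)"

definition linear_size :: "'d::finite rect \<Rightarrow> real" where
  "linear_size D = (\<Sum>j\<in>UNIV. side D j)"

definition lower_child :: "'d::finite rect \<Rightarrow> 'd \<Rightarrow> real \<Rightarrow> 'd::finite rect" where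
  "lower_child D J S = (fst D, \<chi> j. if j = J then S else snd D $ j)"

definition upper_child :: "'d::finite rect \<Rightarrow> 'd \<Rightarrow> real \<Rightarrow> 'd::finite rect" where
  "upper_child D J S = (\<chi> j. if j = J then S else fst D $ j, snd D)"

definition split_axis :: "'d::finite rect \<Rightarrow> 'd measure" where
  "split_axis D = density (count_space UNIV) (\<lambda>j. ennreal (side D j / linear_size D))"

definition split_point :: "'d::finite rect \<Rightarrow> 'd \<Rightarrow> real measure" where
  "split_point D J = uniform_measure lborel {fst D $ J .. snd D $ J}"

text \<open>
  A finite hierarchical axis-aligned partition is a binary tree whose inner nodes carry the
  coordinate and the location of the split, and whose leaves are the cells.
\<close>
type_synonym 'd split_tree = "('d \<times> real) tree"

abbreviation split_tree_algebra :: "'d split_tree measure" where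
  "split_tree_algebra \<equiv> tree_sigma (count_space UNIV \<Otimes>\<^sub>M borel)"

text \<open>
  \<open>mondrian_upto k lam D t\<close> is the law of the partition of a cell \<open>D\<close> formed at time \<open>t\<close>, restricted to
  the event that the resulting tree has height less than \<open>k\<close>. These subprobability measures increase
  with \<open>k\<close>; since the process almost surely performs finitely many splits before the lifetime, their
  supremum is the law of the completed partition.
\<close>
primrec mondrian_upto :: "nat \<Rightarrow> real \<Rightarrow> 'd::finite rect \<Rightarrow> real \<Rightarrow> 'd split_tree measure" where
  "mondrian_upto 0 lam D t = null_measure split_tree_algebra"
| "mondrian_upto (Suc k) lam D t =
     do {
       E \<leftarrow> density lborel (exponential_density (linear_size D));
       if t + E \<le> lam then
         do {
           J \<leftarrow> split_axis D;
           S \<leftarrow> split_point D J;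
           l \<leftarrow> mondrian_upto k lam (lower_child D J S) (t + E);
           r \<leftarrow> mondrian_upto k lam (upper_child D J S) (t + E);
           return split_tree_algebra (Node l (J, S) r)
         }
       else return split_tree_algebra Leaf
     }"

definition mondrian :: "real \<Rightarrow> 'd::finite split_tree measure" where
  "mondrian lam = (SUP k. mondrian_upto k lam (0, 1) 0)"

primrec cells :: "'d::finite split_tree \<Rightarrow> (real ^ 'd) set \<Rightarrow> (real ^ 'd) set set" where
  "cells Leaf D = {D}"
| "cells (Node l s r) D =
     cells l {y \<in> D. y $ fst s \<le> snd s} \<union> cells r {y \<in> D. y $ fst s > snd s}"

definition cell_at :: "'d::finite split_tree \<Rightarrow> real ^ 'd \<Rightarrow> (real ^ 'd) set" where
  "cell_at T x = (THE C. C \<in> cells T unit_cube \<and> x \<in> C)"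


section \<open>Data and forest\<close>

definition cond_var :: "'a measure \<Rightarrow> 'a measure \<Rightarrow> ('a \<Rightarrow> real) \<Rightarrow> 'a \<Rightarrow> real" where
  "cond_var M F Z = real_cond_exp M F (\<lambda>\<omega>. (Z \<omega> - real_cond_exp M F Z \<omega>)\<^sup>2)"

text \<open>
  \<open>P\<close> is the common law of the pairs \<open>(X, Y)\<close>, and \<open>sig2\<close> is the conditional variance function.
  Only the values of \<open>f\<close>, \<open>mu\<close> and \<open>sig2\<close> on the unit cube matter, up to measurability.
\<close>
locale regression_law = prob_space P
  for P :: "((real ^ 'd::finite) \<times> real) measure" +
  fixes f mu sig2 :: "real ^ 'd \<Rightarrow> real" and beta_f beta_mu beta_sig :: real
  assumes sets_P: "sets P = sets borel"
    and density_X: "distributed P lborel fst (\<lambda>x. ennreal (f x * indicat_real unit_cube x))"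
    and f_bounded_below: "\<exists>c>0. \<forall>x\<in>unit_cube. c \<le> f x"
    and f_holder: "beta_f > 0" "f \<in> holder_class beta_f"
    and second_moment: "\<exists>C. AE z in P.
      nn_cond_exp P (vimage_algebra (space P) fst borel) (\<lambda>z. ennreal ((snd z)\<^sup>2)) z \<le> ennreal C"
    and regression: "AE z in P.
      real_cond_exp P (vimage_algebra (space P) fst borel) snd z = mu (fst z)"
    and mu_holder: "beta_mu > 0" "mu \<in> holder_class beta_mu"
    and noise: "AE z in P.
      real_cond_exp P (vimage_algebra (space P) fst borel) (\<lambda>z. (snd z - mu (fst z))\<^sup>2) z
        = sig2 (fst z)"
    and sig2_bounded_below: "\<exists>c>0. \<forall>x\<in>unit_cube. c \<le> sig2 x"
    and sig2_holder: "beta_sig > 0" "sig2 \<in> holder_class beta_sig"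

locale forest_sample = prob_space M
  for M :: "'w measure" +
  fixes P :: "((real ^ 'd::finite) \<times> real) measure"
    and n B :: nat and lam :: real
    and X :: "nat \<Rightarrow> 'w \<Rightarrow> real ^ 'd" and Y :: "nat \<Rightarrow> 'w \<Rightarrow> real"
    and T :: "nat \<Rightarrow> 'w \<Rightarrow> 'd split_tree"
  assumes data_law: "\<And>i. i \<in> {1..n} \<Longrightarrow> distr M borel (\<lambda>\<omega>. (X i \<omega>, Y i \<omega>)) = P"
    and data_indep: "indep_vars (\<lambda>_. borel) (\<lambda>i \<omega>. (X i \<omega>, Y i \<omega>)) {1..n}"
    and tree_law: "\<And>b. b \<in> {1..B} \<Longrightarrow> distr M split_tree_algebra (T b) = mondrian lam"
    and tree_indep: "indep_vars (\<lambda>_. split_tree_algebra) T {1..B}"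
    and data_tree_indep: "indep_set
      (sets (vimage_algebra (space M) (\<lambda>\<omega>. \<lambda>i\<in>{1..n}. (X i \<omega>, Y i \<omega>)) (PiM {1..n} (\<lambda>_. borel))))
      (sets (vimage_algebra (space M) (\<lambda>\<omega>. \<lambda>b\<in>{1..B}. T b \<omega>)
        (PiM {1..B} (\<lambda>_. split_tree_algebra))))"

definition forest_estimate ::
    "nat \<Rightarrow> nat \<Rightarrow> (nat \<Rightarrow> 'w \<Rightarrow> real ^ 'd::finite) \<Rightarrow> (nat \<Rightarrow> 'w \<Rightarrow> real) \<Rightarrow>
     (nat \<Rightarrow> 'w \<Rightarrow> 'd split_tree) \<Rightarrow> real ^ 'd \<Rightarrow> 'w \<Rightarrow> real" where
  "forest_estimate n B X Y T x \<omega> =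
     (1 / real B) * (\<Sum>b = 1..B.
       (\<Sum>i = 1..n. Y i \<omega> * indicat_real (cell_at (T b \<omega>) x) (X i \<omega>)) /
       (\<Sum>i = 1..n. indicat_real (cell_at (T b \<omega>) x) (X i \<omega>)))"

definition covariates_trees_algebra ::
    "'w measure \<Rightarrow> nat \<Rightarrow> nat \<Rightarrow> (nat \<Rightarrow> 'w \<Rightarrow> real ^ 'd::finite) \<Rightarrow>
     (nat \<Rightarrow> 'w \<Rightarrow> 'd split_tree) \<Rightarrow> 'w measure" where
  "covariates_trees_algebra M n B X T = vimage_algebra (space M)
     (\<lambda>\<omega>. (\<lambda>i\<in>{1..n}. X i \<omega>, \<lambda>b\<in>{1..B}. T b \<omega>))
     (PiM {1..n} (\<lambda>_. borel) \<Otimes>\<^sub>M PiM {1..B} (\<lambda>_. split_tree_algebra))"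

definition Sigma_tilde ::
    "'w measure \<Rightarrow> nat \<Rightarrow> nat \<Rightarrow> real \<Rightarrow> (nat \<Rightarrow> 'w \<Rightarrow> real ^ 'd::finite) \<Rightarrow>
     (nat \<Rightarrow> 'w \<Rightarrow> real) \<Rightarrow> (nat \<Rightarrow> 'w \<Rightarrow> 'd split_tree) \<Rightarrow> real ^ 'd \<Rightarrow> 'w \<Rightarrow> real" where
  "Sigma_tilde M n B lam X Y T x \<omega> = real n / lam ^ CARD('d) *
     cond_var M (covariates_trees_algebra M n B X T) (forest_estimate n B X Y T x) \<omega>"

definition Sigma_limit ::
    "(real ^ 'd::finite \<Rightarrow> real) \<Rightarrow> (real ^ 'd \<Rightarrow> real) \<Rightarrow> real ^ 'd \<Rightarrow> real" where
  "Sigma_limit f sig2 x = sig2 x / f x * ((4 - 4 * ln 2) / 3) ^ CARD('d)"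

end

theory Submission
  imports Defs "HOL-Real_Asymp.Real_Asymp"
begin

text \<open>
  The conditional variance is \<open>\<Sum>i. w\<^sub>i\<^sup>2 \<sigma>\<^sup>2(X\<^sub>i)\<close>, where \<open>w\<^sub>i\<close> is the forest weight of the \<open>i\<close>-th
  observation; after scaling it is the average over pairs of trees of a ratio comparing a sum over
  the intersection of two cells with the product of the counts in these cells.
  For two different trees, conditionally on the trees, this ratio is within
  \<open>O(\<lambda>\<^sup>d / n)\<close> (mean square) of \<open>\<sigma>\<^sup>2(x) / f(x)\<close> times the normalised overlap of the two cells, up to a
  bias governed by the diameters of the cells. The overlap is a product over the coordinates.
  The distances from \<open>x\<close> to the faces of its cell are independent truncated exponential variables, so
  the expected overlap is \<open>((4 - 4 ln 2) / 3)\<^sup>d + O(1 / \<lambda>)\<close>. Averages over pairs of distinct trees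
  fluctuate by \<open>O(1 / B)\<close> in mean square, because disjoint pairs are uncorrelated. The \<open>B\<close> diagonal pairs
  have second moment \<open>O((ln n)\<^sup>d)\<close> and weight \<open>1 / B\<^sup>2\<close>, which is where \<open>B \<ge> c (ln n)\<^sup>d\<close> enters.
\<close>

section \<open>The law of the cell around a point\<close>

text \<open>The truncated laws \<open>mondrian_upto\<close> lose mass, so induction on the depth can
  only give upper bounds. The probability that no split crosses a given box around \<open>x\<close>
  is therefore bounded from above together with that of the complementary event; the two bounds add
  up to 1, and \<open>mondrian lam\<close> has mass 1 because it is the law of a tree, so both are
  equalities. The value exp(- lam * sum of side lengths) factorises over the 2d faces, which is the
  source of independence. The width of a cell along one axis behaves like a sum of two exponentials,
  whose density vanishes linearly at 0, so negative moments exist only below order 2. This decides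
  the form of the variance bounds: the error for two cells of masses p and p' is put into the
  symmetric form 1 / (n (p p')^(3/2)), with an exponent below 2 in each cell. On the diagonal the
  exponent is 2, and the growth 1 / (2 - \<alpha>) of the moments near the critical order becomes
  the power of ln n. All constants are built from quantities fixed over n, among them a positive
  lower bound \<open>lam0\<close> of the lifetimes.\<close>

lemma side_measurable [measurable]: "(\<lambda>D. side D j) \<in> borel_measurable (borel :: 'd::finite rect measure)"
  unfolding side_def
  by (intro borel_measurable_continuous_onI continuous_intros)

lemma linear_size_measurable [measurable]: "linear_size \<in> borel_measurable (borel :: 'd::finite rect measure)"
  unfolding linear_size_def[abs_def] by measurable

lemma side_nonneg [simp]: "side D j \<ge> 0"
  by (simp add: side_def)

lemma linear_size_nonneg [simp]: "linear_size D \<ge> 0"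
  by (simp add: linear_size_def sum_nonneg)

lemma lower_child_measurable [measurable]:
  "(\<lambda>(D, S). lower_child D J S) \<in> (borel :: 'd::finite rect measure) \<Otimes>\<^sub>M borel \<rightarrow>\<^sub>M borel"
proof -
  have "continuous_on UNIV (\<lambda>p::'d rect \<times> real. lower_child (fst p) J (snd p))"
    unfolding lower_child_def
    proof (intro continuous_intros continuous_on_vec_lambda)
    show "continuous_on UNIV (\<lambda>p. if j = J then snd p else snd (fst p) $ j)" for j
      by (cases "j = J") (auto intro!: continuous_intros)
  qed
  then show ?thesis
    by (auto simp: borel_prod case_prod_beta intro!: borel_measurable_continuous_onI)
qed

lemma upper_child_measurable [measurable]:
  "(\<lambda>(D, S). upper_child D J S) \<in> (borel :: 'd::finite rect measure) \<Otimes>\<^sub>M borel \<rightarrow>\<^sub>M borel"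
proof -
  have "continuous_on UNIV (\<lambda>p::'d rect \<times> real. upper_child (fst p) J (snd p))"
    unfolding upper_child_def
    proof (intro continuous_intros continuous_on_vec_lambda)
    show "continuous_on UNIV (\<lambda>p. if j = J then snd p else fst (fst p) $ j)" for j
      by (cases "j = J") (auto intro!: continuous_intros)
  qed
  then show ?thesis
    by (auto simp: borel_prod case_prod_beta intro!: borel_measurable_continuous_onI)
qed

section \<open>Kernels of the Mondrian recursion and their integrals\<close>

lemma exponential_density_measurable2 [measurable]:
  "(\<lambda>(l, x). exponential_density l x) \<in> borel_measurable (borel \<Otimes>\<^sub>M borel)"
  unfolding exponential_density_def by measurable

text \<open>At rate 0 the density is identically 0, so a cell without extent receives the zero
  measure instead of a waiting time at infinity. The kernel is therefore only a subprobability
  kernel.\<close>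

lemma nn_integral_exponential_density:
  assumes "l \<ge> 0"
  shows "(\<integral>\<^sup>+x. ennreal (exponential_density l x) \<partial>lborel) = (if l = 0 then 0 else 1)"
proof (cases "l = 0")
  case True
  then have "exponential_density l x = 0" for x
    by (auto simp: exponential_density_def)
  with True show ?thesis by simp
next
  case False
  with assms interpret prob_space "density lborel (exponential_density l)"
    by (intro prob_space_exponential_density) auto
  show ?thesis using emeasure_space_1 False
    by (simp add: emeasure_density)
qed

lemma exponential_kernel:
  "(\<lambda>D. density lborel (\<lambda>x. ennreal (exponential_density (linear_size D) x)))
     \<in> (borel :: 'd::finite rect measure) \<rightarrow>\<^sub>M subprob_algebra borel"
proof (rule measurable_subprob_algebra)
  fix D :: "'d rect"
  show "subprob_space (density lborel (\<lambda>x. ennreal (exponential_density (linear_size D) x)))"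
    by (rule subprob_spaceI) (auto simp: emeasure_density nn_integral_exponential_density)
  show "sets (density lborel (\<lambda>x. ennreal (exponential_density (linear_size D) x))) = sets borel"
    by simp
next
  fix A :: "real set" assume [measurable]: "A \<in> sets borel"
  show "(\<lambda>D. emeasure (density lborel (\<lambda>x. ennreal (exponential_density (linear_size D) x))) A)
      \<in> borel_measurable (borel :: 'd rect measure)"
    by (simp add: emeasure_density)
qed

lemma nn_integral_split_axis:
  fixes D :: "'d::finite rect"
  shows "(\<integral>\<^sup>+J. g J \<partial>split_axis D) = (\<Sum>J\<in>UNIV. ennreal (side D J / linear_size D) * g J)"
  unfolding split_axis_def
  by (subst nn_integral_density) (auto simp: nn_integral_count_space_finite)

lemma split_axis_kernel:
  "split_axis \<in> (borel :: 'd::finite rect measure) \<rightarrow>\<^sub>M subprob_algebra (count_space UNIV)"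
proof (rule measurable_subprob_algebra)
  fix D :: "'d rect"
  have le: "(\<Sum>J\<in>UNIV. side D J / linear_size D) \<le> 1"
    by (simp flip: sum_divide_distrib add: linear_size_def[symmetric])
  have "emeasure (split_axis D) (space (split_axis D)) = (\<integral>\<^sup>+J. 1 \<partial>split_axis D)"
    by simp
  also have "\<dots> = ennreal (\<Sum>J\<in>UNIV. side D J / linear_size D)"
    by (subst nn_integral_split_axis) (simp add: sum_ennreal)
  also have "\<dots> \<le> 1"
    using le by (metis ennreal_1 ennreal_leI)
  finally show "subprob_space (split_axis D)"
    by (intro subprob_spaceI) (auto simp: split_axis_def)
  show "sets (split_axis D) = sets (count_space UNIV)"
    by (simp add: split_axis_def)
next
  fix A :: "'d set"
  have "emeasure (split_axis D) A = (\<Sum>J\<in>UNIV. ennreal (side D J / linear_size D) * indicator A J)" for D :: "'d rect"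
    using nn_integral_split_axis[of D "indicator A"]
    by (subst (asm) nn_integral_indicator) (auto simp: split_axis_def)
  then show "(\<lambda>D. emeasure (split_axis D) A) \<in> borel_measurable (borel :: 'd rect measure)"
    by simp
qed

lemma nn_integral_split_point:
  assumes [measurable]: "g \<in> borel_measurable borel"
  shows "(\<integral>\<^sup>+S. g S \<partial>split_point D J) =
    (\<integral>\<^sup>+S. g S * indicator {fst D $ J .. snd D $ J} S \<partial>lborel) / ennreal (side D J)"
proof -
  have "emeasure lborel {fst D $ J .. snd D $ J} = ennreal (side D J)"
    by (cases "fst D $ J \<le> snd D $ J") (auto simp: side_def)
  then show ?thesis
    unfolding split_point_def
    by (subst nn_integral_uniform_measure) auto
qed

text \<open>On an interval of length 0 the uniform measure is null: numerator and denominator vanish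
  and 0 / 0 = 0 in \<open>ennreal\<close>. Hence degenerate cells also give a subprobability
  measure.\<close>

lemma split_point_kernel:
  "(\<lambda>D. split_point D J) \<in> (borel :: 'd::finite rect measure) \<rightarrow>\<^sub>M subprob_algebra borel"
proof (rule measurable_subprob_algebra)
  fix D :: "'d rect"
  have eq: "emeasure lborel {fst D $ J .. snd D $ J} = ennreal (side D J)"
    by (cases "fst D $ J \<le> snd D $ J") (auto simp: side_def)
  have "emeasure (split_point D J) (space (split_point D J)) = (\<integral>\<^sup>+S. 1 \<partial>split_point D J)"
    by simp
  also have "\<dots> = ennreal (side D J) / ennreal (side D J)"
    by (subst nn_integral_split_point) (auto simp: eq)
  also have "\<dots> \<le> 1"
    by (cases "side D J = 0") (auto simp: divide_ennreal)
  finally show "subprob_space (split_point D J)"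
    by (intro subprob_spaceI) (auto simp: split_point_def)
  show "sets (split_point D J) = sets borel"
    by (simp add: split_point_def)
next
  fix A :: "real set" assume [measurable]: "A \<in> sets borel"
  have [measurable]: "(\<lambda>D::'d rect. fst D $ J) \<in> borel_measurable borel"
    "(\<lambda>D::'d rect. snd D $ J) \<in> borel_measurable borel"
    by (intro borel_measurable_continuous_onI continuous_intros)+
  have "emeasure (split_point D J) A = (\<integral>\<^sup>+S. indicator A S * indicator {fst D $ J .. snd D $ J} S \<partial>lborel) / ennreal (side D J)"
    for D :: "'d rect"
    by (subst nn_integral_split_point[symmetric], simp, subst nn_integral_indicator)
      (auto simp: split_point_def)
  moreover have "(\<lambda>D. (\<integral>\<^sup>+S. indicator A S * indicator {fst D $ J .. snd D $ J} S \<partial>lborel) / ennreal (side D J))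
     \<in> borel_measurable (borel :: 'd rect measure)"
    unfolding atLeastAtMost_def atLeast_def atMost_def indicator_def by measurable
  ultimately show "(\<lambda>D. emeasure (split_point D J) A) \<in> borel_measurable (borel :: 'd rect measure)"
    by simp
qed

lemma space_split_tree_algebra [simp]: "space (split_tree_algebra :: 'd::finite split_tree measure) = UNIV"
  by (simp add: space_tree_sigma space_pair_measure)

text \<open>Cell and time are arbitrary measurable functions of a parameter, since inside the
  recursion the child cells and the time depend on the split drawn before.\<close>

lemma mondrian_upto_kernel':
  fixes D :: "'a \<Rightarrow> 'd::finite rect"
  assumes "D \<in> borel_measurable N" "t \<in> borel_measurable N"
  shows "(\<lambda>x. mondrian_upto k lam (D x) (t x)) \<in> N \<rightarrow>\<^sub>M subprob_algebra split_tree_algebra"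
proof -
  have "(\<lambda>x. mondrian_upto k lam (fst x) (snd x)) \<in>
     (borel :: 'd rect measure) \<Otimes>\<^sub>M borel \<rightarrow>\<^sub>M subprob_algebra split_tree_algebra"
  proof (induction k)
    case 0
    have "subprob_space (null_measure (split_tree_algebra :: 'd split_tree measure))"
      by (rule subprob_spaceI) (auto simp: space_tree_sigma)
    then show ?case
      by (auto intro!: measurable_const simp: space_subprob_algebra)
  next
    case (Suc k)
    have K: "(\<lambda>x. mondrian_upto k lam (D x) (t x)) \<in> N \<rightarrow>\<^sub>M subprob_algebra split_tree_algebra"
      if "D \<in> borel_measurable N" "t \<in> borel_measurable N"
      for D :: "'n \<Rightarrow> 'd rect" and t and N :: "'n measure"
      using measurable_compose[OF measurable_Pair[OF that] Suc] by simp
    have C: "(\<lambda>x. lower_child (D x) J (S x)) \<in> borel_measurable N"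
       "(\<lambda>x. upper_child (D x) J (S x)) \<in> borel_measurable N"
      if "D \<in> borel_measurable N" "S \<in> borel_measurable N"
      for D :: "'n \<Rightarrow> 'd rect" and S J and N :: "'n measure"
      using measurable_compose[OF measurable_Pair[OF that] lower_child_measurable]
        measurable_compose[OF measurable_Pair[OF that] upper_child_measurable] by auto
    show ?case
      unfolding mondrian_upto.simps
      apply (rule measurable_bind[where N = borel])
      subgoal by (rule measurable_compose[OF _ exponential_kernel]) measurable
      apply (rule measurable_If)
      subgoal
        apply (rule measurable_bind[where N = "count_space UNIV"])
        subgoal by (rule measurable_compose[OF _ split_axis_kernel]) measurable
        \<comment> \<open>Measurability of the children is available only for a fixed axis; the axes
          form a countable set, so the axis can be fixed first.\<close>
        apply (rule measurable_compose_countable[where g = snd])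
        subgoal
          apply (rule measurable_bind[where N = borel])
          subgoal by (rule measurable_compose[OF _ split_point_kernel]) measurable
          apply (rule measurable_bind[OF K])
          subgoal by (rule C) measurable
          subgoal by measurable
          apply (rule measurable_bind[OF K])
          subgoal by (rule C) measurable
          subgoal by measurable
          by (rule measurable_compose[OF _ return_measurable]) measurable
        by measurable
      subgoal by (rule measurable_const) (auto simp: space_subprob_algebra subprob_space_return)
      by measurable
  qed
  from measurable_compose[OF measurable_Pair[OF assms] this] show ?thesis
    by simp
qed

lemma sets_mondrian_upto [simp, measurable_cong]: "sets (mondrian_upto k lam D t) = sets split_tree_algebra"
  and subprob_mondrian_upto: "subprob_space (mondrian_upto k lam D t)"
proof -
  \<comment> \<open>A constant kernel still takes its value in the space of subprobability measures,
    which yields both claims.\<close>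
  have "(\<lambda>x. mondrian_upto k lam D t) \<in> (borel :: real measure) \<rightarrow>\<^sub>M subprob_algebra split_tree_algebra"
    by (rule mondrian_upto_kernel') auto
  from measurable_space[OF this, of 0] show "sets (mondrian_upto k lam D t) = sets split_tree_algebra"
    "subprob_space (mondrian_upto k lam D t)"
    by (auto simp: space_subprob_algebra)
qed

text \<open>Turns the monadic recursion into iterated integrals over waiting time, axis, location
  and the two subtrees. Both later inductions on the depth work with this form.\<close>

lemma nn_integral_mondrian_upto_Suc:
  fixes D :: "'d::finite rect"
  assumes [measurable]: "\<phi> \<in> borel_measurable (split_tree_algebra :: 'd split_tree measure)"
  shows "(\<integral>\<^sup>+T. \<phi> T \<partial>mondrian_upto (Suc k) lam D t) =
    (\<integral>\<^sup>+E. ennreal (exponential_density (linear_size D) E) *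
      (if t + E \<le> lam then
        (\<Sum>J\<in>UNIV. ennreal (side D J / linear_size D) * (
          (\<integral>\<^sup>+S. (\<integral>\<^sup>+l. \<integral>\<^sup>+r. \<phi> (Node l (J, S) r) \<partial>mondrian_upto k lam (upper_child D J S) (t + E)
             \<partial>mondrian_upto k lam (lower_child D J S) (t + E)) * indicator {fst D $ J .. snd D $ J} S \<partial>lborel)
          / ennreal (side D J)))
       else \<phi> Leaf) \<partial>lborel)"
proof -
  let ?A = "split_tree_algebra :: 'd split_tree measure"
  have K: "(\<lambda>x. mondrian_upto k lam (D x) (t x)) \<in> N \<rightarrow>\<^sub>M subprob_algebra ?A"
    if "D \<in> borel_measurable N" "t \<in> borel_measurable N"
    for D :: "'n \<Rightarrow> 'd rect" and t and N :: "'n measure"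
    using mondrian_upto_kernel'[OF that] .
  have C: "(\<lambda>x. lower_child (D x) J (S x)) \<in> borel_measurable N"
     "(\<lambda>x. upper_child (D x) J (S x)) \<in> borel_measurable N"
    if "D \<in> borel_measurable N" "S \<in> borel_measurable N"
    for D :: "'n \<Rightarrow> 'd rect" and S J and N :: "'n measure"
    using measurable_compose[OF measurable_Pair[OF that] lower_child_measurable]
      measurable_compose[OF measurable_Pair[OF that] upper_child_measurable] by auto
  \<comment> \<open>\<open>R\<close> is the law of the subtree given axis, location and time of the
    split, and \<open>Q\<close> below averages it over axis and location, so that the binds are
    resolved one at a time.\<close>
  define R where "R = (\<lambda>J S s. mondrian_upto k lam (lower_child D J S) s \<bind>
        (\<lambda>l. mondrian_upto k lam (upper_child D J S) s \<bind> (\<lambda>r. return ?A (Node l (J, S) r))))"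
  have R [measurable]: "(\<lambda>x. R (J x) (S x) (s x)) \<in> N \<rightarrow>\<^sub>M subprob_algebra ?A"
    if [measurable]: "S \<in> borel_measurable N" "J \<in> N \<rightarrow>\<^sub>M count_space UNIV" "s \<in> borel_measurable N"
    for S J s and N :: "'n measure"
    unfolding R_def
    apply (rule measurable_compose_countable[OF _ that(2)])
    apply (rule measurable_bind[OF K])
    subgoal by (rule C) measurable
    subgoal by measurable
    apply (rule measurable_bind[OF K])
    subgoal by (rule C) measurable
    subgoal by measurable
    by (rule measurable_compose[OF _ return_measurable]) measurable
  have SP: "(\<lambda>x. split_point D (J x)) \<in> N \<rightarrow>\<^sub>M subprob_algebra borel"
    if [measurable]: "J \<in> N \<rightarrow>\<^sub>M count_space UNIV" for J and N :: "'n measure"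
    apply (rule measurable_compose_countable[OF _ that])
    apply (rule measurable_compose[OF _ split_point_kernel])
    by measurable
  define Q where "Q = (\<lambda>s. split_axis D \<bind> (\<lambda>J. split_point D J \<bind> (\<lambda>S. R J S s)))"
  have Q [measurable]: "(\<lambda>x. Q (s x)) \<in> N \<rightarrow>\<^sub>M subprob_algebra ?A"
    if [measurable]: "s \<in> borel_measurable N"
    for s and N :: "'n measure"
    unfolding Q_def
    apply (rule measurable_bind[where N = "count_space UNIV"])
    subgoal by (rule measurable_compose[OF _ split_axis_kernel]) measurable
    apply (rule measurable_bind[where N = borel, OF SP])
    subgoal by measurable
    by measurable
  have nnR: "(\<integral>\<^sup>+T. \<phi> T \<partial>R J S s) = (\<integral>\<^sup>+l. \<integral>\<^sup>+r. \<phi> (Node l (J, S) r) \<partial>mondrian_upto k lam (upper_child D J S) s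
             \<partial>mondrian_upto k lam (lower_child D J S) s)" for J S s
  proof -
    have [measurable]: "(\<lambda>l. mondrian_upto k lam (upper_child D J S) s \<bind> (\<lambda>r. return ?A (Node l (J, S) r)))
       \<in> mondrian_upto k lam (lower_child D J S) s \<rightarrow>\<^sub>M subprob_algebra ?A"
      apply (rule measurable_bind[OF K])
      subgoal by measurable
      subgoal by measurable
      by (rule measurable_compose[OF _ return_measurable]) measurable
    have N: "(\<lambda>r. Node l (J, S) r) \<in> mondrian_upto k lam (upper_child D J S) s \<rightarrow>\<^sub>M ?A" for l
      by (rule measurable_Node') (auto simp: space_split_tree_algebra space_pair_measure intro!: measurable_ident_sets)
    show ?thesis
      unfolding R_def
      apply (subst nn_integral_bind[where B = ?A])
      subgoal by measurable
      subgoal by measurable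
      apply (intro nn_integral_cong)
      apply (subst nn_integral_bind[where B = ?A])
      subgoal by measurable
      subgoal by (rule measurable_compose[OF N return_measurable])
      apply (intro nn_integral_cong)
      apply (subst nn_integral_return)
      by auto
  qed
  have nnQ: "(\<integral>\<^sup>+T. \<phi> T \<partial>Q s) = (\<Sum>J\<in>UNIV. ennreal (side D J / linear_size D) * (
      (\<integral>\<^sup>+S. (\<integral>\<^sup>+T. \<phi> T \<partial>R J S s) * indicator {fst D $ J .. snd D $ J} S \<partial>lborel) / ennreal (side D J)))" for s
  proof -
    have 1: "(\<lambda>J. split_point D J \<bind> (\<lambda>S. R J S s)) \<in> split_axis D \<rightarrow>\<^sub>M subprob_algebra ?A"
      apply (rule measurable_bind[where N = borel, OF SP])
       apply (auto simp: split_axis_def)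
      done
    have 2: "(\<lambda>S. R J S s) \<in> split_point D J \<rightarrow>\<^sub>M subprob_algebra ?A" for J
      by (rule R) (auto simp: split_point_def)
    have 3: "(\<lambda>S. \<integral>\<^sup>+T. \<phi> T \<partial>R J S s) \<in> borel_measurable borel" for J
      by (rule measurable_compose[OF _ nn_integral_measurable_subprob_algebra, of _ _ ?A]) measurable
    show ?thesis
      unfolding Q_def
      apply (subst nn_integral_bind[OF assms 1])
      apply (subst nn_integral_split_axis)
      apply (subst nn_integral_bind[OF assms 2])
      apply (subst nn_integral_split_point[OF 3])
      by simp
  qed
  have eq: "mondrian_upto (Suc k) lam D t = density lborel (exponential_density (linear_size D)) \<bind>
      (\<lambda>E. if t + E \<le> lam then Q (t + E) else return ?A Leaf)"
    unfolding Q_def R_def mondrian_upto.simps ..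
  have "(\<integral>\<^sup>+T. \<phi> T \<partial>mondrian_upto (Suc k) lam D t) =
     (\<integral>\<^sup>+E. (\<integral>\<^sup>+T. \<phi> T \<partial>(if t + E \<le> lam then Q (t + E) else return ?A Leaf))
       \<partial>density lborel (exponential_density (linear_size D)))"
    unfolding eq by (rule nn_integral_bind[where B = ?A]) (auto intro!: measurable_If Q)
  also have "\<dots> = (\<integral>\<^sup>+E. (if t + E \<le> lam then \<integral>\<^sup>+T. \<phi> T \<partial>Q (t + E) else \<phi> Leaf)
       \<partial>density lborel (exponential_density (linear_size D)))"
    by (intro nn_integral_cong) (auto simp: nn_integral_return)
  also have "\<dots> = (\<integral>\<^sup>+E. ennreal (exponential_density (linear_size D) E) *
      (if t + E \<le> lam then \<integral>\<^sup>+T. \<phi> T \<partial>Q (t + E) else \<phi> Leaf) \<partial>lborel)"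
  proof (rule nn_integral_density)
    show "(\<lambda>E. if t + E \<le> lam then \<integral>\<^sup>+T. \<phi> T \<partial>Q (t + E) else \<phi> Leaf) \<in> borel_measurable lborel"
      by (intro measurable_If measurable_compose[OF _ nn_integral_measurable_subprob_algebra, of _ _ ?A])
         measurable
  qed measurable
  finally show ?thesis
    unfolding nnQ nnR .
qed

section \<open>Faces of the cell containing the point\<close>

primrec lower_face :: "real ^ 'd \<Rightarrow> 'd \<Rightarrow> 'd::finite split_tree \<Rightarrow> real" where
  "lower_face x j Leaf = - 1"
| "lower_face x j (Node l s r) =
    (if x $ fst s \<le> snd s then lower_face x j l
     else if fst s = j then max (snd s) (lower_face x j r) else lower_face x j r)"

primrec upper_face :: "real ^ 'd \<Rightarrow> 'd \<Rightarrow> 'd::finite split_tree \<Rightarrow> real" where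
  "upper_face x j Leaf = 1"
| "upper_face x j (Node l s r) =
    (if x $ fst s \<le> snd s then if fst s = j then min (snd s) (upper_face x j l) else upper_face x j l
     else upper_face x j r)"

lemma lower_face_measurable [measurable]: "lower_face (x :: real ^ 'd::finite) j \<in> borel_measurable split_tree_algebra"
proof -
  \<comment> \<open>Measurability on trees is available for \<open>rec_tree\<close>, so the
    recursive function is rewritten as an instance of it.\<close>
  have "lower_face (x :: real ^ 'd) j = rec_tree (- 1) (\<lambda>l s r al ar.
      (if x $ fst s \<le> snd s then al else if fst s = j then max (snd s) ar else ar))"
    (is "_ = ?f")
  proof
    show "lower_face x j T = ?f T" for T by (induction T) auto
  qed
  moreover have "(\<lambda>y::'d split_tree. rec_tree (- 1) (\<lambda>l s r al ar.
      (if x $ fst s \<le> snd s then al else if fst s = j then max (snd s) ar else ar)) y)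
        \<in> borel_measurable split_tree_algebra"
    by (rule measurable_rec_tree) measurable
  ultimately show ?thesis by simp
qed

lemma upper_face_measurable [measurable]: "upper_face (x :: real ^ 'd::finite) j \<in> borel_measurable split_tree_algebra"
proof -
  have "upper_face (x :: real ^ 'd) j = rec_tree 1 (\<lambda>l s r al ar.
      (if x $ fst s \<le> snd s then if fst s = j then min (snd s) al else al else ar))"
    (is "_ = ?f")
  proof
    show "upper_face x j T = ?f T" for T by (induction T) auto
  qed
  moreover have "(\<lambda>y::'d split_tree. rec_tree 1 (\<lambda>l s r al ar.
      (if x $ fst s \<le> snd s then if fst s = j then min (snd s) al else al else ar)) y)
        \<in> borel_measurable split_tree_algebra"
    by (rule measurable_rec_tree) measurable
  ultimately show ?thesis by simp
qed

lemma lower_face_less: "(\<And>j. -1 < x $ j) \<Longrightarrow> lower_face x j T < x $ j"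
  by (induction T) (auto split: if_splits)

lemma upper_face_ge: "(\<And>j. x $ j \<le> 1) \<Longrightarrow> x $ j \<le> upper_face x j T"
  by (induction T) (auto split: if_splits)

lemma upper_face_le: "upper_face x j T \<le> 1"
  by (induction T) auto

lemma cells_subset: "C \<in> cells T D \<Longrightarrow> C \<subseteq> D"
proof (induction T arbitrary: D)
  case (Node l s r)
  then show ?case by (auto dest!: Node.IH)
qed auto

text \<open>The cell containing \<open>x\<close> is cut out by two faces in each direction, which
  makes the definite description in \<open>cell_at\<close> well defined. \<open>D\<close> is kept
  arbitrary because the recursion restricts it at every split.\<close>

lemma cells_unique:
  assumes "x \<in> D" "D \<subseteq> unit_cube"
  shows "C \<in> cells T D \<and> x \<in> C \<longleftrightarrow>
    C = {y \<in> D. \<forall>j. lower_face x j T < y $ j \<and> y $ j \<le> upper_face x j T}"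
  using assms
proof (induction T arbitrary: D)
  case Leaf
  \<comment> \<open>Cells are open at the lower faces created by splits, but the cube contains its
    own; the initial value - 1 of \<open>lower_face\<close> keeps points with a coordinate 0 in the
    cell.\<close>
  have "- 1 < y $ j \<and> y $ j \<le> 1" if "y \<in> D" for y j
  proof -
    have "0 \<le> y $ j \<and> y $ j \<le> 1"
      using Leaf that by (auto simp: mem_box_cart subset_eq)
    then show ?thesis by linarith
  qed
  then have *: "{y \<in> D. \<forall>j. - 1 < y $ j \<and> y $ j \<le> 1} = D"
    by blast
  show ?case
    using Leaf(1) by (auto simp: *)
next
  case (Node l s r)
  show ?case
  proof (cases "x $ fst s \<le> snd s")
    case True
    let ?D = "{y \<in> D. y $ fst s \<le> snd s}"
    have "C \<in> cells (Node l s r) D \<and> x \<in> C \<longleftrightarrow> C \<in> cells l ?D \<and> x \<in> C"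
    proof -
      have "x \<notin> C" if "C \<in> cells r {y \<in> D. y $ fst s > snd s}"
        using cells_subset[OF that] True by auto
      then show ?thesis by auto
    qed
    also have "\<dots> \<longleftrightarrow> C = {y \<in> ?D. \<forall>j. lower_face x j l < y $ j \<and> y $ j \<le> upper_face x j l}"
      using True Node.prems by (intro Node.IH) auto
    also have "{y \<in> ?D. \<forall>j. lower_face x j l < y $ j \<and> y $ j \<le> upper_face x j l} =
      {y \<in> D. \<forall>j. lower_face x j (Node l s r) < y $ j \<and> y $ j \<le> upper_face x j (Node l s r)}"
    proof (intro Collect_cong iffI conjI allI; elim conjE CollectE)
      fix y j assume "y \<in> D" "y $ fst s \<le> snd s" and *: "\<forall>j. lower_face x j l < y $ j \<and> y $ j \<le> upper_face x j l"
      with True show "lower_face x j (Node l s r) < y $ j" "y $ j \<le> upper_face x j (Node l s r)"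
        by auto
    next
      fix y assume "y \<in> D" and *: "\<forall>j. lower_face x j (Node l s r) < y $ j \<and> y $ j \<le> upper_face x j (Node l s r)"
      then have *: "lower_face x j (Node l s r) < y $ j \<and> y $ j \<le> upper_face x j (Node l s r)" for j
        by blast
      have "y $ fst s \<le> snd s" using *[of "fst s"] True by auto
      with \<open>y \<in> D\<close> show "y \<in> {y \<in> D. y $ fst s \<le> snd s}" by simp
      show "lower_face x j l < y $ j" "y $ j \<le> upper_face x j l" for j
        using *[of j] True by (auto split: if_splits)
    qed auto
    finally show ?thesis .
  next
    case False
    let ?D = "{y \<in> D. y $ fst s > snd s}"
    have "C \<in> cells (Node l s r) D \<and> x \<in> C \<longleftrightarrow> C \<in> cells r ?D \<and> x \<in> C"
    proof -
      have "x \<notin> C" if "C \<in> cells l {y \<in> D. y $ fst s \<le> snd s}"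
        using cells_subset[OF that] False by auto
      then show ?thesis by auto
    qed
    also have "\<dots> \<longleftrightarrow> C = {y \<in> ?D. \<forall>j. lower_face x j r < y $ j \<and> y $ j \<le> upper_face x j r}"
      using False Node.prems by (intro Node.IH) auto
    also have "{y \<in> ?D. \<forall>j. lower_face x j r < y $ j \<and> y $ j \<le> upper_face x j r} =
      {y \<in> D. \<forall>j. lower_face x j (Node l s r) < y $ j \<and> y $ j \<le> upper_face x j (Node l s r)}"
    proof (intro Collect_cong iffI conjI allI; elim conjE CollectE)
      fix y j assume "y \<in> D" "y $ fst s > snd s" and *: "\<forall>j. lower_face x j r < y $ j \<and> y $ j \<le> upper_face x j r"
      with False show "lower_face x j (Node l s r) < y $ j" "y $ j \<le> upper_face x j (Node l s r)"
        by auto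
    next
      fix y assume "y \<in> D" and *: "\<forall>j. lower_face x j (Node l s r) < y $ j \<and> y $ j \<le> upper_face x j (Node l s r)"
      then have *: "lower_face x j (Node l s r) < y $ j \<and> y $ j \<le> upper_face x j (Node l s r)" for j
        by blast
      have "y $ fst s > snd s" using *[of "fst s"] False by auto
      with \<open>y \<in> D\<close> show "y \<in> {y \<in> D. y $ fst s > snd s}" by simp
      show "lower_face x j r < y $ j" "y $ j \<le> upper_face x j r" for j
        using *[of j] False by (auto split: if_splits)
    qed auto
    finally show ?thesis .
  qed
qed

lemma cell_at_eq:
  assumes "x \<in> unit_cube"
  shows "cell_at T x = {y \<in> unit_cube. \<forall>j. lower_face x j T < y $ j \<and> y $ j \<le> upper_face x j T}"
  unfolding cell_at_def using cells_unique[OF assms order_refl] by simp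

lemma indicator_cell_at_measurable [measurable]:
  assumes "x \<in> unit_cube"
    and [measurable]: "T \<in> N \<rightarrow>\<^sub>M split_tree_algebra" "y \<in> borel_measurable N"
  shows "(\<lambda>w. indicator (cell_at (T w) x) (y w) :: real) \<in> borel_measurable N"
proof -
  have [measurable]: "(\<lambda>z::real ^ 'd. z $ j) \<in> borel_measurable borel" for j
    by (intro borel_measurable_continuous_onI continuous_intros)
  have "indicator (cell_at (T w) x) (y w) = (if y w \<in> unit_cube \<and>
     (\<forall>j\<in>UNIV. lower_face x j (T w) < y w $ j \<and> y w $ j \<le> upper_face x j (T w)) then 1 else 0 :: real)" for w
    by (auto simp: cell_at_eq[OF assms(1)] indicator_def)
  then show ?thesis by simp
qed

section \<open>The event that no split crosses a box around the point\<close>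

definition uncut :: "real ^ 'd \<Rightarrow> real ^ 'd \<Rightarrow> real ^ 'd \<Rightarrow> 'd::finite split_tree \<Rightarrow> bool" where
  "uncut x a b T \<longleftrightarrow> (\<forall>j\<in>UNIV. lower_face x j T \<le> a $ j \<and> b $ j \<le> upper_face x j T)"

lemma uncut_measurable [measurable]: "Measurable.pred split_tree_algebra (uncut x a b)"
  unfolding uncut_def[abs_def] by measurable

text \<open>Only the splits on the path to \<open>x\<close> matter: each of them must leave the
  whole box on the side of \<open>x\<close>. Touching the boundary of the box is allowed.\<close>

lemma uncut_Node:
  "uncut x a b (Node l (J, S) r) \<longleftrightarrow>
     (if x $ J \<le> S then b $ J \<le> S \<and> uncut x a b l else S \<le> a $ J \<and> uncut x a b r)"
  unfolding uncut_def by (auto split: if_splits)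

text \<open>With c = 0 the function \<open>\<psi>\<close> is the probability exp(- R u) that no
  split hits a box of linear size \<open>R\<close> within time u, with c = 1 that of the complement.
  The first split comes at rate \<open>D\<close>; with probability (D - R) / D it misses the box and
  the remaining time counts, otherwise it hits. \<open>c\<close> is the value of the event after a
  hit, and 1 - c its value if no split occurs in time.\<close>

lemma exponential_recursion:
  fixes c s D R :: real
  assumes c: "c = 0 \<or> c = 1" and s: "s \<ge> 0" and R: "0 \<le> R" "R \<le> D" "0 < D"
  defines "\<psi> \<equiv> \<lambda>u. c + (1 - 2 * c) * exp (- R * u)"
  shows "(\<integral>\<^sup>+E. ennreal (exponential_density D E) *
      (if E \<le> s then ennreal ((\<psi> (s - E) * (D - R) + c * R) / D) else ennreal (1 - c)) \<partial>lborel) = ennreal (\<psi> s)"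
proof -
  have \<psi>0: "0 \<le> \<psi> u" if "u \<ge> 0" for u
    using c that R by (auto simp: \<psi>_def)
  \<comment> \<open>\<open>f\<close> is the exponential density times the first branch, the factor
    \<open>D\<close> cancelling, and \<open>F\<close> is an antiderivative of it.\<close>
  define F where "F = (\<lambda>E. - c * exp (- D * E) - (1 - 2 * c) * exp (- R * s) * exp (- (D - R) * E))"
  define f where "f = (\<lambda>E. exp (- D * E) * (\<psi> (s - E) * (D - R) + c * R))"
  have F: "(F has_real_derivative f E) (at E)" for E
  proof -
    have e: "exp (- R * s) * exp (- (D - R) * E) = exp (- D * E) * exp (- R * (s - E))"
      by (simp flip: exp_add add: algebra_simps)
    have "(F has_real_derivative (c * D * exp (- D * E) + (1 - 2 * c) * (D - R) * (exp (- R * s) * exp (- (D - R) * E)))) (at E)"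
      unfolding F_def by (auto intro!: derivative_eq_intros simp: algebra_simps)
    also have "c * D * exp (- D * E) + (1 - 2 * c) * (D - R) * (exp (- R * s) * exp (- (D - R) * E)) = f E"
      unfolding e f_def \<psi>_def by (simp add: algebra_simps)
    finally show ?thesis .
  qed
  have "(\<integral>\<^sup>+E. ennreal (f E) * indicator {0..s} E \<partial>lborel) = ennreal (F s - F 0)"
  proof (rule nn_integral_FTC_Icc)
    show "f \<in> borel_measurable borel" unfolding f_def \<psi>_def by measurable
    show "0 \<le> f E" if "E \<in> {0..s}" for E
    proof -
      have 1: "0 \<le> \<psi> (s - E) * (D - R)" using that R by (intro mult_nonneg_nonneg \<psi>0) auto
      have 2: "0 \<le> c * R" using R c by auto
      show ?thesis unfolding f_def using 1 2 by simp
    qed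
  qed (use F s in \<open>auto intro: has_field_derivative_at_within simp: has_real_derivative_iff_has_vector_derivative\<close>)
  moreover have "F s - F 0 = \<psi> s - (1 - c) * exp (- D * s)"
  proof -
    have "exp (- R * s) * exp (- (D - R) * s) = exp (- D * s)"
      by (simp flip: exp_add add: algebra_simps)
    then show ?thesis unfolding F_def \<psi>_def by (simp add: algebra_simps)
  qed
  moreover have "(\<integral>\<^sup>+E. ennreal (D * exp (- D * E)) * indicator {s..} E \<partial>lborel) = ennreal (0 - (- exp (- D * s)))"
  proof (rule nn_integral_FTC_atLeast)
    show "((\<lambda>E. - exp (- D * E)) \<longlongrightarrow> 0) at_top"
      using R(3) by real_asymp
  qed (use R in \<open>auto intro!: derivative_eq_intros\<close>)
  moreover have "ennreal (exponential_density D E) *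
      (if E \<le> s then ennreal ((\<psi> (s - E) * (D - R) + c * R) / D) else ennreal (1 - c)) =
     ennreal (f E) * indicator {0..s} E + ennreal (1 - c) * (ennreal (D * exp (- D * E)) * indicator {s<..} E)" for E
  proof -
    have "ennreal (D * exp (- (E * D))) * ennreal ((\<psi> (s - E) * (D - R) + c * R) / D) = ennreal (f E)"
      if "0 \<le> E" "E \<le> s"
    proof -
      have 1: "0 \<le> \<psi> (s - E) * (D - R)" using that R by (intro mult_nonneg_nonneg \<psi>0) auto
      have 2: "0 \<le> c * R" using R c by auto
      show ?thesis
        unfolding f_def using R 1 2 by (subst ennreal_mult[symmetric]) (auto simp: mult.commute)
    qed
    then show ?thesis
      using s by (auto simp: exponential_density_def indicator_def mult_ac)
  qed
  moreover have "(\<integral>\<^sup>+E. ennreal (D * exp (- D * E)) * indicator {s<..} E \<partial>lborel) =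
    (\<integral>\<^sup>+E. ennreal (D * exp (- D * E)) * indicator {s..} E \<partial>lborel)"
    by (rule nn_integral_cong_AE) (use AE_lborel_singleton[of s] in \<open>auto simp: indicator_def\<close>)
  moreover have "f \<in> borel_measurable borel" unfolding f_def \<psi>_def by measurable
  moreover have "0 \<le> \<psi> s - (1 - c) * exp (- D * s)"
    using c s R by (auto simp: \<psi>_def mult_right_mono)
  moreover have "0 \<le> 1 - c" using c by auto
  ultimately show ?thesis
    by (simp add: nn_integral_add nn_integral_cmult flip: ennreal_mult ennreal_plus)
qed

lemma uncut_sets [measurable]: "{T. uncut x a b T = q} \<in> sets split_tree_algebra"
proof -
  have "{T \<in> space split_tree_algebra. uncut x a b T = q} \<in> sets split_tree_algebra"
    by measurable
  then show ?thesis by simp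
qed

lemma uncut_sets' [measurable]: "{T. uncut x a b T} \<in> sets split_tree_algebra"
  using uncut_sets[of x a b True] by simp

text \<open>The first split either misses the box, which then lies in the child containing
  \<open>x\<close>, or hits it and decides the event. Only an upper bound can hold at finite depth,
  because trees that are too high have been discarded; \<open>q\<close> selects the event or its
  complement.\<close>

lemma uncut_bound:
  fixes D :: "'d::finite rect"
  assumes x: "\<And>j. 0 \<le> a $ j" "\<And>j. a $ j \<le> x $ j" "\<And>j. x $ j \<le> b $ j" "\<And>j. b $ j \<le> 1"
    and D: "\<And>j. fst D $ j \<le> a $ j" "\<And>j. b $ j \<le> snd D $ j" and t: "t \<le> lam"
    and c: "c = (if q then 0 else 1)"
  shows "emeasure (mondrian_upto k lam D t) {T. uncut x a b T = q} \<le>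
    ennreal (c + (1 - 2 * c) * exp (- (\<Sum>j\<in>UNIV. b $ j - a $ j) * (lam - t)))"
  using D t
proof (induction k arbitrary: D t)
  case 0
  then show ?case by simp
next
  case (Suc k)
  define R where "R = (\<Sum>j\<in>UNIV. b $ j - a $ j)"
  define \<psi> where "\<psi> = (\<lambda>u. c + (1 - 2 * c) * exp (- R * u))"
  define \<phi> where "\<phi> = (\<lambda>T. indicator {T. uncut x a b T = q} T :: ennreal)"
  have [measurable]: "\<phi> \<in> borel_measurable split_tree_algebra"
    unfolding \<phi>_def by measurable
  have c': "c = 0 \<or> c = 1" "c \<ge> 0" using c by auto
  have R0: "0 \<le> R" unfolding R_def using x by (intro sum_nonneg) (simp add: order_trans[OF x(2,3)])
  have \<psi>0: "0 \<le> \<psi> u" if "u \<ge> 0" for u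
    using c' that R0 by (auto simp: \<psi>_def)
  have side: "side D J = snd D $ J - fst D $ J" for J
    using Suc.prems(1,2)[of J] x(2,3)[of J] by (simp add: side_def)
  \<comment> \<open>The total length of the split locations that miss the box, summed over the
    axes.\<close>
  have DR: "linear_size D - R = (\<Sum>J\<in>UNIV. (a $ J - fst D $ J) + (snd D $ J - b $ J))"
    unfolding linear_size_def R_def side by (simp flip: sum_subtractf add: algebra_simps)
  have RD: "R \<le> linear_size D"
    using Suc.prems(1,2) DR sum_nonneg[of UNIV "\<lambda>J. (a $ J - fst D $ J) + (snd D $ J - b $ J)"] by simp
  have IH: "(\<integral>\<^sup>+T. \<phi> T \<partial>mondrian_upto k lam D' s) \<le> ennreal (\<psi> (lam - s))"
    if "\<And>j. fst D' $ j \<le> a $ j" "\<And>j. b $ j \<le> snd D' $ j" "s \<le> lam" for D' s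
  proof -
    have "(\<integral>\<^sup>+T. \<phi> T \<partial>mondrian_upto k lam D' s) = emeasure (mondrian_upto k lam D' s) {T. uncut x a b T = q}"
      unfolding \<phi>_def by (subst nn_integral_indicator[symmetric]) auto
    then show ?thesis using Suc.IH[OF that] by (simp add: \<psi>_def R_def)
  qed
  have sub: "(\<integral>\<^sup>+T. C \<partial>mondrian_upto k lam D' s) \<le> C" for C D' s
  proof -
    interpret subprob_space "mondrian_upto k lam D' s" by (rule subprob_mondrian_upto)
    have "C * emeasure (mondrian_upto k lam D' s) (space (mondrian_upto k lam D' s)) \<le> C * 1"
      using emeasure_space_le_1 by (intro mult_left_mono) auto
    then show ?thesis by (simp del: space_split_tree_algebra)
  qed
  \<comment> \<open>Locations below \<open>a\<close> or above \<open>b\<close> pass the box on to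
    the child containing \<open>x\<close>, where the induction hypothesis applies; locations in
    between cut it and the event takes the value \<open>c\<close>. End points are counted twice,
    which an upper bound allows.\<close>
  have inner: "(\<integral>\<^sup>+l. \<integral>\<^sup>+r. \<phi> (Node l (J, S) r) \<partial>mondrian_upto k lam (upper_child D J S) s
             \<partial>mondrian_upto k lam (lower_child D J S) s) * indicator {fst D $ J .. snd D $ J} S
      \<le> ennreal (\<psi> (lam - s)) * indicator {fst D $ J .. a $ J} S
        + ennreal c * indicator {a $ J .. b $ J} S + ennreal (\<psi> (lam - s)) * indicator {b $ J .. snd D $ J} S"
    (is "?I * _ \<le> ?R") if s: "s \<le> lam" for J S s
  proof (cases "S \<in> {fst D $ J .. snd D $ J}")
    case S: True
    consider "x $ J \<le> S" "b $ J \<le> S" | "S < x $ J" "S \<le> a $ J" | "x $ J \<le> S" "\<not> b $ J \<le> S" | "S < x $ J" "\<not> S \<le> a $ J"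
      by linarith
    then have "?I \<le> ?R"
    proof cases
      case 1
      have "?I = (\<integral>\<^sup>+l. \<integral>\<^sup>+r. \<phi> l \<partial>mondrian_upto k lam (upper_child D J S) s
             \<partial>mondrian_upto k lam (lower_child D J S) s)"
        unfolding \<phi>_def using 1 by (simp add: uncut_Node indicator_def)
      also have "\<dots> \<le> (\<integral>\<^sup>+l. \<phi> l \<partial>mondrian_upto k lam (lower_child D J S) s)"
        by (intro nn_integral_mono sub)
      also have "\<dots> \<le> ennreal (\<psi> (lam - s))"
        using 1 Suc.prems s by (intro IH) (auto simp: lower_child_def)
      also have "\<dots> = ennreal (\<psi> (lam - s)) * indicator {b $ J .. snd D $ J} S"
        using 1 S by simp
      finally show ?thesis by (rule order_trans) simp
    next
      case 2
      have "?I = (\<integral>\<^sup>+l. \<integral>\<^sup>+r. \<phi> r \<partial>mondrian_upto k lam (upper_child D J S) s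
             \<partial>mondrian_upto k lam (lower_child D J S) s)"
        unfolding \<phi>_def using 2 by (simp add: uncut_Node indicator_def)
      also have "\<dots> \<le> (\<integral>\<^sup>+r. \<phi> r \<partial>mondrian_upto k lam (upper_child D J S) s)"
        by (intro sub)
      also have "\<dots> \<le> ennreal (\<psi> (lam - s))"
        using 2 Suc.prems s by (intro IH) (auto simp: upper_child_def)
      also have "\<dots> = ennreal (\<psi> (lam - s)) * indicator {fst D $ J .. a $ J} S"
        using 2 S by simp
      finally show ?thesis by (rule order_trans) (simp add: add.assoc)
    next
      case 3
      have "\<phi> (Node l (J, S) r) = ennreal c" for l r
        unfolding \<phi>_def using 3 c by (simp add: uncut_Node)
      then have "?I = (\<integral>\<^sup>+l. \<integral>\<^sup>+r. ennreal c \<partial>mondrian_upto k lam (upper_child D J S) s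
             \<partial>mondrian_upto k lam (lower_child D J S) s)"
        by (simp only:)
      also have "\<dots> \<le> (\<integral>\<^sup>+l. ennreal c \<partial>mondrian_upto k lam (lower_child D J S) s)"
        by (intro nn_integral_mono sub)
      also have "\<dots> \<le> ennreal c" by (rule sub)
      also have "\<dots> = ennreal c * indicator {a $ J .. b $ J} S"
        using 3 x(2)[of J] by simp
      finally show ?thesis by (rule order_trans) simp
    next
      case 4
      have "\<phi> (Node l (J, S) r) = ennreal c" for l r
        unfolding \<phi>_def using 4 c by (simp add: uncut_Node)
      then have "?I = (\<integral>\<^sup>+l. \<integral>\<^sup>+r. ennreal c \<partial>mondrian_upto k lam (upper_child D J S) s
             \<partial>mondrian_upto k lam (lower_child D J S) s)"
        by (simp only:)
      also have "\<dots> \<le> (\<integral>\<^sup>+l. ennreal c \<partial>mondrian_upto k lam (lower_child D J S) s)"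
        by (intro nn_integral_mono sub)
      also have "\<dots> \<le> ennreal c" by (rule sub)
      also have "\<dots> = ennreal c * indicator {a $ J .. b $ J} S"
        using 4 x(3)[of J] by simp
      finally show ?thesis by (rule order_trans) simp
    qed
    with S show ?thesis by simp
  qed simp
  \<comment> \<open>The axis has probability side / linear size and the location density 1 / side,
    so the side cancels and only lengths relative to the linear size remain.\<close>
  have axis: "ennreal (side D J / linear_size D) * (
          (\<integral>\<^sup>+S. (\<integral>\<^sup>+l. \<integral>\<^sup>+r. \<phi> (Node l (J, S) r) \<partial>mondrian_upto k lam (upper_child D J S) s
             \<partial>mondrian_upto k lam (lower_child D J S) s) * indicator {fst D $ J .. snd D $ J} S \<partial>lborel)
          / ennreal (side D J)) \<le> ennreal ((\<psi> (lam - s) * ((a $ J - fst D $ J) + (snd D $ J - b $ J)) + c * (b $ J - a $ J)) / linear_size D)"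
    (is "_ * (?I / _) \<le> _") if s: "s \<le> lam" for J s
  proof (cases "side D J = 0")
    case False
    have [simp]: "0 < side D J" using False side_nonneg[of D J] by linarith
    have L: "0 < linear_size D"
      unfolding linear_size_def using False by (intro sum_pos2[of _ J]) (auto simp: less_le)
    have "?I \<le> (\<integral>\<^sup>+S. ennreal (\<psi> (lam - s)) * indicator {fst D $ J .. a $ J} S
        + ennreal c * indicator {a $ J .. b $ J} S + ennreal (\<psi> (lam - s)) * indicator {b $ J .. snd D $ J} S \<partial>lborel)"
      by (intro nn_integral_mono inner s)
    also have "\<dots> = ennreal (\<psi> (lam - s) * ((a $ J - fst D $ J) + (snd D $ J - b $ J)) + c * (b $ J - a $ J))"
      (is "_ = ennreal ?v")
    proof -
      let ?p = "\<psi> (lam - s)" and ?u = "a $ J - fst D $ J" and ?v = "b $ J - a $ J" and ?w = "snd D $ J - b $ J"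
      have nn: "0 \<le> ?p" "0 \<le> ?u" "0 \<le> ?v" "0 \<le> ?w"
        using Suc.prems(1,2)[of J] order_trans[OF x(2,3), of J] \<psi>0[of "lam - s"] s by auto
      have "ennreal (?p * (?u + ?w) + c * ?v) = ennreal ?p * (ennreal ?u + ennreal ?w) + ennreal c * ennreal ?v"
        using nn c' by (subst ennreal_plus) (auto simp del: ennreal_plus simp: ennreal_mult simp flip: ennreal_plus)
      with nn show ?thesis
        by (simp add: nn_integral_add nn_integral_cmult distrib_left add_ac)
    qed
    finally have "?I \<le> ennreal ?v" .
    then have "ennreal (side D J / linear_size D) * (?I / ennreal (side D J))
      \<le> ennreal (side D J / linear_size D) * (ennreal ?v / ennreal (side D J))"
      by (intro mult_left_mono divide_right_mono_ennreal) auto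
    also have "\<dots> = ennreal (?v / linear_size D)"
    proof -
      have "0 \<le> v \<Longrightarrow> ennreal (side D J / linear_size D) * (ennreal v / ennreal (side D J)) = ennreal (v / linear_size D)" for v
        using L False by (subst divide_ennreal) (auto simp flip: ennreal_mult)
      moreover have "0 \<le> ?v"
        using Suc.prems(1,2)[of J] order_trans[OF x(2,3), of J] \<psi>0[of "lam - s"] s c'
        by (intro add_nonneg_nonneg mult_nonneg_nonneg) auto
      ultimately show ?thesis by blast
    qed
    finally show ?thesis .
  qed simp
  have "emeasure (mondrian_upto (Suc k) lam D t) {T. uncut x a b T = q} = (\<integral>\<^sup>+T. \<phi> T \<partial>mondrian_upto (Suc k) lam D t)"
    unfolding \<phi>_def by (subst nn_integral_indicator) (auto simp del: mondrian_upto.simps)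
  also have "\<dots> \<le> (\<integral>\<^sup>+E. ennreal (exponential_density (linear_size D) E) *
      (if E \<le> lam - t then ennreal ((\<psi> (lam - t - E) * (linear_size D - R) + c * R) / linear_size D)
        else ennreal (1 - c)) \<partial>lborel)"
    unfolding nn_integral_mondrian_upto_Suc[OF \<open>\<phi> \<in> _\<close>]
  proof (intro nn_integral_mono mult_left_mono)
    fix E
    have leaf: "\<phi> Leaf = ennreal (1 - c)"
    proof -
      have "uncut x a b Leaf"
        using x(1,4) by (auto simp: uncut_def intro: order_trans[of "-1" 0])
      then show ?thesis using c by (auto simp: \<phi>_def)
    qed
    have "(\<Sum>J\<in>UNIV. ennreal (side D J / linear_size D) * (
          (\<integral>\<^sup>+S. (\<integral>\<^sup>+l. \<integral>\<^sup>+r. \<phi> (Node l (J, S) r) \<partial>mondrian_upto k lam (upper_child D J S) (t + E)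
             \<partial>mondrian_upto k lam (lower_child D J S) (t + E)) * indicator {fst D $ J .. snd D $ J} S \<partial>lborel)
          / ennreal (side D J))) \<le>
       ennreal ((\<psi> (lam - t - E) * (linear_size D - R) + c * R) / linear_size D)" (is "?L \<le> _") if E: "t + E \<le> lam"
    proof -
      have "?L \<le> (\<Sum>J\<in>UNIV. ennreal ((\<psi> (lam - (t + E)) * ((a $ J - fst D $ J) + (snd D $ J - b $ J)) + c * (b $ J - a $ J)) / linear_size D))"
        by (intro sum_mono axis E)
      also have "\<dots> = ennreal (\<Sum>J\<in>UNIV. (\<psi> (lam - (t + E)) * ((a $ J - fst D $ J) + (snd D $ J - b $ J)) + c * (b $ J - a $ J)) / linear_size D)"
        using Suc.prems(1,2) order_trans[OF x(2,3)] E c'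
        by (intro sum_ennreal divide_nonneg_nonneg add_nonneg_nonneg mult_nonneg_nonneg \<psi>0) auto
      also have "(\<Sum>J\<in>UNIV. (\<psi> (lam - (t + E)) * ((a $ J - fst D $ J) + (snd D $ J - b $ J)) + c * (b $ J - a $ J)) / linear_size D)
        = (\<psi> (lam - t - E) * (linear_size D - R) + c * R) / linear_size D"
        unfolding DR unfolding R_def diff_diff_eq
        by (simp only: sum_divide_distrib[symmetric] sum.distrib sum_distrib_left[symmetric])
      finally show ?thesis .
    qed
    then show "(if t + E \<le> lam then \<Sum>J\<in>UNIV. ennreal (side D J / linear_size D) * (
          (\<integral>\<^sup>+S. (\<integral>\<^sup>+l. \<integral>\<^sup>+r. \<phi> (Node l (J, S) r) \<partial>mondrian_upto k lam (upper_child D J S) (t + E)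
             \<partial>mondrian_upto k lam (lower_child D J S) (t + E)) * indicator {fst D $ J .. snd D $ J} S \<partial>lborel)
          / ennreal (side D J)) else \<phi> Leaf) \<le> (if E \<le> lam - t then ennreal ((\<psi> (lam - t - E) * (linear_size D - R) + c * R) / linear_size D)
        else ennreal (1 - c))"
      by (simp add: leaf)
  qed auto
  also have "\<dots> \<le> ennreal (\<psi> (lam - t))"
  \<comment> \<open>With linear size 0 the waiting time has the zero density, so the left side is
    0.\<close>
  proof (cases "linear_size D = 0")
    case True
    then have "exponential_density (linear_size D) E = 0" for E
      by (simp add: exponential_density_def)
    then show ?thesis by simp
  next
    case False
    then have "0 < linear_size D" using linear_size_nonneg[of D] by linarith
    then show ?thesis
      using exponential_recursion[OF c'(1) _ R0 RD, of "lam - t"] Suc.prems(3) unfolding \<psi>_def by simp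
  qed
  finally show ?case by (simp add: \<psi>_def R_def)
qed

text \<open>Stated for all non-negative integrands, because the induction raises the depth in the
  right subtree and then in the left one, and the second step is applied to an inner integral
  instead of an indicator.\<close>

lemma mondrian_upto_mono:
  assumes [measurable]: "\<phi> \<in> borel_measurable split_tree_algebra"
  shows "(\<integral>\<^sup>+T. \<phi> T \<partial>mondrian_upto k lam D t) \<le> (\<integral>\<^sup>+T. \<phi> T \<partial>mondrian_upto (Suc k) lam D t)"
  using assms
proof (induction k arbitrary: D t \<phi>)
  case 0
  then show ?case by (simp add: nn_integral_null_measure)
next
  case (Suc k)
  note [measurable] = Suc.prems
  show ?case
    unfolding nn_integral_mondrian_upto_Suc[OF Suc.prems, of k] nn_integral_mondrian_upto_Suc[OF Suc.prems, of "Suc k"]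
  proof (intro nn_integral_mono mult_left_mono)
    fix E
    let ?I = "\<lambda>k J S. (\<integral>\<^sup>+l. \<integral>\<^sup>+r. \<phi> (Node l (J, S) r) \<partial>mondrian_upto k lam (upper_child D J S) (t + E)
      \<partial>mondrian_upto k lam (lower_child D J S) (t + E))"
    have "?I k J S \<le> ?I (Suc k) J S" for J S
    proof -
    have le: "(\<integral>\<^sup>+l. \<integral>\<^sup>+r. \<phi> (Node l (J, S) r) \<partial>mondrian_upto k lam (upper_child D J S) (t + E) \<partial>mondrian_upto k lam (lower_child D J S) (t + E))
      \<le> (\<integral>\<^sup>+l. \<integral>\<^sup>+r. \<phi> (Node l (J, S) r) \<partial>mondrian_upto (Suc k) lam (upper_child D J S) (t + E) \<partial>mondrian_upto k lam (lower_child D J S) (t + E))"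
      by (intro nn_integral_mono Suc.IH) measurable
    show ?thesis
    proof (rule order_trans[OF le])
      interpret subprob_space "mondrian_upto (Suc k) lam (upper_child D J S) (t + E)"
        by (rule subprob_mondrian_upto)
      have "(\<lambda>l. \<integral>\<^sup>+r. \<phi> (Node l (J, S) r) \<partial>mondrian_upto (Suc k) lam (upper_child D J S) (t + E)) \<in> borel_measurable split_tree_algebra"
        by (rule borel_measurable_nn_integral) measurable
      from Suc.IH[OF this] show "(\<integral>\<^sup>+l. \<integral>\<^sup>+r. \<phi> (Node l (J, S) r) \<partial>mondrian_upto (Suc k) lam (upper_child D J S) (t + E) \<partial>mondrian_upto k lam (lower_child D J S) (t + E))
      \<le> (\<integral>\<^sup>+l. \<integral>\<^sup>+r. \<phi> (Node l (J, S) r) \<partial>mondrian_upto (Suc k) lam (upper_child D J S) (t + E) \<partial>mondrian_upto (Suc k) lam (lower_child D J S) (t + E))" .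
    qed
    qed
    then have "(\<Sum>J\<in>UNIV. ennreal (side D J / linear_size D) *
       ((\<integral>\<^sup>+S. ?I k J S * indicator {fst D $ J .. snd D $ J} S \<partial>lborel) / ennreal (side D J))) \<le>
      (\<Sum>J\<in>UNIV. ennreal (side D J / linear_size D) *
       ((\<integral>\<^sup>+S. ?I (Suc k) J S * indicator {fst D $ J .. snd D $ J} S \<partial>lborel) / ennreal (side D J)))"
      by (intro sum_mono mult_left_mono divide_right_mono_ennreal nn_integral_mono mult_right_mono) auto
    then show "(if t + E \<le> lam then \<Sum>J\<in>UNIV. ennreal (side D J / linear_size D) *
       ((\<integral>\<^sup>+S. ?I k J S * indicator {fst D $ J .. snd D $ J} S \<partial>lborel) / ennreal (side D J)) else \<phi> Leaf) \<le>
      (if t + E \<le> lam then \<Sum>J\<in>UNIV. ennreal (side D J / linear_size D) *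
       ((\<integral>\<^sup>+S. ?I (Suc k) J S * indicator {fst D $ J .. snd D $ J} S \<partial>lborel) / ennreal (side D J)) else \<phi> Leaf)"
      by (simp del: mondrian_upto.simps)
  qed auto
qed

text \<open>A supremum of measures need not be taken set by set; along a chain it is.\<close>

lemma emeasure_mondrian:
  assumes "A \<in> sets split_tree_algebra"
  shows "emeasure (mondrian lam) A = (SUP k. emeasure (mondrian_upto k lam (0, 1) 0) A)"
proof -
  have "mondrian_upto k lam D t \<le> mondrian_upto (Suc k) lam D t" for k D t
  \<comment> \<open>The order on measures compares spaces and sigma-algebras before values, so their
    equality has to be supplied as well.\<close>
  proof (rule less_eq_measure.intros(3))
    show "emeasure (mondrian_upto k lam D t) \<le> emeasure (mondrian_upto (Suc k) lam D t)"
    proof (rule le_funI)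
      fix A show "emeasure (mondrian_upto k lam D t) A \<le> emeasure (mondrian_upto (Suc k) lam D t) A"
      proof (cases "A \<in> sets split_tree_algebra")
        case True
        then show ?thesis
          using mondrian_upto_mono[of "indicator A" k lam D t] by (simp del: mondrian_upto.simps)
      qed (simp del: mondrian_upto.simps add: emeasure_notin_sets)
    qed
  qed (simp_all only: sets_mondrian_upto sets_eq_imp_space_eq[OF sets_mondrian_upto])
  then have "incseq (\<lambda>k. mondrian_upto k lam (0, 1) 0)"
    by (rule incseq_SucI)
  then have ch: "Complete_Partial_Order.chain (\<le>) (range (\<lambda>k. mondrian_upto k lam (0, 1) 0))"
    using incseqD[of "\<lambda>k. mondrian_upto k lam (0, 1) 0"] nat_le_linear
    unfolding Complete_Partial_Order.chain_def by blast
  show ?thesis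
    unfolding mondrian_def
    by (rule emeasure_SUP_chain[OF _ assms ch]) auto
qed

lemma sets_mondrian [simp, measurable_cong]: "sets (mondrian lam) = sets split_tree_algebra"
proof -
  have "sets (mondrian lam) = sets (mondrian_upto 0 lam (0, 1) 0 :: 'a split_tree measure)"
    unfolding mondrian_def by (rule sets_SUP) (auto simp del: mondrian_upto.simps)
  then show ?thesis by simp
qed

text \<open>The bounds for the event and for its complement survive the supremum over the depth and
  add up to 1; with total mass 1 both are attained.\<close>

lemma measure_mondrian_uncut:
  fixes x a b :: "real ^ 'd::finite"
  assumes "prob_space (mondrian lam :: 'd split_tree measure)" "lam \<ge> 0"
    and x: "\<And>j. 0 \<le> a $ j" "\<And>j. a $ j \<le> x $ j" "\<And>j. x $ j \<le> b $ j" "\<And>j. b $ j \<le> 1"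
  shows "measure (mondrian lam) {T. uncut x a b T} = exp (- (\<Sum>j\<in>UNIV. b $ j - a $ j) * lam)"
proof -
  interpret prob_space "mondrian lam :: 'd split_tree measure" by fact
  let ?e = "exp (- (\<Sum>j\<in>UNIV. b $ j - a $ j) * lam)"
  have R0: "0 \<le> (\<Sum>j\<in>UNIV. b $ j - a $ j)"
    using x by (intro sum_nonneg) (simp add: order_trans[OF x(2,3)])
  have sp: "space (mondrian lam :: 'd split_tree measure) = UNIV"
    using sets_eq_imp_space_eq[OF sets_mondrian] by simp
  have le: "emeasure (mondrian lam) {T. uncut x a b T = q} \<le> ennreal ((if q then 0 else 1) + (1 - 2 * (if q then 0 else 1)) * ?e)" for q
  proof (subst emeasure_mondrian)
    show "{T. uncut x a b T = q} \<in> sets split_tree_algebra"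
      by measurable
    show "(SUP k. emeasure (mondrian_upto k lam (0, 1) 0) {T. uncut x a b T = q})
       \<le> ennreal ((if q then 0 else 1) + (1 - 2 * (if q then 0 else 1)) * ?e)"
      using assms by (intro SUP_least order_trans[OF uncut_bound[of a x b _ _ _ _ q]]) auto
  qed
  have 1: "prob {T. uncut x a b T} \<le> ?e"
    using le[of True] by (simp add: emeasure_eq_measure)
  have 2: "prob {T. \<not> uncut x a b T} \<le> 1 - ?e"
    using le[of False] R0 assms(2) by (simp add: emeasure_eq_measure)
  have "{T. uncut x a b T} \<in> sets (mondrian lam)"
    by measurable
  from prob_compl[OF this] have "prob {T. \<not> uncut x a b T} = 1 - prob {T. uncut x a b T}"
    by (simp add: sp Compl_eq flip: Compl_eq_Diff_UNIV)
  with 1 2 show ?thesis by simp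
qed

section \<open>Joint law of the distances from the point to the faces of its cell\<close>

definition gap :: "real ^ 'd::finite \<Rightarrow> 'd \<times> bool \<Rightarrow> 'd split_tree \<Rightarrow> real" where
  "gap x i T = (if snd i then x $ fst i - max 0 (lower_face x (fst i) T) else upper_face x (fst i) T - x $ fst i)"

definition gap_max :: "real ^ 'd::finite \<Rightarrow> 'd \<times> bool \<Rightarrow> real" where
  "gap_max x i = (if snd i then x $ fst i else 1 - x $ fst i)"

lemma gap_measurable [measurable]: "gap x i \<in> borel_measurable split_tree_algebra"
  unfolding gap_def[abs_def] by measurable

lemma gap_le: "gap x i T \<le> gap_max x i"
  using upper_face_le[of x "fst i" T] by (auto simp: gap_def gap_max_def)

lemma gap_nonneg: "x \<in> box 0 1 \<Longrightarrow> 0 \<le> gap x i T"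
  using upper_face_ge[of x "fst i" T] lower_face_less[of x "fst i" T]
  by (force simp: gap_def mem_box_cart intro: less_imp_le less_trans[of "-1" 0])

lemma gap_True_pos: "x \<in> box 0 1 \<Longrightarrow> 0 < gap x (j, True) T"
  using lower_face_less[of x j T]
  by (force simp: gap_def mem_box_cart intro: less_imp_le less_trans[of "-1" 0])

lemma gap_max_pos: "x \<in> box 0 1 \<Longrightarrow> 0 < gap_max x i"
  by (auto simp: gap_max_def mem_box_cart)

text \<open>For c > 0 this is the probability that a standard exponential variable truncated at
  \<open>c\<close> is at least \<open>u\<close>.\<close>

definition exp_tail :: "real \<Rightarrow> real \<Rightarrow> real" where
  "exp_tail c u = (if u \<le> 0 then 1 else if u \<le> c then exp (- u) else 0)"

text \<open>Requiring each distance to reach a threshold means that the box with these margins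
  around \<open>x\<close> is not cut, and the exponential of its l1 size is a product over the
  faces. This one formula carries both the marginal laws and the independence.\<close>

lemma measure_mondrian_gaps:
  fixes x :: "real ^ 'd::finite"
  assumes "prob_space (mondrian lam :: 'd split_tree measure)" "lam > 0" and x: "x \<in> box 0 1"
  shows "measure (mondrian lam) {T. \<forall>i\<in>I. u i \<le> lam * gap x i T} = (\<Prod>i\<in>I. exp_tail (lam * gap_max x i) (u i))"
proof (cases "\<exists>i\<in>I. u i > lam * gap_max x i")
  case True
  then obtain i where i: "i \<in> I" "u i > lam * gap_max x i" by auto
  have "0 < lam * gap_max x i" using assms gap_max_pos[OF x, of i] by simp
  with i have "exp_tail (lam * gap_max x i) (u i) = 0"
    by (auto simp: exp_tail_def)
  moreover have "\<not> u i \<le> lam * gap x i T" for T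
    using i mult_left_mono[OF gap_le[of x i T], of lam] assms(2) by linarith
  ultimately have "{T. \<forall>i\<in>I. u i \<le> lam * gap x i T} = {}" "(\<Prod>i\<in>I. exp_tail (lam * gap_max x i) (u i)) = 0"
    using i by (auto intro!: prod_zero)
  then show ?thesis by (simp only: measure_empty)
next
  case False
  \<comment> \<open>Non-positive thresholds and indices outside \<open>I\<close> impose nothing and
    get margin 0.\<close>
  define v where "v = (\<lambda>i. if i \<in> I then max 0 (u i) / lam else 0)"
  have v: "0 \<le> v i" "v i \<le> gap_max x i" for i
    using assms(2) gap_max_pos[OF x, of i] False by (auto simp: v_def field_simps not_less)
  define a where "a = (\<chi> j. x $ j - v (j, True))"
  define b where "b = (\<chi> j. x $ j + v (j, False))"
  have "(\<forall>i\<in>I. u i \<le> lam * gap x i T) \<longleftrightarrow> uncut x a b T" for T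
  proof -
    have "(\<forall>i\<in>I. u i \<le> lam * gap x i T) \<longleftrightarrow> (\<forall>i. v i \<le> gap x i T)"
      using gap_nonneg[OF x] assms(2) by (auto simp: v_def field_simps)
    also have "\<dots> \<longleftrightarrow> (\<forall>j. v (j, True) \<le> gap x (j, True) T \<and> v (j, False) \<le> gap x (j, False) T)"
      by (metis (full_types) surj_pair)
    also have "\<dots> \<longleftrightarrow> uncut x a b T"
      unfolding uncut_def a_def b_def using v(2)[of "(_, True)"]
      by (simp add: gap_def gap_max_def max_def algebra_simps) (smt (verit))
    finally show ?thesis .
  qed
  then have "measure (mondrian lam) {T. \<forall>i\<in>I. u i \<le> lam * gap x i T} = measure (mondrian lam) {T. uncut x a b T}"
    by simp
  also have "\<dots> = exp (- (\<Sum>j\<in>UNIV. b $ j - a $ j) * lam)"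
    using v assms(1,2) v(2)[of "(_, True)"] v(2)[of "(_, False)"]
    by (intro measure_mondrian_uncut) (auto simp: a_def b_def gap_max_def algebra_simps)
  also have "(\<Sum>j\<in>UNIV. b $ j - a $ j) = (\<Sum>j\<in>UNIV. \<Sum>s\<in>UNIV. v (j, s))"
    by (simp add: a_def b_def UNIV_bool)
  also have "\<dots> = (\<Sum>i\<in>UNIV. v i)"
    by (simp add: sum.cartesian_product)
  also have "\<dots> = (\<Sum>i\<in>I. v i)"
    by (rule sum.mono_neutral_right) (auto simp: v_def)
  also have "exp (- \<dots> * lam) = (\<Prod>i\<in>I. exp (- v i * lam))"
    by (simp add: exp_sum[symmetric] sum_negf sum_distrib_right)
  also have "\<dots> = (\<Prod>i\<in>I. exp_tail (lam * gap_max x i) (u i))"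
    using False assms(2) by (intro prod.cong) (auto simp: v_def exp_tail_def)
  finally show ?thesis .
qed

abbreviation exp1 :: "real measure" where
  "exp1 \<equiv> density lborel (exponential_density 1)"

lemma prob_space_exp1: "prob_space exp1"
  by (rule prob_space_exponential_density) simp

lemma measure_exp1_min:
  assumes "c > 0"
  shows "measure exp1 {e. u \<le> min c e} = exp_tail c u"
proof -
  interpret prob_space exp1 by (rule prob_space_exp1)
  have D: "distributed exp1 lborel (\<lambda>x. x) (exponential_density 1)"
    by (auto simp: distributed_def distr_id2)
  consider "u \<le> 0" | "0 < u" "u \<le> c" | "0 < u" "c < u" by linarith
  then show ?thesis
  proof cases
    case 1
    have "AE e in exp1. e \<ge> 0"
      by (simp add: AE_density exponential_density_def)
    then have "prob {e \<in> space exp1. u \<le> min c e} = 1"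
      using 1 assms by (intro prob_Collect_eq_1[THEN iffD2]) auto
    then show ?thesis using 1 by (simp add: exp_tail_def)
  next
    case 2
    have "prob {e. u \<le> min c e} = prob {e \<in> space exp1. u < e}"
    proof (rule finite_measure_eq_AE)
      have "AE e in lborel. e \<noteq> u" by (rule AE_lborel_singleton)
      then show "AE e in exp1. e \<in> {e. u \<le> min c e} \<longleftrightarrow> e \<in> {e \<in> space exp1. u < e}"
        using 2 by (auto simp: AE_density elim!: eventually_mono)
    qed auto
    also have "\<dots> = exp (- u)"
      using exponential_distributedD_gt[OF D, of u] 2 by simp
    finally show ?thesis using 2 by (simp add: exp_tail_def)
  next
    case 3
    then have "{e. u \<le> min c e} = {}" by auto
    then show ?thesis using 3 by (simp add: exp_tail_def)
  qed
qed

text \<open>The whole line joins the half-lines in the generator so that it covers the space and so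
  that single coordinates may be left free in the product formula for independence.\<close>

lemma borel_real_atLeast: "sets (borel :: real measure) = sigma_sets UNIV (insert UNIV (range atLeast))"
  unfolding borel_Ici
  by (subst sets_measure_of) (auto intro!: sigma_sets_eqI intro: sigma_sets_top)

lemma Int_stable_atLeast: "Int_stable (insert UNIV (range (atLeast :: real \<Rightarrow> _)))"
proof (rule Int_stableI)
  fix a b :: "real set" assume "a \<in> insert UNIV (range atLeast)" "b \<in> insert UNIV (range atLeast)"
  moreover have "{u..} \<inter> {v..} = {max u v..}" for u v :: real by auto
  ultimately show "a \<inter> b \<in> insert UNIV (range atLeast)" by auto
qed

lemma distr_gap:
  fixes x :: "real ^ 'd::finite"
  assumes "prob_space (mondrian lam :: 'd split_tree measure)" "lam > 0" and x: "x \<in> box 0 1"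
  shows "distr (mondrian lam) borel (\<lambda>T. lam * gap x i T) = distr exp1 borel (min (lam * gap_max x i))"
proof (rule measure_eqI_generator_eq[where \<Omega> = UNIV and A = "\<lambda>_. UNIV"])
  interpret prob_space "mondrian lam :: 'd split_tree measure" by fact
  interpret e: prob_space exp1 by (rule prob_space_exp1)
  have [simp]: "space (mondrian lam :: 'd split_tree measure) = UNIV"
    using sets_eq_imp_space_eq[OF sets_mondrian] by simp
  have c: "0 < lam * gap_max x i" using assms gap_max_pos[OF x, of i] by simp
  fix X :: "real set" assume "X \<in> insert UNIV (range atLeast)"
  then consider "X = UNIV" | u where "X = {u..}" by auto
  then show "emeasure (distr (mondrian lam) borel (\<lambda>T. lam * gap x i T)) X = emeasure (distr exp1 borel (min (lam * gap_max x i))) X"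
  proof cases
    case 1
    then show ?thesis
      using emeasure_space_1 e.emeasure_space_1 by (simp add: emeasure_distr)
  next
    case (2 u)
    have "prob {T. u \<le> lam * gap x i T} = e.prob {e. u \<le> min (lam * gap_max x i) e}"
      using measure_mondrian_gaps[OF assms, of "{i}" "\<lambda>_. u"] measure_exp1_min[OF c, of u] by simp
    then show ?thesis
      using 2 by (simp add: emeasure_distr emeasure_eq_measure e.emeasure_eq_measure vimage_def)
  qed
next
  interpret D: prob_space "distr (mondrian lam) borel (\<lambda>T. lam * gap x i T)"
    using assms(1) by (intro prob_space.prob_space_distr) auto
  show "emeasure (distr (mondrian lam) borel (\<lambda>T. lam * gap x i T)) UNIV \<noteq> \<infinity>"
    by simp
qed (auto simp: borel_real_atLeast Int_stable_atLeast)

text \<open>Lower and upper faces of all axes share one index type, so that independence of the 2d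
  distances is a single statement. On the generator it is the formula
  \<open>measure_mondrian_gaps\<close>, with free coordinates dropped from the product.\<close>

lemma indep_gaps:
  fixes x :: "real ^ 'd::finite"
  assumes "prob_space (mondrian lam :: 'd split_tree measure)" "lam > 0" and x: "x \<in> box 0 1"
  shows "prob_space.indep_vars (mondrian lam) (\<lambda>_. borel) (\<lambda>i T. lam * gap x i T) UNIV"
proof -
  interpret prob_space "mondrian lam :: 'd split_tree measure" by fact
  have [simp]: "space (mondrian lam :: 'd split_tree measure) = UNIV"
    using sets_eq_imp_space_eq[OF sets_mondrian] by simp
  show ?thesis
  proof (subst indep_vars_finite[where E = "\<lambda>_. insert UNIV (range atLeast)"], safe)
    fix A assume A: "A \<in> (UNIV :: ('d \<times> bool) set) \<rightarrow> insert UNIV (range atLeast :: real set set)"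
    define I where "I = {i. A i \<noteq> UNIV}"
    define u where "u = (\<lambda>i. SOME u. A i = {u..})"
    have u: "A i = {u i..}" if "i \<in> I" for i
    proof -
      have "A i \<in> insert UNIV (range atLeast)" using A by auto
      with that have "\<exists>u. A i = {u..}" by (auto simp: I_def)
      then show ?thesis unfolding u_def by (rule someI_ex)
    qed
    have "(\<Inter>j\<in>UNIV. (\<lambda>T. lam * gap x j T) -` A j \<inter> space (mondrian lam)) = {T. \<forall>i\<in>I. u i \<le> lam * gap x i T}"
    proof -
      have "lam * gap x i T \<in> A i \<longleftrightarrow> (i \<in> I \<longrightarrow> u i \<le> lam * gap x i T)" for i T
        using u[of i] by (cases "i \<in> I") (simp_all add: I_def)
      then show ?thesis by auto
    qed
    then have "prob (\<Inter>j\<in>UNIV. (\<lambda>T. lam * gap x j T) -` A j \<inter> space (mondrian lam)) =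
       (\<Prod>i\<in>I. exp_tail (lam * gap_max x i) (u i))"
      by (simp only: measure_mondrian_gaps[OF assms])
    also have "\<dots> = (\<Prod>i\<in>I. prob ((\<lambda>T. lam * gap x i T) -` A i \<inter> space (mondrian lam)))"
    proof (rule prod.cong)
      fix i assume "i \<in> I"
      then have "(\<lambda>T. lam * gap x i T) -` A i \<inter> space (mondrian lam) = {T. \<forall>j\<in>{i}. u j \<le> lam * gap x j T}"
        using u by auto
      then show "exp_tail (lam * gap_max x i) (u i) = prob ((\<lambda>T. lam * gap x i T) -` A i \<inter> space (mondrian lam))"
        by (simp only: measure_mondrian_gaps[OF assms]) simp
    qed simp
    also have "\<dots> = (\<Prod>i\<in>UNIV. prob ((\<lambda>T. lam * gap x i T) -` A i \<inter> space (mondrian lam)))"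
      using prob_space by (intro prod.mono_neutral_left) (auto simp: I_def)
    finally show "prob (\<Inter>j\<in>UNIV. (\<lambda>T. lam * gap x j T) -` A j \<inter> space (mondrian lam)) =
      (\<Prod>j\<in>UNIV. prob ((\<lambda>T. lam * gap x j T) -` A j \<inter> space (mondrian lam)))" .
  qed (auto simp: borel_real_atLeast Int_stable_atLeast)
qed

section \<open>Moments of the gaps\<close>

lemma nn_integral_gap_pair:
  fixes x :: "real ^ 'd::finite"
  assumes "prob_space (mondrian lam :: 'd split_tree measure)" "lam > 0" and x: "x \<in> box 0 1"
    and [measurable]: "(\<lambda>(a, b). g a b) \<in> borel_measurable (borel \<Otimes>\<^sub>M borel)"
  shows "(\<integral>\<^sup>+T. g (lam * gap x (j, True) T) (lam * gap x (j, False) T) \<partial>mondrian lam) =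
    (\<integral>\<^sup>+a. \<integral>\<^sup>+b. g (min (lam * gap_max x (j, True)) a) (min (lam * gap_max x (j, False)) b) \<partial>exp1 \<partial>exp1)"
proof -
  interpret prob_space "mondrian lam :: 'd split_tree measure" by fact
  interpret e: prob_space exp1 by (rule prob_space_exp1)
  let ?G = "\<lambda>s T. lam * gap x (j, s) T" and ?m = "\<lambda>s. min (lam * gap_max x (j, s))"
  have ind: "indep_var (PiM {(j, True)} (\<lambda>_. borel)) (\<lambda>T. restrict (\<lambda>i. lam * gap x i T) {(j, True)})
     (PiM {(j, False)} (\<lambda>_. borel)) (\<lambda>T. restrict (\<lambda>i. lam * gap x i T) {(j, False)})"
    by (rule indep_var_restrict[OF indep_gaps[OF assms(1-3)]]) auto
  have "indep_var borel ((\<lambda>f. f (j, True)) \<circ> (\<lambda>T. restrict (\<lambda>i. lam * gap x i T) {(j, True)}))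
     borel ((\<lambda>f. f (j, False)) \<circ> (\<lambda>T. restrict (\<lambda>i. lam * gap x i T) {(j, False)}))"
    by (rule indep_var_compose[OF ind]) measurable
  then have "indep_var borel (?G True) borel (?G False)"
    by (simp add: comp_def)
  then have "distr (mondrian lam) (borel \<Otimes>\<^sub>M borel) (\<lambda>T. (?G True T, ?G False T)) =
    distr (mondrian lam) borel (?G True) \<Otimes>\<^sub>M distr (mondrian lam) borel (?G False)"
    by (simp add: indep_var_distribution_eq)
  also have "\<dots> = distr exp1 borel (?m True) \<Otimes>\<^sub>M distr exp1 borel (?m False)"
    by (simp only: distr_gap[OF assms(1-3)])
  finally have D: "distr (mondrian lam) (borel \<Otimes>\<^sub>M borel) (\<lambda>T. (?G True T, ?G False T)) =
    distr exp1 borel (?m True) \<Otimes>\<^sub>M distr exp1 borel (?m False)" .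
  interpret m: prob_space "distr exp1 borel (?m False)"
    by (rule e.prob_space_distr) auto
  have "(\<integral>\<^sup>+T. g (?G True T) (?G False T) \<partial>mondrian lam) =
     (\<integral>\<^sup>+(a, b). g a b \<partial>distr (mondrian lam) (borel \<Otimes>\<^sub>M borel) (\<lambda>T. (?G True T, ?G False T)))"
    by (subst nn_integral_distr) auto
  also have "\<dots> = (\<integral>\<^sup>+a. \<integral>\<^sup>+b. g a b \<partial>distr exp1 borel (?m False) \<partial>distr exp1 borel (?m True))"
    unfolding D by (subst m.nn_integral_fst[symmetric]) auto
  also have "\<dots> = (\<integral>\<^sup>+a. \<integral>\<^sup>+b. g (?m True a) b \<partial>distr exp1 borel (?m False) \<partial>exp1)"
    by (subst nn_integral_distr) auto
  also have "\<dots> = (\<integral>\<^sup>+a. \<integral>\<^sup>+b. g (?m True a) (?m False b) \<partial>exp1 \<partial>exp1)"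
    by (subst nn_integral_distr) auto
  finally show ?thesis .
qed

text \<open>The 2d independent distances are grouped into d pairs, one for each axis. The moments
  needed later are products over the axes and thus reduce to double integrals over
  exponentials.\<close>

lemma nn_integral_gaps_prod:
  fixes x :: "real ^ 'd::finite"
  assumes "prob_space (mondrian lam :: 'd split_tree measure)" "lam > 0" and x: "x \<in> box 0 1"
    and [measurable]: "\<And>j. (\<lambda>(a, b). g j a b) \<in> borel_measurable (borel \<Otimes>\<^sub>M borel)"
  shows "(\<integral>\<^sup>+T. (\<Prod>j\<in>UNIV. g j (lam * gap x (j, True) T) (lam * gap x (j, False) T)) \<partial>mondrian lam) =
    (\<Prod>j\<in>UNIV. \<integral>\<^sup>+a. \<integral>\<^sup>+b. g j (min (lam * gap_max x (j, True)) a) (min (lam * gap_max x (j, False)) b) \<partial>exp1 \<partial>exp1)"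
proof -
  interpret prob_space "mondrian lam :: 'd split_tree measure" by fact
  let ?K = "\<lambda>j::'d. {(j, True), (j, False)}"
  have ind: "indep_vars (\<lambda>j. PiM (?K j) (\<lambda>_. borel)) (\<lambda>j T. restrict (\<lambda>i. lam * gap x i T) (?K j)) UNIV"
    by (rule indep_vars_restrict[OF indep_gaps[OF assms(1-3)]]) (auto simp: disjoint_family_on_def)
  have [measurable]: "(\<lambda>f. f (j, s)) \<in> borel_measurable (PiM (?K j) (\<lambda>_. borel :: real measure))" for j s
    by (cases s) measurable
  have "indep_vars (\<lambda>_. borel) (\<lambda>j T. (\<lambda>f. g j (f (j, True)) (f (j, False))) (restrict (\<lambda>i. lam * gap x i T) (?K j))) UNIV"
    by (rule indep_vars_compose2[OF ind]) measurable
  then have "indep_vars (\<lambda>_. borel) (\<lambda>j T. g j (lam * gap x (j, True) T) (lam * gap x (j, False) T)) UNIV"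
    by simp
  then have "(\<integral>\<^sup>+T. (\<Prod>j\<in>UNIV. g j (lam * gap x (j, True) T) (lam * gap x (j, False) T)) \<partial>mondrian lam) =
     (\<Prod>j\<in>UNIV. \<integral>\<^sup>+T. g j (lam * gap x (j, True) T) (lam * gap x (j, False) T) \<partial>mondrian lam)"
    by (intro indep_vars_nn_integral) auto
  then show ?thesis
    by (simp add: nn_integral_gap_pair[OF assms(1-4)])
qed

section \<open>Cell geometry and Hoelder functions\<close>

definition width :: "real ^ 'd::finite \<Rightarrow> 'd \<Rightarrow> 'd split_tree \<Rightarrow> real" where
  "width x j T = gap x (j, True) T + gap x (j, False) T"

lemma width_measurable [measurable]: "width x j \<in> borel_measurable split_tree_algebra"
  unfolding width_def[abs_def] by measurable

lemma width_pos: "x \<in> box 0 1 \<Longrightarrow> 0 < width x j T"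
  using gap_True_pos[of x j T] gap_nonneg[of x "(j, False)" T] by (simp add: width_def)

text \<open>Cells and their intersections are neither open nor closed; open and closed boxes have
  the same volume, so any set squeezed between them has it too.\<close>

lemma measure_between_boxes:
  fixes a b :: "real ^ 'd::finite"
  assumes "S \<in> sets borel" "box a b \<subseteq> S" "S \<subseteq> cbox a b" "\<And>j. a $ j \<le> b $ j"
  shows "measure lborel S = (\<Prod>j\<in>UNIV. b $ j - a $ j)"
proof -
  have ne: "cbox a b \<noteq> {}" using assms(4) by (auto simp: interval_ne_empty_cart)
  have fin: "S \<in> fmeasurable lborel"
    by (rule fmeasurableI2[OF _ assms(3)]) (use assms(1) in auto)
  have "measure lborel (box a b) \<le> measure lborel S"
    using fin assms by (intro measure_mono_fmeasurable) auto
  moreover have "measure lborel S \<le> measure lborel (cbox a b)"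
    using fin assms by (intro measure_mono_fmeasurable) auto
  moreover have "measure lborel (box a b) = measure lborel (cbox a b)"
    by (simp add: measure_lborel_box_eq measure_lborel_cbox_eq)
  moreover have "measure lborel (cbox a b) = (\<Prod>j\<in>UNIV. b $ j - a $ j)"
    using content_cbox_cart[OF ne] by simp
  ultimately show ?thesis by linarith
qed

context
  fixes x :: "real ^ 'd::finite"
  assumes x: "x \<in> box 0 1"
begin

lemma x_cube: "x \<in> unit_cube"
  using x box_subset_cbox by blast

lemma cell_at_sets [measurable]: "cell_at T x \<in> sets borel"
proof -
  have "(\<lambda>y. indicator (cell_at T x) y :: real) \<in> borel_measurable borel"
    by (rule indicator_cell_at_measurable[OF x_cube]) auto
  then show ?thesis by (simp add: borel_measurable_indicator_iff)
qed

lemma cell_at_subset: "cell_at T x \<subseteq> unit_cube"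
  unfolding cell_at_eq[OF x_cube] by auto

lemma max_lower_face: "max 0 (lower_face x j T) = x $ j - gap x (j, True) T"
  and upper_face_gap: "upper_face x j T = x $ j + gap x (j, False) T"
  by (simp_all add: gap_def)

text \<open>Both cells contain \<open>x\<close>, so their intersection reaches to the nearer of the
  two faces in each of the 2d directions. Taking the same tree twice gives the volume of a
  cell.\<close>

lemma measure_cell_inter:
  "measure lborel (cell_at T x \<inter> cell_at T' x) =
    (\<Prod>j\<in>UNIV. min (gap x (j, True) T) (gap x (j, True) T') + min (gap x (j, False) T) (gap x (j, False) T'))"
proof -
  define a where "a = (\<chi> j. x $ j - min (gap x (j, True) T) (gap x (j, True) T'))"
  define b where "b = (\<chi> j. x $ j + min (gap x (j, False) T) (gap x (j, False) T'))"
  have a: "a $ j = max 0 (max (lower_face x j T) (lower_face x j T'))" for j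
    using max_lower_face[of j T] max_lower_face[of j T'] by (simp add: a_def)
  have b: "b $ j = min (upper_face x j T) (upper_face x j T')" for j
    using upper_face_gap[of j T] upper_face_gap[of j T'] by (simp add: b_def)
  have "measure lborel (cell_at T x \<inter> cell_at T' x) = (\<Prod>j\<in>UNIV. b $ j - a $ j)"
  proof (rule measure_between_boxes)
    show "box a b \<subseteq> cell_at T x \<inter> cell_at T' x"
      using upper_face_le[of x _ T]
      by (auto simp: cell_at_eq[OF x_cube] mem_box_cart a b less_imp_le) (meson less_imp_le less_le_trans)+
    show "cell_at T x \<inter> cell_at T' x \<subseteq> cbox a b"
      by (auto simp: cell_at_eq[OF x_cube] mem_box_cart a b less_imp_le)
    show "a $ j \<le> b $ j" for j
      using gap_nonneg[OF x, of "(j, True)" T] gap_nonneg[OF x, of "(j, False)" T]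
        gap_nonneg[OF x, of "(j, True)" T'] gap_nonneg[OF x, of "(j, False)" T']
      by (auto simp: a_def b_def min_def)
  qed auto
  then show ?thesis by (simp add: a_def b_def add.commute)
qed

lemma measure_cell: "measure lborel (cell_at T x) = (\<Prod>j\<in>UNIV. width x j T)"
  using measure_cell_inter[of T T] by (simp add: width_def)

lemma measure_cell_pos: "0 < measure lborel (cell_at T x)"
  unfolding measure_cell by (intro prod_pos) (simp add: width_pos[OF x])

lemma cell_at_dist:
  assumes "y \<in> cell_at T x"
  shows "norm (y - x) \<le> (\<Sum>j\<in>UNIV. width x j T)"
proof -
  have "\<bar>(y - x) $ j\<bar> \<le> width x j T" for j
  proof -
    have "max 0 (lower_face x j T) \<le> y $ j" "y $ j \<le> upper_face x j T"
      using assms by (auto simp: cell_at_eq[OF x_cube] mem_box_cart less_imp_le)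
    then show ?thesis
      using gap_nonneg[OF x, of "(j, True)" T] gap_nonneg[OF x, of "(j, False)" T]
      unfolding max_lower_face upper_face_gap width_def by (auto simp: abs_le_iff)
  qed
  then have "(\<Sum>j\<in>UNIV. \<bar>(y - x) $ j\<bar>) \<le> (\<Sum>j\<in>UNIV. width x j T)"
    by (intro sum_mono)
  with norm_le_l1_cart[of "y - x"] show ?thesis by linarith
qed

end

text \<open>For \<open>\<beta>\<close> at most 1 the Hoelder condition concerns the function itself.
  For larger \<open>\<beta>\<close> the first derivatives are continuous on the compact cube, hence
  bounded, and the mean value inequality on the convex cube gives a Lipschitz bound.\<close>

lemma holder_class_lipschitz:
  fixes g :: "real ^ 'd::finite \<Rightarrow> real"
  assumes "g \<in> holder_class \<beta>" "\<beta> > 0"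
  obtains C where "C \<ge> 0" "\<And>y z. y \<in> unit_cube \<Longrightarrow> z \<in> unit_cube \<Longrightarrow> \<bar>g y - g z\<bar> \<le> C * norm (y - z) powr min 1 \<beta>"
proof -
  obtain D C where C: "C > 0" and D: "partials_upto (nat \<lceil>\<beta> - 1\<rceil>) g D"
    and H: "\<And>\<nu> y z. (\<Sum>j\<in>UNIV. \<nu> j) = nat \<lceil>\<beta> - 1\<rceil> \<Longrightarrow> y \<in> unit_cube \<Longrightarrow> z \<in> unit_cube \<Longrightarrow>
      \<bar>D \<nu> y - D \<nu> z\<bar> \<le> C * norm (y - z) powr (\<beta> - of_int \<lceil>\<beta> - 1\<rceil>)"
    using assms(1) unfolding holder_class_def by blast
  have D0: "D (\<lambda>_. 0) y = g y" if "y \<in> unit_cube" for y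
    using D that by (auto simp: partials_upto_def)
  show ?thesis
  proof (cases "\<beta> \<le> 1")
    case True
    then have z: "\<lceil>\<beta> - 1\<rceil> = 0" using assms(2) by linarith
    show ?thesis
      by (rule that[of C]) (use H[of "\<lambda>_. 0"] C True z D0 in auto)
  next
    case False
    define k where "k = nat \<lceil>\<beta> - 1\<rceil>"
    have k: "k > 0" using False unfolding k_def by simp
    have e: "\<beta> - of_int \<lceil>\<beta> - 1\<rceil> > 0" by linarith
    \<comment> \<open>Derivatives below the top order are differentiable, and those of top order
      satisfy the Hoelder condition with a positive exponent.\<close>
    have cont: "continuous_on unit_cube (D \<nu>)" if "(\<Sum>j\<in>UNIV. \<nu> j) \<le> k" for \<nu>
    proof (cases "(\<Sum>j\<in>UNIV. \<nu> j) < k")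
      case True
      then have "\<forall>y\<in>unit_cube. (D \<nu> has_derivative (\<lambda>h. \<Sum>j\<in>UNIV. D (\<nu>(j := Suc (\<nu> j))) y * h $ j)) (at y within unit_cube)"
        using D unfolding partials_upto_def k_def by blast
      then show ?thesis
        by (intro continuous_on_eq_continuous_within[THEN iffD2] ballI) (blast intro: has_derivative_continuous)
    next
      case False
      with that have eq: "(\<Sum>j\<in>UNIV. \<nu> j) = k" by simp
      show ?thesis
        unfolding continuous_on_def
      proof
        fix y :: "real ^ 'd" assume y: "y \<in> unit_cube"
        have "((\<lambda>z. C * norm (z - y) powr (\<beta> - of_int \<lceil>\<beta> - 1\<rceil>)) \<longlongrightarrow> C * norm (y - y) powr (\<beta> - of_int \<lceil>\<beta> - 1\<rceil>)) (at y within unit_cube)"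
          using e by (intro tendsto_intros) auto
        then have 0: "((\<lambda>z. C * norm (z - y) powr (\<beta> - of_int \<lceil>\<beta> - 1\<rceil>)) \<longlongrightarrow> 0) (at y within unit_cube)"
          by simp
        have "((\<lambda>z. D \<nu> z - D \<nu> y) \<longlongrightarrow> 0) (at y within unit_cube)"
          by (rule Lim_null_comparison[OF _ 0])
            (use H[OF eq[unfolded k_def] _ y] in \<open>auto simp: eventually_at_filter\<close>)
        then show "(D \<nu> \<longlongrightarrow> D \<nu> y) (at y within unit_cube)"
          by (rule LIM_zero_cancel)
      qed
    qed
    \<comment> \<open>The unit multi-indices, whose derivatives form the gradient.\<close>
    let ?e = "\<lambda>j. (\<lambda>_. 0)(j := Suc 0)"
    have s: "(\<Sum>i\<in>UNIV. ?e j i) = 1" for j :: 'd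
      by (simp add: fun_upd_def sum.delta)
    have "\<exists>B. \<forall>y\<in>unit_cube. \<bar>D (?e j) y\<bar> \<le> B" for j
    proof -
      have "compact (D (?e j) ` unit_cube)"
        using k s[of j] by (intro compact_continuous_image cont) auto
      then have "bounded (D (?e j) ` unit_cube)" by (rule compact_imp_bounded)
      then show ?thesis by (auto simp: bounded_iff)
    qed
    then obtain B where B: "\<And>j y. y \<in> unit_cube \<Longrightarrow> \<bar>D (?e j) y\<bar> \<le> B j" by metis
    have B0: "0 \<le> B j" for j using B[of 0 j] by (auto simp: mem_box_cart intro: order_trans[OF abs_ge_zero])
    have "norm (D (\<lambda>_. 0) y - D (\<lambda>_. 0) z) \<le> (\<Sum>j\<in>UNIV. B j) * norm (y - z)" if "y \<in> unit_cube" "z \<in> unit_cube" for y z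
    proof (rule differentiable_bound[OF _ _ _ that])
      show "convex (unit_cube :: (real ^ 'd) set)" by (rule convex_box)
      fix w :: "real ^ 'd" assume w: "w \<in> unit_cube"
      show "(D (\<lambda>_. 0) has_derivative (\<lambda>h. \<Sum>j\<in>UNIV. D (?e j) w * h $ j)) (at w within unit_cube)"
        using D k w unfolding partials_upto_def k_def by auto
      show "onorm (\<lambda>h. \<Sum>j\<in>UNIV. D (?e j) w * h $ j) \<le> (\<Sum>j\<in>UNIV. B j)"
      proof (rule onorm_le)
        fix h :: "real ^ 'd"
        have "norm (\<Sum>j\<in>UNIV. D (?e j) w * h $ j) \<le> (\<Sum>j\<in>UNIV. B j * norm h)"
          by (rule sum_norm_le) (auto simp: abs_mult intro!: mult_mono B[OF w] B0 component_le_norm_cart)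
        then show "norm (\<Sum>j\<in>UNIV. D (?e j) w * h $ j) \<le> (\<Sum>j\<in>UNIV. B j) * norm h"
          by (simp add: sum_distrib_right)
      qed
    qed
    then show ?thesis
      using False B0 D0 by (intro that[of "\<Sum>j\<in>UNIV. B j"]) (auto intro!: sum_nonneg)
  qed
qed

lemma holder_class_continuous:
  fixes g :: "real ^ 'd::finite \<Rightarrow> real"
  assumes "g \<in> holder_class \<beta>" "\<beta> > 0"
  shows "continuous_on unit_cube g"
proof -
  obtain C where C: "\<And>y z. y \<in> unit_cube \<Longrightarrow> z \<in> unit_cube \<Longrightarrow> \<bar>g y - g z\<bar> \<le> C * norm (y - z) powr min 1 \<beta>"
    using holder_class_lipschitz[OF assms] by metis
  show ?thesis
    unfolding continuous_on_def
  proof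
    fix y :: "real ^ 'd" assume y: "y \<in> unit_cube"
    have "((\<lambda>z. C * norm (z - y) powr min 1 \<beta>) \<longlongrightarrow> C * norm (y - y) powr min 1 \<beta>) (at y within unit_cube)"
      using assms(2) by (intro tendsto_intros) auto
    then have 0: "((\<lambda>z. C * norm (z - y) powr min 1 \<beta>) \<longlongrightarrow> 0) (at y within unit_cube)"
      by simp
    have "((\<lambda>z. g z - g y) \<longlongrightarrow> 0) (at y within unit_cube)"
      by (rule Lim_null_comparison[OF _ 0]) (use C[OF _ y] in \<open>auto simp: eventually_at_filter\<close>)
    then show "(g \<longlongrightarrow> g y) (at y within unit_cube)"
      by (rule LIM_zero_cancel)
  qed
qed

section \<open>Integrals against the standard exponential law\<close>

lemma nn_integral_exp1:
  assumes [measurable]: "f \<in> borel_measurable borel"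
  shows "(\<integral>\<^sup>+a. f a \<partial>exp1) = (\<integral>\<^sup>+a. ennreal (exp (- a)) * f a * indicator {0<..} a \<partial>lborel)"
proof -
  have "(\<integral>\<^sup>+a. f a \<partial>exp1) = (\<integral>\<^sup>+a. ennreal (exponential_density 1 a) * f a \<partial>lborel)"
    by (rule nn_integral_density) auto
  also have "\<dots> = (\<integral>\<^sup>+a. ennreal (exp (- a)) * f a * indicator {0<..} a \<partial>lborel)"
    by (rule nn_integral_cong_AE)
      (use AE_lborel_singleton[of 0] in \<open>auto simp: exponential_density_def indicator_def elim!: eventually_mono\<close>)
  finally show ?thesis .
qed

lemma AE_exp1_pos: "AE a in exp1. 0 < a"
  using AE_lborel_singleton[of 0]
  by (auto simp: AE_density exponential_density_def elim!: eventually_mono)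

lemma emeasure_exp1_UNIV [simp]: "emeasure exp1 UNIV = 1"
  using prob_space.emeasure_space_1[OF prob_space_exp1] by simp

lemma nn_integral_exp1_mono:
  assumes "\<And>a. 0 < a \<Longrightarrow> f a \<le> g a"
  shows "(\<integral>\<^sup>+a. f a \<partial>exp1) \<le> (\<integral>\<^sup>+a. g a \<partial>exp1)"
  by (rule nn_integral_mono_AE) (use AE_exp1_pos assms in \<open>auto elim!: eventually_mono\<close>)

interpretation exp1: prob_space exp1
  by (rule prob_space_exp1)

interpretation exp1_pair: pair_prob_space exp1 exp1 ..

lemma nn_integral_exp1_id: "(\<integral>\<^sup>+a. ennreal a \<partial>exp1) = 1"
proof -
  have "(\<integral>\<^sup>+a. ennreal a \<partial>exp1) = (\<integral>\<^sup>+a. ennreal (a * exp (- a)) * indicator {0..} a \<partial>lborel)"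
    by (subst nn_integral_exp1) (auto intro!: nn_integral_cong simp: indicator_def ennreal_mult' mult.commute)
  also have "\<dots> = ennreal (0 - (- (0 + 1) * exp (- 0)))"
  proof (rule nn_integral_FTC_atLeast)
    show "((\<lambda>a::real. - (a + 1) * exp (- a)) \<longlongrightarrow> 0) at_top" by real_asymp
  qed (auto intro!: derivative_eq_intros simp: algebra_simps)
  finally show ?thesis by simp
qed

text \<open>The part on [0, 1] contributes at most 1 / (2 - \<alpha>), the part beyond 1 at most the
  mean 1. The dependence on 2 - \<alpha> is kept explicit because \<open>\<alpha>\<close> will
  approach 2.\<close>

lemma nn_integral_exp1_powr:
  assumes "0 \<le> \<alpha>" "\<alpha> < 2"
  shows "(\<integral>\<^sup>+a. ennreal (a powr (1 - \<alpha>)) \<partial>exp1) \<le> ennreal (1 / (2 - \<alpha>) + 1)"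
proof -
  have "(\<integral>\<^sup>+a. ennreal (a powr (1 - \<alpha>)) \<partial>exp1) \<le>
      (\<integral>\<^sup>+a. ennreal (a powr (1 - \<alpha>)) * indicator {0..1} a + ennreal a \<partial>exp1)"
  proof (rule nn_integral_exp1_mono)
    fix a :: real assume a: "0 < a"
    have "a powr (1 - \<alpha>) \<le> a powr 1" if "1 \<le> a"
      using that assms by (intro powr_mono) auto
    with a show "ennreal (a powr (1 - \<alpha>)) \<le> ennreal (a powr (1 - \<alpha>)) * indicator {0..1} a + ennreal a"
      by (cases "a \<le> 1") (auto simp: indicator_def intro!: ennreal_leI)
  qed
  also have "\<dots> = (\<integral>\<^sup>+a. ennreal (a powr (1 - \<alpha>)) * indicator {0..1} a \<partial>exp1) + 1"
    by (subst nn_integral_add) (auto simp: nn_integral_exp1_id)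
  also have "(\<integral>\<^sup>+a. ennreal (a powr (1 - \<alpha>)) * indicator {0..1} a \<partial>exp1) \<le>
      (\<integral>\<^sup>+a. ennreal (indicator {0..1} a * a powr (1 - \<alpha>)) \<partial>lborel)"
    by (subst nn_integral_exp1, simp, rule nn_integral_mono)
      (auto simp: indicator_def intro!: ennreal_leI mult_left_le_one_le simp flip: ennreal_mult)
  also have "\<dots> = ennreal (1 powr (1 - \<alpha> + 1) / (1 - \<alpha> + 1))"
    using assms by (intro nn_integral_has_integral_lebesgue has_integral_powr_from_0) auto
  also have "\<dots> + 1 = ennreal (1 / (2 - \<alpha>) + 1)"
    using assms by (simp add: ennreal_plus)
  finally show ?thesis by (simp add: add_right_mono)
qed

lemma emeasure_exp1_atMost_le: "emeasure exp1 {..a} \<le> ennreal a"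
proof -
  have "emeasure exp1 {..a} = (\<integral>\<^sup>+b. indicator {..a} b \<partial>exp1)"
    by simp
  also have "\<dots> \<le> (\<integral>\<^sup>+b. indicator {0..a} b \<partial>lborel)"
    by (subst nn_integral_exp1, simp, rule nn_integral_mono)
      (auto simp: indicator_def)
  also have "\<dots> \<le> ennreal a"
    by (cases "a \<ge> 0") auto
  finally show ?thesis .
qed

text \<open>The sum is at least the larger of the two exponentials, and the other one lies below it
  with probability at most its size; this turns the power - \<alpha> into 1 - \<alpha> and admits
  every \<open>\<alpha>\<close> below 2. If a truncation is active, the sum is at least
  \<open>\<tau>\<close>.\<close>

lemma negative_moment:
  assumes \<alpha>: "0 \<le> \<alpha>" "\<alpha> < 2" and c: "0 < \<tau>" "\<tau> \<le> c" "\<tau> \<le> c'"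
  shows "(\<integral>\<^sup>+a. \<integral>\<^sup>+b. ennreal ((min c a + min c' b) powr (- \<alpha>)) \<partial>exp1 \<partial>exp1)
    \<le> ennreal ((6 + 2 * max 1 (\<tau> powr (- 2))) / (2 - \<alpha>))"
proof -
  let ?f = "\<lambda>a b. ennreal (a powr (- \<alpha>)) * indicator {..a} b"
  define m where "m = max 1 (\<tau> powr (- 2))"
  have m: "0 \<le> m" by (simp add: m_def)
  have [measurable]: "(\<lambda>(a, b). ?f a b) \<in> borel_measurable (exp1 \<Otimes>\<^sub>M exp1)"
  proof -
    have "(\<lambda>(a, b). ennreal (a powr (- \<alpha>)) * (if b \<le> a then 1 else 0)) \<in> borel_measurable (exp1 \<Otimes>\<^sub>M exp1)"
      by measurable
    then show ?thesis by (simp add: indicator_def)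
  qed
  have one: "(\<integral>\<^sup>+a. \<integral>\<^sup>+b. ?f a b \<partial>exp1 \<partial>exp1) \<le> ennreal (1 / (2 - \<alpha>) + 1)"
  proof -
    have "(\<integral>\<^sup>+a. \<integral>\<^sup>+b. ?f a b \<partial>exp1 \<partial>exp1) = (\<integral>\<^sup>+a. ennreal (a powr (- \<alpha>)) * emeasure exp1 {..a} \<partial>exp1)"
      by (simp add: nn_integral_cmult)
    also have "\<dots> \<le> (\<integral>\<^sup>+a. ennreal (a powr (1 - \<alpha>)) \<partial>exp1)"
    proof (rule nn_integral_exp1_mono)
      fix a :: real assume a: "0 < a"
      have "ennreal (a powr (- \<alpha>)) * emeasure exp1 {..a} \<le> ennreal (a powr (- \<alpha>)) * ennreal a"
        by (intro mult_left_mono emeasure_exp1_atMost_le) auto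
      also have "\<dots> = ennreal (a powr (1 - \<alpha>))"
        using a by (simp add: powr_diff powr_minus field_simps flip: ennreal_mult)
      finally show "ennreal (a powr (- \<alpha>)) * emeasure exp1 {..a} \<le> ennreal (a powr (1 - \<alpha>))" .
    qed
    also have "\<dots> \<le> ennreal (1 / (2 - \<alpha>) + 1)"
      by (rule nn_integral_exp1_powr[OF \<alpha>])
    finally show ?thesis .
  qed
  have two: "(\<integral>\<^sup>+a. \<integral>\<^sup>+b. ?f b a \<partial>exp1 \<partial>exp1) \<le> ennreal (1 / (2 - \<alpha>) + 1)"
    by (subst exp1_pair.Fubini') (use one in \<open>auto\<close>)
  have "(\<integral>\<^sup>+a. \<integral>\<^sup>+b. ennreal ((min c a + min c' b) powr (- \<alpha>)) \<partial>exp1 \<partial>exp1)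
    \<le> (\<integral>\<^sup>+a. \<integral>\<^sup>+b. ?f a b + ?f b a + ennreal m \<partial>exp1 \<partial>exp1)"
  proof (intro nn_integral_exp1_mono)
    fix a b :: real assume ab: "0 < a" "0 < b"
    have *: "t powr (- \<alpha>) \<le> s powr (- \<alpha>)" if "0 < s" "s \<le> t" for s t :: real
      using that \<alpha> by (intro powr_mono2') auto
    show "ennreal ((min c a + min c' b) powr (- \<alpha>)) \<le> ?f a b + ?f b a + ennreal m"
    proof (cases "a \<le> c \<and> b \<le> c'")
      case True
      have "(a + b) powr (- \<alpha>) \<le> (max a b) powr (- \<alpha>)"
        using ab by (intro *) auto
      with True ab show ?thesis
        by (cases "b \<le> a") (auto simp: indicator_def max_def intro: order_trans[OF ennreal_leI])
    next
      case False
      have "(min c a + min c' b) powr (- \<alpha>) \<le> \<tau> powr (- \<alpha>)"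
        using False ab c by (intro *) (auto simp: min_def)
      \<comment> \<open>\<open>m\<close> dominates this power for all exponents between 0 and 2,
        whether \<open>\<tau>\<close> is above or below 1.\<close>
      also have "\<dots> \<le> m"
      proof (cases "1 \<le> \<tau>")
        case True
        then have "\<tau> powr (- \<alpha>) \<le> 1 powr (- \<alpha>)" by (intro *) auto
        then show ?thesis by (simp add: m_def)
      next
        case False
        then have "\<tau> powr (- \<alpha>) \<le> \<tau> powr (- 2)" using c \<alpha> by (intro powr_mono') auto
        then show ?thesis by (simp add: m_def)
      qed
      finally have "(min c a + min c' b) powr (- \<alpha>) \<le> m" .
      then have "ennreal ((min c a + min c' b) powr (- \<alpha>)) \<le> ennreal m"
        by (rule ennreal_leI)
      then show ?thesis by (simp add: add_increasing)
    qed
  qed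
  also have "\<dots> = (\<integral>\<^sup>+a. \<integral>\<^sup>+b. ?f a b \<partial>exp1 \<partial>exp1) + (\<integral>\<^sup>+a. \<integral>\<^sup>+b. ?f b a \<partial>exp1 \<partial>exp1) + ennreal m"
  proof -
    have [measurable]: "(\<lambda>(a, b). ?f b a) \<in> borel_measurable (exp1 \<Otimes>\<^sub>M exp1)"
    proof -
      have "(\<lambda>(a, b). ennreal (b powr (- \<alpha>)) * (if a \<le> b then 1 else 0)) \<in> borel_measurable (exp1 \<Otimes>\<^sub>M exp1)"
        by measurable
      then show ?thesis by (simp add: indicator_def)
    qed
    show ?thesis by (simp add: nn_integral_add)
  qed
  also have "\<dots> \<le> ennreal (1 / (2 - \<alpha>) + 1) + ennreal (1 / (2 - \<alpha>) + 1) + ennreal m"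
    by (intro add_mono one two) auto
  also have "\<dots> = ennreal (2 / (2 - \<alpha>) + 2 + m)"
    using \<alpha> m by (simp flip: ennreal_plus add: add_divide_distrib[symmetric])
  \<comment> \<open>Since 2 - \<alpha> is at most 2, the constant terms are absorbed into the common
    denominator.\<close>
  also have "2 / (2 - \<alpha>) + 2 + m \<le> (6 + 2 * m) / (2 - \<alpha>)"
  proof -
    have "(2 + m) * (2 - \<alpha>) \<le> (2 + m) * 2"
      using \<alpha> m by (intro mult_left_mono) auto
    moreover have "(2 + m) * 2 = 4 + 2 * m" by simp
    ultimately have "2 + (2 + m) * (2 - \<alpha>) \<le> 6 + 2 * m" by linarith
    moreover have "2 / (2 - \<alpha>) + 2 + m = (2 + (2 + m) * (2 - \<alpha>)) / (2 - \<alpha>)"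
      using \<alpha> by (simp add: add_divide_distrib)
    ultimately show ?thesis using \<alpha> by (auto intro!: divide_right_mono)
  qed
  finally show ?thesis unfolding m_def by (simp add: ennreal_leI)
qed

lemma positive_moment:
  "(\<integral>\<^sup>+a. \<integral>\<^sup>+b. ennreal (min c a + min c' b) \<partial>exp1 \<partial>exp1) \<le> 2"
proof -
  have "(\<integral>\<^sup>+a. \<integral>\<^sup>+b. ennreal (min c a + min c' b) \<partial>exp1 \<partial>exp1) \<le> (\<integral>\<^sup>+a. \<integral>\<^sup>+b. ennreal a + ennreal b \<partial>exp1 \<partial>exp1)"
    by (intro nn_integral_exp1_mono) (auto intro!: ennreal_leI simp flip: ennreal_plus)
  also have "\<dots> = 2"
    by (simp add: nn_integral_add nn_integral_exp1_id)
  finally show ?thesis .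
qed

section \<open>Overlap of two random intervals around 0, relative to the product of their
  lengths\<close>

definition overlap_ratio :: "real \<times> real \<Rightarrow> real \<times> real \<Rightarrow> real" where
  "overlap_ratio p q = (min (fst p) (fst q) + min (snd p) (snd q)) / ((fst p + snd p) * (fst q + snd q))"

lemma overlap_ratio_measurable [measurable]:
  assumes [measurable]: "p \<in> N \<rightarrow>\<^sub>M borel \<Otimes>\<^sub>M borel" "q \<in> N \<rightarrow>\<^sub>M borel \<Otimes>\<^sub>M borel"
  shows "(\<lambda>w. overlap_ratio (p w) (q w)) \<in> borel_measurable N"
  unfolding overlap_ratio_def by measurable

lemma overlap_ratio_commute: "overlap_ratio p q = overlap_ratio q p"
  by (simp add: overlap_ratio_def min.commute mult.commute)

lemma overlap_ratio_nonneg: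
  "0 \<le> a \<Longrightarrow> 0 \<le> b \<Longrightarrow> 0 \<le> a' \<Longrightarrow> 0 \<le> b' \<Longrightarrow> 0 \<le> overlap_ratio (a, b) (a', b')"
  by (auto simp: overlap_ratio_def)

text \<open>The intersection is no longer than the second interval, whose length cancels.\<close>

lemma overlap_ratio_le:
  assumes "0 \<le> a" "0 \<le> b" "0 \<le> a'" "0 \<le> b'" "0 < \<tau>" "\<tau> \<le> a + b"
  shows "overlap_ratio (a, b) (a', b') \<le> 1 / \<tau>"
proof (cases "a' + b' = 0")
  case False
  then have p: "0 < a' + b'" using assms by linarith
  have "overlap_ratio (a, b) (a', b') \<le> (a' + b') / ((a + b) * (a' + b'))"
    unfolding overlap_ratio_def fst_conv snd_conv
    by (rule divide_right_mono) (use assms p in \<open>auto intro!: add_mono\<close>)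
  also have "\<dots> = 1 / (a + b)" using p by simp
  also have "\<dots> \<le> 1 / \<tau>" using assms by (intro divide_left_mono) auto
  finally show ?thesis .
qed (use assms in \<open>auto simp: overlap_ratio_def\<close>)

text \<open>If the truncation acts, the same interval is long before and after it, so both ratios
  lie between 0 and 1 / \<tau> and their difference is no larger than either bound.\<close>

lemma overlap_ratio_truncate:
  assumes "0 < a" "0 < b" "0 < a'" "0 < b'" and \<tau>: "0 < \<tau>" "\<tau> \<le> c" "\<tau> \<le> c'"
  shows "\<bar>overlap_ratio (min c a, min c' b) (min c a', min c' b') - overlap_ratio (a, b) (a', b')\<bar> \<le> 1 / \<tau>"
proof (cases "a \<le> c \<and> b \<le> c' \<and> a' \<le> c \<and> b' \<le> c'")
  case True
  then have "min c a = a" "min c' b = b" "min c a' = a'" "min c' b' = b'" by auto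
  then show ?thesis using \<tau> by simp
next
  case False
  have nn: "0 \<le> min c a" "0 \<le> min c' b" "0 \<le> min c a'" "0 \<le> min c' b'"
    using assms by auto
  have "overlap_ratio (min c a, min c' b) (min c a', min c' b') \<le> 1 / \<tau> \<and> overlap_ratio (a, b) (a', b') \<le> 1 / \<tau>"
  proof (cases "a \<le> c \<and> b \<le> c'")
    case True
    with False have "\<tau> \<le> min c a' + min c' b'" "\<tau> \<le> a' + b'"
      using assms by (auto simp: min_def)
    then show ?thesis
      using overlap_ratio_le[OF nn(3,4,1,2) \<tau>(1)] overlap_ratio_le[of a' b' a b \<tau>] assms
      by (auto simp: overlap_ratio_commute)
  next
    case False
    then have "\<tau> \<le> min c a + min c' b" "\<tau> \<le> a + b"
      using assms by (auto simp: min_def)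
    then show ?thesis
      using overlap_ratio_le[OF nn \<tau>(1)] overlap_ratio_le[of a b a' b' \<tau>] assms by auto
  qed
  moreover have "0 \<le> overlap_ratio (min c a, min c' b) (min c a', min c' b')" "0 \<le> overlap_ratio (a, b) (a', b')"
    using nn assms by (auto intro!: overlap_ratio_nonneg)
  ultimately show ?thesis by linarith
qed

text \<open>Writing the overlap as \<open>\<integral> 1{y \<in> I} 1{y \<in> I'} dy\<close> turns the expected overlap ratio into
  \<open>2 \<integral> h(y)\<^sup>2 dy\<close>, where \<open>h\<close> is the following function.\<close>

definition kernel_half :: "real \<Rightarrow> ennreal" where
  "kernel_half y = (\<integral>\<^sup>+g. ennreal (exp (- g) * (g - y) / g) * indicator {y<..} g \<partial>lborel)"

text \<open>Here \<open>kernel_half\<close> appears as the mean of 1 / (a + b) on the event a > y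
  for independent exponentials. With g = a + b as variable in place of b, exchanging the integrals
  leaves the length g - y of the range of a.\<close>

lemma kernel_half_eq:
  assumes "y > 0"
  shows "(\<integral>\<^sup>+a. \<integral>\<^sup>+b. ennreal (1 / (a + b)) * indicator {y<..} a \<partial>exp1 \<partial>exp1) = kernel_half y"
proof -
  have "(\<integral>\<^sup>+a. \<integral>\<^sup>+b. ennreal (1 / (a + b)) * indicator {y<..} a \<partial>exp1 \<partial>exp1) =
     (\<integral>\<^sup>+a. (\<integral>\<^sup>+b. ennreal (1 / (a + b)) \<partial>exp1) * indicator {y<..} a \<partial>exp1)"
    by (simp add: nn_integral_multc)
  also have "\<dots> = (\<integral>\<^sup>+a. (ennreal (exp (- a)) * (\<integral>\<^sup>+b. ennreal (1 / (a + b)) \<partial>exp1)) * indicator {y<..} a \<partial>lborel)"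
    using assms
    by (subst nn_integral_exp1, measurable) (auto intro!: nn_integral_cong simp: indicator_def)
  also have "\<dots> = (\<integral>\<^sup>+a. (\<integral>\<^sup>+g. ennreal (exp (- g) / g) * indicator {a<..} g \<partial>lborel) * indicator {y<..} a \<partial>lborel)"
  proof (rule nn_integral_cong)
    fix a :: real
    show "(ennreal (exp (- a)) * (\<integral>\<^sup>+b. ennreal (1 / (a + b)) \<partial>exp1)) * indicator {y<..} a =
       (\<integral>\<^sup>+g. ennreal (exp (- g) / g) * indicator {a<..} g \<partial>lborel) * indicator {y<..} a"
    proof (cases "a > y")
      case True
      have e: "exp (- a - b) = exp (- a) * exp (- b)" for b
        by (simp flip: exp_add)
      have "ennreal (exp (- a)) * (\<integral>\<^sup>+b. ennreal (1 / (a + b)) \<partial>exp1) =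
        (\<integral>\<^sup>+b. ennreal (exp (- (a + b)) / (a + b)) * indicator {a<..} (a + 1 * b) \<partial>lborel)"
        using True assms
        by (subst nn_integral_exp1, measurable)
          (auto simp flip: nn_integral_cmult ennreal_mult intro!: nn_integral_cong
            simp: indicator_def e)
      also have "\<dots> = (\<integral>\<^sup>+g. ennreal (exp (- g) / g) * indicator {a<..} g \<partial>lborel)"
        by (subst nn_integral_real_affine[where c = 1 and t = a]) auto
      finally show ?thesis by simp
    qed simp
  qed
  also have "\<dots> = (\<integral>\<^sup>+a. \<integral>\<^sup>+g. ennreal (exp (- g) / g) * (if a < g \<and> y < a then 1 else 0) \<partial>lborel \<partial>lborel)"
    by (subst nn_integral_multc[symmetric], measurable) (auto intro!: nn_integral_cong simp: indicator_def)
  also have "\<dots> = (\<integral>\<^sup>+g. \<integral>\<^sup>+a. ennreal (exp (- g) / g) * (if a < g \<and> y < a then 1 else 0) \<partial>lborel \<partial>lborel)"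
    by (rule lborel_pair.Fubini') measurable
  also have "\<dots> = (\<integral>\<^sup>+g. ennreal (exp (- g) / g) * emeasure lborel {y<..<g} \<partial>lborel)"
  proof (rule nn_integral_cong)
    fix g :: real
    have "(\<integral>\<^sup>+a. ennreal (exp (- g) / g) * (if a < g \<and> y < a then 1 else 0) \<partial>lborel) =
      (\<integral>\<^sup>+a. ennreal (exp (- g) / g) * indicator {y<..<g} a \<partial>lborel)"
      by (intro nn_integral_cong) (auto simp: indicator_def)
    then show "(\<integral>\<^sup>+a. ennreal (exp (- g) / g) * (if a < g \<and> y < a then 1 else 0) \<partial>lborel) = ennreal (exp (- g) / g) * emeasure lborel {y<..<g}"
      by (simp add: nn_integral_cmult)
  qed
  also have "\<dots> = kernel_half y"
    unfolding kernel_half_def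
  proof (rule nn_integral_cong)
    fix g :: real
    show "ennreal (exp (- g) / g) * emeasure lborel {y<..<g} = ennreal (exp (- g) * (g - y) / g) * indicator {y<..} g"
      using assms by (cases "y < g") (auto simp flip: ennreal_mult)
  qed
  finally show ?thesis .
qed

text \<open>The square becomes a double integral over lengths g and g'. Integrating y out first
  leaves a function of their minimum and maximum; by symmetry the part g < g' counts twice, and
  taking the ratio of the two lengths as variable separates an elementary exponential integral from
  a rational one.\<close>

lemma kernel_half_square:
  "(\<integral>\<^sup>+y. (kernel_half y)\<^sup>2 * indicator {0<..} y \<partial>lborel) = ennreal ((2 - 2 * ln 2) / 3)"
proof -
  define Q where "Q = (\<lambda>y g. ennreal (exp (- g) * (g - y) / g) * (if y < g then 1 else 0))"
  \<comment> \<open>For s the minimum and m the maximum of g and g', the integral of (g - y) (g' -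
    y) / (g g') over y in [0, s] equals s / 2 - s^2 / (6 m).\<close>
  define J where "J = (\<lambda>g g'::real. ennreal (exp (- g) * exp (- g') * (min g g' / 2 - (min g g')\<^sup>2 / (6 * max g g'))) *
     (if 0 < g \<and> 0 < g' then 1 else 0))"
  define H where "H = (\<lambda>g g'. J g g' * (if g < g' then 1 else 0))"
  have [measurable]: "(\<lambda>(y, g). Q y g) \<in> borel_measurable (borel \<Otimes>\<^sub>M borel)"
    unfolding Q_def by measurable
  have [measurable]: "(\<lambda>(y, g). J y g) \<in> borel_measurable (borel \<Otimes>\<^sub>M borel)"
    unfolding J_def by measurable
  have [measurable]: "(\<lambda>(y, g). H y g) \<in> borel_measurable (borel \<Otimes>\<^sub>M borel)"
    unfolding H_def by measurable
  have k: "kernel_half y = (\<integral>\<^sup>+g. Q y g \<partial>lborel)" for y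
    unfolding kernel_half_def Q_def by (intro nn_integral_cong) (simp add: indicator_def)
  have J_eq: "(\<integral>\<^sup>+y. Q y g * Q y g' * indicator {0<..} y \<partial>lborel) = J g g'" for g g'
  proof (cases "0 < g \<and> 0 < g'")
    case False
    then have "Q y g * Q y g' * indicator {0<..} y = 0" for y
      by (auto simp: Q_def indicator_def)
    then have "(\<integral>\<^sup>+y. Q y g * Q y g' * indicator {0<..} y \<partial>lborel) = 0"
      by (simp only: nn_integral_const mult_zero_left)
    then show ?thesis using False by (auto simp: J_def)
  next
    case True
    let ?s = "min g g'" and ?e = "exp (- g) * exp (- g') / (g * g')"
    have "(\<integral>\<^sup>+y. Q y g * Q y g' * indicator {0<..} y \<partial>lborel) =
      (\<integral>\<^sup>+y. ennreal (?e * ((g - y) * (g' - y))) * indicator {0..?s} y \<partial>lborel)"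
    proof (rule nn_integral_cong_AE)
      have "AE y in lborel. y \<noteq> 0 \<and> y \<noteq> g \<and> y \<noteq> g'"
        using AE_lborel_singleton[of 0] AE_lborel_singleton[of g] AE_lborel_singleton[of g'] by auto
      then show "AE y in lborel. Q y g * Q y g' * indicator {0<..} y =
        ennreal (?e * ((g - y) * (g' - y))) * indicator {0..?s} y"
        by eventually_elim (insert True, auto simp: Q_def indicator_def field_simps simp flip: ennreal_mult)
    qed
    also have "\<dots> = ennreal (?e * (g * g' * ?s - (g + g') * ?s\<^sup>2 / 2 + ?s ^ 3 / 3) -
         ?e * (g * g' * 0 - (g + g') * 0\<^sup>2 / 2 + 0 ^ 3 / 3))"
    proof (rule nn_integral_FTC_Icc)
      show "((\<lambda>y. ?e * (g * g' * y - (g + g') * y\<^sup>2 / 2 + y ^ 3 / 3)) has_real_derivative ?e * ((g - y) * (g' - y))) (at y)" for y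
      proof -
        have "((\<lambda>y. g * g' * y - (g + g') * y\<^sup>2 / 2 + y ^ 3 / 3) has_real_derivative (g - y) * (g' - y)) (at y)"
          by (auto intro!: derivative_eq_intros simp: algebra_simps power2_eq_square)
        from DERIV_cmult[OF this, of ?e] show ?thesis .
      qed
      show "0 \<le> ?e * ((g - y) * (g' - y))" if "y \<in> {0..?s}" for y
        using that True by (intro mult_nonneg_nonneg divide_nonneg_nonneg) auto
    qed (use True in auto)
    also have "\<dots> = J g g'"
      unfolding J_def using True
      by (auto simp: min_def max_def field_simps power2_eq_square power3_eq_cube intro!: arg_cong[where f = ennreal])
    finally show ?thesis .
  qed
  have "(\<integral>\<^sup>+y. (kernel_half y)\<^sup>2 * indicator {0<..} y \<partial>lborel) =
    (\<integral>\<^sup>+y. \<integral>\<^sup>+g. \<integral>\<^sup>+g'. Q y g * Q y g' * indicator {0<..} y \<partial>lborel \<partial>lborel \<partial>lborel)"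
    unfolding k power2_eq_square
    by (intro nn_integral_cong) (simp add: nn_integral_cmult nn_integral_multc)
  also have "\<dots> = (\<integral>\<^sup>+g. \<integral>\<^sup>+y. \<integral>\<^sup>+g'. Q y g * Q y g' * indicator {0<..} y \<partial>lborel \<partial>lborel \<partial>lborel)"
    by (rule lborel_pair.Fubini') measurable
  also have "\<dots> = (\<integral>\<^sup>+g. \<integral>\<^sup>+g'. \<integral>\<^sup>+y. Q y g * Q y g' * indicator {0<..} y \<partial>lborel \<partial>lborel \<partial>lborel)"
    by (intro nn_integral_cong lborel_pair.Fubini') measurable
  \<comment> \<open>The diagonal is a null set, so the two strict halves make up the whole.\<close>
  also have "\<dots> = (\<integral>\<^sup>+g. \<integral>\<^sup>+g'. H g g' + H g' g \<partial>lborel \<partial>lborel)"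
  proof (rule nn_integral_cong, rule nn_integral_cong_AE)
    fix g :: real
    show "AE g' in lborel. (\<integral>\<^sup>+y. Q y g * Q y g' * indicator {0<..} y \<partial>lborel) = H g g' + H g' g"
      unfolding J_eq using AE_lborel_singleton[of g]
      by eventually_elim (auto simp: H_def J_def min.commute max.commute mult.commute)
  qed
  also have "\<dots> = (\<integral>\<^sup>+g. \<integral>\<^sup>+g'. H g g' \<partial>lborel \<partial>lborel) + (\<integral>\<^sup>+g. \<integral>\<^sup>+g'. H g' g \<partial>lborel \<partial>lborel)"
    by (simp add: nn_integral_add)
  also have "(\<integral>\<^sup>+g. \<integral>\<^sup>+g'. H g g' \<partial>lborel \<partial>lborel) = (\<integral>\<^sup>+g. \<integral>\<^sup>+g'. H g' g \<partial>lborel \<partial>lborel)"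
    by (rule lborel_pair.Fubini') measurable
  \<comment> \<open>Substitution of s = t * r with r in (0, 1); the Jacobian t and the factor t of
    \<open>H\<close> combine to t^2.\<close>
  also have "(\<integral>\<^sup>+g. \<integral>\<^sup>+g'. H g' g \<partial>lborel \<partial>lborel) =
     (\<integral>\<^sup>+t. \<integral>\<^sup>+r. ennreal (t\<^sup>2 * exp (- t * (1 + r))) * indicator {0..} t * (ennreal (r / 2 - r\<^sup>2 / 6) * indicator {0<..<1} r) \<partial>lborel \<partial>lborel)"
  proof (rule nn_integral_cong)
    fix t :: real
    show "(\<integral>\<^sup>+s. H s t \<partial>lborel) =
      (\<integral>\<^sup>+r. ennreal (t\<^sup>2 * exp (- t * (1 + r))) * indicator {0..} t * (ennreal (r / 2 - r\<^sup>2 / 6) * indicator {0<..<1} r) \<partial>lborel)"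
    proof (cases "t > 0")
      case False
      then have "H s t = 0" for s by (auto simp: H_def J_def)
      moreover have "t\<^sup>2 * exp (- t * (1 + r)) = 0" if "t \<ge> 0" for r using False that by simp
      ultimately show ?thesis by (auto simp: indicator_def)
    next
      case True
      have "(\<integral>\<^sup>+s. H s t \<partial>lborel) = (\<integral>\<^sup>+r. ennreal \<bar>t\<bar> * H (0 + t * r) t \<partial>lborel)"
        using True by (subst nn_integral_real_affine[where c = t and t = 0]) (auto simp: nn_integral_cmult)
      also have "\<dots> = (\<integral>\<^sup>+r. ennreal (t\<^sup>2 * exp (- t * (1 + r))) * indicator {0..} t * (ennreal (r / 2 - r\<^sup>2 / 6) * indicator {0<..<1} r) \<partial>lborel)"
      proof (rule nn_integral_cong)
        fix r :: real
        have sgn: "0 < t * r \<longleftrightarrow> 0 < r" "t * r < t \<longleftrightarrow> r < 1"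
          using True by (auto simp: zero_less_mult_iff)
        show "ennreal \<bar>t\<bar> * H (0 + t * r) t = ennreal (t\<^sup>2 * exp (- t * (1 + r))) * indicator {0..} t * (ennreal (r / 2 - r\<^sup>2 / 6) * indicator {0<..<1} r)"
        proof (cases "0 < r \<and> r < 1")
          case False
          then show ?thesis using sgn by (auto simp: H_def J_def)
        next
          case r: True
          then have m: "min (t * r) t = t * r" "max (t * r) t = t" using sgn(2) by auto
          have "r * r \<le> r * 1" using r by (intro mult_left_mono) auto
          then have nn: "0 \<le> r / 2 - r\<^sup>2 / 6" using r unfolding power2_eq_square by linarith
          have "t * (exp (- (t * r)) * exp (- t) * (t * r / 2 - (t * r)\<^sup>2 / (6 * t))) =
             t\<^sup>2 * exp (- t * (1 + r)) * (r / 2 - r\<^sup>2 / 6)"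
            using True by (simp add: mult_exp_exp field_simps power2_eq_square)
          then show ?thesis
            using r True sgn nn m unfolding H_def J_def
            by (simp add: ennreal_mult'[symmetric] ennreal_mult''[symmetric])
        qed
      qed
      finally show ?thesis .
    qed
  qed
  also have "\<dots> = (\<integral>\<^sup>+r. \<integral>\<^sup>+t. ennreal (t\<^sup>2 * exp (- t * (1 + r))) * indicator {0..} t * (ennreal (r / 2 - r\<^sup>2 / 6) * indicator {0<..<1} r) \<partial>lborel \<partial>lborel)"
    by (rule lborel_pair.Fubini') measurable
  also have "\<dots> = (\<integral>\<^sup>+r. ennreal ((r - r\<^sup>2 / 3) / (1 + r) ^ 3) * indicator {0..1} r \<partial>lborel)"
  proof (rule nn_integral_cong_AE)
    have "AE r in lborel. r \<noteq> 0 \<and> r \<noteq> (1::real)"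
      using AE_lborel_singleton[of 0] AE_lborel_singleton[of 1] by auto
    then show "AE r in lborel. (\<integral>\<^sup>+t. ennreal (t\<^sup>2 * exp (- t * (1 + r))) * indicator {0..} t * (ennreal (r / 2 - r\<^sup>2 / 6) * indicator {0<..<1} r) \<partial>lborel) =
      ennreal ((r - r\<^sup>2 / 3) / (1 + r) ^ 3) * indicator {0..1} r"
    proof eventually_elim
      case (elim r)
      show ?case
      proof (cases "0 < r \<and> r < 1")
        case False
        with elim show ?thesis by (auto simp: indicator_def)
      next
        case True
        define c where "c = 1 + r"
        have c: "c > 0" using True by (simp add: c_def)
        have "(\<integral>\<^sup>+t. ennreal (t\<^sup>2 * exp (- t * c)) * indicator {0..} t \<partial>lborel) =
           ennreal (0 - (- (0\<^sup>2 / c + 2 * 0 / c\<^sup>2 + 2 / c ^ 3) * exp (- 0 * c)))"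
        proof (rule nn_integral_FTC_atLeast)
          show "((\<lambda>t. - (t\<^sup>2 / c + 2 * t / c\<^sup>2 + 2 / c ^ 3) * exp (- t * c)) \<longlongrightarrow> 0) at_top"
            using c by real_asymp
          show "((\<lambda>t. - (t\<^sup>2 / c + 2 * t / c\<^sup>2 + 2 / c ^ 3) * exp (- t * c)) has_real_derivative t\<^sup>2 * exp (- t * c)) (at t)" for t
            using c by (auto intro!: derivative_eq_intros simp: field_simps power2_eq_square power3_eq_cube)
        qed auto
        then have "(\<integral>\<^sup>+t. ennreal (t\<^sup>2 * exp (- t * (1 + r))) * indicator {0..} t \<partial>lborel) = ennreal (2 / (1 + r) ^ 3)"
          by (simp add: c_def)
        then have "(\<integral>\<^sup>+t. ennreal (t\<^sup>2 * exp (- t * (1 + r))) * indicator {0..} t * (ennreal (r / 2 - r\<^sup>2 / 6) * indicator {0<..<1} r) \<partial>lborel)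
           = ennreal (2 / (1 + r) ^ 3) * ennreal (r / 2 - r\<^sup>2 / 6)"
          using True by (subst nn_integral_multc) auto
        also have "\<dots> = ennreal (2 / (1 + r) ^ 3 * (r / 2 - r\<^sup>2 / 6))"
          using True by (intro ennreal_mult''[symmetric]) (auto simp: power2_eq_square mult_left_le_one_le intro: order_trans[of _ r])
        also have "2 / (1 + r) ^ 3 * (r / 2 - r\<^sup>2 / 6) = 2 * (r / 2 - r\<^sup>2 / 6) / (1 + r) ^ 3"
          by simp
        also have "2 * (r / 2 - r\<^sup>2 / 6) = r - r\<^sup>2 / 3" by simp
        finally show ?thesis using True by simp
      qed
    qed
  qed
  \<comment> \<open>In terms of s = 1 + r the integrand is - 1 / (3 s) + 5 / (3 s^2) - 4 / (3 s^3),
    which gives this antiderivative.\<close>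
  also have "\<dots> = ennreal ((- ln (1 + 1) / 3 - 5 / (3 * (1 + 1)) + 2 / (3 * (1 + 1)\<^sup>2)) - (- ln (1 + 0) / 3 - 5 / (3 * (1 + 0)) + 2 / (3 * (1 + 0)\<^sup>2)))"
  proof (rule nn_integral_FTC_Icc)
    show "((\<lambda>r. - ln (1 + r) / 3 - 5 / (3 * (1 + r)) + 2 / (3 * (1 + r)\<^sup>2)) has_real_derivative (r - r\<^sup>2 / 3) / (1 + r) ^ 3) (at r)"
      if "r \<in> {0..1}" for r :: real
    proof -
      define s where "s = 1 + r"
      have s: "s > 0" "r = s - 1" using that by (auto simp: s_def)
      have "((\<lambda>r. - ln (1 + r) / 3 - 5 / (3 * (1 + r)) + 2 / (3 * (1 + r)\<^sup>2)) has_real_derivative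
         (- (1 / s) / 3 + 5 / (3 * s\<^sup>2) - 4 / (3 * s ^ 3))) (at r)"
      proof -
        have 1: "((\<lambda>r. - ln (1 + r) / 3) has_real_derivative - (1 / s) / 3) (at r)"
          unfolding s_def using that by (auto intro!: derivative_eq_intros simp: divide_simps)
        have "((\<lambda>r. 5 / (3 * (1 + r))) has_real_derivative - (5 * 3) / ((3 * s) * (3 * s))) (at r)"
          unfolding s_def using that by (auto intro!: derivative_eq_intros)
        also have "- (5 * 3) / ((3 * s) * (3 * s)) = - 5 / (3 * s\<^sup>2)"
          using s(1) by (simp add: field_simps power2_eq_square)
        finally have 2: "((\<lambda>r. 5 / (3 * (1 + r))) has_real_derivative - 5 / (3 * s\<^sup>2)) (at r)" .
        have "((\<lambda>r. 2 / (3 * (1 + r)\<^sup>2)) has_real_derivative - (2 * (3 * (2 * s))) / ((3 * s\<^sup>2) * (3 * s\<^sup>2))) (at r)"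
          unfolding s_def using that by (auto intro!: derivative_eq_intros)
        also have "- (2 * (3 * (2 * s))) / ((3 * s\<^sup>2) * (3 * s\<^sup>2)) = - 4 / (3 * s ^ 3)"
          using s(1) by (simp add: field_simps power2_eq_square power3_eq_cube)
        finally have 3: "((\<lambda>r. 2 / (3 * (1 + r)\<^sup>2)) has_real_derivative - 4 / (3 * s ^ 3)) (at r)" .
        from DERIV_add[OF DERIV_diff[OF 1 2] 3] show ?thesis by simp
      qed
      also have "(- (1 / s) / 3 + 5 / (3 * s\<^sup>2) - 4 / (3 * s ^ 3)) = (r - r\<^sup>2 / 3) / (1 + r) ^ 3"
        unfolding s_def[symmetric] using s(1) unfolding s(2)
        by (simp add: field_simps power2_eq_square power3_eq_cube)
      finally show ?thesis .
    qed
    show "0 \<le> (r - r\<^sup>2 / 3) / (1 + r) ^ 3" if "r \<in> {0..1}" for r :: real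
    proof -
      have "r * r \<le> r * 1" using that by (intro mult_left_mono) auto
      then have "0 \<le> r - r\<^sup>2 / 3" using that unfolding power2_eq_square by auto
      then show ?thesis using that by auto
    qed
  qed auto
  also have "\<dots> = ennreal ((1 - ln 2) / 3)"
    by (auto intro!: arg_cong[where f = ennreal] simp: field_simps)
  also have "ennreal ((1 - ln 2) / 3) + ennreal ((1 - ln 2) / 3) = ennreal ((2 - 2 * ln 2) / 3)"
    using ln_le_minus_one[of 2] by (simp flip: ennreal_plus add: field_simps)
  finally show ?thesis .
qed

text \<open>The ratio is split into the parts of the overlap on the two sides of 0, which have equal
  means by exchanging the roles of \<open>a\<close> and \<open>b\<close>. On one side the two
  independent intervals contribute equal factors for each y, so Fubini yields the square of
  \<open>kernel_half\<close>.\<close>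

lemma overlap_ratio_expectation:
  "(\<integral>\<^sup>+a. \<integral>\<^sup>+b. \<integral>\<^sup>+a'. \<integral>\<^sup>+b'. ennreal (overlap_ratio (a, b) (a', b')) \<partial>exp1 \<partial>exp1 \<partial>exp1 \<partial>exp1)
    = ennreal ((4 - 4 * ln 2) / 3)"
proof -
  let ?E = "exp1 \<Otimes>\<^sub>M exp1"
  interpret E: prob_space ?E by (rule exp1_pair.prob_space_axioms)
  interpret EE: pair_sigma_finite ?E ?E ..
  interpret LE: pair_sigma_finite lborel ?E ..
  interpret EL: pair_sigma_finite ?E lborel ..
  define h where "h = (\<lambda>p q. ennreal (min (fst p) (fst q) / ((fst p + snd p) * (fst q + snd q :: real))))"
  have [measurable]: "(\<lambda>(p, q). h p q) \<in> borel_measurable (?E \<Otimes>\<^sub>M ?E)"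
    unfolding h_def by measurable
  define u where "u = (\<lambda>y p. ennreal (1 / (fst p + snd p :: real)) * indicator {y<..} (fst p))"
  have [measurable]: "(\<lambda>(y, p). u y p) \<in> borel_measurable (borel \<Otimes>\<^sub>M ?E)"
    unfolding u_def indicator_def greaterThan_iff by measurable
  have pos: "AE p in ?E. 0 < fst p \<and> 0 < snd p"
  proof (rule exp1_pair.AE_pair_measure)
    show "{p \<in> space ?E. 0 < fst p \<and> 0 < snd p} \<in> sets ?E" by measurable
    show "AE a in exp1. AE b in exp1. 0 < fst (a, b) \<and> 0 < snd (a, b)"
      using AE_exp1_pos by eventually_elim (use AE_exp1_pos in \<open>auto elim!: eventually_mono\<close>)
  qed
  have swap: "(\<integral>\<^sup>+p. f p \<partial>?E) = (\<integral>\<^sup>+p. f (snd p, fst p) \<partial>?E)" if [measurable]: "f \<in> borel_measurable ?E" for f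
    by (subst exp1_pair.distr_pair_swap, subst nn_integral_distr) (auto simp: case_prod_beta)
  have half: "(\<integral>\<^sup>+p. \<integral>\<^sup>+q. h p q \<partial>?E \<partial>?E) = (\<integral>\<^sup>+y. (kernel_half y)\<^sup>2 * indicator {0<..} y \<partial>lborel)"
  proof -
    have I: "(\<integral>\<^sup>+p. u y p \<partial>?E) = kernel_half y" if "y > 0" for y
      using kernel_half_eq[OF that]
      by (subst exp1.nn_integral_fst[symmetric]) (auto simp: u_def)
    have "(\<integral>\<^sup>+p. \<integral>\<^sup>+q. h p q \<partial>?E \<partial>?E) = (\<integral>\<^sup>+p. \<integral>\<^sup>+q. \<integral>\<^sup>+y. u y p * u y q * indicator {0<..} y \<partial>lborel \<partial>?E \<partial>?E)"
    proof (rule nn_integral_cong_AE, rule AE_mp[OF pos], rule AE_I2, rule impI, rule nn_integral_cong_AE, rule AE_mp[OF pos], rule AE_I2, rule impI)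
      fix p q :: "real \<times> real" assume pq: "0 < fst p \<and> 0 < snd p" "0 < fst q \<and> 0 < snd q"
      let ?c = "1 / (fst p + snd p) * (1 / (fst q + snd q))"
      have "(\<integral>\<^sup>+y. u y p * u y q * indicator {0<..} y \<partial>lborel) = (\<integral>\<^sup>+y. ennreal ?c * indicator {0<..<min (fst p) (fst q)} y \<partial>lborel)"
        using pq by (intro nn_integral_cong) (auto simp: u_def indicator_def simp flip: ennreal_mult)
      also have "\<dots> = ennreal ?c * ennreal (min (fst p) (fst q))"
        using pq by (subst nn_integral_cmult_indicator) auto
      also have "\<dots> = h p q"
        using pq unfolding h_def by (subst ennreal_mult[symmetric]) auto
      finally show "h p q = (\<integral>\<^sup>+y. u y p * u y q * indicator {0<..} y \<partial>lborel)" ..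
    qed
    also have "\<dots> = (\<integral>\<^sup>+p. \<integral>\<^sup>+y. \<integral>\<^sup>+q. u y p * u y q * indicator {0<..} y \<partial>?E \<partial>lborel \<partial>?E)"
      by (intro nn_integral_cong LE.Fubini') measurable
    also have "\<dots> = (\<integral>\<^sup>+y. \<integral>\<^sup>+p. \<integral>\<^sup>+q. u y p * u y q * indicator {0<..} y \<partial>?E \<partial>?E \<partial>lborel)"
      by (intro LE.Fubini') measurable
    also have "\<dots> = (\<integral>\<^sup>+y. (kernel_half y)\<^sup>2 * indicator {0<..} y \<partial>lborel)"
    proof (rule nn_integral_cong)
      fix y :: real
      have "(\<integral>\<^sup>+p. \<integral>\<^sup>+q. u y p * u y q * indicator {0<..} y \<partial>?E \<partial>?E) = (\<integral>\<^sup>+p. u y p \<partial>?E) * (\<integral>\<^sup>+p. u y p \<partial>?E) * indicator {0<..} y"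
        by (simp add: nn_integral_multc nn_integral_cmult)
      then show "(\<integral>\<^sup>+p. \<integral>\<^sup>+q. u y p * u y q * indicator {0<..} y \<partial>?E \<partial>?E) = (kernel_half y)\<^sup>2 * indicator {0<..} y"
        by (cases "y > 0") (simp_all add: I power2_eq_square)
    qed
    finally show ?thesis .
  qed
  let ?h' = "\<lambda>p q. h (snd p, fst p) (snd q, fst q)"
  have "(\<integral>\<^sup>+a. \<integral>\<^sup>+b. \<integral>\<^sup>+a'. \<integral>\<^sup>+b'. ennreal (overlap_ratio (a, b) (a', b')) \<partial>exp1 \<partial>exp1 \<partial>exp1 \<partial>exp1) =
    (\<integral>\<^sup>+p. \<integral>\<^sup>+q. ennreal (overlap_ratio p q) \<partial>?E \<partial>?E)"
    by (simp add: exp1.nn_integral_fst[symmetric])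
  also have "\<dots> = (\<integral>\<^sup>+p. \<integral>\<^sup>+q. h p q + ?h' p q \<partial>?E \<partial>?E)"
  proof (rule nn_integral_cong_AE, rule AE_mp[OF pos], rule AE_I2, rule impI, rule nn_integral_cong_AE, rule AE_mp[OF pos], rule AE_I2, rule impI)
    fix p q :: "real \<times> real" assume pq: "0 < fst p \<and> 0 < snd p" "0 < fst q \<and> 0 < snd q"
    then show "ennreal (overlap_ratio p q) = h p q + ?h' p q"
      unfolding h_def overlap_ratio_def
      by (subst ennreal_plus[symmetric]) (auto simp: add_divide_distrib add.commute)
  qed
  also have "\<dots> = (\<integral>\<^sup>+p. (\<integral>\<^sup>+q. h p q \<partial>?E) + (\<integral>\<^sup>+q. ?h' p q \<partial>?E) \<partial>?E)"
    by (intro nn_integral_cong nn_integral_add) measurable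
  also have "\<dots> = (\<integral>\<^sup>+p. \<integral>\<^sup>+q. h p q \<partial>?E \<partial>?E) + (\<integral>\<^sup>+p. \<integral>\<^sup>+q. ?h' p q \<partial>?E \<partial>?E)"
    by (rule nn_integral_add) measurable
  also have "(\<integral>\<^sup>+p. \<integral>\<^sup>+q. ?h' p q \<partial>?E \<partial>?E) = (\<integral>\<^sup>+p. \<integral>\<^sup>+q. h p q \<partial>?E \<partial>?E)"
  proof -
    have "(\<integral>\<^sup>+p. \<integral>\<^sup>+q. h p q \<partial>?E \<partial>?E) = (\<integral>\<^sup>+p. \<integral>\<^sup>+q. h (snd p, fst p) q \<partial>?E \<partial>?E)"
      by (rule swap) measurable
    also have "\<dots> = (\<integral>\<^sup>+p. \<integral>\<^sup>+q. ?h' p q \<partial>?E \<partial>?E)"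
      by (intro nn_integral_cong swap) measurable
    finally show ?thesis ..
  qed
  also have "(\<integral>\<^sup>+p. \<integral>\<^sup>+q. h p q \<partial>?E \<partial>?E) + (\<integral>\<^sup>+p. \<integral>\<^sup>+q. h p q \<partial>?E \<partial>?E) = ennreal ((4 - 4 * ln 2) / 3)"
    using ln_le_minus_one[of 2] unfolding half kernel_half_square
    by (simp flip: ennreal_plus add: field_simps)
  finally show ?thesis .
qed

text \<open>The truncation at the boundary of the cube changes the ratio only when one of the cells is at
  least \<open>\<tau>\<close> wide, and then the ratio is at most \<open>1 / \<tau>\<close>.\<close>

lemma truncated_overlap_ratio_expectation:
  assumes \<tau>: "0 < \<tau>" "\<tau> \<le> c" "\<tau> \<le> c'"
  shows "\<exists>r\<ge>0. (\<integral>\<^sup>+a. \<integral>\<^sup>+b. \<integral>\<^sup>+a'. \<integral>\<^sup>+b'. ennreal (overlap_ratio (min c a, min c' b) (min c a', min c' b')) \<partial>exp1 \<partial>exp1 \<partial>exp1 \<partial>exp1) = ennreal r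
    \<and> \<bar>r - (4 - 4 * ln 2) / 3\<bar> \<le> 1 / \<tau>"
proof -
  let ?k = "(4 - 4 * ln 2) / 3 :: real"
  let ?E = "\<lambda>f. \<integral>\<^sup>+a. \<integral>\<^sup>+b. \<integral>\<^sup>+a'. \<integral>\<^sup>+b'. ennreal (f a b a' b') \<partial>exp1 \<partial>exp1 \<partial>exp1 \<partial>exp1"
  let ?t = "\<lambda>a b a' b'. overlap_ratio (min c a, min c' b) (min c a', min c' b')"
  let ?o = "\<lambda>a b a' b'. overlap_ratio (a, b) (a', b')"
  have k: "?k \<ge> 0" using ln_le_minus_one[of 2] by simp
  have add: "(\<integral>\<^sup>+a. \<integral>\<^sup>+b. \<integral>\<^sup>+a'. \<integral>\<^sup>+b'. ennreal (f a b a' b') + ennreal (1 / \<tau>) \<partial>exp1 \<partial>exp1 \<partial>exp1 \<partial>exp1) = ?E f + ennreal (1 / \<tau>)"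
    if "f = (\<lambda>a b a' b'. g (a, b) (a', b'))" and [measurable]: "(\<lambda>(p, q). g p q) \<in> borel_measurable ((borel \<Otimes>\<^sub>M borel) \<Otimes>\<^sub>M (borel \<Otimes>\<^sub>M borel))" for f g
    unfolding that(1) by (simp add: nn_integral_add)
  have "?E ?t \<le> (\<integral>\<^sup>+a. \<integral>\<^sup>+b. \<integral>\<^sup>+a'. \<integral>\<^sup>+b'. ennreal (?o a b a' b') + ennreal (1 / \<tau>) \<partial>exp1 \<partial>exp1 \<partial>exp1 \<partial>exp1)"
  proof (intro nn_integral_exp1_mono)
    fix a b a' b' :: real assume p: "0 < a" "0 < b" "0 < a'" "0 < b'"
    show "ennreal (?t a b a' b') \<le> ennreal (?o a b a' b') + ennreal (1 / \<tau>)"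
    proof -
      have "?t a b a' b' \<le> ?o a b a' b' + 1 / \<tau>" "0 \<le> ?o a b a' b'"
        using overlap_ratio_truncate[OF p \<tau>] overlap_ratio_nonneg[of a b a' b'] p by auto
      then show ?thesis using ennreal_leI[of "?t a b a' b'" "?o a b a' b' + 1 / \<tau>"] \<tau> by simp
    qed
  qed
  also have "\<dots> = ennreal (?k + 1 / \<tau>)"
    using k \<tau> by (subst add[of _ overlap_ratio]) (auto simp: overlap_ratio_expectation)
  finally have le: "?E ?t \<le> ennreal (?k + 1 / \<tau>)" .
  then obtain r where r: "r \<ge> 0" "?E ?t = ennreal r"
    by (cases "?E ?t") (auto simp: top_unique)
  have "ennreal ?k \<le> (\<integral>\<^sup>+a. \<integral>\<^sup>+b. \<integral>\<^sup>+a'. \<integral>\<^sup>+b'. ennreal (?t a b a' b') + ennreal (1 / \<tau>) \<partial>exp1 \<partial>exp1 \<partial>exp1 \<partial>exp1)"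
    unfolding overlap_ratio_expectation[symmetric]
  proof (intro nn_integral_exp1_mono)
    fix a b a' b' :: real assume p: "0 < a" "0 < b" "0 < a'" "0 < b'"
    have "0 \<le> ?t a b a' b'" using p \<tau> by (intro overlap_ratio_nonneg) auto
    moreover have "?o a b a' b' \<le> ?t a b a' b' + 1 / \<tau>"
      using overlap_ratio_truncate[OF p \<tau>] by linarith
    ultimately show "ennreal (?o a b a' b') \<le> ennreal (?t a b a' b') + ennreal (1 / \<tau>)"
      using ennreal_leI[of "?o a b a' b'" "?t a b a' b' + 1 / \<tau>"] \<tau> by simp
  qed
  also have "\<dots> = ennreal (r + 1 / \<tau>)"
    using r \<tau>
    by (subst add[of _ "\<lambda>p q. overlap_ratio (min c (fst p), min c' (snd p)) (min c (fst q), min c' (snd q))"]) auto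
  finally have "ennreal ?k \<le> ennreal (r + 1 / \<tau>)" .
  then have "?k \<le> r + 1 / \<tau>"
    by (subst (asm) ennreal_le_iff) (use r \<tau> in auto)
  moreover have "r \<le> ?k + 1 / \<tau>"
    using le unfolding r(2) by (subst (asm) ennreal_le_iff) (use k \<tau> in auto)
  ultimately have "\<bar>r - ?k\<bar> \<le> 1 / \<tau>" by linarith
  with r show ?thesis by blast
qed

section \<open>Counts in an i.i.d. sample\<close>

locale iid_sample = prob_space M for M :: "'w measure" +
  fixes S :: "'a measure" and Q :: "'a measure" and n :: nat and X :: "nat \<Rightarrow> 'w \<Rightarrow> 'a"
  assumes indep: "indep_vars (\<lambda>_. S) X {1..n}"
    and law: "\<And>i. i \<in> {1..n} \<Longrightarrow> distr M S (X i) = Q"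
    and n_pos: "n \<ge> 1"
begin

lemma X_measurable [measurable]: "i \<in> {1..n} \<Longrightarrow> X i \<in> M \<rightarrow>\<^sub>M S"
  using indep by (simp add: indep_vars_def)

lemma sets_Q: "sets Q = sets S"
  using law[of 1] n_pos by (metis atLeastAtMost_iff order_refl sets_distr)

lemma prob_space_Q: "prob_space Q"
proof -
  have "prob_space (distr M S (X 1))"
    using n_pos by (intro prob_space_distr X_measurable) auto
  then show ?thesis using law[of 1] n_pos by simp
qed

lemma integral_law:
  fixes g :: "'a \<Rightarrow> real"
  assumes "i \<in> {1..n}" "g \<in> borel_measurable S"
  shows "expectation (\<lambda>\<omega>. g (X i \<omega>)) = (\<integral>x. g x \<partial>Q)"
  unfolding law[OF assms(1), symmetric] using assms X_measurable by (subst integral_distr) auto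

lemma compose_measurable:
  "g \<in> S \<rightarrow>\<^sub>M N \<Longrightarrow> i \<in> {1..n} \<Longrightarrow> (\<lambda>\<omega>. g (X i \<omega>)) \<in> M \<rightarrow>\<^sub>M N"
  using X_measurable by (rule measurable_compose)

lemma sum_measurable:
  "g \<in> borel_measurable S \<Longrightarrow> (\<lambda>\<omega>. \<Sum>i=1..n. g (X i \<omega>)) \<in> borel_measurable M" for g :: "_ \<Rightarrow> real"
  by (intro borel_measurable_sum) (rule compose_measurable)

lemma nn_integral_deviation:
  fixes g :: "'a \<Rightarrow> real" and b v :: real
  assumes [measurable]: "g \<in> borel_measurable S" and bd: "\<And>x. \<bar>g x\<bar> \<le> b"
    and v: "(\<integral>x. (g x)\<^sup>2 \<partial>Q) \<le> v"
  shows "(\<integral>\<^sup>+\<omega>. ennreal (((\<Sum>i=1..n. g (X i \<omega>)) - n * (\<integral>x. g x \<partial>Q))\<^sup>2) \<partial>M) \<le> ennreal (n * v)"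
proof -
  interpret Q: prob_space Q by (rule prob_space_Q)
  have gQ [measurable]: "g \<in> borel_measurable Q" using assms(1) sets_Q by (simp cong: measurable_cong_sets)
  define m where "m = (\<integral>x. g x \<partial>Q)"
  define Z where "Z = (\<lambda>i \<omega>. g (X i \<omega>) - m)"
  have b0: "0 \<le> b" using bd[of undefined] by linarith
  have bd2: "(g x)\<^sup>2 \<le> b\<^sup>2" for x
    using power_mono[OF bd[of x], of 2] by simp
  have intQ: "integrable Q g" "integrable Q (\<lambda>x. (g x)\<^sup>2)"
    using bd Q.integrable_const_bound[of g b] bd2 Q.integrable_const_bound[of "\<lambda>x. (g x)\<^sup>2" "b\<^sup>2"] by auto
  have [measurable]: "Z i \<in> borel_measurable M" if "i \<in> {1..n}" for i
    unfolding Z_def using that by measurable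
  have Zb: "\<bar>Z i \<omega>\<bar> \<le> b + \<bar>m\<bar>" for i \<omega>
    unfolding Z_def using bd[of "X i \<omega>"] by linarith
  have int1: "integrable M (Z i)" if "i \<in> {1..n}" for i
    by (rule integrable_const_bound[where B = "b + \<bar>m\<bar>"]) (use that Zb in auto)
  have int2: "integrable M (\<lambda>\<omega>. Z i \<omega> * Z j \<omega>)" if "i \<in> {1..n}" "j \<in> {1..n}" for i j
  proof (rule integrable_const_bound[where B = "(b + \<bar>m\<bar>) * (b + \<bar>m\<bar>)"])
    show "AE \<omega> in M. norm (Z i \<omega> * Z j \<omega>) \<le> (b + \<bar>m\<bar>) * (b + \<bar>m\<bar>)"
      using Zb b0 by (auto simp: abs_mult intro!: mult_mono)
  qed (use that in measurable)
  have mean: "expectation (Z i) = 0" if "i \<in> {1..n}" for i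
  proof -
    have "integrable M (\<lambda>\<omega>. g (X i \<omega>))"
      by (rule integrable_const_bound[where B = b]) (use that bd in auto)
    then show ?thesis
      unfolding Z_def using integral_law[OF that assms(1)] prob_space by (simp add: m_def)
  qed
  have cross: "expectation (\<lambda>\<omega>. Z i \<omega> * Z j \<omega>) = 0" if "i \<in> {1..n}" "j \<in> {1..n}" "i \<noteq> j" for i j
  proof -
    have "indep_vars (\<lambda>_. borel) (\<lambda>i \<omega>. g (X i \<omega>) - m) {1..n}"
      by (rule indep_vars_compose2[OF indep]) measurable
    then have "indep_vars (\<lambda>_. borel) Z {i, j}"
      unfolding Z_def by (rule indep_vars_subset) (use that in auto)
    then have "expectation (\<lambda>\<omega>. \<Prod>k\<in>{i, j}. Z k \<omega>) = (\<Prod>k\<in>{i, j}. expectation (Z k))"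
      using that int1 by (intro indep_vars_lebesgue_integral) auto
    then show ?thesis using that by (simp add: mean)
  qed
  have var: "expectation (\<lambda>\<omega>. Z i \<omega> * Z i \<omega>) \<le> v" if "i \<in> {1..n}" for i
  proof -
    have "expectation (\<lambda>\<omega>. Z i \<omega> * Z i \<omega>) = (\<integral>x. (g x - m) * (g x - m) \<partial>Q)"
      unfolding Z_def by (rule integral_law[OF that]) measurable
    also have "\<dots> = (\<integral>x. (g x)\<^sup>2 - 2 * m * g x + m\<^sup>2 \<partial>Q)"
      by (simp add: algebra_simps power2_eq_square)
    also have "\<dots> = (\<integral>x. (g x)\<^sup>2 \<partial>Q) - m\<^sup>2"
      using intQ Q.prob_space by (simp add: m_def power2_eq_square)
    also have "\<dots> \<le> v" using v by (smt (verit) zero_le_power2)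
    finally show ?thesis .
  qed
  have "(\<integral>\<^sup>+\<omega>. ennreal (((\<Sum>i=1..n. g (X i \<omega>)) - n * m)\<^sup>2) \<partial>M) = (\<integral>\<^sup>+\<omega>. ennreal (\<Sum>i=1..n. \<Sum>j=1..n. Z i \<omega> * Z j \<omega>) \<partial>M)"
    by (simp add: Z_def sum_subtractf power2_eq_square sum_product[symmetric])
  also have "\<dots> = ennreal (expectation (\<lambda>\<omega>. \<Sum>i=1..n. \<Sum>j=1..n. Z i \<omega> * Z j \<omega>))"
  proof (rule nn_integral_eq_integral)
    show "integrable M (\<lambda>\<omega>. \<Sum>i=1..n. \<Sum>j=1..n. Z i \<omega> * Z j \<omega>)"
      by (intro Bochner_Integration.integrable_sum int2) auto
    show "AE \<omega> in M. 0 \<le> (\<Sum>i=1..n. \<Sum>j=1..n. Z i \<omega> * Z j \<omega>)"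
      by (simp add: sum_product[symmetric])
  qed
  also have "expectation (\<lambda>\<omega>. \<Sum>i=1..n. \<Sum>j=1..n. Z i \<omega> * Z j \<omega>) = (\<Sum>i=1..n. \<Sum>j=1..n. expectation (\<lambda>\<omega>. Z i \<omega> * Z j \<omega>))"
    using int2 by (subst Bochner_Integration.integral_sum) (auto intro!: Bochner_Integration.integrable_sum sum.cong Bochner_Integration.integral_sum)
  also have "\<dots> = (\<Sum>i=1..n. \<Sum>j=1..n. if j = i then expectation (\<lambda>\<omega>. Z i \<omega> * Z i \<omega>) else 0)"
    using cross by (intro sum.cong) auto
  also have "\<dots> = (\<Sum>i=1..n. expectation (\<lambda>\<omega>. Z i \<omega> * Z i \<omega>))"
    by (intro sum.cong) auto
  also have "\<dots> \<le> (\<Sum>i=1..n. v)" using var by (intro sum_mono) auto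
  finally show ?thesis by (simp add: m_def ennreal_leI)
qed

definition hits :: "'a set \<Rightarrow> 'w \<Rightarrow> real" where
  "hits C \<omega> = (\<Sum>i=1..n. indicat_real C (X i \<omega>))"

lemma hits_measurable [measurable]: "C \<in> sets S \<Longrightarrow> hits C \<in> borel_measurable M"
  unfolding hits_def[abs_def]
  by (intro borel_measurable_sum measurable_compose[OF X_measurable borel_measurable_indicator])

text \<open>A count is an integer; with division by 0 giving 0 this makes n / count at most n
  without any condition on the cell.\<close>

lemma hits_cases: "hits C \<omega> = 0 \<or> 1 \<le> hits C \<omega>"
proof -
  have "hits C \<omega> = real (card {i\<in>{1..n}. X i \<omega> \<in> C})"
    unfolding hits_def indicator_def by (simp add: sum.If_cases Int_def)
  then show ?thesis by (cases "card {i\<in>{1..n}. X i \<omega> \<in> C}") auto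
qed

lemma hits_nonneg: "0 \<le> hits C \<omega>"
  using hits_cases[of C \<omega>] by linarith

lemma nn_integral_hits_deviation:
  assumes "C \<in> sets S"
  shows "(\<integral>\<^sup>+\<omega>. ennreal ((hits C \<omega> - n * measure Q C)\<^sup>2) \<partial>M) \<le> ennreal (n * measure Q C)"
proof -
  interpret Q: prob_space Q by (rule prob_space_Q)
  have [simp]: "(\<lambda>x. (indicat_real C x)\<^sup>2) = indicat_real C"
    by (auto simp: indicator_def)
  have C: "C \<in> sets Q" using assms sets_Q by simp
  show ?thesis
    using nn_integral_deviation[where g = "indicat_real C" and b = 1 and v = "measure Q C"] assms C
    by (simp add: hits_def indicator_le_1)
qed

text \<open>Chernoff bound with parameter 1: since 1 - exp(- 1) is at least 3/5, the mean of exp(-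
  count) is at most exp(- 3 n p / 5), and Markov at the level n p / 2 costs a factor exp(n p / 2);
  3/5 - 1/2 = 1/10.\<close>

lemma hits_lower_tail:
  assumes C: "C \<in> sets S"
  shows "prob {\<omega> \<in> space M. hits C \<omega> \<le> n * measure Q C / 2} \<le> exp (- (n * measure Q C / 10))"
proof -
  interpret Q: prob_space Q by (rule prob_space_Q)
  define p where "p = measure Q C"
  note [measurable] = C
  have CQ [measurable]: "C \<in> sets Q" using C sets_Q by simp
  have p: "0 \<le> p" "p \<le> 1" by (auto simp: p_def)
  have e1: "exp (- 1) \<le> (2 / 5 :: real)"
  proof -
    have "(5 / 2 :: real) \<le> exp 1"
      using exp_lower_Taylor_quadratic[of 1] by simp
    then have "inverse (exp 1) \<le> inverse (5 / 2 :: real)" by (intro le_imp_inverse_le) auto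
    then show ?thesis by (simp add: exp_minus)
  qed
  have one: "expectation (\<lambda>\<omega>. exp (- indicat_real C (X i \<omega>))) \<le> exp (- (3 / 5) * p)" if i: "i \<in> {1..n}" for i
  proof -
    have "expectation (\<lambda>\<omega>. exp (- indicat_real C (X i \<omega>))) = (\<integral>x. exp (- indicat_real C x) \<partial>Q)"
      by (rule integral_law[OF i]) measurable
    also have "\<dots> = (\<integral>x. 1 - (1 - exp (- 1)) * indicat_real C x \<partial>Q)"
      by (intro Bochner_Integration.integral_cong) (auto simp: indicator_def)
    also have "\<dots> = 1 - (1 - exp (- 1)) * p"
      using Q.prob_space by (subst Bochner_Integration.integral_diff) (auto simp: p_def intro!: Q.integrable_const_bound[where B = 1])
    also have "\<dots> \<le> 1 + (- (3 / 5) * p)"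
      using mult_right_mono[OF e1 p(1)] by (simp add: algebra_simps)
    also have "\<dots> \<le> exp (- (3 / 5) * p)" by (rule exp_ge_add_one_self)
    finally show ?thesis .
  qed
  have int: "integrable M (\<lambda>\<omega>. exp (- indicat_real C (X i \<omega>)))" if "i \<in> {1..n}" for i
    by (rule integrable_const_bound[where B = 1]) (use that in \<open>auto simp: indicator_def\<close>)
  have "indep_vars (\<lambda>_. borel) (\<lambda>i \<omega>. exp (- indicat_real C (X i \<omega>))) {1..n}"
    by (rule indep_vars_compose2[OF indep]) measurable
  then have "expectation (\<lambda>\<omega>. \<Prod>i\<in>{1..n}. exp (- indicat_real C (X i \<omega>))) = (\<Prod>i\<in>{1..n}. expectation (\<lambda>\<omega>. exp (- indicat_real C (X i \<omega>))))"
    using int by (intro indep_vars_lebesgue_integral) auto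
  also have "\<dots> \<le> (\<Prod>i\<in>{1..n}. exp (- (3 / 5) * p))"
    using one by (intro prod_mono) (auto intro!: integral_nonneg)
  also have "\<dots> = exp (n * (- (3 / 5) * p))"
    by (simp only: exp_of_nat_mult prod_constant card_atLeastAtMost diff_Suc_1 add_diff_cancel_right')
  also have "(\<lambda>\<omega>. \<Prod>i\<in>{1..n}. exp (- indicat_real C (X i \<omega>))) = (\<lambda>\<omega>. exp (- hits C \<omega>))"
    by (simp add: hits_def exp_sum[symmetric] sum_negf)
  finally have E: "expectation (\<lambda>\<omega>. exp (- hits C \<omega>)) \<le> exp (n * (- (3 / 5) * p))" .
  have "prob {\<omega> \<in> space M. hits C \<omega> \<le> n * p / 2} = prob {\<omega> \<in> space M. exp (- (n * p / 2)) \<le> exp (- hits C \<omega>)}"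
    by simp
  also have "\<dots> \<le> expectation (\<lambda>\<omega>. exp (- hits C \<omega>)) / exp (- (n * p / 2))"
    using hits_nonneg
    by (intro integral_Markov_inequality_measure[where A = "{}"]) (auto intro!: integrable_const_bound[where B = 1])
  also have "\<dots> \<le> exp (n * (- (3 / 5) * p)) / exp (- (n * p / 2))"
    using E by (intro divide_right_mono) auto
  also have "\<dots> = exp (- (n * p / 10))"
    by (simp flip: exp_diff)
  finally show ?thesis by (simp add: p_def)
qed

text \<open>The lower tail is traded for powers of n p in the two moment bounds that follow: 200 = 2
  * 10^2 comes from the quadratic Taylor term, 27000 = 30^3 from the cube of t / 30 \<le> exp(t /
  30).\<close>

lemma exp_le_inverse_powers:
  fixes t :: real
  assumes "t > 0"
  shows "exp (- (t / 10)) \<le> 200 / t\<^sup>2" "exp (- (t / 10)) \<le> 27000 / t ^ 3"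
proof -
  have 2: "(t / 10)\<^sup>2 / 2 \<le> exp (t / 10)"
    using exp_lower_Taylor_quadratic[of "t / 10"] assms by simp
  have 3: "(t / 30) ^ 3 \<le> exp (t / 10)"
  proof -
    have "t / 30 \<le> exp (t / 30)" using exp_ge_add_one_self[of "t / 30"] by linarith
    then have "(t / 30) ^ 3 \<le> exp (t / 30) ^ 3"
      using assms by (intro power_mono) auto
    also have "\<dots> = exp (t / 10)" by (simp flip: exp_of_nat_mult)
    finally show ?thesis .
  qed
  show "exp (- (t / 10)) \<le> 200 / t\<^sup>2" "exp (- (t / 10)) \<le> 27000 / t ^ 3"
    using 2 3 assms by (auto simp: exp_minus field_simps power2_eq_square power3_eq_cube)
qed

text \<open>When the count exceeds half its mean the ratio is at most 2 / p, contributing 4 / p^2;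
  otherwise it is at most n, and the tail probability brings this down to 200 / p^2.\<close>

lemma inverse_hits_moment:
  fixes p :: real
  assumes C: "C \<in> sets S" and p: "p = measure Q C" "p > 0"
  shows "(\<integral>\<^sup>+\<omega>. ennreal ((n / hits C \<omega>)\<^sup>2) \<partial>M) \<le> ennreal (204 / p\<^sup>2)"
proof -
  note [measurable] = C
  let ?A = "{\<omega> \<in> space M. hits C \<omega> \<le> n * p / 2}"
  have n: "real n > 0" using n_pos by simp
  have "(\<integral>\<^sup>+\<omega>. ennreal ((n / hits C \<omega>)\<^sup>2) \<partial>M) \<le> (\<integral>\<^sup>+\<omega>. ennreal (4 / p\<^sup>2) + ennreal ((real n)\<^sup>2) * indicator ?A \<omega> \<partial>M)"
  proof (rule nn_integral_mono)
    fix \<omega> assume \<omega>: "\<omega> \<in> space M"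
    show "ennreal ((n / hits C \<omega>)\<^sup>2) \<le> ennreal (4 / p\<^sup>2) + ennreal ((real n)\<^sup>2) * indicator ?A \<omega>"
    proof (cases "\<omega> \<in> ?A")
      case True
      have "n / hits C \<omega> \<le> n"
        using hits_cases[of C \<omega>] n by (auto simp: field_simps)
      then have "(n / hits C \<omega>)\<^sup>2 \<le> (real n)\<^sup>2"
        using hits_nonneg[of C \<omega>] by (intro power_mono) auto
      with True show ?thesis by (simp add: add_increasing ennreal_leI)
    next
      case False
      with \<omega> have h: "n * p / 2 < hits C \<omega>" by auto
      have "n / hits C \<omega> \<le> n / (n * p / 2)"
        using h n p by (intro divide_left_mono mult_pos_pos) (auto intro: less_trans[of 0 "n * p / 2"])
      then have "(n / hits C \<omega>)\<^sup>2 \<le> (2 / p)\<^sup>2"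
        using hits_nonneg[of C \<omega>] n by (intro power_mono) auto
      with False show ?thesis by (simp add: power_divide ennreal_leI)
    qed
  qed
  also have "\<dots> = ennreal (4 / p\<^sup>2) + ennreal ((real n)\<^sup>2) * ennreal (prob ?A)"
    by (simp add: nn_integral_add nn_integral_cmult emeasure_eq_measure emeasure_space_1 prob_space)
  also have "\<dots> = ennreal (4 / p\<^sup>2 + (real n)\<^sup>2 * prob ?A)"
    by (simp add: ennreal_mult)
  also have "4 / p\<^sup>2 + (real n)\<^sup>2 * prob ?A \<le> 4 / p\<^sup>2 + (real n)\<^sup>2 * (200 / (n * p)\<^sup>2)"
    using hits_lower_tail[OF C] exp_le_inverse_powers(1)[of "n * p"] n p
    by (intro add_left_mono mult_left_mono) auto
  also have "\<dots> = 204 / p\<^sup>2"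
    using n p by (simp add: power_mult_distrib field_simps)
  finally show ?thesis by (simp add: ennreal_leI)
qed

text \<open>Again a split at half the mean. Above it the factor (2 / p)^2 multiplies the variance of
  the relative error, at most 1 / (n p), giving 4 / (n p^3); below it n^2 meets the cubic tail
  bound, giving 27000 / (n p^3).\<close>

lemma inverse_hits_deviation:
  fixes p :: real
  assumes C: "C \<in> sets S" and p: "p = measure Q C" "p > 0"
  shows "(\<integral>\<^sup>+\<omega>. ennreal ((n / hits C \<omega> * (1 - hits C \<omega> / (n * p)))\<^sup>2) \<partial>M) \<le> ennreal (27004 / (n * p ^ 3))"
proof -
  note [measurable] = C
  let ?A = "{\<omega> \<in> space M. hits C \<omega> \<le> n * p / 2}"
  let ?D = "\<lambda>\<omega>. (hits C \<omega> - n * measure Q C)\<^sup>2"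
  have n: "real n > 0" using n_pos by simp
  have "(\<integral>\<^sup>+\<omega>. ennreal ((n / hits C \<omega> * (1 - hits C \<omega> / (n * p)))\<^sup>2) \<partial>M) \<le>
     (\<integral>\<^sup>+\<omega>. ennreal (4 / (n\<^sup>2 * p ^ 4)) * ennreal (?D \<omega>) + ennreal ((real n)\<^sup>2) * indicator ?A \<omega> \<partial>M)"
  proof (rule nn_integral_mono)
    fix \<omega> assume \<omega>: "\<omega> \<in> space M"
    show "ennreal ((n / hits C \<omega> * (1 - hits C \<omega> / (n * p)))\<^sup>2) \<le> ennreal (4 / (n\<^sup>2 * p ^ 4)) * ennreal (?D \<omega>) + ennreal ((real n)\<^sup>2) * indicator ?A \<omega>"
    proof (cases "\<omega> \<in> ?A")
      case True
      have "0 \<le> n / hits C \<omega>" "n / hits C \<omega> \<le> n"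
        using hits_cases[of C \<omega>] n by (auto simp: field_simps)
      moreover have "0 \<le> 1 - hits C \<omega> / (n * p)" "1 - hits C \<omega> / (n * p) \<le> 1"
        using True hits_nonneg[of C \<omega>] n p by (auto simp: field_simps)
      ultimately have "\<bar>n / hits C \<omega> * (1 - hits C \<omega> / (n * p))\<bar> \<le> real n * 1"
        unfolding abs_mult by (intro mult_mono) auto
      then have "(n / hits C \<omega> * (1 - hits C \<omega> / (n * p)))\<^sup>2 \<le> (real n)\<^sup>2"
        by (intro abs_le_square_iff[THEN iffD1]) auto
      with True show ?thesis by (simp add: add_increasing ennreal_leI)
    next
      case False
      with \<omega> have h: "n * p / 2 < hits C \<omega>" by auto
      have h0: "0 < n * p / 2" using n p by simp
      have "0 < hits C \<omega>" using h h0 by linarith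
      then have "n / hits C \<omega> \<le> n / (n * p / 2)"
        using h h0 n by (intro divide_left_mono mult_pos_pos) simp_all
      then have 1: "(n / hits C \<omega>)\<^sup>2 \<le> (2 / p)\<^sup>2"
        using hits_nonneg[of C \<omega>] n by (intro power_mono) auto
      have q: "1 - hits C \<omega> / (n * p) = - (hits C \<omega> - n * p) / (n * p)"
        using n p by (simp add: field_simps)
      have "(n / hits C \<omega> * (1 - hits C \<omega> / (n * p)))\<^sup>2 = (n / hits C \<omega>)\<^sup>2 * (1 - hits C \<omega> / (n * p))\<^sup>2"
        by (rule power_mult_distrib)
      also have "\<dots> \<le> (2 / p)\<^sup>2 * (1 - hits C \<omega> / (n * p))\<^sup>2"
        using 1 by (intro mult_right_mono) auto
      also note q
      also have "(2 / p)\<^sup>2 * (- (hits C \<omega> - n * p) / (n * p))\<^sup>2 = 4 / (n\<^sup>2 * p ^ 4) * ?D \<omega>"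
        using n p by (simp add: power_divide power_mult_distrib p(1) power2_commute field_simps flip: power_add)
      finally have le: "(n / hits C \<omega> * (1 - hits C \<omega> / (n * p)))\<^sup>2 \<le> 4 / (n\<^sup>2 * p ^ 4) * ?D \<omega>"
        unfolding q .
      have eq: "ennreal (4 / (n\<^sup>2 * p ^ 4)) * ennreal (?D \<omega>) = ennreal (4 / (n\<^sup>2 * p ^ 4) * ?D \<omega>)"
        by (rule ennreal_mult[symmetric]) auto
      show ?thesis
        unfolding eq by (rule order_trans[OF ennreal_leI[OF le]]) (auto intro: add_increasing2)
    qed
  qed
  also have "\<dots> = ennreal (4 / (n\<^sup>2 * p ^ 4)) * (\<integral>\<^sup>+\<omega>. ennreal (?D \<omega>) \<partial>M) + ennreal ((real n)\<^sup>2) * ennreal (prob ?A)"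
    by (simp add: nn_integral_add nn_integral_cmult emeasure_eq_measure)
  also have "\<dots> \<le> ennreal (4 / (n\<^sup>2 * p ^ 4)) * ennreal (n * p) + ennreal ((real n)\<^sup>2) * ennreal (27000 / (n * p) ^ 3)"
    unfolding p(1)
    using hits_lower_tail[OF C] exp_le_inverse_powers(2)[of "n * p"] n p
    by (intro add_mono mult_left_mono nn_integral_hits_deviation[OF C] ennreal_leI) auto
  also have "\<dots> = ennreal (4 / (n\<^sup>2 * p ^ 4) * (n * p) + (real n)\<^sup>2 * (27000 / (n * p) ^ 3))"
  proof -
    have "0 \<le> a \<Longrightarrow> 0 \<le> b \<Longrightarrow> 0 \<le> c \<Longrightarrow> 0 \<le> d \<Longrightarrow> ennreal a * ennreal b + ennreal c * ennreal d = ennreal (a * b + c * d)" for a b c d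
      by (simp add: ennreal_mult)
    then show ?thesis using n p by auto
  qed
  also have "4 / (n\<^sup>2 * p ^ 4) * (n * p) + (real n)\<^sup>2 * (27000 / (n * p) ^ 3) = 27004 / (n * p ^ 3)"
    using n p by (simp add: power_mult_distrib field_simps eval_nat_numeral)
  finally show ?thesis .
qed

text \<open>Counts and weighted sum are replaced by their means one at a time, the count of the
  larger cell first. The weighted sum is at most \<open>b\<close> times the count of the smaller
  cell, so that ratio is bounded by \<open>b\<close> and no second inverse count has to be
  estimated. The errors are of order b^2 / (n p^3) once and b^2 / (n p^2 p') twice, all at most b^2
  / (n (p p')^(3/2)) since \<open>p' \<le> p\<close>; 81018 = 3 * (27004 + 1 + 1).\<close>

lemma weighted_hits_deviation_aux:
  fixes p p' b :: real
  assumes C: "C \<in> sets S" "C' \<in> sets S" and p: "p = measure Q C" "p' = measure Q C'" "0 < p'" "p' \<le> p"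
    and g [measurable]: "g \<in> borel_measurable S" and gb: "\<And>x. 0 \<le> g x" "\<And>x. g x \<le> b"
  shows "(\<integral>\<^sup>+\<omega>. ennreal ((n * (\<Sum>i=1..n. g (X i \<omega>) * indicat_real (C \<inter> C') (X i \<omega>)) / (hits C \<omega> * hits C' \<omega>)
      - (\<integral>x. g x * indicat_real (C \<inter> C') x \<partial>Q) / (p * p'))\<^sup>2) \<partial>M) \<le> ennreal (81018 * b\<^sup>2 / (n * (p * p') powr (3 / 2)))"
proof -
  interpret Q: prob_space Q by (rule prob_space_Q)
  note [measurable] = C
  have n: "real n > 0" using n_pos by simp
  have p0: "0 < p" using p by linarith
  have b0: "0 \<le> b" using gb[of undefined] by linarith
  define G where "G = (\<lambda>x. g x * indicat_real (C \<inter> C') x)"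
  have [measurable]: "G \<in> borel_measurable S" unfolding G_def by measurable
  have GQ [measurable]: "G \<in> borel_measurable Q" using \<open>G \<in> _\<close> sets_Q by (simp cong: measurable_cong_sets)
  have CQ [measurable]: "C \<in> sets Q" "C' \<in> sets Q" using C sets_Q by auto
  define Z where "Z = (\<lambda>\<omega>. \<Sum>i=1..n. G (X i \<omega>))"
  have [measurable]: "Z \<in> borel_measurable M"
    unfolding Z_def by (rule sum_measurable) measurable
  define s where "s = (\<integral>x. G x \<partial>Q)"
  let ?N = "hits C" and ?N' = "hits C'"
  have Gb: "0 \<le> G x" "\<bar>G x\<bar> \<le> b" for x
    using gb[of x] by (auto simp: G_def indicator_def b0)
  have Z0: "0 \<le> Z \<omega>" for \<omega> unfolding Z_def using Gb by (intro sum_nonneg) auto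
  have ZN: "Z \<omega> \<le> b * ?N \<omega>" "Z \<omega> \<le> b * ?N' \<omega>" for \<omega>
  proof -
    have 1: "G y \<le> b * indicat_real C y" and 2: "G y \<le> b * indicat_real C' y" for y
      using gb[of y] b0 by (auto simp: G_def indicator_def)
    show "Z \<omega> \<le> b * ?N \<omega>" unfolding Z_def hits_def sum_distrib_left by (intro sum_mono 1)
    show "Z \<omega> \<le> b * ?N' \<omega>" unfolding Z_def hits_def sum_distrib_left by (intro sum_mono 2)
  qed
  \<comment> \<open>A telescoping sum. If one of the counts is 0, the weighted sum vanishes as well,
    so the identity also holds under division by 0.\<close>
  have dec: "n * Z \<omega> / (?N \<omega> * ?N' \<omega>) - s / (p * p') =
     Z \<omega> / ?N' \<omega> * (n / ?N \<omega> * (1 - ?N \<omega> / (n * p)))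
     + Z \<omega> / ?N' \<omega> * (?N \<omega> / ?N \<omega>) / p * (1 - ?N' \<omega> / (n * p')) + (Z \<omega> - n * s) / (n * (p * p'))" for \<omega>
  proof (cases "?N \<omega> = 0 \<or> ?N' \<omega> = 0")
    case True
    then have "Z \<omega> = 0" using ZN[of \<omega>] Z0[of \<omega>] by auto
    then show ?thesis using n p0 p by simp
  next
    case False
    then have N: "?N \<omega> \<noteq> 0" "?N' \<omega> \<noteq> 0" by auto
    have "Z \<omega> / ?N' \<omega> * (n / ?N \<omega> * (1 - ?N \<omega> / (n * p))) = n * Z \<omega> / (?N \<omega> * ?N' \<omega>) - Z \<omega> / (?N' \<omega> * p)"
      using N n p0 by (simp add: right_diff_distrib mult.commute)
    moreover have "Z \<omega> / ?N' \<omega> * (?N \<omega> / ?N \<omega>) / p * (1 - ?N' \<omega> / (n * p')) = Z \<omega> / (?N' \<omega> * p) - Z \<omega> / (n * (p * p'))"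
      using N n p0 p(3) by (simp add: right_diff_distrib mult_ac)
    moreover have "(Z \<omega> - n * s) / (n * (p * p')) = Z \<omega> / (n * (p * p')) - s / (p * p')"
      using n by (simp add: diff_divide_distrib)
    ultimately show ?thesis by simp
  qed
  define e where "e = b\<^sup>2 / (n * (p * p') powr (3 / 2))"
  have e0: "0 \<le> e" using n p0 p(3) by (auto simp: e_def)
  have pw: "(p * p') powr (3 / 2) = p * p' * sqrt (p * p')"
  proof -
    have "(p * p') powr (3 / 2) = (p * p') powr (1 + 1 / 2)" by simp
    also have "\<dots> = (p * p') powr 1 * (p * p') powr (1 / 2)" by (rule powr_add)
    also have "\<dots> = p * p' * sqrt (p * p')" using p0 p(3) by (simp only: powr_half_sqrt powr_one mult_pos_pos less_imp_le)
    finally show ?thesis .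
  qed
  have sq: "sqrt (p * p') \<le> p"
    using p0 p(3,4) by (intro real_le_lsqrt) (auto simp: power2_eq_square)
  have pw1: "(p * p') powr (3 / 2) \<le> p\<^sup>2 * p'"
    unfolding pw using mult_left_mono[OF sq, of "p * p'"] p0 p(3) by (simp add: power2_eq_square mult_ac)
  have pw2: "(p * p') powr (3 / 2) \<le> p ^ 3"
  proof -
    have "p\<^sup>2 * p' \<le> p\<^sup>2 * p" using p0 p(4) by (intro mult_left_mono) auto
    with pw1 show ?thesis by (simp add: eval_nat_numeral mult_ac)
  qed
  have pwpos: "0 < (p * p') powr (3 / 2)" using p0 p(3) by simp
  have e1: "b\<^sup>2 / (n * (p\<^sup>2 * p')) \<le> e"
    unfolding e_def using pw1 n p0 p(3) pwpos
    by (intro divide_left_mono mult_left_mono mult_pos_pos) auto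
  have e2: "b\<^sup>2 / (n * p ^ 3) \<le> e"
    unfolding e_def using pw2 n p0 p(3) pwpos
    by (intro divide_left_mono mult_left_mono mult_pos_pos) auto
  have ratio: "\<bar>Z \<omega> / ?N' \<omega>\<bar> \<le> b" for \<omega>
    using ZN(2)[of \<omega>] Z0[of \<omega>] hits_nonneg[of C' \<omega>] b0 by (cases "?N' \<omega> = 0") (auto simp: field_simps)
  have t3: "(\<integral>\<^sup>+\<omega>. ennreal ((Z \<omega> / ?N' \<omega> * (n / ?N \<omega> * (1 - ?N \<omega> / (n * p))))\<^sup>2) \<partial>M) \<le> ennreal (27004 * e)"
  proof -
    have "(\<integral>\<^sup>+\<omega>. ennreal ((Z \<omega> / ?N' \<omega> * (n / ?N \<omega> * (1 - ?N \<omega> / (n * p))))\<^sup>2) \<partial>M) \<le>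
      (\<integral>\<^sup>+\<omega>. ennreal (b\<^sup>2) * ennreal ((n / ?N \<omega> * (1 - ?N \<omega> / (n * p)))\<^sup>2) \<partial>M)"
    proof (rule nn_integral_mono)
      fix \<omega>
      have "(Z \<omega> / ?N' \<omega>)\<^sup>2 \<le> b\<^sup>2" using ratio[of \<omega>] b0 abs_le_square_iff[of "Z \<omega> / ?N' \<omega>" b] by simp
      then have "(Z \<omega> / ?N' \<omega>)\<^sup>2 * (n / ?N \<omega> * (1 - ?N \<omega> / (n * p)))\<^sup>2 \<le> b\<^sup>2 * (n / ?N \<omega> * (1 - ?N \<omega> / (n * p)))\<^sup>2"
        by (intro mult_right_mono) auto
      then show "ennreal ((Z \<omega> / ?N' \<omega> * (n / ?N \<omega> * (1 - ?N \<omega> / (n * p))))\<^sup>2) \<le> ennreal (b\<^sup>2) * ennreal ((n / ?N \<omega> * (1 - ?N \<omega> / (n * p)))\<^sup>2)"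
        unfolding power_mult_distrib[of "Z \<omega> / ?N' \<omega>"] by (simp add: ennreal_leI flip: ennreal_mult)
    qed
    also have "\<dots> = ennreal (b\<^sup>2) * (\<integral>\<^sup>+\<omega>. ennreal ((n / ?N \<omega> * (1 - ?N \<omega> / (n * p)))\<^sup>2) \<partial>M)"
      by (rule nn_integral_cmult) measurable
    also have "\<dots> \<le> ennreal (b\<^sup>2) * ennreal (27004 / (n * p ^ 3))"
      by (intro mult_left_mono inverse_hits_deviation C p p0) auto
    also have "\<dots> = ennreal (27004 * (b\<^sup>2 / (n * p ^ 3)))"
      using p0 by (simp flip: ennreal_mult)
    also have "\<dots> \<le> ennreal (27004 * e)" using e2 by (intro ennreal_leI mult_left_mono) auto
    finally show ?thesis .
  qed
  have t2: "(\<integral>\<^sup>+\<omega>. ennreal ((Z \<omega> / ?N' \<omega> * (?N \<omega> / ?N \<omega>) / p * (1 - ?N' \<omega> / (n * p')))\<^sup>2) \<partial>M) \<le> ennreal e"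
  proof -
    have "(\<integral>\<^sup>+\<omega>. ennreal ((Z \<omega> / ?N' \<omega> * (?N \<omega> / ?N \<omega>) / p * (1 - ?N' \<omega> / (n * p')))\<^sup>2) \<partial>M) \<le>
      (\<integral>\<^sup>+\<omega>. ennreal (b\<^sup>2 / (n * (p * p'))\<^sup>2) * ennreal ((?N' \<omega> - n * measure Q C')\<^sup>2) \<partial>M)"
    proof (rule nn_integral_mono)
      fix \<omega>
      have "\<bar>Z \<omega> / ?N' \<omega> * (?N \<omega> / ?N \<omega>)\<bar> \<le> b" using ratio[of \<omega>] b0 by simp
      then have 1: "(Z \<omega> / ?N' \<omega> * (?N \<omega> / ?N \<omega>))\<^sup>2 \<le> b\<^sup>2"
        using b0 abs_le_square_iff[of "Z \<omega> / ?N' \<omega> * (?N \<omega> / ?N \<omega>)" b] by simp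
      have "1 - ?N' \<omega> / (n * p') = - (?N' \<omega> - n * p') / (n * p')"
        using n p(3) by (simp add: field_simps)
      then have "Z \<omega> / ?N' \<omega> * (?N \<omega> / ?N \<omega>) / p * (1 - ?N' \<omega> / (n * p')) =
         (Z \<omega> / ?N' \<omega> * (?N \<omega> / ?N \<omega>)) * (- (?N' \<omega> - n * p') / (n * (p * p')))"
        by (simp add: mult_ac)
      then have "(Z \<omega> / ?N' \<omega> * (?N \<omega> / ?N \<omega>) / p * (1 - ?N' \<omega> / (n * p')))\<^sup>2 =
         (Z \<omega> / ?N' \<omega> * (?N \<omega> / ?N \<omega>))\<^sup>2 * ((?N' \<omega> - n * p')\<^sup>2 / (n * (p * p'))\<^sup>2)"
        by (simp add: power_mult_distrib power_divide power2_commute)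
      also have "\<dots> \<le> b\<^sup>2 * ((?N' \<omega> - n * p')\<^sup>2 / (n * (p * p'))\<^sup>2)"
        using 1 by (intro mult_right_mono) auto
      finally show "ennreal ((Z \<omega> / ?N' \<omega> * (?N \<omega> / ?N \<omega>) / p * (1 - ?N' \<omega> / (n * p')))\<^sup>2) \<le>
         ennreal (b\<^sup>2 / (n * (p * p'))\<^sup>2) * ennreal ((?N' \<omega> - n * measure Q C')\<^sup>2)"
        by (simp add: p(2) ennreal_leI flip: ennreal_mult)
    qed
    also have "\<dots> = ennreal (b\<^sup>2 / (n * (p * p'))\<^sup>2) * (\<integral>\<^sup>+\<omega>. ennreal ((?N' \<omega> - n * measure Q C')\<^sup>2) \<partial>M)"
      by (rule nn_integral_cmult) measurable
    also have "\<dots> \<le> ennreal (b\<^sup>2 / (n * (p * p'))\<^sup>2) * ennreal (n * measure Q C')"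
      by (intro mult_left_mono nn_integral_hits_deviation C) auto
    also have "\<dots> = ennreal (b\<^sup>2 / (n * (p\<^sup>2 * p')))"
      using n p0 p(3) by (simp flip: ennreal_mult p(2) add: field_simps power2_eq_square)
    also have "\<dots> \<le> ennreal e" using e1 by (rule ennreal_leI)
    finally show ?thesis .
  qed
  have t1: "(\<integral>\<^sup>+\<omega>. ennreal (((Z \<omega> - n * s) / (n * (p * p')))\<^sup>2) \<partial>M) \<le> ennreal e"
  proof -
    \<comment> \<open>Bounding by the indicator of the smaller cell produces the factor
      \<open>p'\<close> that this variance term needs.\<close>
    have sqG: "(\<integral>x. (G x)\<^sup>2 \<partial>Q) \<le> b\<^sup>2 * p'"
    proof -
      have G2: "(G x)\<^sup>2 \<le> b\<^sup>2 * indicat_real C' x" for x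
        using gb[of x] by (auto simp: G_def indicator_def intro!: power_mono)
      have "(\<integral>x. (G x)\<^sup>2 \<partial>Q) \<le> (\<integral>x. b\<^sup>2 * indicat_real C' x \<partial>Q)"
      proof (rule integral_mono)
        show "integrable Q (\<lambda>x. (G x)\<^sup>2)"
          using Gb by (intro Q.integrable_const_bound[where B = "b\<^sup>2"]) (auto intro!: AE_I2 power_mono)
        show "integrable Q (\<lambda>x. b\<^sup>2 * indicat_real C' x)"
          by (intro Q.integrable_const_bound[where B = "b\<^sup>2"]) (auto simp: indicator_def)
      qed (rule G2)
      then show ?thesis by (simp add: p(2))
    qed
    have "(\<integral>\<^sup>+\<omega>. ennreal (((Z \<omega> - n * s) / (n * (p * p')))\<^sup>2) \<partial>M) =
      (\<integral>\<^sup>+\<omega>. ennreal (1 / (n * (p * p'))\<^sup>2) * ennreal ((Z \<omega> - n * s)\<^sup>2) \<partial>M)"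
      by (simp add: power_divide flip: ennreal_mult)
    also have "\<dots> = ennreal (1 / (n * (p * p'))\<^sup>2) * (\<integral>\<^sup>+\<omega>. ennreal ((Z \<omega> - n * s)\<^sup>2) \<partial>M)"
      by (rule nn_integral_cmult) measurable
    also have "\<dots> \<le> ennreal (1 / (n * (p * p'))\<^sup>2) * ennreal (n * (b\<^sup>2 * p'))"
      unfolding Z_def s_def using sqG Gb
      by (intro mult_left_mono nn_integral_deviation[where b = b]) auto
    also have "\<dots> = ennreal (1 / (n * (p * p'))\<^sup>2 * (n * (b\<^sup>2 * p')))"
      using p(3) by (intro ennreal_mult[symmetric]) auto
    also have "1 / (n * (p * p'))\<^sup>2 * (n * (b\<^sup>2 * p')) = b\<^sup>2 / (n * (p\<^sup>2 * p'))"
      using n p0 p(3) by (simp add: field_simps power2_eq_square)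
    also have "\<dots> \<le> ennreal e" using e1 by (rule ennreal_leI)
    finally show ?thesis .
  qed
  have three: "(u + v + w)\<^sup>2 \<le> 3 * u\<^sup>2 + 3 * v\<^sup>2 + 3 * w\<^sup>2" for u v w :: real
  proof -
    have "0 \<le> (u - v)\<^sup>2 + (u - w)\<^sup>2 + (v - w)\<^sup>2" by simp
    then show ?thesis by (simp add: power2_eq_square algebra_simps)
  qed
  have "(\<integral>\<^sup>+\<omega>. ennreal ((n * Z \<omega> / (?N \<omega> * ?N' \<omega>) - s / (p * p'))\<^sup>2) \<partial>M) \<le>
    (\<integral>\<^sup>+\<omega>. 3 * ennreal ((Z \<omega> / ?N' \<omega> * (n / ?N \<omega> * (1 - ?N \<omega> / (n * p))))\<^sup>2)
      + 3 * ennreal ((Z \<omega> / ?N' \<omega> * (?N \<omega> / ?N \<omega>) / p * (1 - ?N' \<omega> / (n * p')))\<^sup>2)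
      + 3 * ennreal (((Z \<omega> - n * s) / (n * (p * p')))\<^sup>2) \<partial>M)"
  proof (rule nn_integral_mono)
    fix \<omega>
    show "ennreal ((n * Z \<omega> / (?N \<omega> * ?N' \<omega>) - s / (p * p'))\<^sup>2) \<le>
      3 * ennreal ((Z \<omega> / ?N' \<omega> * (n / ?N \<omega> * (1 - ?N \<omega> / (n * p))))\<^sup>2)
      + 3 * ennreal ((Z \<omega> / ?N' \<omega> * (?N \<omega> / ?N \<omega>) / p * (1 - ?N' \<omega> / (n * p')))\<^sup>2)
      + 3 * ennreal (((Z \<omega> - n * s) / (n * (p * p')))\<^sup>2)"
      unfolding dec
      using ennreal_leI[OF three[of "Z \<omega> / ?N' \<omega> * (n / ?N \<omega> * (1 - ?N \<omega> / (n * p)))"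
        "Z \<omega> / ?N' \<omega> * (?N \<omega> / ?N \<omega>) / p * (1 - ?N' \<omega> / (n * p'))" "(Z \<omega> - n * s) / (n * (p * p'))"]]
      by (simp add: ennreal_mult')
  qed
  also have "\<dots> = 3 * (\<integral>\<^sup>+\<omega>. ennreal ((Z \<omega> / ?N' \<omega> * (n / ?N \<omega> * (1 - ?N \<omega> / (n * p))))\<^sup>2) \<partial>M)
      + 3 * (\<integral>\<^sup>+\<omega>. ennreal ((Z \<omega> / ?N' \<omega> * (?N \<omega> / ?N \<omega>) / p * (1 - ?N' \<omega> / (n * p')))\<^sup>2) \<partial>M)
      + 3 * (\<integral>\<^sup>+\<omega>. ennreal (((Z \<omega> - n * s) / (n * (p * p')))\<^sup>2) \<partial>M)"
    apply (subst nn_integral_add, measurable)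
    apply (subst nn_integral_add, measurable)
    apply (subst nn_integral_cmult, measurable)+
    done
  also have "\<dots> \<le> 3 * ennreal (27004 * e) + 3 * ennreal e + 3 * ennreal e"
    by (intro add_mono mult_left_mono t1 t2 t3) auto
  also have "\<dots> = ennreal (81018 * e)"
    using e0 by (simp add: ennreal_mult' flip: ennreal_plus distrib_right)
  finally show ?thesis
    unfolding Z_def s_def G_def e_def by simp
qed

lemma weighted_hits_deviation:
  fixes p p' b :: real
  assumes C: "C \<in> sets S" "C' \<in> sets S" and p: "p = measure Q C" "p' = measure Q C'" "0 < p" "0 < p'"
    and g: "g \<in> borel_measurable S" and gb: "\<And>x. 0 \<le> g x" "\<And>x. g x \<le> b"
  shows "(\<integral>\<^sup>+\<omega>. ennreal ((n * (\<Sum>i=1..n. g (X i \<omega>) * indicat_real (C \<inter> C') (X i \<omega>)) / (hits C \<omega> * hits C' \<omega>)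
      - (\<integral>x. g x * indicat_real (C \<inter> C') x \<partial>Q) / (p * p'))\<^sup>2) \<partial>M) \<le> ennreal (81018 * b\<^sup>2 / (n * (p * p') powr (3 / 2)))"
proof (cases "p' \<le> p")
  case True
  then show ?thesis using weighted_hits_deviation_aux[OF C p(1,2) p(4) _ g gb] by simp
next
  case False
  then show ?thesis
    using weighted_hits_deviation_aux[OF C(2,1) p(2,1) p(3) _ g gb]
    by (simp add: Int_commute mult.commute[of p] mult.commute[of "hits C _"])
qed

end

section \<open>The conditional variance of the forest\<close>

text \<open>The product law arises by drawing coordinate \<open>i\<close> separately and inserting
  it. This isolates one observation, so that its response can be integrated with everything else
  held fixed.\<close>

lemma PiM_pair_split:
  assumes "prob_space P" "prob_space N" "finite I" "i \<in> I"
  shows "PiM I (\<lambda>_. P) \<Otimes>\<^sub>M N = distr (P \<Otimes>\<^sub>M (PiM (I - {i}) (\<lambda>_. P) \<Otimes>\<^sub>M N)) (PiM I (\<lambda>_. P) \<Otimes>\<^sub>M N)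
    (\<lambda>(w, z, t). (z(i := w), t))"
proof -
  interpret Q: prob_space P by fact
  interpret N: prob_space N by fact
  interpret PP: product_prob_space "\<lambda>_. P" by standard
  interpret I: prob_space "PiM I (\<lambda>_. P)" by (intro prob_space_PiM assms(1))
  interpret J: prob_space "PiM (I - {i}) (\<lambda>_. P)" by (intro prob_space_PiM assms(1))
  interpret JN: pair_prob_space "PiM (I - {i}) (\<lambda>_. P)" N ..
  have I: "I = insert i (I - {i})" using assms by auto
  have m [measurable]: "(\<lambda>(w, z, t). (z(i := w), t)) \<in> P \<Otimes>\<^sub>M (PiM (I - {i}) (\<lambda>_. P) \<Otimes>\<^sub>M N) \<rightarrow>\<^sub>M PiM I (\<lambda>_. P) \<Otimes>\<^sub>M N"
  proof -
    have "(\<lambda>p. (fst (snd p))(i := fst p)) \<in> P \<Otimes>\<^sub>M (PiM (I - {i}) (\<lambda>_. P) \<Otimes>\<^sub>M N) \<rightarrow>\<^sub>M PiM (insert i (I - {i})) (\<lambda>_. P)"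
      by (rule measurable_fun_upd[where J = "I - {i}"]) auto
    then show ?thesis using I by (simp add: case_prod_beta)
  qed
  show ?thesis
  proof (rule pair_measure_eqI)
    show "sigma_finite_measure (PiM I (\<lambda>_. P))" "sigma_finite_measure N" by unfold_locales
    fix A B assume A: "A \<in> sets (PiM I (\<lambda>_. P))" and B: "B \<in> sets N"
    note [measurable] = A B
    have "emeasure (distr (P \<Otimes>\<^sub>M (PiM (I - {i}) (\<lambda>_. P) \<Otimes>\<^sub>M N)) (PiM I (\<lambda>_. P) \<Otimes>\<^sub>M N) (\<lambda>(w, z, t). (z(i := w), t))) (A \<times> B) =
      (\<integral>\<^sup>+p. indicator (A \<times> B) p \<partial>distr (P \<Otimes>\<^sub>M (PiM (I - {i}) (\<lambda>_. P) \<Otimes>\<^sub>M N)) (PiM I (\<lambda>_. P) \<Otimes>\<^sub>M N) (\<lambda>(w, z, t). (z(i := w), t)))"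
      by simp
    also have "\<dots> = (\<integral>\<^sup>+p. indicator (A \<times> B) (case p of (w, z, t) \<Rightarrow> (z(i := w), t)) \<partial>(P \<Otimes>\<^sub>M (PiM (I - {i}) (\<lambda>_. P) \<Otimes>\<^sub>M N)))"
      by (rule nn_integral_distr) measurable
    also have "\<dots> = (\<integral>\<^sup>+w. \<integral>\<^sup>+z. \<integral>\<^sup>+t. indicator A (z(i := w)) * indicator B t \<partial>N \<partial>PiM (I - {i}) (\<lambda>_. P) \<partial>P)"
    proof -
      let ?F = "\<lambda>p. indicator (A \<times> B) (case p of (w, z, t) \<Rightarrow> (z(i := w), t)) :: ennreal"
      have F: "?F \<in> borel_measurable (P \<Otimes>\<^sub>M (PiM (I - {i}) (\<lambda>_. P) \<Otimes>\<^sub>M N))"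
        by (rule measurable_compose[OF m]) measurable
      show ?thesis
      proof (subst JN.nn_integral_fst[OF F, symmetric], rule nn_integral_cong)
        fix w assume "w \<in> space P"
        then have "(\<lambda>y. ?F (w, y)) \<in> borel_measurable (PiM (I - {i}) (\<lambda>_. P) \<Otimes>\<^sub>M N)"
          by (rule measurable_Pair2[OF F])
        from N.nn_integral_fst[OF this, symmetric]
        show "(\<integral>\<^sup>+y. ?F (w, y) \<partial>(PiM (I - {i}) (\<lambda>_. P) \<Otimes>\<^sub>M N)) = (\<integral>\<^sup>+z. \<integral>\<^sup>+t. indicator A (z(i := w)) * indicator B t \<partial>N \<partial>PiM (I - {i}) (\<lambda>_. P))"
          by (simp add: indicator_times)
      qed
    qed
    also have "\<dots> = (\<integral>\<^sup>+w. \<integral>\<^sup>+z. indicator A (z(i := w)) * emeasure N B \<partial>PiM (I - {i}) (\<lambda>_. P) \<partial>P)"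
      by (simp add: nn_integral_cmult)
    also have "\<dots> = (\<integral>\<^sup>+w. (\<integral>\<^sup>+z. indicator A (z(i := w)) \<partial>PiM (I - {i}) (\<lambda>_. P)) \<partial>P) * emeasure N B"
    proof -
      have [measurable]: "(\<lambda>(w, z). indicator A (z(i := w)) :: ennreal) \<in> borel_measurable (P \<Otimes>\<^sub>M PiM (I - {i}) (\<lambda>_. P))"
      proof -
        have [measurable]: "(\<lambda>p. (snd p)(i := fst p)) \<in> P \<Otimes>\<^sub>M PiM (I - {i}) (\<lambda>_. P) \<rightarrow>\<^sub>M PiM I (\<lambda>_. P)"
          using measurable_fun_upd[of I "I - {i}" i snd "P \<Otimes>\<^sub>M PiM (I - {i}) (\<lambda>_. P)" "\<lambda>_. P" fst] I by auto
        show ?thesis unfolding case_prod_beta by measurable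
      qed
      have "(\<lambda>w. \<integral>\<^sup>+z. indicator A (z(i := w)) \<partial>PiM (I - {i}) (\<lambda>_. P)) \<in> borel_measurable P"
        by (rule J.borel_measurable_nn_integral) measurable
      then have "(\<integral>\<^sup>+w. (\<integral>\<^sup>+z. indicator A (z(i := w)) \<partial>PiM (I - {i}) (\<lambda>_. P)) * emeasure N B \<partial>P) =
          (\<integral>\<^sup>+w. \<integral>\<^sup>+z. indicator A (z(i := w)) \<partial>PiM (I - {i}) (\<lambda>_. P) \<partial>P) * emeasure N B"
        by (rule nn_integral_multc)
      moreover have "(\<integral>\<^sup>+z. indicator A (z(i := w)) * emeasure N B \<partial>PiM (I - {i}) (\<lambda>_. P)) =
          (\<integral>\<^sup>+z. indicator A (z(i := w)) \<partial>PiM (I - {i}) (\<lambda>_. P)) * emeasure N B" if "w \<in> space P" for w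
        using that by (intro nn_integral_multc) measurable
      ultimately show ?thesis by (simp cong: nn_integral_cong)
    qed
    also have "(\<integral>\<^sup>+w. (\<integral>\<^sup>+z. indicator A (z(i := w)) \<partial>PiM (I - {i}) (\<lambda>_. P)) \<partial>P) = emeasure (PiM I (\<lambda>_. P)) A"
    proof -
      have "emeasure (PiM I (\<lambda>_. P)) A = (\<integral>\<^sup>+z. indicator A z \<partial>PiM (insert i (I - {i})) (\<lambda>_. P))"
        using I by simp
      also have "\<dots> = (\<integral>\<^sup>+w. (\<integral>\<^sup>+z. indicator A (z(i := w)) \<partial>PiM (I - {i}) (\<lambda>_. P)) \<partial>P)"
        using I assms(3) by (intro PP.product_nn_integral_insert_rev) auto
      finally show ?thesis ..
    qed
    finally show "emeasure (PiM I (\<lambda>_. P)) A * emeasure N B = emeasure (distr (P \<Otimes>\<^sub>M (PiM (I - {i}) (\<lambda>_. P) \<Otimes>\<^sub>M N)) (PiM I (\<lambda>_. P) \<Otimes>\<^sub>M N) (\<lambda>(w, z, t). (z(i := w), t))) (A \<times> B)" ..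
  qed simp
qed

text \<open>Says that \<open>r\<close> of the first component is a version of the conditional
  expectation of \<open>h\<close>, in terms of test functions; this form can be applied under an
  outer integral over the other variables.\<close>

definition regresses :: "('a \<times> real) measure \<Rightarrow> 'a measure \<Rightarrow> ('a \<times> real \<Rightarrow> real) \<Rightarrow> ('a \<Rightarrow> real) \<Rightarrow> bool" where
  "regresses P S h r \<longleftrightarrow> h \<in> borel_measurable P \<and> r \<in> borel_measurable S \<and>
     (\<forall>g \<in> borel_measurable S. integrable P (\<lambda>z. g (fst z) * h z) \<longrightarrow>
       (\<integral>z. g (fst z) * h z \<partial>P) = (\<integral>z. g (fst z) * r (fst z) \<partial>P))"

text \<open>For almost every \<open>a\<close> the integrand is integrable in \<open>w\<close>, and
  \<open>\<phi>\<close> with \<open>a\<close> frozen serves as test function.\<close>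

lemma regresses_integral_pair:
  assumes "prob_space P" "prob_space A" and r: "regresses P S h r"
    and [measurable]: "fst \<in> P \<rightarrow>\<^sub>M S" "(\<lambda>(u, a). \<phi> u a) \<in> borel_measurable (S \<Otimes>\<^sub>M A)"
    and int: "integrable (P \<Otimes>\<^sub>M A) (\<lambda>(w, a). \<phi> (fst w) a * h w)" "integrable (P \<Otimes>\<^sub>M A) (\<lambda>(w, a). \<phi> (fst w) a * r (fst w))"
  shows "(\<integral>p. (case p of (w, a) \<Rightarrow> \<phi> (fst w) a * h w) \<partial>(P \<Otimes>\<^sub>M A)) = (\<integral>p. (case p of (w, a) \<Rightarrow> \<phi> (fst w) a * r (fst w)) \<partial>(P \<Otimes>\<^sub>M A))"
proof -
  interpret P: prob_space P by fact
  interpret A: prob_space A by fact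
  interpret PA: pair_prob_space P A ..
  have [measurable]: "h \<in> borel_measurable P" "r \<in> borel_measurable S"
    using r by (auto simp: regresses_def)
  have "(\<integral>p. (case p of (w, a) \<Rightarrow> \<phi> (fst w) a * h w) \<partial>(P \<Otimes>\<^sub>M A)) = (\<integral>a. (\<integral>w. \<phi> (fst w) a * h w \<partial>P) \<partial>A)"
    using PA.integral_snd[OF int(1)] by simp
  also have "\<dots> = (\<integral>a. (\<integral>w. \<phi> (fst w) a * r (fst w) \<partial>P) \<partial>A)"
  proof (rule integral_cong_AE)
    show "AE a in A. (\<integral>w. \<phi> (fst w) a * h w \<partial>P) = (\<integral>w. \<phi> (fst w) a * r (fst w) \<partial>P)"
      using PA.AE_integrable_snd[OF int(1)] AE_space
    proof eventually_elim
      case (elim a)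
      then have "(\<lambda>u. \<phi> u a) \<in> borel_measurable S" by measurable
      then show ?case using r elim(1) by (auto simp: regresses_def)
    qed
  qed measurable
  also have "\<dots> = (\<integral>p. (case p of (w, a) \<Rightarrow> \<phi> (fst w) a * r (fst w)) \<partial>(P \<Otimes>\<^sub>M A))"
    using PA.integral_snd[OF int(2)] by simp
  finally show ?thesis .
qed

text \<open>The hypothesis on \<open>\<phi>\<close> expresses that \<open>g\<close> depends on
  observation \<open>i\<close> only through its covariate. Drawing that observation separately
  reduces the claim to a pair of independent variables.\<close>

lemma regresses_integral:
  assumes "prob_space P" "prob_space N" "finite I" "i \<in> I" and r: "regresses P S h r"
    and [measurable]: "fst \<in> P \<rightarrow>\<^sub>M S" "(\<lambda>(z, t). g z t) \<in> borel_measurable (PiM I (\<lambda>_. P) \<Otimes>\<^sub>M N)"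
      "(\<lambda>(u, z, t). \<phi> u z t) \<in> borel_measurable (S \<Otimes>\<^sub>M (PiM (I - {i}) (\<lambda>_. P) \<Otimes>\<^sub>M N))"
    and \<phi>: "\<And>z w t. g (z(i := w)) t = \<phi> (fst w) z t"
    and int: "integrable (PiM I (\<lambda>_. P) \<Otimes>\<^sub>M N) (\<lambda>(z, t). g z t * h (z i))"
      "integrable (PiM I (\<lambda>_. P) \<Otimes>\<^sub>M N) (\<lambda>(z, t). g z t * r (fst (z i)))"
  shows "(\<integral>p. (case p of (z, t) \<Rightarrow> g z t * h (z i)) \<partial>(PiM I (\<lambda>_. P) \<Otimes>\<^sub>M N)) = (\<integral>p. (case p of (z, t) \<Rightarrow> g z t * r (fst (z i))) \<partial>(PiM I (\<lambda>_. P) \<Otimes>\<^sub>M N))"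
proof -
  let ?A = "PiM (I - {i}) (\<lambda>_. P) \<Otimes>\<^sub>M N"
  let ?\<psi> = "\<lambda>(w, z, t). (z(i := w), t)"
  interpret J: prob_space "PiM (I - {i}) (\<lambda>_. P)" by (intro prob_space_PiM assms(1))
  interpret N: prob_space N by fact
  interpret JN: pair_prob_space "PiM (I - {i}) (\<lambda>_. P)" N ..
  have [measurable]: "h \<in> borel_measurable P" "r \<in> borel_measurable S"
    using r by (auto simp: regresses_def)
  have I: "I = insert i (I - {i})" using assms by auto
  have m [measurable]: "?\<psi> \<in> P \<Otimes>\<^sub>M ?A \<rightarrow>\<^sub>M PiM I (\<lambda>_. P) \<Otimes>\<^sub>M N"
  proof -
    have "(\<lambda>p. (fst (snd p))(i := fst p)) \<in> P \<Otimes>\<^sub>M ?A \<rightarrow>\<^sub>M PiM (insert i (I - {i})) (\<lambda>_. P)"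
      by (rule measurable_fun_upd[where J = "I - {i}"]) auto
    then show ?thesis using I by (simp add: case_prod_beta)
  qed
  have comp [measurable]: "(\<lambda>p. fst p i) \<in> PiM I (\<lambda>_. P) \<Otimes>\<^sub>M N \<rightarrow>\<^sub>M P"
    using assms(4) by measurable
  have meas: "(\<lambda>(z, t). g z t * h (z i)) \<in> borel_measurable (PiM I (\<lambda>_. P) \<Otimes>\<^sub>M N)"
    "(\<lambda>(z, t). g z t * r (fst (z i))) \<in> borel_measurable (PiM I (\<lambda>_. P) \<Otimes>\<^sub>M N)"
    unfolding case_prod_beta by measurable
  have push: "(\<integral>p. F p \<partial>(PiM I (\<lambda>_. P) \<Otimes>\<^sub>M N)) = (\<integral>p. F (?\<psi> p) \<partial>(P \<Otimes>\<^sub>M ?A))"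
    and pushi: "integrable (PiM I (\<lambda>_. P) \<Otimes>\<^sub>M N) F \<longleftrightarrow> integrable (P \<Otimes>\<^sub>M ?A) (\<lambda>p. F (?\<psi> p))"
    if "F \<in> borel_measurable (PiM I (\<lambda>_. P) \<Otimes>\<^sub>M N)" for F :: "_ \<Rightarrow> real"
    using integral_distr[OF m, of F] integrable_distr_eq[OF m, of F] that
    unfolding PiM_pair_split[OF assms(1-4), symmetric] by auto
  have "(\<integral>p. (case p of (w, a) \<Rightarrow> \<phi> (fst w) (fst a) (snd a) * h w) \<partial>(P \<Otimes>\<^sub>M ?A)) =
    (\<integral>p. (case p of (w, a) \<Rightarrow> \<phi> (fst w) (fst a) (snd a) * r (fst w)) \<partial>(P \<Otimes>\<^sub>M ?A))"
  proof (rule regresses_integral_pair[OF assms(1) _ r])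
    show "prob_space ?A" by (rule JN.prob_space_axioms)
    show "(\<lambda>(u, a). \<phi> u (fst a) (snd a)) \<in> borel_measurable (S \<Otimes>\<^sub>M ?A)"
      using assms(8) unfolding split_beta' .
    show "integrable (P \<Otimes>\<^sub>M ?A) (\<lambda>(w, a). \<phi> (fst w) (fst a) (snd a) * h w)"
      using int(1) unfolding pushi[OF meas(1)] by (simp add: split_beta' \<phi>)
    show "integrable (P \<Otimes>\<^sub>M ?A) (\<lambda>(w, a). \<phi> (fst w) (fst a) (snd a) * r (fst w))"
      using int(2) unfolding pushi[OF meas(2)] by (simp add: split_beta' \<phi>)
  qed measurable
  then show ?thesis
    unfolding push[OF meas(1)] push[OF meas(2)] by (simp add: split_beta' \<phi>)
qed

text \<open>Off the cube \<open>f\<close>, \<open>mu\<close> and \<open>sig2\<close> are arbitrary;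
  extension by 0 makes them Borel measurable and bounded on the whole space.\<close>

definition cube_part :: "(real ^ 'd::finite \<Rightarrow> real) \<Rightarrow> real ^ 'd \<Rightarrow> real" where
  "cube_part g u = g u * indicat_real unit_cube u"

lemma cube_part_measurable:
  assumes "g \<in> holder_class \<beta>" "\<beta> > 0"
  shows "cube_part g \<in> borel_measurable borel"
proof -
  have "(\<lambda>u. indicat_real unit_cube u *\<^sub>R g u) \<in> borel_measurable borel"
    by (rule borel_measurable_continuous_on_indicator) (auto intro: holder_class_continuous[OF assms])
  then show ?thesis unfolding cube_part_def[abs_def] by (simp add: mult.commute)
qed

lemma holder_class_bounded:
  fixes g :: "real ^ 'd::finite \<Rightarrow> real"
  assumes "g \<in> holder_class \<beta>" "\<beta> > 0"
  obtains b where "\<And>u. u \<in> unit_cube \<Longrightarrow> \<bar>g u\<bar> \<le> b" "b > 0"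
proof -
  have "bounded (g ` unit_cube)"
    by (intro compact_imp_bounded compact_continuous_image holder_class_continuous[OF assms]) simp
  then show thesis using that unfolding bounded_pos by (auto simp: image_iff)
qed

section \<open>Conditional moments of a single observation\<close>

context regression_law
begin

abbreviation "X_algebra \<equiv> vimage_algebra (space P) fst (borel :: (real ^ 'd) measure)"

lemma fst_measurable [measurable]: "fst \<in> P \<rightarrow>\<^sub>M borel"
  and snd_measurable [measurable]: "snd \<in> borel_measurable P"
proof -
  have "sets P = sets (borel \<Otimes>\<^sub>M borel)" unfolding sets_P borel_prod[symmetric] ..
  then show "fst \<in> P \<rightarrow>\<^sub>M borel" "snd \<in> borel_measurable P"
    by (auto cong: measurable_cong_sets)
qed

lemma X_subalgebra: "sigma_finite_subalgebra P X_algebra"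
proof (rule finite_measure_subalgebra_is_sigma_finite)
  show "finite_measure_subalgebra P X_algebra"
  proof
    show "subalgebra P X_algebra"
      unfolding subalgebra_def
    proof (intro conjI subsetI)
      fix A assume "A \<in> sets X_algebra"
      then obtain B where "B \<in> sets borel" "A = fst -` B \<inter> space P"
        by (subst (asm) sets_vimage_algebra2) auto
      then show "A \<in> sets P" using measurable_sets[OF fst_measurable] by blast
    qed simp
  qed
qed

lemma compose_fst_measurable: "g \<in> borel_measurable borel \<Longrightarrow> (\<lambda>z. g (fst z)) \<in> borel_measurable X_algebra"
  by (rule measurable_compose[OF measurable_vimage_algebra1]) auto

lemma AE_in_cube: "AE z in P. fst z \<in> unit_cube"
proof -
  have "AE u in density lborel (\<lambda>x. ennreal (f x * indicat_real unit_cube x)). u \<in> unit_cube"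
    using density_X by (subst AE_density) (auto simp: distributed_def indicator_def intro!: AE_I2)
  then have "AE u in distr P lborel fst. u \<in> unit_cube"
    by (simp only: distributed_distr_eq_density[OF density_X])
  then show ?thesis
    by (subst (asm) AE_distr_iff) auto
qed

lemma square_integrable_Y: "integrable P (\<lambda>z. (snd z)\<^sup>2)"
proof -
  interpret F: sigma_finite_subalgebra P X_algebra by (rule X_subalgebra)
  obtain C where C: "AE z in P. nn_cond_exp P X_algebra (\<lambda>z. ennreal ((snd z)\<^sup>2)) z \<le> ennreal C"
    using second_moment by auto
  have "(\<integral>\<^sup>+z. ennreal ((snd z)\<^sup>2) \<partial>P) = (\<integral>\<^sup>+z. nn_cond_exp P X_algebra (\<lambda>z. ennreal ((snd z)\<^sup>2)) z \<partial>P)"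
    using F.nn_cond_exp_intg[of "\<lambda>_. 1" "\<lambda>z. ennreal ((snd z)\<^sup>2)"] by simp
  also have "\<dots> \<le> (\<integral>\<^sup>+z. ennreal C \<partial>P)"
    by (rule nn_integral_mono_AE) (rule C)
  also have "\<dots> < \<infinity>" using emeasure_space_1 by simp
  finally show ?thesis by (intro integrableI_bounded) auto
qed

lemma integrable_Y: "integrable P snd"
  by (rule square_integrable_imp_integrable[OF _ square_integrable_Y]) measurable

lemma regresses_Y: "regresses P borel snd (cube_part mu)"
proof -
  interpret F: sigma_finite_subalgebra P X_algebra by (rule X_subalgebra)
  have m [measurable]: "cube_part mu \<in> borel_measurable borel" using mu_holder by (intro cube_part_measurable)
  have ae: "AE z in P. real_cond_exp P X_algebra snd z = cube_part mu (fst z)"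
    using regression AE_in_cube by eventually_elim (simp add: cube_part_def)
  show ?thesis
    unfolding regresses_def
  proof (intro conjI ballI impI)
    fix g :: "real ^ 'd \<Rightarrow> real" assume g [measurable]: "g \<in> borel_measurable borel" and int: "integrable P (\<lambda>z. g (fst z) * snd z)"
    have "(\<integral>z. g (fst z) * snd z \<partial>P) = (\<integral>z. g (fst z) * real_cond_exp P X_algebra snd z \<partial>P)"
      by (rule F.real_cond_exp_intg(2)[symmetric, OF int compose_fst_measurable[OF g]]) measurable
    also have "\<dots> = (\<integral>z. g (fst z) * cube_part mu (fst z) \<partial>P)"
      using ae by (intro integral_cong_AE) (auto elim!: eventually_mono)
    finally show "(\<integral>z. g (fst z) * snd z \<partial>P) = (\<integral>z. g (fst z) * cube_part mu (fst z) \<partial>P)" .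
  qed measurable
qed

definition noise_term :: "(real ^ 'd) \<times> real \<Rightarrow> real" where
  "noise_term z = snd z - cube_part mu (fst z)"

lemma noise_term_measurable [measurable]: "noise_term \<in> borel_measurable P"
proof -
  have [measurable]: "cube_part mu \<in> borel_measurable borel" using mu_holder by (intro cube_part_measurable)
  show ?thesis unfolding noise_term_def[abs_def] by measurable
qed

lemma cube_part_bounded:
  assumes "g \<in> holder_class \<beta>" "\<beta> > 0"
  obtains b where "\<And>u. \<bar>cube_part g u\<bar> \<le> b" "b > 0"
proof -
  obtain b where "\<And>u. u \<in> unit_cube \<Longrightarrow> \<bar>g u\<bar> \<le> b" "b > 0"
    using holder_class_bounded[OF assms] by metis
  then show thesis by (intro that[of b]) (auto simp: cube_part_def indicator_def)
qed

lemma square_integrable_noise: "integrable P (\<lambda>z. (noise_term z)\<^sup>2)"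
proof -
  have [measurable]: "cube_part mu \<in> borel_measurable borel" using mu_holder by (intro cube_part_measurable)
  obtain b where b: "\<And>u. \<bar>cube_part mu u\<bar> \<le> b" "b > 0"
    using cube_part_bounded[OF mu_holder(2,1)] by metis
  show ?thesis
  proof (rule Bochner_Integration.integrable_bound)
    show "integrable P (\<lambda>z. 2 * (snd z)\<^sup>2 + 2 * b\<^sup>2)"
      using square_integrable_Y by auto
    show "AE z in P. norm ((noise_term z)\<^sup>2) \<le> norm (2 * (snd z)\<^sup>2 + 2 * b\<^sup>2)"
    proof (rule AE_I2)
      fix z :: "(real ^ 'd) \<times> real"
      let ?m = "cube_part mu (fst z)"
      have "(noise_term z)\<^sup>2 + (snd z + ?m)\<^sup>2 = 2 * (snd z)\<^sup>2 + 2 * ?m\<^sup>2"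
        by (simp add: noise_term_def power2_eq_square algebra_simps)
      moreover have "?m\<^sup>2 \<le> b\<^sup>2" using b(1)[of "fst z"] b(2) abs_le_square_iff[of ?m b] by simp
      ultimately have "(noise_term z)\<^sup>2 \<le> 2 * (snd z)\<^sup>2 + 2 * b\<^sup>2"
        using zero_le_power2[of "snd z + ?m"] by linarith
      then show "norm ((noise_term z)\<^sup>2) \<le> norm (2 * (snd z)\<^sup>2 + 2 * b\<^sup>2)" by simp
    qed
  qed measurable
qed

lemma regresses_noise: "regresses P borel noise_term (\<lambda>_. 0)"
  unfolding regresses_def
proof (intro conjI ballI impI)
  have m [measurable]: "cube_part mu \<in> borel_measurable borel" using mu_holder by (intro cube_part_measurable)
  obtain b where b: "\<And>u. \<bar>cube_part mu u\<bar> \<le> b" "b > 0"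
    using cube_part_bounded[OF mu_holder(2,1)] by metis
  fix g :: "real ^ 'd \<Rightarrow> real" assume g [measurable]: "g \<in> borel_measurable borel" and int: "integrable P (\<lambda>z. g (fst z) * noise_term z)"
  text \<open>Only \<open>g(X) (Y - mu X)\<close> is assumed integrable, so \<open>g\<close> is truncated first.\<close>
  define gk where "gk = (\<lambda>k::nat. \<lambda>u. if \<bar>g u\<bar> \<le> real k then g u else 0)"
  have [measurable]: "gk k \<in> borel_measurable borel" for k unfolding gk_def by measurable
  have gkb: "\<bar>gk k u\<bar> \<le> real k" for k u by (simp add: gk_def)
  have zero: "(\<integral>z. gk k (fst z) * noise_term z \<partial>P) = 0" for k
  proof -
    have i1: "integrable P (\<lambda>z. gk k (fst z) * snd z)"
      by (rule Bochner_Integration.integrable_bound[OF integrable_mult_right[OF integrable_Y, of "real k"]])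
        (auto simp: abs_mult intro!: mult_right_mono gkb)
    have i2: "integrable P (\<lambda>z. gk k (fst z) * cube_part mu (fst z))"
      by (rule integrable_const_bound[where B = "real k * b"]) (auto simp: abs_mult intro!: mult_mono gkb b)
    have "(\<integral>z. gk k (fst z) * snd z \<partial>P) = (\<integral>z. gk k (fst z) * cube_part mu (fst z) \<partial>P)"
      using regresses_Y i1 unfolding regresses_def by auto
    then show ?thesis
      unfolding noise_term_def right_diff_distrib using i1 i2 by simp
  qed
  have "(\<lambda>k. \<integral>z. gk k (fst z) * noise_term z \<partial>P) \<longlonglongrightarrow> (\<integral>z. g (fst z) * noise_term z \<partial>P)"
  proof (rule integral_dominated_convergence[where w = "\<lambda>z. \<bar>g (fst z) * noise_term z\<bar>"])
    show "AE z in P. (\<lambda>k. gk k (fst z) * noise_term z) \<longlonglongrightarrow> g (fst z) * noise_term z"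
    proof (rule AE_I2)
      fix z :: "(real ^ 'd) \<times> real"
      obtain k0 :: nat where "\<bar>g (fst z)\<bar> \<le> real k0" using real_arch_simple by blast
      then have "eventually (\<lambda>k. gk k (fst z) * noise_term z = g (fst z) * noise_term z) sequentially"
        unfolding eventually_sequentially gk_def by (intro exI[of _ k0]) auto
      then show "(\<lambda>k. gk k (fst z) * noise_term z) \<longlonglongrightarrow> g (fst z) * noise_term z"
        by (rule tendsto_eventually)
    qed
    show "AE z in P. norm (gk k (fst z) * noise_term z) \<le> \<bar>g (fst z) * noise_term z\<bar>" for k
      by (rule AE_I2) (auto simp: gk_def abs_mult)
    show "integrable P (\<lambda>z. \<bar>g (fst z) * noise_term z\<bar>)" using int by (rule integrable_abs)
  qed measurable
  then have "(\<integral>z. g (fst z) * noise_term z \<partial>P) = 0"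
    unfolding zero by (simp add: LIMSEQ_const_iff)
  then show "(\<integral>z. g (fst z) * noise_term z \<partial>P) = (\<integral>z. g (fst z) * 0 \<partial>P)" by simp
qed measurable

lemma sig2_pos: "u \<in> unit_cube \<Longrightarrow> 0 < sig2 u"
  using sig2_bounded_below by force

lemma regresses_noise_square: "regresses P borel (\<lambda>z. (noise_term z)\<^sup>2) (cube_part sig2)"
proof -
  interpret F: sigma_finite_subalgebra P X_algebra by (rule X_subalgebra)
  have m [measurable]: "cube_part sig2 \<in> borel_measurable borel" using sig2_holder by (intro cube_part_measurable)
  let ?h = "\<lambda>z. (snd z - mu (fst z))\<^sup>2"
  have h: "?h \<in> borel_measurable P"
  proof (rule ccontr)
    text \<open>The conditional expectation of a non-measurable function is 0 by convention, which
      contradicts the positivity of \<open>sig2\<close>.\<close>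
    assume "?h \<notin> borel_measurable P"
    then have "(\<lambda>z. ennreal (?h z)) \<notin> borel_measurable P"
      using measurable_compose[of "\<lambda>z. ennreal (?h z)" P borel enn2real borel] by auto
    then have 1: "nn_cond_exp P X_algebra (\<lambda>z. ennreal (?h z)) z = 0" for z
      by (simp add: nn_cond_exp_def)
    have 2: "AE z in P. nn_cond_exp P X_algebra (\<lambda>z. ennreal (- ?h z)) z = 0"
      using F.nn_cond_exp_F_meas[of "\<lambda>_. 0"] by (simp add: ennreal_neg)
    have "AE z in P. False"
      using noise AE_in_cube 2
      by eventually_elim (use sig2_pos in \<open>force simp: real_cond_exp_def 1\<close>)
    then show False using emeasure_space_1 by (simp add: AE_False)
  qed
  have eq: "AE z in P. ?h z = (noise_term z)\<^sup>2"
    using AE_in_cube by eventually_elim (simp add: noise_term_def cube_part_def)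
  have "AE z in P. real_cond_exp P X_algebra ?h z = real_cond_exp P X_algebra (\<lambda>z. (noise_term z)\<^sup>2) z"
    by (rule F.real_cond_exp_cong[OF eq h]) measurable
  then have ae: "AE z in P. real_cond_exp P X_algebra (\<lambda>z. (noise_term z)\<^sup>2) z = cube_part sig2 (fst z)"
    using noise AE_in_cube by eventually_elim (simp add: cube_part_def)
  show ?thesis
    unfolding regresses_def
  proof (intro conjI ballI impI)
    fix g :: "real ^ 'd \<Rightarrow> real" assume g [measurable]: "g \<in> borel_measurable borel" and int: "integrable P (\<lambda>z. g (fst z) * (noise_term z)\<^sup>2)"
    have "(\<integral>z. g (fst z) * (noise_term z)\<^sup>2 \<partial>P) = (\<integral>z. g (fst z) * real_cond_exp P X_algebra (\<lambda>z. (noise_term z)\<^sup>2) z \<partial>P)"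
      by (rule F.real_cond_exp_intg(2)[symmetric, OF int compose_fst_measurable[OF g]]) measurable
    also have "\<dots> = (\<integral>z. g (fst z) * cube_part sig2 (fst z) \<partial>P)"
      using ae by (intro integral_cong_AE) (auto elim!: eventually_mono)
    finally show "(\<integral>z. g (fst z) * (noise_term z)\<^sup>2 \<partial>P) = (\<integral>z. g (fst z) * cube_part sig2 (fst z) \<partial>P)" .
  qed measurable
qed

end

section \<open>Joint law of data and trees\<close>

locale mondrian_forest = law: regression_law P f mu sig2 beta_f beta_mu beta_sig + forest_sample M P n B lam X Y T
  for M :: "'w measure" and P :: "((real ^ 'd::finite) \<times> real) measure" and f mu sig2 beta_f beta_mu beta_sig n B lam X Y T +
  fixes x :: "real ^ 'd"
  assumes x: "x \<in> box 0 1" and n_ge_1: "n \<ge> 1" and B_ge_1: "B \<ge> 1" and lam_pos: "lam > 0"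
begin

declare One_nat_def [simp del]

lemma XY_measurable: "i \<in> {1..n} \<Longrightarrow> (\<lambda>\<omega>. (X i \<omega>, Y i \<omega>)) \<in> M \<rightarrow>\<^sub>M borel"
  using data_indep by (simp add: indep_vars_def)

lemma X_measurable [measurable]: "i \<in> {1..n} \<Longrightarrow> X i \<in> M \<rightarrow>\<^sub>M borel"
  using measurable_compose[OF XY_measurable, of i fst borel] by (simp add: borel_prod[symmetric])

lemma Y_measurable [measurable]: "i \<in> {1..n} \<Longrightarrow> Y i \<in> borel_measurable M"
  using measurable_compose[OF XY_measurable, of i snd borel] by (simp add: borel_prod[symmetric])

lemma T_measurable [measurable]: "b \<in> {1..B} \<Longrightarrow> T b \<in> M \<rightarrow>\<^sub>M split_tree_algebra"
  using tree_indep by (simp add: indep_vars_def)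

text \<open>The mass 1 is inherited from the random tree with index 1, whose law is
  \<open>mondrian lam\<close>.\<close>

lemma prob_space_mondrian: "prob_space (mondrian lam :: 'd split_tree measure)"
  using prob_space_distr[OF T_measurable[of 1]] tree_law[of 1] B_ge_1 by simp

abbreviation "data_space \<equiv> PiM {1..n} (\<lambda>_. borel :: ((real ^ 'd) \<times> real) measure)"
abbreviation "tree_space \<equiv> PiM {1..B} (\<lambda>_. split_tree_algebra :: 'd split_tree measure)"
definition "data \<omega> = (\<lambda>i\<in>{1..n}. (X i \<omega>, Y i \<omega>))"
definition "trees_of \<omega> = (\<lambda>b\<in>{1..B}. T b \<omega>)"

lemma data_measurable [measurable]: "data \<in> M \<rightarrow>\<^sub>M data_space"
  unfolding data_def[abs_def] by (intro measurable_restrict XY_measurable)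

lemma trees_of_measurable [measurable]: "trees_of \<in> M \<rightarrow>\<^sub>M tree_space"
  unfolding trees_of_def[abs_def] by (intro measurable_restrict T_measurable)

lemma data_law_PiM: "distr M data_space data = PiM {1..n} (\<lambda>_. P)"
proof -
  have "distr M data_space data = PiM {1..n} (\<lambda>i. distr M borel (\<lambda>\<omega>. (X i \<omega>, Y i \<omega>)))"
    using data_indep n_ge_1 XY_measurable unfolding data_def[abs_def]
    by (subst (asm) indep_vars_iff_distr_eq_PiM') auto
  also have "\<dots> = PiM {1..n} (\<lambda>_. P)"
    by (intro PiM_cong) (auto simp: data_law)
  finally show ?thesis .
qed

lemma tree_law_PiM: "distr M tree_space trees_of = PiM {1..B} (\<lambda>_. mondrian lam)"
proof -
  have "distr M tree_space trees_of = PiM {1..B} (\<lambda>i. distr M split_tree_algebra (T i))"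
    using tree_indep B_ge_1 T_measurable unfolding trees_of_def[abs_def]
    by (subst (asm) indep_vars_iff_distr_eq_PiM') auto
  also have "\<dots> = PiM {1..B} (\<lambda>_. mondrian lam)"
    by (intro PiM_cong) (auto simp: tree_law)
  finally show ?thesis .
qed

abbreviation "tree_law_PiM_space \<equiv> PiM {1..B} (\<lambda>_. mondrian lam :: 'd split_tree measure)"

lemma joint_law:
  "distr M (data_space \<Otimes>\<^sub>M tree_space) (\<lambda>\<omega>. (data \<omega>, trees_of \<omega>)) = PiM {1..n} (\<lambda>_. P) \<Otimes>\<^sub>M tree_law_PiM_space"
proof -
  have v: "f -` A \<inter> space M \<in> sets (vimage_algebra (space M) f N)" if "f \<in> M \<rightarrow>\<^sub>M N" "A \<in> sets N" for f A and N :: "'z measure"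
    using that by (subst sets_vimage_algebra2) (auto simp: measurable_def)
  interpret D: prob_space "distr M data_space data" by (rule prob_space_distr) measurable
  interpret E: prob_space "distr M tree_space trees_of" by (rule prob_space_distr) measurable
  have "distr M data_space data \<Otimes>\<^sub>M distr M tree_space trees_of = distr M (data_space \<Otimes>\<^sub>M tree_space) (\<lambda>\<omega>. (data \<omega>, trees_of \<omega>))"
  proof (rule pair_measure_eqI)
    fix A C assume "A \<in> sets (distr M data_space data)" "C \<in> sets (distr M tree_space trees_of)"
    then have A [measurable]: "A \<in> sets data_space" and C [measurable]: "C \<in> sets tree_space" by auto
    have "prob ((data -` A \<inter> space M) \<inter> (trees_of -` C \<inter> space M)) = prob (data -` A \<inter> space M) * prob (trees_of -` C \<inter> space M)"
      using indep_setD[OF data_tree_indep v[OF data_measurable A, unfolded data_def[abs_def]]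
          v[OF trees_of_measurable C, unfolded trees_of_def[abs_def]]]
      unfolding data_def[abs_def] trees_of_def[abs_def] .
    also have "(data -` A \<inter> space M) \<inter> (trees_of -` C \<inter> space M) = (\<lambda>\<omega>. (data \<omega>, trees_of \<omega>)) -` (A \<times> C) \<inter> space M"
      by auto
    finally show "emeasure (distr M data_space data) A * emeasure (distr M tree_space trees_of) C =
        emeasure (distr M (data_space \<Otimes>\<^sub>M tree_space) (\<lambda>\<omega>. (data \<omega>, trees_of \<omega>))) (A \<times> C)"
      unfolding emeasure_distr[OF data_measurable A] emeasure_distr[OF trees_of_measurable C]
        emeasure_distr[OF measurable_Pair[OF data_measurable trees_of_measurable] pair_measureI[OF A C]]
      by (simp add: emeasure_eq_measure ennreal_mult'[symmetric])
  qed (simp_all add: D.sigma_finite_measure_axioms E.sigma_finite_measure_axioms)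
  then show ?thesis unfolding data_law_PiM tree_law_PiM by simp
qed

lemma sets_joint: "sets (PiM {1..n} (\<lambda>_. P) \<Otimes>\<^sub>M tree_law_PiM_space) = sets (data_space \<Otimes>\<^sub>M tree_space)"
  unfolding joint_law[symmetric] by simp

lemma integral_joint:
  fixes F :: "_ \<Rightarrow> real"
  assumes "F \<in> borel_measurable (data_space \<Otimes>\<^sub>M tree_space)"
  shows "expectation (\<lambda>\<omega>. F (data \<omega>, trees_of \<omega>)) = (\<integral>p. F p \<partial>(PiM {1..n} (\<lambda>_. P) \<Otimes>\<^sub>M tree_law_PiM_space))"
    and "integrable M (\<lambda>\<omega>. F (data \<omega>, trees_of \<omega>)) \<longleftrightarrow> integrable (PiM {1..n} (\<lambda>_. P) \<Otimes>\<^sub>M tree_law_PiM_space) F"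
proof -
  have m: "(\<lambda>\<omega>. (data \<omega>, trees_of \<omega>)) \<in> M \<rightarrow>\<^sub>M data_space \<Otimes>\<^sub>M tree_space"
    by (intro measurable_Pair data_measurable trees_of_measurable)
  show "expectation (\<lambda>\<omega>. F (data \<omega>, trees_of \<omega>)) = (\<integral>p. F p \<partial>(PiM {1..n} (\<lambda>_. P) \<Otimes>\<^sub>M tree_law_PiM_space))"
    "integrable M (\<lambda>\<omega>. F (data \<omega>, trees_of \<omega>)) \<longleftrightarrow> integrable (PiM {1..n} (\<lambda>_. P) \<Otimes>\<^sub>M tree_law_PiM_space) F"
    unfolding joint_law[symmetric] using integral_distr[OF m assms] integrable_distr_eq[OF m assms] by auto
qed

abbreviation "XT_space \<equiv> PiM {1..n} (\<lambda>_. borel :: (real ^ 'd) measure) \<Otimes>\<^sub>M tree_space"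
definition "XT \<omega> = (\<lambda>i\<in>{1..n}. X i \<omega>, \<lambda>b\<in>{1..B}. T b \<omega>)"
abbreviation "XT_algebra \<equiv> covariates_trees_algebra M n B X T"

lemma XT_algebra_eq: "XT_algebra = vimage_algebra (space M) XT XT_space"
  by (simp add: covariates_trees_algebra_def XT_def[abs_def])

lemma XT_measurable [measurable]: "XT \<in> M \<rightarrow>\<^sub>M XT_space"
  unfolding XT_def[abs_def] by (intro measurable_Pair measurable_restrict X_measurable T_measurable)

lemma XT_measurable': "XT \<in> XT_algebra \<rightarrow>\<^sub>M XT_space"
  unfolding XT_algebra_eq by (rule measurable_vimage_algebra1) (use XT_measurable in \<open>auto simp: measurable_def\<close>)

lemma space_XT_algebra: "space XT_algebra = space M"
  by (simp add: XT_algebra_eq)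

lemma XT_sets:
  assumes "A \<in> sets XT_algebra"
  obtains A' where "A' \<in> sets XT_space" "A = XT -` A' \<inter> space M"
proof -
  have "sets XT_algebra = {XT -` A \<inter> space M | A. A \<in> sets XT_space}"
    unfolding XT_algebra_eq using XT_measurable by (intro sets_vimage_algebra2) (auto simp: measurable_def)
  then show thesis using assms that by auto
qed

lemma XT_subalgebra: "subalgebra M XT_algebra"
  unfolding subalgebra_def
proof (intro conjI subsetI)
  fix A assume "A \<in> sets XT_algebra"
  then obtain A' where "A' \<in> sets XT_space" "A = XT -` A' \<inter> space M" by (rule XT_sets)
  then show "A \<in> sets M" using measurable_sets[OF XT_measurable] by blast
qed (simp add: space_XT_algebra)

lemma XT_sigma_finite: "sigma_finite_subalgebra M XT_algebra"
proof (rule finite_measure_subalgebra_is_sigma_finite)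
  show "finite_measure_subalgebra M XT_algebra"
    by standard (rule XT_subalgebra)
qed

text \<open>\<open>G\<close> may involve the responses other than the \<open>i\<close>-th one.\<close>

lemma expectation_regresses:
  assumes i: "i \<in> {1..n}" and r: "regresses P borel h r"
    and G [measurable]: "(\<lambda>(z, t). G z t) \<in> borel_measurable (data_space \<Otimes>\<^sub>M tree_space)"
    and \<phi>: "(\<lambda>(u, z, t). \<phi> u z t) \<in> borel_measurable (borel \<Otimes>\<^sub>M (PiM ({1..n} - {i}) (\<lambda>_. borel) \<Otimes>\<^sub>M tree_space))"
      "\<And>z w t. G (z(i := w)) t = \<phi> (fst w) z t"
    and int: "integrable M (\<lambda>\<omega>. G (data \<omega>) (trees_of \<omega>) * h (X i \<omega>, Y i \<omega>))"
      "integrable M (\<lambda>\<omega>. G (data \<omega>) (trees_of \<omega>) * r (X i \<omega>))"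
  shows "expectation (\<lambda>\<omega>. G (data \<omega>) (trees_of \<omega>) * h (X i \<omega>, Y i \<omega>)) = expectation (\<lambda>\<omega>. G (data \<omega>) (trees_of \<omega>) * r (X i \<omega>))"
proof -
  interpret N: prob_space tree_law_PiM_space by (intro prob_space_PiM prob_space_mondrian)
  have h: "h \<in> borel_measurable borel" and [measurable]: "r \<in> borel_measurable borel"
    using r law.sets_P by (auto simp: regresses_def cong: measurable_cong_sets)
  have [measurable]: "(\<lambda>p. fst p i) \<in> data_space \<Otimes>\<^sub>M tree_space \<rightarrow>\<^sub>M borel"
    by (rule measurable_compose[OF measurable_fst measurable_component_singleton[OF i]])
  have fb: "fst \<in> (borel :: ((real ^ 'd) \<times> real) measure) \<rightarrow>\<^sub>M borel"
    by (simp add: borel_prod[symmetric])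
  have [measurable]: "(\<lambda>p. h (fst p i)) \<in> borel_measurable (data_space \<Otimes>\<^sub>M tree_space)"
    by (rule measurable_compose[OF _ h]) measurable
  have [measurable]: "(\<lambda>p. r (fst (fst p i))) \<in> borel_measurable (data_space \<Otimes>\<^sub>M tree_space)"
    by (rule measurable_compose[OF measurable_compose[OF _ fb] \<open>r \<in> _\<close>]) measurable
  have m1: "(\<lambda>p. G (fst p) (snd p) * h (fst p i)) \<in> borel_measurable (data_space \<Otimes>\<^sub>M tree_space)"
    and m2: "(\<lambda>p. G (fst p) (snd p) * r (fst (fst p i))) \<in> borel_measurable (data_space \<Otimes>\<^sub>M tree_space)"
    by measurable
  have data_i: "data \<omega> i = (X i \<omega>, Y i \<omega>)" for \<omega> using i by (simp add: data_def)
  have sets1: "sets (PiM J (\<lambda>_. P)) = sets (PiM J (\<lambda>_. borel))" for J :: "nat set"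
    by (intro sets_PiM_cong) (auto simp: law.sets_P)
  have sets2: "sets tree_law_PiM_space = sets tree_space"
    by (intro sets_PiM_cong) auto
  have "(\<integral>p. (case p of (z, t) \<Rightarrow> G z t * h (z i)) \<partial>(PiM {1..n} (\<lambda>_. P) \<Otimes>\<^sub>M tree_law_PiM_space)) =
    (\<integral>p. (case p of (z, t) \<Rightarrow> G z t * r (fst (z i))) \<partial>(PiM {1..n} (\<lambda>_. P) \<Otimes>\<^sub>M tree_law_PiM_space))"
  proof (rule regresses_integral[where g = G and \<phi> = \<phi> and h = h and r = r and S = borel and i = i, OF law.prob_space_axioms N.prob_space_axioms _ i r])
    show "\<And>z w t. G (z(i := w)) t = \<phi> (fst w) z t" by (rule \<phi>(2))
    show "(\<lambda>(z, t). G z t) \<in> borel_measurable (PiM {1..n} (\<lambda>_. P) \<Otimes>\<^sub>M tree_law_PiM_space)"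
      using G by (simp cong: measurable_cong_sets add: sets_joint)
    show "(\<lambda>(u, z, t). \<phi> u z t) \<in> borel_measurable (borel \<Otimes>\<^sub>M (PiM ({1..n} - {i}) (\<lambda>_. P) \<Otimes>\<^sub>M tree_law_PiM_space))"
      using \<phi>(1) by (simp cong: measurable_cong_sets sets_pair_measure_cong add: sets_pair_measure_cong[OF refl sets_pair_measure_cong[OF sets1 sets2]])
    show "integrable (PiM {1..n} (\<lambda>_. P) \<Otimes>\<^sub>M tree_law_PiM_space) (\<lambda>(z, t). G z t * h (z i))"
      using int(1) integral_joint(2)[OF m1] by (simp add: split_beta' data_i)
    show "integrable (PiM {1..n} (\<lambda>_. P) \<Otimes>\<^sub>M tree_law_PiM_space) (\<lambda>(z, t). G z t * r (fst (z i)))"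
      using int(2) integral_joint(2)[OF m2] by (simp add: split_beta' data_i)
  qed auto
  then show ?thesis
    using integral_joint(1)[OF m1] integral_joint(1)[OF m2] by (simp add: split_beta' data_i)
qed

lemma x_in_cube: "x \<in> unit_cube"
  using x box_subset_cbox by blast

section \<open>The forest as a weighted sum, and its conditional mean and variance\<close>

definition weight_fn :: "nat \<Rightarrow> (nat \<Rightarrow> real ^ 'd) \<times> (nat \<Rightarrow> 'd split_tree) \<Rightarrow> real" where
  "weight_fn i p = (1 / real B) * (\<Sum>b=1..B. indicat_real (cell_at (snd p b) x) (fst p i) / (\<Sum>k=1..n. indicat_real (cell_at (snd p b) x) (fst p k)))"

lemma weight_fn_measurable:
  assumes "i \<in> {1..n}"
  shows "weight_fn i \<in> borel_measurable XT_space"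
proof -
  have X: "(\<lambda>p. fst p k) \<in> XT_space \<rightarrow>\<^sub>M borel" if "k \<in> {1..n}" for k
    by (rule measurable_compose[OF measurable_fst measurable_component_singleton[OF that]])
  have T: "(\<lambda>p. snd p b) \<in> XT_space \<rightarrow>\<^sub>M split_tree_algebra" if "b \<in> {1..B}" for b
    by (rule measurable_compose[OF measurable_snd measurable_component_singleton[OF that]])
  have "(\<lambda>p. indicat_real (cell_at (snd p b) x) (fst p k)) \<in> borel_measurable XT_space" if "k \<in> {1..n}" "b \<in> {1..B}" for k b
    by (rule indicator_cell_at_measurable[OF x_in_cube T[OF that(2)] X[OF that(1)]])
  then show ?thesis
    unfolding weight_fn_def[abs_def] using assms
    by (intro borel_measurable_times borel_measurable_sum borel_measurable_divide borel_measurable_const) auto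
qed

text \<open>Each ratio has an indicator over a sum that contains it, and 0 / 0 = 0 is in range too.
  Boundedness makes products of weights with responses and noises integrable.\<close>

lemma weight_fn_bounds:
  assumes "i \<in> {1..n}"
  shows "0 \<le> weight_fn i p" "weight_fn i p \<le> 1"
proof -
  let ?q = "\<lambda>b. indicat_real (cell_at (snd p b) x) (fst p i) / (\<Sum>k=1..n. indicat_real (cell_at (snd p b) x) (fst p k))"
  have le: "indicat_real A (fst p i) \<le> (\<Sum>k=1..n. indicat_real A (fst p k))" for A
    using assms by (intro member_le_sum) auto
  have q: "0 \<le> ?q b" "?q b \<le> 1" for b
    using le[of "cell_at (snd p b) x"] by (auto intro!: sum_nonneg divide_nonneg_nonneg simp: divide_le_eq_1 sum_nonneg less_le)
  show "0 \<le> weight_fn i p" unfolding weight_fn_def using q by (intro mult_nonneg_nonneg sum_nonneg) auto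
  have "(\<Sum>b=1..B. ?q b) \<le> (\<Sum>b=1..B. 1)" by (intro sum_mono q)
  then show "weight_fn i p \<le> 1" unfolding weight_fn_def using B_ge_1 by (simp add: field_simps)
qed

abbreviation "weight i \<omega> \<equiv> weight_fn i (XT \<omega>)"
abbreviation "noise_at i \<omega> \<equiv> law.noise_term (X i \<omega>, Y i \<omega>)"

lemma XT_apply: "i \<in> {1..n} \<Longrightarrow> fst (XT \<omega>) i = X i \<omega>" "b \<in> {1..B} \<Longrightarrow> snd (XT \<omega>) b = T b \<omega>"
  by (simp_all add: XT_def)

lemma forest_estimate_eq: "forest_estimate n B X Y T x \<omega> = (\<Sum>i=1..n. weight i \<omega> * Y i \<omega>)"
proof -
  have "(\<Sum>i=1..n. weight i \<omega> * Y i \<omega>) =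
    (\<Sum>i=1..n. \<Sum>b=1..B. (1 / real B) * (Y i \<omega> * indicat_real (cell_at (T b \<omega>) x) (X i \<omega>) / (\<Sum>k=1..n. indicat_real (cell_at (T b \<omega>) x) (X k \<omega>))))"
    unfolding weight_fn_def sum_distrib_left sum_distrib_right
    by (intro sum.cong refl) (simp add: XT_apply mult_ac)
  also have "\<dots> = (\<Sum>b=1..B. \<Sum>i=1..n. (1 / real B) * (Y i \<omega> * indicat_real (cell_at (T b \<omega>) x) (X i \<omega>) / (\<Sum>k=1..n. indicat_real (cell_at (T b \<omega>) x) (X k \<omega>))))"
    by (rule sum.swap)
  also have "\<dots> = forest_estimate n B X Y T x \<omega>"
    unfolding forest_estimate_def sum_distrib_left sum_divide_distrib by simp
  finally show ?thesis ..
qed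

lemma integral_XY:
  fixes h :: "_ \<Rightarrow> real"
  assumes "i \<in> {1..n}" "h \<in> borel_measurable P"
  shows "integrable M (\<lambda>\<omega>. h (X i \<omega>, Y i \<omega>)) \<longleftrightarrow> integrable P h"
  using integrable_distr_eq[OF XY_measurable[OF assms(1)], of h] assms law.sets_P data_law[OF assms(1)]
  by (simp cong: measurable_cong_sets)

lemma comp_measurable: "i \<in> {1..n} \<Longrightarrow> h \<in> borel_measurable P \<Longrightarrow> (\<lambda>\<omega>. h (X i \<omega>, Y i \<omega>)) \<in> borel_measurable M"
  using measurable_compose[OF XY_measurable, of i h borel] law.sets_P by (simp cong: measurable_cong_sets)

text \<open>\<open>G\<close> covers weights as well as indicators of conditioning events. The factor
  \<open>\<kappa>\<close> may use the responses of the other observations: it is 1 for the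
  conditional mean and the noise of another observation in the covariance terms.\<close>

lemma expectation_bounded_factor:
  assumes i: "i \<in> {1..n}" and r: "regresses P borel h r"
    and G: "G \<in> borel_measurable XT_space" "\<And>p. \<bar>G p\<bar> \<le> c"
    and \<kappa>: "\<kappa> \<in> borel_measurable data_space" "\<kappa> \<in> borel_measurable (PiM ({1..n} - {i}) (\<lambda>_. borel))" "\<And>z w. \<kappa> (z(i := w)) = \<kappa> z"
    and int: "integrable M (\<lambda>\<omega>. \<kappa> (data \<omega>) * h (X i \<omega>, Y i \<omega>))" "integrable M (\<lambda>\<omega>. \<kappa> (data \<omega>) * r (X i \<omega>))"
  shows "expectation (\<lambda>\<omega>. G (XT \<omega>) * (\<kappa> (data \<omega>) * h (X i \<omega>, Y i \<omega>))) = expectation (\<lambda>\<omega>. G (XT \<omega>) * (\<kappa> (data \<omega>) * r (X i \<omega>)))"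
    and "integrable M (\<lambda>\<omega>. G (XT \<omega>) * (\<kappa> (data \<omega>) * h (X i \<omega>, Y i \<omega>)))"
    and "integrable M (\<lambda>\<omega>. G (XT \<omega>) * (\<kappa> (data \<omega>) * r (X i \<omega>)))"
proof -
  have GM: "(\<lambda>\<omega>. G (XT \<omega>)) \<in> borel_measurable M"
    by (rule measurable_compose[OF XT_measurable G(1)])
  have bd: "integrable M (\<lambda>\<omega>. G (XT \<omega>) * k \<omega>)" if "integrable M k" for k
  proof (rule Bochner_Integration.integrable_bound)
    show "integrable M (\<lambda>\<omega>. c * k \<omega>)" using that by simp
    show "(\<lambda>\<omega>. G (XT \<omega>) * k \<omega>) \<in> borel_measurable M"
      using GM borel_measurable_integrable[OF that] by (rule borel_measurable_times)
    show "AE \<omega> in M. norm (G (XT \<omega>) * k \<omega>) \<le> norm (c * k \<omega>)"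
      using G(2) by (auto intro!: AE_I2 mult_right_mono order_trans[OF G(2)] simp: abs_mult)
  qed
  show i1: "integrable M (\<lambda>\<omega>. G (XT \<omega>) * (\<kappa> (data \<omega>) * h (X i \<omega>, Y i \<omega>)))"
    and i2: "integrable M (\<lambda>\<omega>. G (XT \<omega>) * (\<kappa> (data \<omega>) * r (X i \<omega>)))"
    by (intro bd int)+
  define F where "F = (\<lambda>z t. G (\<lambda>k\<in>{1..n}. fst (z k), t) * \<kappa> z)"
  \<comment> \<open>This is \<open>F\<close> with the covariate of observation \<open>i\<close>
    passed separately as \<open>u\<close>.\<close>
  define \<phi> where "\<phi> = (\<lambda>u z t. G (\<lambda>k\<in>{1..n}. if k = i then u else fst (z k), t) * \<kappa> z)"
  have fb: "fst \<in> (borel :: ((real ^ 'd) \<times> real) measure) \<rightarrow>\<^sub>M borel"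
    by (simp add: borel_prod[symmetric])
  have fst1: "(\<lambda>p. fst (fst p k)) \<in> data_space \<Otimes>\<^sub>M N' \<rightarrow>\<^sub>M borel" if "k \<in> {1..n}" for k and N' :: "'z measure"
  proof -
    have "(\<lambda>p. fst p k) \<in> data_space \<Otimes>\<^sub>M N' \<rightarrow>\<^sub>M borel"
      by (rule measurable_compose[OF measurable_fst measurable_component_singleton[OF that]])
    from measurable_compose[where g = fst, OF this fb] show ?thesis .
  qed
  have fst2: "(\<lambda>p. fst (fst (snd p) k)) \<in> N'' \<Otimes>\<^sub>M (PiM J (\<lambda>_. borel :: ((real ^ 'd) \<times> real) measure) \<Otimes>\<^sub>M N') \<rightarrow>\<^sub>M borel" if "k \<in> J"
    for k J and N' :: "'z measure" and N'' :: "'y measure"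
  proof -
    have "(\<lambda>p. fst (snd p) k) \<in> N'' \<Otimes>\<^sub>M (PiM J (\<lambda>_. borel :: ((real ^ 'd) \<times> real) measure) \<Otimes>\<^sub>M N') \<rightarrow>\<^sub>M borel"
      by (rule measurable_compose[OF measurable_compose[OF measurable_snd measurable_fst] measurable_component_singleton[OF that]])
    from measurable_compose[where g = fst, OF this fb] show ?thesis .
  qed
  have F: "F (data \<omega>) (trees_of \<omega>) = G (XT \<omega>) * \<kappa> (data \<omega>)" for \<omega>
    unfolding F_def XT_def data_def trees_of_def by (simp cong: restrict_cong)
  have Fm: "(\<lambda>(z, t). F z t) \<in> borel_measurable (data_space \<Otimes>\<^sub>M tree_space)"
    unfolding F_def split_beta'
  proof (rule borel_measurable_times)
    show "(\<lambda>p. G (\<lambda>k\<in>{1..n}. fst (fst p k), snd p)) \<in> borel_measurable (data_space \<Otimes>\<^sub>M tree_space)"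
      by (rule measurable_compose[OF _ G(1)], intro measurable_Pair measurable_restrict measurable_snd fst1)
    show "(\<lambda>p. \<kappa> (fst p)) \<in> borel_measurable (data_space \<Otimes>\<^sub>M tree_space)"
      by (rule measurable_compose[OF measurable_fst \<kappa>(1)])
  qed
  have \<phi>m: "(\<lambda>(u, z, t). \<phi> u z t) \<in> borel_measurable (borel \<Otimes>\<^sub>M (PiM ({1..n} - {i}) (\<lambda>_. borel) \<Otimes>\<^sub>M tree_space))"
    (is "_ \<in> borel_measurable ?R")
    unfolding \<phi>_def split_beta'
  proof (rule borel_measurable_times)
    have c: "(\<lambda>p. if k = i then fst p else fst (fst (snd p) k)) \<in> ?R \<rightarrow>\<^sub>M borel" if "k \<in> {1..n}" for k
    proof (cases "k = i")
      case False
      then have k: "k \<in> {1..n} - {i}" using that by simp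
      have "(\<lambda>p. fst (fst (snd p) k)) \<in> ?R \<rightarrow>\<^sub>M borel"
        by (rule fst2[OF k])
      with False show ?thesis by simp
    qed simp
    show "(\<lambda>p. G (\<lambda>k\<in>{1..n}. if k = i then fst p else fst (fst (snd p) k), snd (snd p))) \<in> borel_measurable ?R"
      by (rule measurable_compose[OF _ G(1)], intro measurable_Pair measurable_restrict c measurable_compose[OF measurable_snd measurable_snd])
    show "(\<lambda>p. \<kappa> (fst (snd p))) \<in> borel_measurable ?R"
      by (rule measurable_compose[OF measurable_compose[OF measurable_snd measurable_fst] \<kappa>(2)])
  qed
  have "F (z(i := w)) t = \<phi> (fst w) z t" for z w t
    unfolding F_def \<phi>_def \<kappa>(3) by (intro arg_cong2[where f = "(*)"] arg_cong[where f = G]) (auto simp: fun_eq_iff)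
  from expectation_regresses[OF i r Fm \<phi>m this]
  show "expectation (\<lambda>\<omega>. G (XT \<omega>) * (\<kappa> (data \<omega>) * h (X i \<omega>, Y i \<omega>))) = expectation (\<lambda>\<omega>. G (XT \<omega>) * (\<kappa> (data \<omega>) * r (X i \<omega>)))"
    using i1 i2 unfolding F by (simp add: mult.assoc)
qed

lemma integrable_bounded_X:
  assumes "i \<in> {1..n}" "g \<in> borel_measurable borel" "\<And>u. \<bar>g u\<bar> \<le> (c :: real)"
  shows "integrable M (\<lambda>\<omega>. g (X i \<omega>))"
  by (rule integrable_const_bound[where B = c])
    (use assms measurable_compose[OF X_measurable assms(2)] in auto)

lemma weight_XT_algebra: "i \<in> {1..n} \<Longrightarrow> weight i \<in> borel_measurable XT_algebra"
  by (rule measurable_compose[OF XT_measurable' weight_fn_measurable])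

lemma X_XT_algebra:
  assumes "i \<in> {1..n}" "g \<in> borel_measurable borel"
  shows "(\<lambda>\<omega>. g (X i \<omega>)) \<in> borel_measurable XT_algebra"
proof -
  have "(\<lambda>p. fst p i) \<in> XT_space \<rightarrow>\<^sub>M borel"
    by (rule measurable_compose[OF measurable_fst measurable_component_singleton[OF assms(1)]])
  from measurable_compose[OF XT_measurable' this] have "X i \<in> XT_algebra \<rightarrow>\<^sub>M borel"
    using assms(1) by (simp add: XT_apply)
  from measurable_compose[OF this assms(2)] show ?thesis .
qed

text \<open>Tested on the conditioning events: the indicator of such an event is a function of
  covariates and trees and is merged with the weight into the bounded factor.\<close>

lemma cond_exp_estimate:
  "AE \<omega> in M. real_cond_exp M XT_algebra (forest_estimate n B X Y T x) \<omega> = (\<Sum>i=1..n. weight i \<omega> * cube_part mu (X i \<omega>))"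
proof -
  interpret F: sigma_finite_subalgebra M XT_algebra by (rule XT_sigma_finite)
  have mm: "cube_part mu \<in> borel_measurable borel" using law.mu_holder by (intro cube_part_measurable)
  obtain c where c: "\<And>u. \<bar>cube_part mu u\<bar> \<le> c" using law.cube_part_bounded[OF law.mu_holder(2,1)] by metis
  have iY: "integrable M (\<lambda>\<omega>. Y i \<omega>)" if "i \<in> {1..n}" for i
    using integral_XY[OF that law.snd_measurable] law.integrable_Y by simp
  have iX: "integrable M (\<lambda>\<omega>. cube_part mu (X i \<omega>))" if "i \<in> {1..n}" for i
    by (rule integrable_bounded_X[OF that mm c])
  have key: "expectation (\<lambda>\<omega>. G (XT \<omega>) * Y i \<omega>) = expectation (\<lambda>\<omega>. G (XT \<omega>) * cube_part mu (X i \<omega>))"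
     "integrable M (\<lambda>\<omega>. G (XT \<omega>) * Y i \<omega>)" "integrable M (\<lambda>\<omega>. G (XT \<omega>) * cube_part mu (X i \<omega>))"
    if "i \<in> {1..n}" "G \<in> borel_measurable XT_space" "\<And>p. \<bar>G p\<bar> \<le> 1" for G i
  proof -
    have a: "(\<lambda>_. 1 :: real) \<in> borel_measurable data_space" "(\<lambda>_. 1 :: real) \<in> borel_measurable (PiM ({1..n} - {i}) (\<lambda>_. borel))"
      by (rule borel_measurable_const)+
    have b: "integrable M (\<lambda>\<omega>. 1 * snd (X i \<omega>, Y i \<omega>))" "integrable M (\<lambda>\<omega>. 1 * cube_part mu (X i \<omega>))"
      using iY[OF that(1)] iX[OF that(1)] by simp_all
    note e = expectation_bounded_factor[OF that(1) law.regresses_Y that(2,3) a refl b, unfolded mult_1 snd_conv]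
    show "expectation (\<lambda>\<omega>. G (XT \<omega>) * Y i \<omega>) = expectation (\<lambda>\<omega>. G (XT \<omega>) * cube_part mu (X i \<omega>))" by (rule e(1))
    show "integrable M (\<lambda>\<omega>. G (XT \<omega>) * Y i \<omega>)" by (rule e(2))
    show "integrable M (\<lambda>\<omega>. G (XT \<omega>) * cube_part mu (X i \<omega>))" by (rule e(3))
  qed
  have w: "\<bar>weight_fn i p\<bar> \<le> 1" if "i \<in> {1..n}" for i p using weight_fn_bounds[OF that, of p] by simp
  show ?thesis
  proof (rule F.real_cond_exp_charact)
    show "integrable M (forest_estimate n B X Y T x)"
      unfolding forest_estimate_eq[abs_def]
      by (rule Bochner_Integration.integrable_sum) (rule key(2)[OF _ weight_fn_measurable w])
    show "integrable M (\<lambda>\<omega>. \<Sum>i=1..n. weight i \<omega> * cube_part mu (X i \<omega>))"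
      by (rule Bochner_Integration.integrable_sum) (rule key(3)[OF _ weight_fn_measurable w])
    show "(\<lambda>\<omega>. \<Sum>i=1..n. weight i \<omega> * cube_part mu (X i \<omega>)) \<in> borel_measurable XT_algebra"
      by (rule borel_measurable_sum, rule borel_measurable_times[OF weight_XT_algebra X_XT_algebra[OF _ mm]])
    fix A assume "A \<in> sets XT_algebra"
    then obtain A' where A': "A' \<in> sets XT_space" "A = XT -` A' \<inter> space M" by (rule XT_sets)
    define G where "G = (\<lambda>i p. indicat_real A' p * weight_fn i p)"
    have G: "G i \<in> borel_measurable XT_space" "\<bar>G i p\<bar> \<le> 1" if "i \<in> {1..n}" for i p
      unfolding G_def using A'(1) weight_fn_measurable[OF that] w[OF that] by (auto simp: indicator_def)
    have ind: "indicator A \<omega> = indicat_real A' (XT \<omega>)" if "\<omega> \<in> space M" for \<omega>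
      using that by (auto simp: A'(2) indicator_def)
    have "(\<integral>\<omega>\<in>A. forest_estimate n B X Y T x \<omega> \<partial>M) = expectation (\<lambda>\<omega>. \<Sum>i=1..n. G i (XT \<omega>) * Y i \<omega>)"
      unfolding set_lebesgue_integral_def forest_estimate_eq G_def
      by (intro Bochner_Integration.integral_cong) (auto simp: ind sum_distrib_left mult.assoc)
    also have "\<dots> = (\<Sum>i=1..n. expectation (\<lambda>\<omega>. G i (XT \<omega>) * Y i \<omega>))"
      by (rule Bochner_Integration.integral_sum) (rule key(2)[OF _ G])
    also have "\<dots> = (\<Sum>i=1..n. expectation (\<lambda>\<omega>. G i (XT \<omega>) * cube_part mu (X i \<omega>)))"
      by (rule sum.cong[OF refl]) (rule key(1)[OF _ G])
    also have "\<dots> = expectation (\<lambda>\<omega>. \<Sum>i=1..n. G i (XT \<omega>) * cube_part mu (X i \<omega>))"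
      by (rule Bochner_Integration.integral_sum[symmetric]) (rule key(3)[OF _ G])
    also have "\<dots> = (\<integral>\<omega>\<in>A. (\<Sum>i=1..n. weight i \<omega> * cube_part mu (X i \<omega>)) \<partial>M)"
      unfolding set_lebesgue_integral_def G_def
      by (intro Bochner_Integration.integral_cong) (auto simp: ind sum_distrib_left mult.assoc)
    finally show "(\<integral>\<omega>\<in>A. forest_estimate n B X Y T x \<omega> \<partial>M) = (\<integral>\<omega>\<in>A. (\<Sum>i=1..n. weight i \<omega> * cube_part mu (X i \<omega>)) \<partial>M)" .
  qed
qed

text \<open>The centred estimate is the weighted sum of the noises. In its square the mixed terms
  have conditional mean 0, the noise of \<open>j\<close> being a fixed factor while observation
  \<open>i\<close> is integrated, and the diagonal terms give \<open>sig2\<close>.\<close>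

lemma cond_var_estimate:
  "AE \<omega> in M. cond_var M XT_algebra (forest_estimate n B X Y T x) \<omega> = (\<Sum>i=1..n. (weight i \<omega>)\<^sup>2 * cube_part sig2 (X i \<omega>))"
proof -
  interpret F: sigma_finite_subalgebra M XT_algebra by (rule XT_sigma_finite)
  have sm: "cube_part sig2 \<in> borel_measurable borel" using law.sig2_holder by (intro cube_part_measurable)
  obtain c where c: "\<And>u. \<bar>cube_part sig2 u\<bar> \<le> c" using law.cube_part_bounded[OF law.sig2_holder(2,1)] by metis
  have mm: "cube_part mu \<in> borel_measurable borel" using law.mu_holder by (intro cube_part_measurable)
  have em: "(\<lambda>\<omega>. noise_at i \<omega>) \<in> borel_measurable M" if "i \<in> {1..n}" for i
    by (rule comp_measurable[OF that law.noise_term_measurable])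
  have ie2: "integrable M (\<lambda>\<omega>. (noise_at i \<omega>)\<^sup>2)" if "i \<in> {1..n}" for i
    using integral_XY[OF that, of "\<lambda>z. (law.noise_term z)\<^sup>2"] law.square_integrable_noise by simp
  have ie: "integrable M (\<lambda>\<omega>. noise_at i \<omega> * noise_at j \<omega>)" if "i \<in> {1..n}" "j \<in> {1..n}" for i j
  proof (rule Bochner_Integration.integrable_bound)
    show "integrable M (\<lambda>\<omega>. (noise_at i \<omega>)\<^sup>2 + (noise_at j \<omega>)\<^sup>2)" using ie2 that by auto
    show "(\<lambda>\<omega>. noise_at i \<omega> * noise_at j \<omega>) \<in> borel_measurable M" using em that by auto
    have "\<bar>a * b\<bar> \<le> a\<^sup>2 + b\<^sup>2" for a b :: real
    proof -
      have "2 * (\<bar>a\<bar> * \<bar>b\<bar>) \<le> a\<^sup>2 + b\<^sup>2" using sum_squares_bound[of "\<bar>a\<bar>" "\<bar>b\<bar>"] by simp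
      moreover have "0 \<le> \<bar>a\<bar> * \<bar>b\<bar>" by simp
      ultimately show ?thesis unfolding abs_mult by linarith
    qed
    then show "AE \<omega> in M. norm (noise_at i \<omega> * noise_at j \<omega>) \<le> norm ((noise_at i \<omega>)\<^sup>2 + (noise_at j \<omega>)\<^sup>2)"
      by auto
  qed
  \<comment> \<open>The conditional mean of the product of the noises of \<open>i\<close> and
    \<open>j\<close>.\<close>
  define r where "r = (\<lambda>(i::nat) j u. if i = j then cube_part sig2 u else 0 :: real)"
  have key: "expectation (\<lambda>\<omega>. G (XT \<omega>) * (noise_at j \<omega> * noise_at i \<omega>)) = expectation (\<lambda>\<omega>. G (XT \<omega>) * r i j (X i \<omega>))"
     "integrable M (\<lambda>\<omega>. G (XT \<omega>) * (noise_at j \<omega> * noise_at i \<omega>))" "integrable M (\<lambda>\<omega>. G (XT \<omega>) * r i j (X i \<omega>))"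
    if ij: "i \<in> {1..n}" "j \<in> {1..n}" and G: "G \<in> borel_measurable XT_space" "\<And>p. \<bar>G p\<bar> \<le> 1" for G i j
  proof -
    have "expectation (\<lambda>\<omega>. G (XT \<omega>) * (noise_at j \<omega> * noise_at i \<omega>)) = expectation (\<lambda>\<omega>. G (XT \<omega>) * r i j (X i \<omega>)) \<and>
      integrable M (\<lambda>\<omega>. G (XT \<omega>) * (noise_at j \<omega> * noise_at i \<omega>)) \<and> integrable M (\<lambda>\<omega>. G (XT \<omega>) * r i j (X i \<omega>))"
    proof (cases "i = j")
      case True
      then show ?thesis
      proof -
        have a: "(\<lambda>_. 1 :: real) \<in> borel_measurable data_space" "(\<lambda>_. 1 :: real) \<in> borel_measurable (PiM ({1..n} - {i}) (\<lambda>_. borel))"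
          by (rule borel_measurable_const)+
        have b: "integrable M (\<lambda>\<omega>. 1 * (noise_at i \<omega>)\<^sup>2)" "integrable M (\<lambda>\<omega>. 1 * cube_part sig2 (X i \<omega>))"
          using ie2[OF ij(1)] integrable_bounded_X[OF ij(1) sm c] by simp_all
        note e = expectation_bounded_factor[OF ij(1) law.regresses_noise_square G a refl b, unfolded mult_1]
        show ?thesis unfolding r_def True[symmetric] using e by (simp only: power2_eq_square if_True simp_thms)
      qed
    next
      case False
      have nm: "law.noise_term \<in> borel_measurable borel"
        using law.noise_term_measurable law.sets_P by (simp cong: measurable_cong_sets)
      have m: "(\<lambda>z. law.noise_term (z j)) \<in> borel_measurable (PiM J (\<lambda>_. borel))" if "j \<in> J" for J
        by (rule measurable_compose[OF measurable_component_singleton[OF that] nm])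
      have dj: "data \<omega> j = (X j \<omega>, Y j \<omega>)" for \<omega> using ij by (simp add: data_def)
      have eq: "law.noise_term ((z(i := w)) j) = law.noise_term (z j)" for z :: "nat \<Rightarrow> (real ^ 'd) \<times> real" and w
        using False by simp
      have b: "integrable M (\<lambda>\<omega>. law.noise_term (data \<omega> j) * noise_at i \<omega>)" "integrable M (\<lambda>\<omega>. law.noise_term (data \<omega> j) * 0)"
        using ie[OF ij(2,1)] unfolding dj by simp_all
      have "j \<in> {1..n} - {i}" using False ij by simp
      note e = expectation_bounded_factor[OF ij(1) law.regresses_noise G m[OF ij(2)] m[OF this] eq b, unfolded dj]
      show ?thesis using e False by (simp only: r_def if_False mult_zero_right simp_thms)
    qed
    then show "expectation (\<lambda>\<omega>. G (XT \<omega>) * (noise_at j \<omega> * noise_at i \<omega>)) = expectation (\<lambda>\<omega>. G (XT \<omega>) * r i j (X i \<omega>))"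
     "integrable M (\<lambda>\<omega>. G (XT \<omega>) * (noise_at j \<omega> * noise_at i \<omega>))" "integrable M (\<lambda>\<omega>. G (XT \<omega>) * r i j (X i \<omega>))"
      by auto
  qed
  have w: "\<bar>weight_fn i p\<bar> \<le> 1" if "i \<in> {1..n}" for i p using weight_fn_bounds[OF that, of p] by simp
  have ww: "(\<lambda>p. weight_fn i p * weight_fn j p) \<in> borel_measurable XT_space" "\<bar>weight_fn i p * weight_fn j p\<bar> \<le> 1"
    if "i \<in> {1..n}" "j \<in> {1..n}" for i j p
    using weight_fn_measurable that w[OF that(1), of p] w[OF that(2), of p] by (auto simp: abs_mult intro!: mult_le_one)
  define V where "V = (\<lambda>\<omega>. \<Sum>i=1..n. \<Sum>j=1..n. weight i \<omega> * weight j \<omega> * (noise_at j \<omega> * noise_at i \<omega>))"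
  define U where "U = (\<lambda>\<omega>. \<Sum>i=1..n. \<Sum>j=1..n. weight i \<omega> * weight j \<omega> * r i j (X i \<omega>))"
  have U: "U \<omega> = (\<Sum>i=1..n. (weight i \<omega>)\<^sup>2 * cube_part sig2 (X i \<omega>))" for \<omega>
  proof -
    have "(\<Sum>j=1..n. weight i \<omega> * weight j \<omega> * r i j (X i \<omega>)) = (\<Sum>j=1..n. if i = j then (weight i \<omega>)\<^sup>2 * cube_part sig2 (X i \<omega>) else 0)" for i
      unfolding r_def by (intro sum.cong) (auto simp: power2_eq_square)
    then show ?thesis unfolding U_def by simp
  qed
  have Vi: "integrable M V" unfolding V_def
    by (rule Bochner_Integration.integrable_sum, rule Bochner_Integration.integrable_sum) (rule key(2)[OF _ _ ww])
  have Ui: "integrable M U" unfolding U_def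
    by (rule Bochner_Integration.integrable_sum, rule Bochner_Integration.integrable_sum) (rule key(3)[OF _ _ ww])
  have VU: "AE \<omega> in M. real_cond_exp M XT_algebra V \<omega> = U \<omega>"
  proof (rule F.real_cond_exp_charact[OF _ Vi Ui])
    show "U \<in> borel_measurable XT_algebra"
      unfolding U[abs_def]
      by (rule borel_measurable_sum, rule borel_measurable_times[OF borel_measurable_power[OF weight_XT_algebra] X_XT_algebra[OF _ sm]])
    fix A assume "A \<in> sets XT_algebra"
    then obtain A' where A': "A' \<in> sets XT_space" "A = XT -` A' \<inter> space M" by (rule XT_sets)
    define G where "G = (\<lambda>i j p. indicat_real A' p * (weight_fn i p * weight_fn j p))"
    have G: "G i j \<in> borel_measurable XT_space" "\<bar>G i j p\<bar> \<le> 1" if "i \<in> {1..n}" "j \<in> {1..n}" for i j p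
      unfolding G_def using A'(1) ww[OF that] by (auto simp: indicator_def)
    have ind: "indicator A \<omega> = indicat_real A' (XT \<omega>)" if "\<omega> \<in> space M" for \<omega>
      using that by (auto simp: A'(2) indicator_def)
    have "(\<integral>\<omega>\<in>A. V \<omega> \<partial>M) = expectation (\<lambda>\<omega>. \<Sum>i=1..n. \<Sum>j=1..n. G i j (XT \<omega>) * (noise_at j \<omega> * noise_at i \<omega>))"
      unfolding set_lebesgue_integral_def V_def G_def
      by (intro Bochner_Integration.integral_cong) (auto simp: ind sum_distrib_left mult.assoc)
    also have "\<dots> = (\<Sum>i=1..n. expectation (\<lambda>\<omega>. \<Sum>j=1..n. G i j (XT \<omega>) * (noise_at j \<omega> * noise_at i \<omega>)))"
      by (rule Bochner_Integration.integral_sum, rule Bochner_Integration.integrable_sum) (rule key(2)[OF _ _ G])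
    also have "\<dots> = (\<Sum>i=1..n. \<Sum>j=1..n. expectation (\<lambda>\<omega>. G i j (XT \<omega>) * (noise_at j \<omega> * noise_at i \<omega>)))"
      by (rule sum.cong[OF refl], rule Bochner_Integration.integral_sum) (rule key(2)[OF _ _ G])
    also have "\<dots> = (\<Sum>i=1..n. \<Sum>j=1..n. expectation (\<lambda>\<omega>. G i j (XT \<omega>) * r i j (X i \<omega>)))"
      by (rule sum.cong[OF refl], rule sum.cong[OF refl]) (rule key(1)[OF _ _ G])
    also have "\<dots> = (\<Sum>i=1..n. expectation (\<lambda>\<omega>. \<Sum>j=1..n. G i j (XT \<omega>) * r i j (X i \<omega>)))"
      by (rule sum.cong[OF refl], rule Bochner_Integration.integral_sum[symmetric]) (rule key(3)[OF _ _ G])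
    also have "\<dots> = expectation (\<lambda>\<omega>. \<Sum>i=1..n. \<Sum>j=1..n. G i j (XT \<omega>) * r i j (X i \<omega>))"
      by (rule Bochner_Integration.integral_sum[symmetric], rule Bochner_Integration.integrable_sum) (rule key(3)[OF _ _ G])
    also have "\<dots> = (\<integral>\<omega>\<in>A. U \<omega> \<partial>M)"
      unfolding set_lebesgue_integral_def U_def G_def
      by (intro Bochner_Integration.integral_cong) (auto simp: ind sum_distrib_left mult.assoc)
    finally show "(\<integral>\<omega>\<in>A. V \<omega> \<partial>M) = (\<integral>\<omega>\<in>A. U \<omega> \<partial>M)" .
  qed
  let ?Z = "forest_estimate n B X Y T x"
  have eq: "AE \<omega> in M. (?Z \<omega> - real_cond_exp M XT_algebra ?Z \<omega>)\<^sup>2 = V \<omega>"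
    using cond_exp_estimate
  proof eventually_elim
    case (elim \<omega>)
    have "?Z \<omega> - real_cond_exp M XT_algebra ?Z \<omega> = (\<Sum>i=1..n. weight i \<omega> * noise_at i \<omega>)"
      unfolding elim forest_estimate_eq law.noise_term_def by (simp add: right_diff_distrib sum_subtractf)
    then show ?case
      unfolding V_def by (simp add: power2_eq_square sum_product mult_ac)
  qed
  have Zm: "?Z \<in> borel_measurable M"
    unfolding forest_estimate_eq[abs_def]
    by (intro borel_measurable_sum borel_measurable_times Y_measurable measurable_compose[OF XT_measurable weight_fn_measurable])
  have "AE \<omega> in M. real_cond_exp M XT_algebra (\<lambda>\<omega>. (?Z \<omega> - real_cond_exp M XT_algebra ?Z \<omega>)\<^sup>2) \<omega> = real_cond_exp M XT_algebra V \<omega>"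
    by (rule F.real_cond_exp_cong[OF eq]) (use Zm borel_measurable_integrable[OF Vi] in measurable)
  then show ?thesis
    unfolding cond_var_def using VU by eventually_elim (simp add: U)
qed

end

section \<open>Bounds for fixed trees\<close>

context regression_law
begin

definition X_law :: "(real ^ 'd) measure" where
  "X_law = distr P borel fst"

lemma cube_part_f_measurable [measurable]: "cube_part f \<in> borel_measurable borel"
  using f_holder by (intro cube_part_measurable)

lemma cube_part_f_nonneg: "0 \<le> cube_part f u"
  using f_bounded_below by (force simp: cube_part_def indicator_def)

lemma X_law_density: "X_law = density lborel (\<lambda>u. ennreal (cube_part f u))"
proof -
  have "X_law = distr P lborel fst"
    unfolding X_law_def by (rule distr_cong) auto
  then show ?thesis
    unfolding cube_part_def by (simp only: distributed_distr_eq_density[OF density_X])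
qed

lemma sets_X_law [simp, measurable_cong]: "sets X_law = sets borel"
  by (simp add: X_law_def)

lemma integral_X_law:
  fixes g :: "real ^ 'd \<Rightarrow> real"
  assumes [measurable]: "g \<in> borel_measurable borel"
  shows "(\<integral>u. g u \<partial>X_law) = (\<integral>u. cube_part f u * g u \<partial>lborel)"
  unfolding X_law_density using cube_part_f_nonneg
  by (subst integral_density) auto

lemma measure_X_law: "A \<in> sets borel \<Longrightarrow> measure X_law A = (\<integral>u. cube_part f u * indicat_real A u \<partial>lborel)"
  using integral_X_law[of "indicat_real A"] by simp

end

lemma average_deviation:
  fixes h :: "real ^ 'd::finite \<Rightarrow> real"
  assumes D: "D \<in> sets borel" "D \<subseteq> unit_cube" and [measurable]: "h \<in> borel_measurable borel"
    and e: "\<And>u. u \<in> D \<Longrightarrow> \<bar>h u - c\<bar> \<le> e"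
  shows "\<bar>(\<integral>u. h u * indicat_real D u \<partial>lborel) - c * measure lborel D\<bar> \<le> e * measure lborel D"
    and "integrable lborel (\<lambda>u. h u * indicat_real D u)"
proof -
  note [measurable] = D(1)
  have "emeasure lborel D \<le> emeasure lborel (unit_cube :: (real ^ 'd) set)"
    using D by (intro emeasure_mono) auto
  also have "\<dots> < \<infinity>" by (rule emeasure_bounded_finite) (rule bounded_cbox)
  finally have fin: "emeasure lborel D < \<infinity>" .
  have iD: "integrable lborel (indicat_real D)"
    using D fin by (intro integrable_real_indicator) auto
  have i: "integrable lborel (\<lambda>u. (h u - c) * indicat_real D u)"
    by (rule Bochner_Integration.integrable_bound[OF integrable_mult_right[OF iD, of e]])
      (use e in \<open>auto simp: indicator_def intro!: AE_I2 order_trans[OF e]\<close>)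
  have "integrable lborel (\<lambda>u. (h u - c) * indicat_real D u + c * indicat_real D u)"
    using i iD by auto
  then show ih: "integrable lborel (\<lambda>u. h u * indicat_real D u)"
    by (simp add: algebra_simps)
  have "(\<integral>u. h u * indicat_real D u \<partial>lborel) - c * measure lborel D = (\<integral>u. (h u - c) * indicat_real D u \<partial>lborel)"
    using ih iD by (simp add: left_diff_distrib)
  also have "\<bar>\<dots>\<bar> \<le> (\<integral>u. e * indicat_real D u \<partial>lborel)"
  proof (rule order_trans[OF integral_abs_bound], rule integral_mono)
    show "integrable lborel (\<lambda>u. \<bar>(h u - c) * indicat_real D u\<bar>)" by (rule integrable_abs[OF i])
    show "integrable lborel (\<lambda>u. e * indicat_real D u)" by (rule integrable_mult_right[OF iD])
    show "\<bar>(h u - c) * indicat_real D u\<bar> \<le> e * indicat_real D u" for u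
      using e[of u] by (cases "u \<in> D") auto
  qed
  also have "\<dots> = e * measure lborel D" by simp
  finally show "\<bar>(\<integral>u. h u * indicat_real D u \<partial>lborel) - c * measure lborel D\<bar> \<le> e * measure lborel D" .
qed

text \<open>The added parameters are fixed once for all n, so that constants built from them are
  uniform. \<open>\<gamma>\<close> is a common exponent for \<open>f\<close> and
  \<open>sig2\<close>. For every lifetime from \<open>lam0\<close> on, \<open>\<tau>\<close> is a
  lower bound for the levels at which the exponential variables are truncated by the boundary of the
  cube.\<close>

locale forest_bounds = mondrian_forest M P f mu sig2 beta_f beta_mu beta_sig n B lam X Y T x
  for M :: "'w measure" and P :: "((real ^ 'd::finite) \<times> real) measure" and f mu sig2 beta_f beta_mu beta_sig n B lam X Y T x +
  fixes fl fb sb L \<gamma> \<tau> lam0 :: real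
  assumes fl: "0 < fl" "\<And>u. u \<in> unit_cube \<Longrightarrow> fl \<le> f u" and fb: "\<And>u. u \<in> unit_cube \<Longrightarrow> f u \<le> fb"
    and sb: "\<And>u. u \<in> unit_cube \<Longrightarrow> sig2 u \<le> sb"
    and L: "0 \<le> L" "\<And>u. u \<in> unit_cube \<Longrightarrow> \<bar>f u - f x\<bar> \<le> L * norm (u - x) powr \<gamma>"
      "\<And>u. u \<in> unit_cube \<Longrightarrow> \<bar>sig2 u - sig2 x\<bar> \<le> L * norm (u - x) powr \<gamma>"
    and \<gamma>: "0 < \<gamma>" "\<gamma> \<le> 1" and \<tau>: "0 < \<tau>" "\<And>i. \<tau> \<le> lam0 * gap_max x i" and lam0: "0 < lam0" "lam0 \<le> lam"
begin

sublocale iid: iid_sample M borel law.X_law n X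
proof
  have "indep_vars (\<lambda>_. borel) (\<lambda>i \<omega>. fst (X i \<omega>, Y i \<omega>)) {1..n}"
    by (rule indep_vars_compose2[OF data_indep]) (simp add: borel_prod[symmetric])
  then show "indep_vars (\<lambda>_. borel) X {1..n}" by simp
  show "distr M borel (X i) = law.X_law" if i: "i \<in> {1..n}" for i
  proof -
    have "law.X_law = distr (distr M borel (\<lambda>\<omega>. (X i \<omega>, Y i \<omega>))) borel fst"
      unfolding law.X_law_def data_law[OF i] ..
    also have "\<dots> = distr M borel (fst \<circ> (\<lambda>\<omega>. (X i \<omega>, Y i \<omega>)))"
      by (rule distr_distr[OF _ XY_measurable[OF i]]) (simp add: borel_prod[symmetric])
    finally show ?thesis by (simp add: comp_def)
  qed
qed (rule n_ge_1)

abbreviation "vol t \<equiv> measure lborel (cell_at t x)"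
abbreviation "prob_cell t \<equiv> measure law.X_law (cell_at t x)"
definition "radius t = (\<Sum>j\<in>UNIV. width x j t) powr \<gamma>"

lemmas cell_sets = cell_at_sets[OF x]

lemma cell_bounds:
  assumes "u \<in> cell_at t x"
  shows "u \<in> unit_cube" "\<bar>f u - f x\<bar> \<le> L * radius t" "\<bar>sig2 u - sig2 x\<bar> \<le> L * radius t"
proof -
  show u: "u \<in> unit_cube" using assms cell_at_subset[OF x] by blast
  have "norm (u - x) powr \<gamma> \<le> radius t"
    unfolding radius_def using cell_at_dist[OF x assms] \<gamma> by (intro powr_mono2) auto
  then have "L * norm (u - x) powr \<gamma> \<le> L * radius t" using L(1) by (rule mult_left_mono)
  then show "\<bar>f u - f x\<bar> \<le> L * radius t" "\<bar>sig2 u - sig2 x\<bar> \<le> L * radius t"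
    using L(2,3)[OF u] by linarith+
qed

lemma fb_pos: "0 < fb" and sb_pos: "0 < sb"
  using fl fb[OF x_in_cube] fl(2)[OF x_in_cube] sb[OF x_in_cube] law.sig2_pos[OF x_in_cube] by linarith+

lemma vol_pos: "0 < vol t" by (rule measure_cell_pos[OF x])

lemma prob_cell_eq: "prob_cell t = (\<integral>u. cube_part f u * indicat_real (cell_at t x) u \<partial>lborel)"
  by (rule law.measure_X_law[OF cell_sets])

lemma prob_cell_deviation: "\<bar>prob_cell t - f x * vol t\<bar> \<le> L * radius t * vol t"
  unfolding prob_cell_eq
  by (rule average_deviation(1)[OF cell_sets cell_at_subset[OF x] law.cube_part_f_measurable])
    (use cell_bounds in \<open>auto simp: cube_part_def\<close>)

lemma prob_cell_bounds: "fl * vol t \<le> prob_cell t" "prob_cell t \<le> fb * vol t"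
proof -
  \<comment> \<open>A two-sided bound on the density is a deviation from the midpoint by at most
    half the range.\<close>
  have "\<bar>prob_cell t - (fl + fb) / 2 * vol t\<bar> \<le> (fb - fl) / 2 * vol t"
    unfolding prob_cell_eq
  proof (rule average_deviation(1)[OF cell_sets cell_at_subset[OF x] law.cube_part_f_measurable])
    fix u assume "u \<in> cell_at t x"
    then have "u \<in> unit_cube" by (rule cell_bounds)
    then show "\<bar>cube_part f u - (fl + fb) / 2\<bar> \<le> (fb - fl) / 2"
      using fl(2)[of u] fb[of u] by (simp add: cube_part_def abs_le_iff field_simps)
  qed
  then show "fl * vol t \<le> prob_cell t" "prob_cell t \<le> fb * vol t"
    by (auto simp: abs_le_iff field_simps)
qed

lemma prob_cell_pos: "0 < prob_cell t"
  using prob_cell_bounds(1)[of t] fl(1) vol_pos[of t] by (smt (verit) mult_pos_pos)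

definition "overlap t t' = measure lborel (cell_at t x \<inter> cell_at t' x) / (vol t * vol t')"
definition "weighted_overlap t t' = (\<integral>u. cube_part sig2 u * indicat_real (cell_at t x \<inter> cell_at t' x) u \<partial>law.X_law)"
text \<open>The first summand comes from replacing \<open>f\<close> and \<open>sig2\<close> by their
  values at \<open>x\<close> in the numerator, the second from doing so in the product of the two
  cell probabilities.\<close>

definition "bias_const = (sb + fb) * L / fl\<^sup>2 + sb * fb\<^sup>2 * L / fl ^ 4"

lemma radius_nonneg: "0 \<le> radius t" by (simp add: radius_def)

lemma overlap_nonneg: "0 \<le> overlap t t'" by (simp add: overlap_def)

text \<open>On the cells \<open>f\<close> and \<open>sig2\<close> deviate from their values at
  \<open>x\<close> by at most \<open>L\<close> times the radius, and every denominator is at least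
  \<open>fl\<close> times a volume. The factor \<open>overlap\<close> is kept because its square is
  later integrated together with the radii.\<close>

lemma weighted_overlap_bias:
  "\<bar>weighted_overlap t t' / (prob_cell t * prob_cell t') - sig2 x / f x * overlap t t'\<bar>
    \<le> bias_const * overlap t t' * (radius t + radius t')"
proof -
  let ?D = "cell_at t x \<inter> cell_at t' x"
  define w where "w = measure lborel ?D"
  define s p p' v v' r r' where "s = weighted_overlap t t'" and "p = prob_cell t" and "p' = prob_cell t'"
    and "v = vol t" and "v' = vol t'" and "r = radius t" and "r' = radius t'"
  have w: "0 \<le> w" by (simp add: w_def)
  have v: "0 < v" "0 < v'" using vol_pos by (auto simp: v_def v'_def)
  have p: "0 < p" "0 < p'" using prob_cell_pos by (auto simp: p_def p'_def)
  have r: "0 \<le> r" "0 \<le> r'" using radius_nonneg by (auto simp: r_def r'_def)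
  have fx: "fl \<le> f x" "f x \<le> fb" using fl fb x_in_cube by auto
  have sx: "0 < sig2 x" "sig2 x \<le> sb" using sb law.sig2_pos x_in_cube by auto
  have sm [measurable]: "cube_part sig2 \<in> borel_measurable borel" using law.sig2_holder by (intro cube_part_measurable)
  have D [measurable]: "?D \<in> sets borel" using cell_sets by auto
  have s_eq: "s = (\<integral>u. (cube_part f u * cube_part sig2 u) * indicat_real ?D u \<partial>lborel)"
    unfolding s_def weighted_overlap_def by (subst law.integral_X_law) (auto simp: mult_ac)
  have sdev: "\<bar>s - (f x * sig2 x) * w\<bar> \<le> (sb + fb) * L * r * w"
    unfolding s_eq w_def
  proof (rule average_deviation(1))
    fix u assume "u \<in> ?D"
    then have u: "u \<in> cell_at t x" by simp
    note c = cell_bounds[OF u]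
    have "f u * sig2 u - f x * sig2 x = sig2 u * (f u - f x) + f x * (sig2 u - sig2 x)"
      by (simp add: algebra_simps)
    also have "\<bar>\<dots>\<bar> \<le> \<bar>sig2 u * (f u - f x)\<bar> + \<bar>f x * (sig2 u - sig2 x)\<bar>" by (rule abs_triangle_ineq)
    also have "\<dots> \<le> sb * (L * r) + fb * (L * r)"
      unfolding abs_mult r_def using c sb[OF c(1)] law.sig2_pos[OF c(1)] fx fl sb_pos fb_pos by (intro add_mono mult_mono) auto
    also have "\<dots> = (sb + fb) * L * r" by (simp add: algebra_simps)
    finally show "\<bar>cube_part f u * cube_part sig2 u - f x * sig2 x\<bar> \<le> (sb + fb) * L * r"
      using c(1) by (simp add: cube_part_def)
  qed (use cell_at_subset[OF x] in auto)
  have pd: "\<bar>p - f x * v\<bar> \<le> L * r * v" "\<bar>p' - f x * v'\<bar> \<le> L * r' * v'"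
    using prob_cell_deviation by (auto simp: p_def p'_def v_def v'_def r_def r'_def)
  have pl: "fl * v \<le> p" "fl * v' \<le> p'" "p \<le> fb * v"
    using prob_cell_bounds by (auto simp: p_def p'_def v_def v'_def)
  have pp: "fl\<^sup>2 * (v * v') \<le> p * p'"
    using mult_mono[OF pl(1,2)] fl(1) v p by (simp add: power2_eq_square mult_ac)
  have pos: "0 < fl\<^sup>2 * (v * v')" using fl v by simp
  have 1: "\<bar>(s - f x * sig2 x * w) / (p * p')\<bar> \<le> (sb + fb) * L / fl\<^sup>2 * (w / (v * v')) * r"
  proof -
    have "\<bar>(s - f x * sig2 x * w) / (p * p')\<bar> \<le> ((sb + fb) * L * r * w) / (fl\<^sup>2 * (v * v'))"
      unfolding abs_divide using sdev pp pos p by (intro frac_le) auto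
    then show ?thesis by (simp add: mult_ac)
  qed
  have "(f x)\<^sup>2 * (v * v') - p * p' = (f x * v - p) * (f x * v') + p * (f x * v' - p')"
    by (simp add: algebra_simps power2_eq_square)
  also have "\<bar>\<dots>\<bar> \<le> \<bar>(f x * v - p) * (f x * v')\<bar> + \<bar>p * (f x * v' - p')\<bar>" by (rule abs_triangle_ineq)
  also have "\<dots> \<le> (L * r * v) * (fb * v') + (fb * v) * (L * r' * v')"
    unfolding abs_mult using pd pl(3) p v fx fl(1) L(1) r by (intro add_mono mult_mono) (auto simp: abs_minus_commute)
  finally have 2: "\<bar>(f x)\<^sup>2 * (v * v') - p * p'\<bar> \<le> L * fb * (r + r') * (v * v')"
    by (simp add: algebra_simps)
  have 3: "\<bar>f x * sig2 x * w * (((f x)\<^sup>2 * (v * v') - p * p') / ((p * p') * ((f x)\<^sup>2 * (v * v'))))\<bar>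
     \<le> sb * fb\<^sup>2 * L / fl ^ 4 * (w / (v * v')) * (r + r')"
  proof -
    have "\<bar>((f x)\<^sup>2 * (v * v') - p * p') / ((p * p') * ((f x)\<^sup>2 * (v * v')))\<bar>
        \<le> (L * fb * (r + r') * (v * v')) / ((fl\<^sup>2 * (v * v')) * (fl\<^sup>2 * (v * v')))"
      unfolding abs_divide
    proof (intro frac_le)
      have "fl\<^sup>2 * (v * v') \<le> (f x)\<^sup>2 * (v * v')" using fx fl v by (intro mult_right_mono power_mono) auto
      then have "(fl\<^sup>2 * (v * v')) * (fl\<^sup>2 * (v * v')) \<le> (p * p') * ((f x)\<^sup>2 * (v * v'))"
        by (rule mult_mono[OF pp]) (use pos p v in auto)
      then show "(fl\<^sup>2 * (v * v')) * (fl\<^sup>2 * (v * v')) \<le> \<bar>(p * p') * ((f x)\<^sup>2 * (v * v'))\<bar>" by linarith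
      show "0 < (fl\<^sup>2 * (v * v')) * (fl\<^sup>2 * (v * v'))" using pos by simp
    qed (use 2 L fb_pos r v in auto)
    also have "\<dots> = L * fb * (r + r') / (fl ^ 4 * (v * v'))"
    proof -
      have eq: "(fl\<^sup>2 * (v * v')) * (fl\<^sup>2 * (v * v')) = (fl ^ 4 * (v * v')) * (v * v')"
        by (simp add: power2_eq_square power4_eq_xxxx mult_ac)
      show ?thesis unfolding eq by (rule nonzero_mult_divide_mult_cancel_right) (use v in auto)
    qed
    finally have "\<bar>f x * sig2 x * w\<bar> * \<bar>((f x)\<^sup>2 * (v * v') - p * p') / ((p * p') * ((f x)\<^sup>2 * (v * v')))\<bar>
       \<le> (fb * sb * w) * (L * fb * (r + r') / (fl ^ 4 * (v * v')))"
      using fx fl sx w fb_pos sb_pos by (intro mult_mono) (auto simp: abs_mult intro!: mult_mono)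
    then show ?thesis unfolding abs_mult[symmetric] by (simp add: power2_eq_square mult_ac)
  qed
  \<comment> \<open>First the numerator is exchanged, then the denominators, whose reciprocals
    differ by the quotient in the second term.\<close>
  have "s / (p * p') - sig2 x / f x * (w / (v * v')) = (s - f x * sig2 x * w) / (p * p')
     + f x * sig2 x * w * (((f x)\<^sup>2 * (v * v') - p * p') / ((p * p') * ((f x)\<^sup>2 * (v * v'))))"
  proof -
    have nz: "p * p' \<noteq> 0" "(f x)\<^sup>2 * (v * v') \<noteq> 0" "f x \<noteq> 0" "v * v' \<noteq> 0" using p v fx fl by auto
    have "((f x)\<^sup>2 * (v * v') - p * p') / ((p * p') * ((f x)\<^sup>2 * (v * v'))) = 1 / (p * p') - 1 / ((f x)\<^sup>2 * (v * v'))"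
      using nz by (simp add: diff_divide_distrib)
    then show ?thesis using nz by (simp add: diff_divide_distrib right_diff_distrib power2_eq_square)
  qed
  also have "\<bar>\<dots>\<bar> \<le> (sb + fb) * L / fl\<^sup>2 * (w / (v * v')) * r + sb * fb\<^sup>2 * L / fl ^ 4 * (w / (v * v')) * (r + r')"
    using 1 3 by (intro abs_triangle_ineq[THEN order_trans] add_mono)
  also have "\<dots> \<le> (sb + fb) * L / fl\<^sup>2 * (w / (v * v')) * (r + r') + sb * fb\<^sup>2 * L / fl ^ 4 * (w / (v * v')) * (r + r')"
    using r w v sb_pos fb_pos L(1) by (intro add_right_mono mult_left_mono) auto
  also have "\<dots> = bias_const * (w / (v * v')) * (r + r')"
    by (simp add: bias_const_def algebra_simps)
  finally show ?thesis
    by (simp add: overlap_def s_def p_def p'_def v_def v'_def r_def r'_def w_def)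
qed

text \<open>The contribution of one pair of trees to the scaled conditional variance.\<close>

definition pair_term :: "'d split_tree \<Rightarrow> 'd split_tree \<Rightarrow> 'w \<Rightarrow> real" where
  "pair_term t t' \<omega> = n / lam ^ CARD('d) * ((\<Sum>i=1..n. cube_part sig2 (X i \<omega>) * indicat_real (cell_at t x \<inter> cell_at t' x) (X i \<omega>))
     / (iid.hits (cell_at t x) \<omega> * iid.hits (cell_at t' x) \<omega>))"

lemma cube_part_sig2: "0 \<le> cube_part sig2 u" "cube_part sig2 u \<le> sb"
  using sb[of u] law.sig2_pos[of u] sb_pos by (auto simp: cube_part_def indicator_def less_imp_le)

text \<open>Stochastic error and bias are separated by (c + d)^2 \<le> 2 c^2 + 2 d^2, so 162036 = 2
  * 81018. Cell probabilities are replaced by volumes at the price of \<open>fl ^ 3\<close>, the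
  power 3/2 of the square of \<open>fl\<close>.\<close>

lemma pair_term_deviation:
  "(\<integral>\<^sup>+\<omega>. ennreal ((pair_term t t' \<omega> - sig2 x / f x * (overlap t t' / lam ^ CARD('d)))\<^sup>2) \<partial>M)
    \<le> ennreal (162036 * sb\<^sup>2 / fl ^ 3 / (n * (vol t * vol t') powr (3 / 2) * (lam ^ CARD('d))\<^sup>2)
       + 2 * (bias_const * (overlap t t' / lam ^ CARD('d)) * (radius t + radius t'))\<^sup>2)"
proof -
  let ?l = "lam ^ CARD('d)"
  let ?p = "prob_cell t" and ?p' = "prob_cell t'"
  let ?Z = "\<lambda>\<omega>. n * (\<Sum>i=1..n. cube_part sig2 (X i \<omega>) * indicat_real (cell_at t x \<inter> cell_at t' x) (X i \<omega>)) / (iid.hits (cell_at t x) \<omega> * iid.hits (cell_at t' x) \<omega>)"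
  have sm [measurable]: "cube_part sig2 \<in> borel_measurable borel" using law.sig2_holder by (intro cube_part_measurable)
  have cs: "cell_at t x \<in> sets borel" "cell_at t' x \<in> sets borel" by (rule cell_sets)+
  have l: "0 < ?l" using lam_pos by simp
  define q where "q = weighted_overlap t t' / (?p * ?p')"
  define b where "b = q - sig2 x / f x * overlap t t'"
  have bb: "\<bar>b\<bar> \<le> bias_const * overlap t t' * (radius t + radius t')"
    unfolding b_def q_def by (rule weighted_overlap_bias)
  have Zm: "?Z \<in> borel_measurable M"
  proof -
    have "(\<lambda>u. cube_part sig2 u * indicat_real (cell_at t x \<inter> cell_at t' x) u) \<in> borel_measurable borel"
      using cs by (intro borel_measurable_times sm borel_measurable_indicator) auto
    from iid.sum_measurable[OF this] show ?thesis
      using iid.hits_measurable[OF cs(1)] iid.hits_measurable[OF cs(2)] by (intro borel_measurable_divide borel_measurable_times) auto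
  qed
  have "(\<integral>\<^sup>+\<omega>. ennreal ((pair_term t t' \<omega> - sig2 x / f x * (overlap t t' / ?l))\<^sup>2) \<partial>M)
    \<le> (\<integral>\<^sup>+\<omega>. ennreal (2 / ?l\<^sup>2) * ennreal ((?Z \<omega> - q)\<^sup>2) + ennreal (2 / ?l\<^sup>2 * b\<^sup>2) \<partial>M)"
  proof (rule nn_integral_mono)
    fix \<omega>
    have "pair_term t t' \<omega> - sig2 x / f x * (overlap t t' / ?l) = ((?Z \<omega> - q) + b) / ?l"
      by (simp add: pair_term_def b_def diff_divide_distrib add_divide_distrib)
    then have "(pair_term t t' \<omega> - sig2 x / f x * (overlap t t' / ?l))\<^sup>2 = ((?Z \<omega> - q) + b)\<^sup>2 / ?l\<^sup>2"
      by (simp add: power_divide)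
    also have "\<dots> \<le> (2 * (?Z \<omega> - q)\<^sup>2 + 2 * b\<^sup>2) / ?l\<^sup>2"
    proof (rule divide_right_mono)
      have "(c + d)\<^sup>2 \<le> 2 * c\<^sup>2 + 2 * d\<^sup>2" for c d :: real
        using zero_le_power2[of "c - d"] by (simp add: power2_eq_square algebra_simps)
      then show "((?Z \<omega> - q) + b)\<^sup>2 \<le> 2 * (?Z \<omega> - q)\<^sup>2 + 2 * b\<^sup>2" .
    qed simp
    also have "\<dots> = 2 / ?l\<^sup>2 * (?Z \<omega> - q)\<^sup>2 + 2 / ?l\<^sup>2 * b\<^sup>2" by (simp add: add_divide_distrib)
    finally have "ennreal ((pair_term t t' \<omega> - sig2 x / f x * (overlap t t' / ?l))\<^sup>2) \<le> ennreal (2 / ?l\<^sup>2 * (?Z \<omega> - q)\<^sup>2 + 2 / ?l\<^sup>2 * b\<^sup>2)"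
      by (rule ennreal_leI)
    also have "\<dots> = ennreal (2 / ?l\<^sup>2) * ennreal ((?Z \<omega> - q)\<^sup>2) + ennreal (2 / ?l\<^sup>2 * b\<^sup>2)"
      by (subst ennreal_plus) (auto simp: ennreal_mult[symmetric])
    finally show "ennreal ((pair_term t t' \<omega> - sig2 x / f x * (overlap t t' / ?l))\<^sup>2) \<le> ennreal (2 / ?l\<^sup>2) * ennreal ((?Z \<omega> - q)\<^sup>2) + ennreal (2 / ?l\<^sup>2 * b\<^sup>2)" .
  qed
  also have "\<dots> = ennreal (2 / ?l\<^sup>2) * (\<integral>\<^sup>+\<omega>. ennreal ((?Z \<omega> - q)\<^sup>2) \<partial>M) + ennreal (2 / ?l\<^sup>2 * b\<^sup>2)"
    using Zm by (subst nn_integral_add) (auto simp: nn_integral_cmult emeasure_space_1)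
  also have "\<dots> \<le> ennreal (2 / ?l\<^sup>2) * ennreal (81018 * sb\<^sup>2 / (n * (?p * ?p') powr (3 / 2))) + ennreal (2 / ?l\<^sup>2 * b\<^sup>2)"
    unfolding q_def weighted_overlap_def
    by (intro add_right_mono mult_left_mono iid.weighted_hits_deviation[OF cs refl refl prob_cell_pos prob_cell_pos sm cube_part_sig2]) simp
  also have "\<dots> = ennreal (2 / ?l\<^sup>2 * (81018 * sb\<^sup>2 / (n * (?p * ?p') powr (3 / 2))) + 2 / ?l\<^sup>2 * b\<^sup>2)"
    by (subst ennreal_mult[symmetric]) (auto simp: ennreal_plus[symmetric] simp del: ennreal_plus)
  also have "\<dots> \<le> ennreal (162036 * sb\<^sup>2 / fl ^ 3 / (n * (vol t * vol t') powr (3 / 2) * ?l\<^sup>2)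
       + 2 * (bias_const * (overlap t t' / ?l) * (radius t + radius t'))\<^sup>2)"
  proof (intro ennreal_leI add_mono)
    have "fl\<^sup>2 * (vol t * vol t') \<le> ?p * ?p'"
      using mult_mono[OF prob_cell_bounds(1)[of t] prob_cell_bounds(1)[of t']] fl(1) vol_pos[of t'] prob_cell_pos[of t]
      by (simp add: power2_eq_square mult_ac)
    then have "(fl\<^sup>2 * (vol t * vol t')) powr (3 / 2) \<le> (?p * ?p') powr (3 / 2)"
      using vol_pos by (intro powr_mono2) (auto simp: less_imp_le)
    moreover have "(fl\<^sup>2 * (vol t * vol t')) powr (3 / 2) = fl ^ 3 * (vol t * vol t') powr (3 / 2)"
    proof -
      have "(fl\<^sup>2) powr (3 / 2) = fl ^ 3"
        using fl(1) by (simp add: powr_powr flip: powr_numeral)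
      then show ?thesis using vol_pos[of t] vol_pos[of t'] by (simp add: powr_mult)
    qed
    ultimately have le: "fl ^ 3 * (vol t * vol t') powr (3 / 2) \<le> (?p * ?p') powr (3 / 2)" by simp
    have n: "0 < real n" using n_ge_1 by simp
    have "81018 * sb\<^sup>2 / (n * (?p * ?p') powr (3 / 2)) \<le> 81018 * sb\<^sup>2 / (n * (fl ^ 3 * (vol t * vol t') powr (3 / 2)))"
      using le n fl(1) vol_pos[of t] vol_pos[of t'] prob_cell_pos[of t] prob_cell_pos[of t']
      by (intro divide_left_mono mult_left_mono mult_pos_pos) auto
    then have "2 / ?l\<^sup>2 * (81018 * sb\<^sup>2 / (n * (?p * ?p') powr (3 / 2))) \<le> 2 / ?l\<^sup>2 * (81018 * sb\<^sup>2 / (n * (fl ^ 3 * (vol t * vol t') powr (3 / 2))))"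
      by (intro mult_left_mono) auto
    also have "\<dots> = 162036 * sb\<^sup>2 / fl ^ 3 / (n * (vol t * vol t') powr (3 / 2) * ?l\<^sup>2)"
      by simp
    finally show "2 / ?l\<^sup>2 * (81018 * sb\<^sup>2 / (n * (?p * ?p') powr (3 / 2))) \<le> 162036 * sb\<^sup>2 / fl ^ 3 / (n * (vol t * vol t') powr (3 / 2) * ?l\<^sup>2)" .
    have "b\<^sup>2 \<le> (bias_const * overlap t t' * (radius t + radius t'))\<^sup>2"
      using bb by (metis abs_ge_zero power2_abs power_mono)
    then have "2 / ?l\<^sup>2 * b\<^sup>2 \<le> 2 / ?l\<^sup>2 * (bias_const * overlap t t' * (radius t + radius t'))\<^sup>2"
      by (intro mult_left_mono) auto
    then show "2 / ?l\<^sup>2 * b\<^sup>2 \<le> 2 * (bias_const * (overlap t t' / ?l) * (radius t + radius t'))\<^sup>2"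
      by (simp add: power_mult_distrib power_divide)
  qed
  finally show ?thesis .
qed

text \<open>With equal cells the numerator is at most \<open>sb\<close> times the count and cancels
  one of the two counts, leaving the square of an inverse count. Both bounds for it are kept so that
  they can be interpolated when the tree becomes random.\<close>

lemma diagonal_term_bound:
  "(\<integral>\<^sup>+\<omega>. ennreal ((pair_term t t \<omega>)\<^sup>2) \<partial>M) \<le> ennreal (sb\<^sup>2 / (lam ^ CARD('d))\<^sup>2 * min ((real n)\<^sup>2) (204 / fl\<^sup>2 / (vol t)\<^sup>2))"
proof -
  let ?l = "lam ^ CARD('d)" and ?N = "iid.hits (cell_at t x)"
  have l: "0 < ?l" using lam_pos by simp
  have n: "0 < real n" using n_ge_1 by simp
  have cs [measurable]: "cell_at t x \<in> sets borel" by (rule cell_sets)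
  have le: "(pair_term t t \<omega>)\<^sup>2 \<le> sb\<^sup>2 / ?l\<^sup>2 * (n / ?N \<omega>)\<^sup>2" for \<omega>
  proof -
    let ?Z = "\<Sum>i=1..n. cube_part sig2 (X i \<omega>) * indicat_real (cell_at t x) (X i \<omega>)"
    have Z: "0 \<le> ?Z"
      by (intro sum_nonneg mult_nonneg_nonneg cube_part_sig2) auto
    have Z2: "?Z \<le> sb * ?N \<omega>"
      unfolding iid.hits_def sum_distrib_left by (intro sum_mono mult_right_mono cube_part_sig2) auto
    have "?Z / (?N \<omega> * ?N \<omega>) \<le> sb / ?N \<omega>"
    proof (cases "?N \<omega> = 0")
      case False
      then have N: "0 < ?N \<omega>" using iid.hits_nonneg[of "cell_at t x" \<omega>] by simp
      have "?Z / (?N \<omega> * ?N \<omega>) \<le> sb * ?N \<omega> / (?N \<omega> * ?N \<omega>)" using Z2 N by (intro divide_right_mono) auto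
      then show ?thesis using N by simp
    qed simp
    then have "n / ?l * (?Z / (?N \<omega> * ?N \<omega>)) \<le> n / ?l * (sb / ?N \<omega>)"
      using n l by (intro mult_left_mono) auto
    moreover have "0 \<le> n / ?l * (?Z / (?N \<omega> * ?N \<omega>))"
      using n l Z iid.hits_nonneg[of "cell_at t x" \<omega>] by (intro mult_nonneg_nonneg divide_nonneg_nonneg) auto
    ultimately have "(pair_term t t \<omega>)\<^sup>2 \<le> (n / ?l * (sb / ?N \<omega>))\<^sup>2"
      unfolding pair_term_def Int_absorb by (intro power_mono)
    then show ?thesis by (simp add: power_mult_distrib power_divide mult_ac)
  qed
  have I: "(\<integral>\<^sup>+\<omega>. ennreal ((n / ?N \<omega>)\<^sup>2) \<partial>M) \<le> ennreal (min ((real n)\<^sup>2) (204 / fl\<^sup>2 / (vol t)\<^sup>2))"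
  proof -
    have "(\<integral>\<^sup>+\<omega>. ennreal ((n / ?N \<omega>)\<^sup>2) \<partial>M) \<le> (\<integral>\<^sup>+\<omega>. ennreal ((real n)\<^sup>2) \<partial>M)"
    proof (intro nn_integral_mono ennreal_leI power_mono)
      fix \<omega> show "n / ?N \<omega> \<le> real n" using iid.hits_cases[of "cell_at t x" \<omega>] n by (auto simp: field_simps)
      show "0 \<le> n / ?N \<omega>" using iid.hits_nonneg[of "cell_at t x" \<omega>] by simp
    qed
    then have 1: "(\<integral>\<^sup>+\<omega>. ennreal ((n / ?N \<omega>)\<^sup>2) \<partial>M) \<le> ennreal ((real n)\<^sup>2)" by (simp add: emeasure_space_1)
    have "(\<integral>\<^sup>+\<omega>. ennreal ((n / ?N \<omega>)\<^sup>2) \<partial>M) \<le> ennreal (204 / (prob_cell t)\<^sup>2)"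
      by (rule iid.inverse_hits_moment[OF cs refl prob_cell_pos])
    also have "\<dots> \<le> ennreal (204 / (fl * vol t)\<^sup>2)"
      using prob_cell_bounds(1)[of t] fl(1) vol_pos[of t] prob_cell_pos[of t]
      by (intro ennreal_leI divide_left_mono power_mono mult_pos_pos zero_less_power) auto
    also have "204 / (fl * vol t)\<^sup>2 = 204 / fl\<^sup>2 / (vol t)\<^sup>2" by (simp add: power_mult_distrib)
    finally show ?thesis using 1 by (auto simp: min_def)
  qed
  have "(\<integral>\<^sup>+\<omega>. ennreal ((pair_term t t \<omega>)\<^sup>2) \<partial>M) \<le> (\<integral>\<^sup>+\<omega>. ennreal (sb\<^sup>2 / ?l\<^sup>2) * ennreal ((n / ?N \<omega>)\<^sup>2) \<partial>M)"
    using le by (intro nn_integral_mono) (simp add: ennreal_leI flip: ennreal_mult)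
  also have "\<dots> = ennreal (sb\<^sup>2 / ?l\<^sup>2) * (\<integral>\<^sup>+\<omega>. ennreal ((n / ?N \<omega>)\<^sup>2) \<partial>M)"
    using iid.hits_measurable[OF cs] by (intro nn_integral_cmult) measurable
  also have "\<dots> \<le> ennreal (sb\<^sup>2 / ?l\<^sup>2) * ennreal (min ((real n)\<^sup>2) (204 / fl\<^sup>2 / (vol t)\<^sup>2))"
    using I by (intro mult_left_mono) auto
  also have "\<dots> = ennreal (sb\<^sup>2 / ?l\<^sup>2 * min ((real n)\<^sup>2) (204 / fl\<^sup>2 / (vol t)\<^sup>2))"
    by (rule ennreal_mult[symmetric]) auto
  finally show ?thesis .
qed

end

section \<open>Averaging over the trees\<close>

text \<open>Among the at most B^2 ordered pairs, each has an index in common with at most 4 B of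
  them; these covariances are at most \<open>v\<close> and all others vanish. The average over pairs
  thus has a second moment of order 1 / B.\<close>

lemma (in prob_space) pair_sum_second_moment:
  fixes Z :: "nat \<times> nat \<Rightarrow> 'a \<Rightarrow> real" and B :: nat
  defines "I \<equiv> {p \<in> {1..B} \<times> {1..B}. fst p \<noteq> snd p}"
  assumes meas: "\<And>p. p \<in> I \<Longrightarrow> Z p \<in> borel_measurable M"
    and int: "\<And>p. p \<in> I \<Longrightarrow> integrable M (\<lambda>\<omega>. (Z p \<omega>)\<^sup>2)"
    and v: "\<And>p. p \<in> I \<Longrightarrow> expectation (\<lambda>\<omega>. (Z p \<omega>)\<^sup>2) \<le> v" "0 \<le> v"
    and orth: "\<And>p q. p \<in> I \<Longrightarrow> q \<in> I \<Longrightarrow> {fst p, snd p} \<inter> {fst q, snd q} = {} \<Longrightarrow> expectation (\<lambda>\<omega>. Z p \<omega> * Z q \<omega>) = 0"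
  shows "integrable M (\<lambda>\<omega>. (\<Sum>p\<in>I. Z p \<omega>)\<^sup>2)"
    and "expectation (\<lambda>\<omega>. (\<Sum>p\<in>I. Z p \<omega>)\<^sup>2) \<le> 4 * real B ^ 3 * v"
proof -
  have fin: "finite I" by (simp add: I_def)
  have amgm: "\<bar>a * b\<bar> \<le> (a\<^sup>2 + b\<^sup>2) / 2" for a b :: real
    using zero_le_power2[of "\<bar>a\<bar> - \<bar>b\<bar>"] by (simp add: power2_eq_square algebra_simps abs_mult)
  have i2: "integrable M (\<lambda>\<omega>. ((Z p \<omega>)\<^sup>2 + (Z q \<omega>)\<^sup>2) / 2)" if "p \<in> I" "q \<in> I" for p q
    using int that by auto
  have iZ: "integrable M (\<lambda>\<omega>. Z p \<omega> * Z q \<omega>)" if "p \<in> I" "q \<in> I" for p q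
    by (rule Bochner_Integration.integrable_bound[OF i2[OF that]])
      (use meas that amgm in \<open>auto intro!: AE_I2 borel_measurable_times order_trans[OF _ abs_ge_self]\<close>)
  have sq: "(\<Sum>p\<in>I. Z p \<omega>)\<^sup>2 = (\<Sum>p\<in>I. \<Sum>q\<in>I. Z p \<omega> * Z q \<omega>)" for \<omega>
    by (simp add: power2_eq_square sum_product)
  show "integrable M (\<lambda>\<omega>. (\<Sum>p\<in>I. Z p \<omega>)\<^sup>2)"
    unfolding sq using iZ by (intro Bochner_Integration.integrable_sum)
  have le: "expectation (\<lambda>\<omega>. Z p \<omega> * Z q \<omega>) \<le> v" if "p \<in> I" "q \<in> I" for p q
  proof -
    have "expectation (\<lambda>\<omega>. Z p \<omega> * Z q \<omega>) \<le> expectation (\<lambda>\<omega>. ((Z p \<omega>)\<^sup>2 + (Z q \<omega>)\<^sup>2) / 2)"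
      by (rule integral_mono[OF iZ[OF that] i2[OF that]]) (rule order_trans[OF abs_ge_self amgm])
    also have "\<dots> \<le> v" using int that v(1)[OF that(1)] v(1)[OF that(2)] by simp
    finally show ?thesis .
  qed
  have row: "(\<Sum>q\<in>I. expectation (\<lambda>\<omega>. Z p \<omega> * Z q \<omega>)) \<le> 4 * real B * v" if p: "p \<in> I" for p
  proof -
    let ?a = "fst p" and ?b = "snd p"
    let ?J = "{?a, ?b} \<times> {1..B} \<union> {1..B} \<times> {?a, ?b}"
    have "(\<Sum>q\<in>I. expectation (\<lambda>\<omega>. Z p \<omega> * Z q \<omega>)) \<le> (\<Sum>q\<in>I. if q \<in> ?J then v else 0)"
    proof (rule sum_mono)
      fix q assume q: "q \<in> I"
      show "expectation (\<lambda>\<omega>. Z p \<omega> * Z q \<omega>) \<le> (if q \<in> ?J then v else 0)"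
      proof (cases "q \<in> ?J")
        case False
        then have "{fst p, snd p} \<inter> {fst q, snd q} = {}" using q by (cases q) (auto simp: I_def)
        then show ?thesis using orth[OF p q] False by simp
      qed (use le[OF p q] in simp)
    qed
    also have "\<dots> = (\<Sum>q\<in>I \<inter> ?J. v)" by (rule sum.inter_restrict[OF fin, symmetric])
    also have "\<dots> \<le> (\<Sum>q\<in>?J. v)" using v by (intro sum_mono2) auto
    also have "\<dots> = card ?J * v" by simp
    also have "\<dots> \<le> (4 * real B) * v"
    proof (rule mult_right_mono)
      have c2: "card {?a, ?b} \<le> 2" by (simp add: card_insert_if)
      have "card ?J \<le> card ({?a, ?b} \<times> {1..B}) + card ({1..B} \<times> {?a, ?b})" by (rule card_Un_le)
      also have "\<dots> \<le> 2 * B + B * 2"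
        unfolding card_cartesian_product using c2 by (intro add_mono mult_mono) auto
      finally show "real (card ?J) \<le> 4 * real B" by simp
    qed (use v in simp)
    finally show ?thesis .
  qed
  have "expectation (\<lambda>\<omega>. (\<Sum>p\<in>I. Z p \<omega>)\<^sup>2) = (\<Sum>p\<in>I. \<Sum>q\<in>I. expectation (\<lambda>\<omega>. Z p \<omega> * Z q \<omega>))"
    unfolding sq using iZ by (subst Bochner_Integration.integral_sum) (auto intro!: Bochner_Integration.integral_sum sum.cong)
  also have "\<dots> \<le> (\<Sum>p\<in>I. 4 * real B * v)" by (intro sum_mono row)
  also have "\<dots> = card I * (4 * real B * v)" by simp
  also have "\<dots> \<le> (real B * real B) * (4 * real B * v)"
  proof (rule mult_right_mono)
    have "card I \<le> card ({1..B} \<times> {1..B})" unfolding I_def by (intro card_mono) auto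
    then show "real (card I) \<le> real B * real B" by (simp flip: of_nat_mult)
  qed (use v in simp)
  finally show "expectation (\<lambda>\<omega>. (\<Sum>p\<in>I. Z p \<omega>)\<^sup>2) \<le> 4 * real B ^ 3 * v"
    by (simp add: power3_eq_cube mult_ac)
qed

lemma prod_le_power_ennreal:
  fixes f :: "'i \<Rightarrow> ennreal"
  assumes "finite A" "\<And>i. i \<in> A \<Longrightarrow> f i \<le> K"
  shows "(\<Prod>i\<in>A. f i) \<le> K ^ card A"
  using assms by (induction A) (auto intro!: mult_mono)

context mondrian_forest
begin

text \<open>By independence a second copy \<open>\<omega>'\<close> of the sample point may carry the
  trees, so bounds for fixed trees apply to the inner integral.\<close>

lemma nn_integral_data_trees:
  assumes F: "(\<lambda>(z, t). F z t) \<in> borel_measurable (data_space \<Otimes>\<^sub>M tree_space)"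
  shows "(\<integral>\<^sup>+\<omega>. F (data \<omega>) (trees_of \<omega>) \<partial>M) = (\<integral>\<^sup>+\<omega>'. \<integral>\<^sup>+\<omega>. F (data \<omega>) (trees_of \<omega>') \<partial>M \<partial>M)"
proof -
  let ?D = "distr M data_space data" and ?E = "distr M tree_space trees_of"
  interpret D: prob_space ?D by (rule prob_space_distr) measurable
  interpret E: prob_space ?E by (rule prob_space_distr) measurable
  interpret DE: pair_sigma_finite ?D ?E ..
  have J: "distr M (data_space \<Otimes>\<^sub>M tree_space) (\<lambda>\<omega>. (data \<omega>, trees_of \<omega>)) = ?D \<Otimes>\<^sub>M ?E"
    unfolding joint_law data_law_PiM tree_law_PiM ..
  have F': "(\<lambda>(z, t). F z t) \<in> borel_measurable (?D \<Otimes>\<^sub>M ?E)"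
    using F by (simp cong: measurable_cong_sets)
  have "(\<integral>\<^sup>+\<omega>. F (data \<omega>) (trees_of \<omega>) \<partial>M) =
    (\<integral>\<^sup>+p. (case p of (z, t) \<Rightarrow> F z t) \<partial>distr M (data_space \<Otimes>\<^sub>M tree_space) (\<lambda>\<omega>. (data \<omega>, trees_of \<omega>)))"
    by (subst nn_integral_distr) (use F in \<open>auto intro!: measurable_Pair data_measurable trees_of_measurable\<close>)
  also have "\<dots> = (\<integral>\<^sup>+t. \<integral>\<^sup>+z. F z t \<partial>?D \<partial>?E)"
    unfolding J using DE.nn_integral_snd[OF F'] by simp
  also have "\<dots> = (\<integral>\<^sup>+\<omega>'. \<integral>\<^sup>+z. F z (trees_of \<omega>') \<partial>?D \<partial>M)"
  proof -
    have "(\<lambda>(t, z). F z t) \<in> borel_measurable (tree_space \<Otimes>\<^sub>M ?D)"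
      using measurable_compose[OF measurable_pair_swap' F] by (simp add: split_beta' cong: measurable_cong_sets)
    then have "(\<lambda>t. \<integral>\<^sup>+z. F z t \<partial>?D) \<in> borel_measurable tree_space"
      by (rule D.borel_measurable_nn_integral)
    then show ?thesis by (subst nn_integral_distr[OF trees_of_measurable]) (simp_all cong: measurable_cong_sets)
  qed
  also have "\<dots> = (\<integral>\<^sup>+\<omega>'. \<integral>\<^sup>+\<omega>. F (data \<omega>) (trees_of \<omega>') \<partial>M \<partial>M)"
  proof (rule nn_integral_cong)
    fix \<omega>' assume "\<omega>' \<in> space M"
    then have "trees_of \<omega>' \<in> space tree_space" using trees_of_measurable by (rule measurable_space[rotated])
    then have "(\<lambda>z. F z (trees_of \<omega>')) \<in> borel_measurable data_space"
      using measurable_compose[OF measurable_Pair2' F] by simp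
    then show "(\<integral>\<^sup>+z. F z (trees_of \<omega>') \<partial>?D) = (\<integral>\<^sup>+\<omega>. F (data \<omega>) (trees_of \<omega>') \<partial>M)"
      by (subst nn_integral_distr[OF data_measurable]) (simp_all cong: measurable_cong_sets)
  qed
  finally show ?thesis .
qed

lemma tree_pair_measurable:
  assumes "b \<in> {1..B}" "b' \<in> {1..B}"
  shows "(\<lambda>\<omega>. (T b \<omega>, T b' \<omega>)) \<in> M \<rightarrow>\<^sub>M split_tree_algebra \<Otimes>\<^sub>M split_tree_algebra"
  using assms by (intro measurable_Pair T_measurable)

lemma tree_pair_law:
  assumes b: "b \<in> {1..B}" "b' \<in> {1..B}" "b \<noteq> b'"
  shows "distr M (split_tree_algebra \<Otimes>\<^sub>M split_tree_algebra) (\<lambda>\<omega>. (T b \<omega>, T b' \<omega>)) = mondrian lam \<Otimes>\<^sub>M mondrian lam"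
proof -
  have "indep_var split_tree_algebra ((\<lambda>z. z b) \<circ> (\<lambda>\<omega>. \<lambda>i\<in>{b}. T i \<omega>)) split_tree_algebra ((\<lambda>z. z b') \<circ> (\<lambda>\<omega>. \<lambda>i\<in>{b'}. T i \<omega>))"
    by (rule indep_var_compose[OF indep_var_restrict[OF tree_indep]])
      (use b in \<open>auto intro!: measurable_component_singleton\<close>)
  then have "indep_var split_tree_algebra (T b) split_tree_algebra (T b')" by (simp add: comp_def)
  then show ?thesis
    using tree_law[OF b(1)] tree_law[OF b(2)] by (simp add: indep_var_distribution_eq)
qed

lemma nn_integral_tree_pair:
  assumes b: "b \<in> {1..B}" "b' \<in> {1..B}" "b \<noteq> b'"
    and F: "(\<lambda>(t, t'). F t t') \<in> borel_measurable (split_tree_algebra \<Otimes>\<^sub>M split_tree_algebra)"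
  shows "(\<integral>\<^sup>+\<omega>. F (T b \<omega>) (T b' \<omega>) \<partial>M) = (\<integral>\<^sup>+t. \<integral>\<^sup>+t'. F t t' \<partial>mondrian lam \<partial>mondrian lam)"
proof -
  interpret mu: prob_space "mondrian lam :: 'd split_tree measure" by (rule prob_space_mondrian)
  have "(\<integral>\<^sup>+\<omega>. F (T b \<omega>) (T b' \<omega>) \<partial>M) =
    (\<integral>\<^sup>+p. (case p of (t, t') \<Rightarrow> F t t') \<partial>distr M (split_tree_algebra \<Otimes>\<^sub>M split_tree_algebra) (\<lambda>\<omega>. (T b \<omega>, T b' \<omega>)))"
    by (subst nn_integral_distr[OF tree_pair_measurable[OF b(1,2)]]) (use F in auto)
  also have "\<dots> = (\<integral>\<^sup>+t. \<integral>\<^sup>+t'. F t t' \<partial>mondrian lam \<partial>mondrian lam)"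
    unfolding tree_pair_law[OF b] using F by (subst mu.nn_integral_fst[symmetric]) (auto cong: measurable_cong_sets)
  finally show ?thesis .
qed

lemma nn_integral_tree:
  assumes b: "b \<in> {1..B}" and F: "F \<in> borel_measurable split_tree_algebra"
  shows "(\<integral>\<^sup>+\<omega>. F (T b \<omega>) \<partial>M) = (\<integral>\<^sup>+t. F t \<partial>mondrian lam)"
  using nn_integral_distr[OF T_measurable[OF b], of F] tree_law[OF b] F by simp

lemma disjoint_tree_pairs_indep:
  assumes b: "{a, b, c, d} \<subseteq> {1..B}" "{a, b} \<inter> {c, d} = {}"
    and F: "(\<lambda>(t, t'). F t t' :: real) \<in> borel_measurable (split_tree_algebra \<Otimes>\<^sub>M split_tree_algebra)"
  shows "indep_var borel (\<lambda>\<omega>. F (T a \<omega>) (T b \<omega>)) borel (\<lambda>\<omega>. F (T c \<omega>) (T d \<omega>))"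
proof -
  have m: "(\<lambda>z. F (z i) (z j)) \<in> borel_measurable (PiM {i, j} (\<lambda>_. split_tree_algebra))" for i j :: nat
    using measurable_compose[OF measurable_Pair[OF measurable_component_singleton[of i "{i, j}"] measurable_component_singleton[of j "{i, j}"]] F]
    by simp
  have "indep_var borel ((\<lambda>z. F (z a) (z b)) \<circ> (\<lambda>\<omega>. \<lambda>i\<in>{a, b}. T i \<omega>)) borel ((\<lambda>z. F (z c) (z d)) \<circ> (\<lambda>\<omega>. \<lambda>i\<in>{c, d}. T i \<omega>))"
    by (rule indep_var_compose[OF indep_var_restrict[OF tree_indep] m m]) (use b in auto)
  then show ?thesis by (simp add: comp_def)
qed

end

context forest_bounds
begin

section \<open>Moments of scaled widths, volumes and radii\<close>

definition "scaled_gaps j t = (lam * gap x (j, True) t, lam * gap x (j, False) t)"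
definition "scaled_width j t = lam * width x j t"
definition "scaled_vol t = (\<Prod>j\<in>UNIV. scaled_width j t)"
text \<open>Negative moments up to order 3/2 are bounded by this number less 2; the added 2 makes it
  dominate the first moment of a width as well.\<close>

definition "moment_const = 14 + 4 * max 1 (\<tau> powr (- 2))"
definition "scaled_overlap t t' = overlap t t' / lam ^ CARD('d)"

lemma scaled_width_measurable [measurable]: "scaled_width j \<in> borel_measurable split_tree_algebra"
  unfolding scaled_width_def[abs_def] by measurable

lemma scaled_vol_measurable [measurable]: "scaled_vol \<in> borel_measurable split_tree_algebra"
  unfolding scaled_vol_def[abs_def] by measurable

lemma scaled_gaps_measurable [measurable]: "scaled_gaps j \<in> split_tree_algebra \<rightarrow>\<^sub>M borel \<Otimes>\<^sub>M borel"
  unfolding scaled_gaps_def[abs_def] by measurable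

lemma scaled_width_pos: "0 < scaled_width j t"
  using lam_pos width_pos[OF x] by (simp add: scaled_width_def)

lemma scaled_vol_pos: "0 < scaled_vol t"
  unfolding scaled_vol_def by (intro prod_pos) (simp add: scaled_width_pos)

lemma scaled_vol_eq: "scaled_vol t = lam ^ CARD('d) * vol t"
  by (simp add: scaled_vol_def scaled_width_def prod.distrib measure_cell[OF x])

lemma moment_const_ge: "1 \<le> moment_const"
  by (simp add: moment_const_def)

lemma \<tau>_le: "\<tau> \<le> lam * gap_max x i"
  using \<tau>(2)[of i] mult_right_mono[OF lam0(2), of "gap_max x i"] gap_max_pos[OF x, of i] by linarith

text \<open>\<open>K\<close> has to serve all truncation levels from \<open>\<tau>\<close> on, which
  makes the bound uniform in the lifetime and in the axis.\<close>

lemma scaled_width_moment: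
  assumes [measurable]: "\<And>j. \<phi> j \<in> borel_measurable borel"
    and K: "\<And>j c c'. \<tau> \<le> c \<Longrightarrow> \<tau> \<le> c' \<Longrightarrow> (\<integral>\<^sup>+a. \<integral>\<^sup>+b. ennreal (\<phi> j (min c a + min c' b)) \<partial>exp1 \<partial>exp1) \<le> ennreal K" and "0 \<le> K"
    and nonneg: "\<And>j v. 0 \<le> \<phi> j v"
  shows "(\<integral>\<^sup>+t. ennreal (\<Prod>j\<in>UNIV. \<phi> j (scaled_width j t)) \<partial>mondrian lam) \<le> ennreal (K ^ CARD('d))"
proof -
  have "(\<integral>\<^sup>+t. ennreal (\<Prod>j\<in>UNIV. \<phi> j (scaled_width j t)) \<partial>mondrian lam) =
    (\<integral>\<^sup>+t. (\<Prod>j\<in>UNIV. ennreal (\<phi> j (lam * gap x (j, True) t + lam * gap x (j, False) t))) \<partial>mondrian lam)"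
    using nonneg by (simp add: prod_ennreal scaled_width_def width_def distrib_left)
  also have "\<dots> = (\<Prod>j\<in>UNIV. \<integral>\<^sup>+a. \<integral>\<^sup>+b. ennreal (\<phi> j (min (lam * gap_max x (j, True)) a + min (lam * gap_max x (j, False)) b)) \<partial>exp1 \<partial>exp1)"
    by (rule nn_integral_gaps_prod[OF prob_space_mondrian lam_pos x, of "\<lambda>j a b. ennreal (\<phi> j (a + b))"]) measurable
  also have "\<dots> \<le> ennreal K ^ CARD('d)"
    by (intro prod_le_power_ennreal K \<tau>_le) auto
  also have "\<dots> = ennreal (K ^ CARD('d))" using \<open>0 \<le> K\<close> by (simp add: ennreal_power)
  finally show ?thesis .
qed

text \<open>Up to order 3/2 the factor 1 / (2 - \<alpha>) is at most 2.\<close>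

lemma negative_moment_le:
  assumes "0 \<le> \<alpha>" "\<alpha> \<le> 3 / 2" "\<tau> \<le> c" "\<tau> \<le> c'"
  shows "(\<integral>\<^sup>+a. \<integral>\<^sup>+b. ennreal ((min c a + min c' b) powr (- \<alpha>)) \<partial>exp1 \<partial>exp1) \<le> ennreal (12 + 4 * max 1 (\<tau> powr (- 2)))"
proof -
  have "(\<integral>\<^sup>+a. \<integral>\<^sup>+b. ennreal ((min c a + min c' b) powr (- \<alpha>)) \<partial>exp1 \<partial>exp1) \<le> ennreal ((6 + 2 * max 1 (\<tau> powr (- 2))) / (2 - \<alpha>))"
    using assms \<tau>(1) by (intro negative_moment) auto
  also have "\<dots> \<le> ennreal ((6 + 2 * max 1 (\<tau> powr (- 2))) / (1 / 2))"
    using assms by (intro ennreal_leI divide_left_mono) (auto intro: add_nonneg_nonneg)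
  finally show ?thesis by (simp add: algebra_simps)
qed

lemma scaled_vol_powr_moment:
  assumes "0 \<le> \<alpha>" "\<alpha> \<le> 3 / 2"
  shows "(\<integral>\<^sup>+t. ennreal (scaled_vol t powr (- \<alpha>)) \<partial>mondrian lam) \<le> ennreal (moment_const ^ CARD('d))"
  unfolding scaled_vol_def prod_powr_distrib
proof (rule scaled_width_moment)
  show "(\<integral>\<^sup>+a. \<integral>\<^sup>+b. ennreal ((min c a + min c' b) powr (- \<alpha>)) \<partial>exp1 \<partial>exp1) \<le> ennreal moment_const"
    if "\<tau> \<le> c" "\<tau> \<le> c'" for c c'
    by (rule order_trans[OF negative_moment_le[OF assms that]]) (simp add: moment_const_def ennreal_leI)
qed (use moment_const_ge in auto)

lemma scaled_vol_inverse_moment: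
  "(\<integral>\<^sup>+t. ennreal (1 / scaled_vol t) \<partial>mondrian lam) \<le> ennreal (moment_const ^ CARD('d))"
proof -
  have "1 / scaled_vol t = scaled_vol t powr (- 1)" for t
    using scaled_vol_pos[of t] by (simp add: powr_minus_divide)
  then show ?thesis using scaled_vol_powr_moment[of 1] by simp
qed

text \<open>One power of the width of axis \<open>j\<close> cancels against the volume, leaving a
  first moment for this axis and an inverse first moment for each of the others.\<close>

lemma scaled_width_square_moment:
  "(\<integral>\<^sup>+t. ennreal ((scaled_width j t)\<^sup>2 / scaled_vol t) \<partial>mondrian lam) \<le> ennreal (moment_const ^ CARD('d))"
proof -
  \<comment> \<open>Widths are positive; \<open>max 0\<close> serves the non-negativity required for
    all real arguments.\<close>
  define \<phi> where "\<phi> k v = (if k = j then max 0 v else v powr (- 1))" for k :: 'd and v :: real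
  have "(scaled_width j t)\<^sup>2 / scaled_vol t = (\<Prod>k\<in>UNIV. \<phi> k (scaled_width k t))" for t
  proof -
    have A: "(\<Prod>k\<in>UNIV. \<phi> k (scaled_width k t)) = scaled_width j t * (\<Prod>k\<in>UNIV - {j}. 1 / scaled_width k t)"
    proof -
      have "(\<Prod>k\<in>UNIV - {j}. \<phi> k (scaled_width k t)) = (\<Prod>k\<in>UNIV - {j}. 1 / scaled_width k t)"
        by (rule prod.cong) (simp_all add: \<phi>_def powr_minus_divide scaled_width_pos abs_of_pos)
      moreover have "\<phi> j (scaled_width j t) = scaled_width j t"
        using scaled_width_pos[of j t] by (simp add: \<phi>_def)
      ultimately show ?thesis by (subst prod.remove[of _ j]) simp_all
    qed
    have B: "scaled_vol t = scaled_width j t * (\<Prod>k\<in>UNIV - {j}. scaled_width k t)"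
      unfolding scaled_vol_def by (rule prod.remove) auto
    have C: "(\<Prod>k\<in>UNIV - {j}. 1 / scaled_width k t) = 1 / (\<Prod>k\<in>UNIV - {j}. scaled_width k t)"
      by (simp add: prod_dividef)
    have D: "v\<^sup>2 / (v * q) = v * (1 / q)" if "0 < v" for v q :: real
      using that by (simp add: power2_eq_square)
    show ?thesis unfolding A B C by (rule D[OF scaled_width_pos])
  qed
  moreover have "(\<integral>\<^sup>+t. ennreal (\<Prod>k\<in>UNIV. \<phi> k (scaled_width k t)) \<partial>mondrian lam) \<le> ennreal (moment_const ^ CARD('d))"
  proof (rule scaled_width_moment[of \<phi> moment_const])
    fix k :: 'd and c c' :: real assume c: "\<tau> \<le> c" "\<tau> \<le> c'"
    show "(\<integral>\<^sup>+a. \<integral>\<^sup>+b. ennreal (\<phi> k (min c a + min c' b)) \<partial>exp1 \<partial>exp1) \<le> ennreal moment_const"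
    proof (cases "k = j")
      case True
      have "(\<integral>\<^sup>+a. \<integral>\<^sup>+b. ennreal (\<phi> k (min c a + min c' b)) \<partial>exp1 \<partial>exp1) = (\<integral>\<^sup>+a. \<integral>\<^sup>+b. ennreal (min c a + min c' b) \<partial>exp1 \<partial>exp1)"
      proof -
        have "ennreal (max 0 v) = ennreal v" for v
          by (cases "0 \<le> v") (simp_all add: max_def ennreal_neg)
        then have "ennreal (\<phi> k v) = ennreal v" for v unfolding \<phi>_def using True by simp
        then show ?thesis by (simp only:)
      qed
      also have "\<dots> \<le> ennreal 2" using positive_moment[of c c'] by simp
      also have "\<dots> \<le> ennreal moment_const" by (rule ennreal_leI) (simp add: moment_const_def)
      finally show ?thesis .
    next
      case False
      then show ?thesis
        using order_trans[OF negative_moment_le[of 1 c c'] ennreal_leI[of _ moment_const]] c by (simp add: \<phi>_def moment_const_def)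
    qed
  next
    show "\<phi> k \<in> borel_measurable borel" for k
      unfolding \<phi>_def[abs_def] by measurable
    show "0 \<le> \<phi> k v" for k v by (simp add: \<phi>_def)
    show "0 \<le> moment_const" using moment_const_ge by linarith
  qed
  ultimately show ?thesis by (simp only:)
qed

text \<open>Since \<open>\<gamma>\<close> is at most 1, the power 2 \<gamma> of the total scaled
  width is at most 1 plus its square, and Cauchy-Schwarz bounds that square by d times the sum of
  squares. The rescaling produces the factor in \<open>lam\<close>.\<close>

lemma radius_square_le:
  "(radius t)\<^sup>2 \<le> lam powr (- 2 * \<gamma>) * (1 + CARD('d) * (\<Sum>j\<in>UNIV. (scaled_width j t)\<^sup>2))"
proof -
  define S where "S = (\<Sum>j\<in>UNIV. scaled_width j t)"
  have S: "0 \<le> S" unfolding S_def by (intro sum_nonneg less_imp_le scaled_width_pos)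
  have "S powr (2 * \<gamma>) \<le> 1 + S\<^sup>2"
  proof (cases "S \<le> 1")
    case True
    then have "S powr (2 * \<gamma>) \<le> 1" using S \<gamma> by (intro powr_le1) auto
    then show ?thesis using zero_le_power2[of S] by linarith
  next
    case False
    then have "S powr (2 * \<gamma>) \<le> S powr 2" using \<gamma> by (intro powr_mono) auto
    then show ?thesis using False by (simp add: powr_numeral)
  qed
  also have "S\<^sup>2 \<le> CARD('d) * (\<Sum>j\<in>UNIV. (scaled_width j t)\<^sup>2)"
    unfolding S_def using sum_squared_le_sum_of_squares[of "\<lambda>j. scaled_width j t" UNIV] by (simp add: mult.commute)
  finally have le: "S powr (2 * \<gamma>) \<le> 1 + CARD('d) * (\<Sum>j\<in>UNIV. (scaled_width j t)\<^sup>2)" by simp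
  have "(\<Sum>j\<in>UNIV. width x j t) = S / lam"
    using lam_pos by (simp add: S_def scaled_width_def sum_distrib_left[symmetric])
  then have "(radius t)\<^sup>2 = (S / lam) powr (2 * \<gamma>)"
    by (simp add: radius_def power2_eq_square powr_add[symmetric])
  also have "\<dots> = lam powr (- 2 * \<gamma>) * S powr (2 * \<gamma>)"
    using S lam_pos by (simp add: powr_divide powr_minus_divide)
  finally show ?thesis using le by (simp add: mult_left_mono)
qed

lemma radius_measurable [measurable]: "radius \<in> borel_measurable split_tree_algebra"
  unfolding radius_def[abs_def] by measurable

text \<open>One inverse volume, and d times d squared widths over the volume, make up 1 + d^2
  moments.\<close>

definition "radius_const = (1 + (real CARD('d))\<^sup>2) * moment_const ^ CARD('d)"

lemma radius_moment:
  "(\<integral>\<^sup>+t. ennreal ((radius t)\<^sup>2 / scaled_vol t) \<partial>mondrian lam) \<le> ennreal (radius_const * lam powr (- 2 * \<gamma>))"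
proof -
  let ?d = "real CARD('d)" and ?l = "lam powr (- 2 * \<gamma>)" and ?m = "moment_const ^ CARD('d)"
  have m: "0 \<le> ?m" using moment_const_ge by simp
  have "(\<integral>\<^sup>+t. ennreal ((radius t)\<^sup>2 / scaled_vol t) \<partial>mondrian lam) \<le>
    (\<integral>\<^sup>+t. ennreal ?l * (ennreal (1 / scaled_vol t) + ennreal ?d * (\<Sum>j\<in>UNIV. ennreal ((scaled_width j t)\<^sup>2 / scaled_vol t))) \<partial>mondrian lam)"
  proof (rule nn_integral_mono)
    fix t
    have p: "0 < scaled_vol t" by (rule scaled_vol_pos)
    have "(radius t)\<^sup>2 / scaled_vol t \<le> ?l * (1 + ?d * (\<Sum>j\<in>UNIV. (scaled_width j t)\<^sup>2)) / scaled_vol t"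
      using radius_square_le[of t] p by (intro divide_right_mono) auto
    also have "\<dots> = ?l * (1 / scaled_vol t + ?d * (\<Sum>j\<in>UNIV. (scaled_width j t)\<^sup>2 / scaled_vol t))"
      by (simp add: sum_divide_distrib[symmetric] add_divide_distrib distrib_left)
    finally have "ennreal ((radius t)\<^sup>2 / scaled_vol t) \<le> ennreal \<dots>" by (rule ennreal_leI)
    also have "\<dots> = ennreal ?l * (ennreal (1 / scaled_vol t) + ennreal ?d * (\<Sum>j\<in>UNIV. ennreal ((scaled_width j t)\<^sup>2 / scaled_vol t)))"
    proof -
      have "(\<Sum>j\<in>UNIV. ennreal ((scaled_width j t)\<^sup>2 / scaled_vol t)) = ennreal (\<Sum>j\<in>UNIV. (scaled_width j t)\<^sup>2 / scaled_vol t)"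
        using p by (intro sum_ennreal) auto
      moreover have "0 \<le> (\<Sum>j\<in>UNIV. (scaled_width j t)\<^sup>2 / scaled_vol t)" using p by (intro sum_nonneg) auto
      ultimately show ?thesis using p by (simp add: ennreal_mult ennreal_plus)
    qed
    finally show "ennreal ((radius t)\<^sup>2 / scaled_vol t) \<le> \<dots>" .
  qed
  also have "\<dots> = ennreal ?l * ((\<integral>\<^sup>+t. ennreal (1 / scaled_vol t) \<partial>mondrian lam) + ennreal ?d * (\<Sum>j\<in>UNIV. \<integral>\<^sup>+t. ennreal ((scaled_width j t)\<^sup>2 / scaled_vol t) \<partial>mondrian lam))"
    by (simp add: nn_integral_cmult nn_integral_add nn_integral_sum)
  also have "\<dots> \<le> ennreal ?l * (ennreal ?m + ennreal ?d * (\<Sum>j\<in>(UNIV :: 'd set). ennreal ?m))"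
    by (intro mult_left_mono add_mono sum_mono scaled_vol_inverse_moment scaled_width_square_moment) auto
  also have "\<dots> = ennreal (?l * (?m + ?d * (\<Sum>j\<in>(UNIV :: 'd set). ?m)))"
  proof -
    have "(\<Sum>j\<in>(UNIV :: 'd set). ennreal ?m) = ennreal (\<Sum>j\<in>(UNIV :: 'd set). ?m)" using m by (intro sum_ennreal)
    moreover have "0 \<le> (\<Sum>j\<in>(UNIV :: 'd set). ?m)" using m by (intro sum_nonneg)
    ultimately show ?thesis using m by (simp add: ennreal_mult ennreal_plus del: sum_constant)
  qed
  also have "?l * (?m + ?d * (\<Sum>j\<in>(UNIV :: 'd set). ?m)) = radius_const * ?l"
    by (simp add: radius_const_def algebra_simps power2_eq_square)
  finally show ?thesis .
qed

section \<open>The overlap of two random cells\<close>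

lemma scaled_overlap_eq: "scaled_overlap t t' = (\<Prod>j\<in>UNIV. overlap_ratio (scaled_gaps j t) (scaled_gaps j t'))"
proof -
  have "overlap_ratio (scaled_gaps j t) (scaled_gaps j t') =
    (min (gap x (j, True) t) (gap x (j, True) t') + min (gap x (j, False) t) (gap x (j, False) t')) / (lam * (width x j t * width x j t'))" for j
  proof -
    have "min (lam * a) (lam * b) = lam * min a b" for a b
      using lam_pos by (simp add: min_mult_distrib_left)
    then show ?thesis
      using lam_pos by (simp add: overlap_ratio_def scaled_gaps_def width_def flip: distrib_left)
  qed
  then show ?thesis
    by (simp add: scaled_overlap_def overlap_def measure_cell_inter[OF x] measure_cell[OF x] prod_dividef prod.distrib)
qed

lemma scaled_overlap_measurable [measurable]:
  "(\<lambda>(t, t'). scaled_overlap t t') \<in> borel_measurable (split_tree_algebra \<Otimes>\<^sub>M split_tree_algebra)"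
  unfolding scaled_overlap_eq by measurable

lemma scaled_overlap_nonneg: "0 \<le> scaled_overlap t t'"
  using lam_pos by (simp add: scaled_overlap_def overlap_nonneg)

text \<open>The intersection lies in each cell, so the square of its volume is at most the product
  of the two volumes. The bound separates the trees and asks only for inverse first moments.\<close>

lemma scaled_overlap_square: "(scaled_overlap t t')\<^sup>2 \<le> 1 / scaled_vol t * (1 / scaled_vol t')"
proof -
  let ?w = "measure lborel (cell_at t x \<inter> cell_at t' x)"
  have "?w \<le> vol t" "?w \<le> vol t'"
    unfolding measure_cell_inter[OF x] measure_cell[OF x] width_def
    using gap_nonneg[OF x] by (auto intro!: prod_mono add_mono add_nonneg_nonneg)
  then have "?w\<^sup>2 \<le> vol t * vol t'"
    unfolding power2_eq_square by (intro mult_mono) auto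
  then have "(scaled_overlap t t')\<^sup>2 \<le> vol t * vol t' / ((vol t * vol t') * lam ^ CARD('d))\<^sup>2"
    unfolding scaled_overlap_def overlap_def by (simp add: power_divide power_mult_distrib divide_right_mono)
  also have "\<dots> = 1 / scaled_vol t * (1 / scaled_vol t')"
    using vol_pos[of t] vol_pos[of t'] lam_pos by (simp add: scaled_vol_eq power2_eq_square)
  finally show ?thesis .
qed

lemma scaled_overlap_square_moment:
  "(\<integral>\<^sup>+t. \<integral>\<^sup>+t'. ennreal ((scaled_overlap t t')\<^sup>2) \<partial>mondrian lam \<partial>mondrian lam) \<le> ennreal ((moment_const ^ CARD('d))\<^sup>2)"
proof -
  let ?m = "moment_const ^ CARD('d)"
  have "(\<integral>\<^sup>+t. \<integral>\<^sup>+t'. ennreal ((scaled_overlap t t')\<^sup>2) \<partial>mondrian lam \<partial>mondrian lam)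
    \<le> (\<integral>\<^sup>+t. \<integral>\<^sup>+t'. ennreal (1 / scaled_vol t) * ennreal (1 / scaled_vol t') \<partial>mondrian lam \<partial>mondrian lam)"
    using scaled_overlap_square scaled_vol_pos
    by (intro nn_integral_mono) (simp add: ennreal_leI less_imp_le flip: ennreal_mult)
  also have "\<dots> = (\<integral>\<^sup>+t. ennreal (1 / scaled_vol t) \<partial>mondrian lam) * (\<integral>\<^sup>+t. ennreal (1 / scaled_vol t) \<partial>mondrian lam)"
    by (simp add: nn_integral_cmult nn_integral_multc)
  also have "\<dots> \<le> ennreal ?m * ennreal ?m"
    by (intro mult_mono scaled_vol_inverse_moment) auto
  also have "\<dots> = ennreal (?m\<^sup>2)" using moment_const_ge by (simp add: power2_eq_square ennreal_mult[symmetric])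
  finally show ?thesis .
qed

definition "overlap_const = (2 + 1 / \<tau>) ^ CARD('d) * real CARD('d) * (lam0 / \<tau>)"

text \<open>For independent trees the mean is a product over the axes, each factor within order 1 /
  lam of its limit.\<close>

lemma mean_overlap:
  obtains \<theta> where "0 \<le> \<theta>"
    "(\<integral>\<^sup>+t. \<integral>\<^sup>+t'. ennreal (scaled_overlap t t') \<partial>mondrian lam \<partial>mondrian lam) = ennreal \<theta>"
    "\<bar>\<theta> - ((4 - 4 * ln 2) / 3) ^ CARD('d)\<bar> \<le> overlap_const / lam"
proof -
  define \<kappa> where "\<kappa> = (4 - 4 * ln 2) / (3 :: real)"
  have \<kappa>: "0 \<le> \<kappa>" "\<kappa> \<le> 2"
  proof -
    have l: "ln 2 \<le> (1 :: real)" "0 \<le> ln (2 :: real)" using ln_le_minus_one[of 2] by auto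
    have "0 \<le> (4 - 4 * y) / 3 \<and> (4 - 4 * y) / 3 \<le> 2" if "y \<le> 1" "0 \<le> y" for y :: real
      using that by simp
    from this[OF l] show "0 \<le> \<kappa>" "\<kappa> \<le> 2" unfolding \<kappa>_def by blast+
  qed
  let ?c = "\<lambda>j. lam * gap_max x (j, True)" and ?c' = "\<lambda>j. lam * gap_max x (j, False)"
  define I where "I j p = (\<integral>\<^sup>+a. \<integral>\<^sup>+b. ennreal (overlap_ratio p (min (?c j) a, min (?c' j) b)) \<partial>exp1 \<partial>exp1)" for j p
  have inner: "(\<integral>\<^sup>+t'. ennreal (scaled_overlap t t') \<partial>mondrian lam) = (\<Prod>j\<in>UNIV. I j (scaled_gaps j t))" for t
  proof -
    have nn: "0 \<le> overlap_ratio (scaled_gaps j t) (scaled_gaps j t')" for j t'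
      unfolding scaled_gaps_def using lam_pos gap_nonneg[OF x] by (intro overlap_ratio_nonneg) auto
    have "(\<integral>\<^sup>+t'. ennreal (scaled_overlap t t') \<partial>mondrian lam) =
      (\<integral>\<^sup>+t'. (\<Prod>j\<in>UNIV. ennreal (overlap_ratio (scaled_gaps j t) (lam * gap x (j, True) t', lam * gap x (j, False) t'))) \<partial>mondrian lam)"
      unfolding scaled_overlap_eq by (subst prod_ennreal[OF nn, symmetric]) (simp add: scaled_gaps_def)
    also have "\<dots> = (\<Prod>j\<in>UNIV. I j (scaled_gaps j t))"
      unfolding I_def
      by (rule nn_integral_gaps_prod[OF prob_space_mondrian lam_pos x, of "\<lambda>j a b. ennreal (overlap_ratio (scaled_gaps j t) (a, b))"]) measurable
    finally show ?thesis .
  qed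
  \<comment> \<open>The truncation levels grow in proportion to \<open>lam\<close>;
    \<open>\<tau>'\<close> follows this growth, so that the error 1 / \<tau>' is of order 1 /
    lam.\<close>
  define \<tau>' where "\<tau>' = lam * \<tau> / lam0"
  have \<tau>': "0 < \<tau>'" "1 / \<tau>' = (lam0 / \<tau>) / lam" using \<tau>(1) lam0 lam_pos by (auto simp: \<tau>'_def)
  have \<tau>'_le: "\<tau>' \<le> lam * gap_max x i" for i
  proof -
    have "lam * \<tau> \<le> lam * (lam0 * gap_max x i)" using \<tau>(2)[of i] lam_pos by (intro mult_left_mono) auto
    then show ?thesis using lam0(1) by (simp add: \<tau>'_def field_simps)
  qed
  have "\<exists>r. \<forall>j. 0 \<le> r j \<and> (\<integral>\<^sup>+a. \<integral>\<^sup>+b. I j (min (?c j) a, min (?c' j) b) \<partial>exp1 \<partial>exp1) = ennreal (r j) \<and> \<bar>r j - \<kappa>\<bar> \<le> 1 / \<tau>'"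
  proof (rule choice, rule allI)
    fix j
    show "\<exists>r. 0 \<le> r \<and> (\<integral>\<^sup>+a. \<integral>\<^sup>+b. I j (min (?c j) a, min (?c' j) b) \<partial>exp1 \<partial>exp1) = ennreal r \<and> \<bar>r - \<kappa>\<bar> \<le> 1 / \<tau>'"
      using truncated_overlap_ratio_expectation[OF \<tau>'(1) \<tau>'_le[of "(j, True)"] \<tau>'_le[of "(j, False)"]] by (auto simp: I_def \<kappa>_def)
  qed
  then obtain r where r: "\<And>j. 0 \<le> r j" "\<And>j. (\<integral>\<^sup>+a. \<integral>\<^sup>+b. I j (min (?c j) a, min (?c' j) b) \<partial>exp1 \<partial>exp1) = ennreal (r j)"
    "\<And>j. \<bar>r j - \<kappa>\<bar> \<le> 1 / \<tau>'" by blast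
  have [measurable]: "(\<lambda>(a, b). I j (a, b)) \<in> borel_measurable (borel \<Otimes>\<^sub>M borel)" for j
    unfolding I_def by measurable
  have outer: "(\<integral>\<^sup>+t. (\<Prod>j\<in>UNIV. I j (scaled_gaps j t)) \<partial>mondrian lam) = (\<Prod>j\<in>UNIV. ennreal (r j))"
    unfolding r(2)[symmetric] scaled_gaps_def
    by (rule nn_integral_gaps_prod[OF prob_space_mondrian lam_pos x, of "\<lambda>j a b. I j (a, b)"]) measurable
  \<comment> \<open>Comparing products factor by factor needs factors of norm at most 1;
    \<open>m\<close> bounds \<open>\<kappa>\<close> and every \<open>r j\<close>, and its d-th power
    is restored afterwards.\<close>
  define m where "m = 2 + 1 / \<tau>"
  have m: "1 \<le> m" using \<tau>(1) by (simp add: m_def)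
  have e: "1 / \<tau>' \<le> 1 / \<tau>"
    using \<tau>(1) lam0 lam_pos by (intro divide_left_mono) (auto simp: \<tau>'_def field_simps)
  have rm: "r j \<le> m" for j using r(3)[of j] \<kappa>(2) e by (simp add: m_def abs_le_iff)
  have "\<bar>(\<Prod>j\<in>UNIV. r j / m) - (\<Prod>j\<in>(UNIV :: 'd set). \<kappa> / m)\<bar> \<le> (\<Sum>j\<in>(UNIV :: 'd set). \<bar>r j / m - \<kappa> / m\<bar>)"
  proof -
    have "2 \<le> m" using \<tau>(1) by (simp add: m_def)
    then have "norm (r j / m) \<le> 1" "norm (\<kappa> / m) \<le> 1" for j using r(1)[of j] rm[of j] \<kappa> by auto
    then show ?thesis using norm_prod_diff[of UNIV "\<lambda>j. r j / m" "\<lambda>j. \<kappa> / m"] by simp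
  qed
  also have "\<dots> \<le> (\<Sum>j\<in>(UNIV :: 'd set). 1 / \<tau>')"
  proof (rule sum_mono)
    fix j
    have "\<bar>r j / m - \<kappa> / m\<bar> = \<bar>r j - \<kappa>\<bar> / m" using m by (simp add: diff_divide_distrib[symmetric])
    also have "\<dots> \<le> \<bar>r j - \<kappa>\<bar> / 1" using m by (intro divide_left_mono) auto
    also have "\<dots> \<le> 1 / \<tau>'" using r(3)[of j] by simp
    finally show "\<bar>r j / m - \<kappa> / m\<bar> \<le> 1 / \<tau>'" .
  qed
  also have "\<dots> = CARD('d) * ((lam0 / \<tau>) / lam)" by (simp add: \<tau>'(2))
  finally have le: "\<bar>(\<Prod>j\<in>UNIV. r j) - \<kappa> ^ CARD('d)\<bar> / m ^ CARD('d) \<le> CARD('d) * ((lam0 / \<tau>) / lam)"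
    using m by (simp add: prod_dividef power_divide diff_divide_distrib[symmetric])
  have mp: "0 < m ^ CARD('d)" using m by simp
  have "\<bar>(\<Prod>j\<in>UNIV. r j) - \<kappa> ^ CARD('d)\<bar> \<le> m ^ CARD('d) * (CARD('d) * ((lam0 / \<tau>) / lam))"
    using le mp by (simp only: pos_divide_le_eq mult.commute)
  also have "\<dots> = overlap_const / lam" by (simp add: overlap_const_def m_def)
  finally have "\<bar>(\<Prod>j\<in>UNIV. r j) - \<kappa> ^ CARD('d)\<bar> \<le> overlap_const / lam" .
  moreover have "(\<integral>\<^sup>+t. \<integral>\<^sup>+t'. ennreal (scaled_overlap t t') \<partial>mondrian lam \<partial>mondrian lam) = ennreal (\<Prod>j\<in>UNIV. r j)"
    unfolding inner outer using r(1) by (rule prod_ennreal)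
  moreover have "0 \<le> (\<Prod>j\<in>UNIV. r j)" using r(1) by (intro prod_nonneg) auto
  ultimately show ?thesis using that unfolding \<kappa>_def by blast
qed

section \<open>Mean square error of one pair of distinct trees\<close>

definition pair_fn :: "(nat \<Rightarrow> (real ^ 'd) \<times> real) \<Rightarrow> 'd split_tree \<Rightarrow> 'd split_tree \<Rightarrow> real" where
  "pair_fn z t t' = n / lam ^ CARD('d) * ((\<Sum>i=1..n. cube_part sig2 (fst (z i)) * (indicat_real (cell_at t x) (fst (z i)) * indicat_real (cell_at t' x) (fst (z i))))
     / ((\<Sum>i=1..n. indicat_real (cell_at t x) (fst (z i))) * (\<Sum>i=1..n. indicat_real (cell_at t' x) (fst (z i)))))"

text \<open>As a function of the array of data and two trees, the term can be integrated over the
  joint law of data and trees.\<close>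

lemma pair_term_eq: "pair_term t t' \<omega> = pair_fn (data \<omega>) t t'"
  by (simp add: pair_term_def pair_fn_def data_def iid.hits_def indicator_inter_arith)

lemma pair_fn_measurable:
  assumes z: "z \<in> N \<rightarrow>\<^sub>M data_space" and t: "t \<in> N \<rightarrow>\<^sub>M split_tree_algebra" "t' \<in> N \<rightarrow>\<^sub>M split_tree_algebra"
  shows "(\<lambda>w. pair_fn (z w) (t w) (t' w)) \<in> borel_measurable N"
proof -
  have X: "(\<lambda>w. fst (z w i)) \<in> N \<rightarrow>\<^sub>M borel" if "i \<in> {1..n}" for i
    using measurable_compose[OF measurable_compose[OF z measurable_component_singleton[OF that]], of fst borel]
    by (simp add: borel_prod[symmetric])
  have sm: "cube_part sig2 \<in> borel_measurable borel" using law.sig2_holder by (intro cube_part_measurable)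
  note [measurable] = measurable_compose[OF X sm] indicator_cell_at_measurable[OF x_in_cube t(1) X] indicator_cell_at_measurable[OF x_in_cube t(2) X]
  show ?thesis
    unfolding pair_fn_def by measurable
qed

lemma component_measurable:
  "b \<in> {1..B} \<Longrightarrow> (\<lambda>p. snd p b) \<in> data_space \<Otimes>\<^sub>M tree_space \<rightarrow>\<^sub>M split_tree_algebra"
  by (rule measurable_compose[OF measurable_snd measurable_component_singleton])

definition "pair_const = 162036 * sb\<^sup>2 / fl ^ 3 * (moment_const ^ CARD('d))\<^sup>2 + 8 * bias_const\<^sup>2 * radius_const * moment_const ^ CARD('d)"

lemma const_nonneg: "0 \<le> bias_const" "0 \<le> radius_const" "0 \<le> moment_const ^ CARD('d)"
  using L(1) fl(1) sb_pos fb_pos moment_const_ge by (auto simp: bias_const_def radius_const_def)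

text \<open>In scaled volumes the powers of \<open>lam\<close> combine to lam^d / n, and each
  summand becomes a function of \<open>t\<close> times a function of \<open>t'\<close>, so that the
  mean over independent trees factorises. The two radius terms have equal means, hence the 8 in
  \<open>pair_const\<close>.\<close>

lemma pair_bound_le:
  "162036 * sb\<^sup>2 / fl ^ 3 / (n * (vol t * vol t') powr (3 / 2) * (lam ^ CARD('d))\<^sup>2)
     + 2 * (bias_const * scaled_overlap t t' * (radius t + radius t'))\<^sup>2
   \<le> (162036 * sb\<^sup>2 / fl ^ 3 * (lam ^ CARD('d) / n)) * (scaled_vol t powr (- (3 / 2)) * scaled_vol t' powr (- (3 / 2)))
     + 4 * bias_const\<^sup>2 * ((radius t)\<^sup>2 / scaled_vol t * (1 / scaled_vol t') + 1 / scaled_vol t * ((radius t')\<^sup>2 / scaled_vol t'))"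
proof (rule add_mono)
  let ?l = "lam ^ CARD('d)"
  have l: "0 < ?l" using lam_pos by simp
  have v: "0 < vol t" "0 < vol t'" by (rule vol_pos)+
  have "scaled_vol t powr (3 / 2) * scaled_vol t' powr (3 / 2) = (?l\<^sup>2 * (vol t * vol t')) powr (3 / 2)"
    using l v by (simp add: scaled_vol_eq powr_mult[symmetric] power2_eq_square mult_ac)
  also have "\<dots> = (?l\<^sup>2) powr (3 / 2) * (vol t * vol t') powr (3 / 2)" by (rule powr_mult)
  also have "(?l\<^sup>2) powr (3 / 2) = ?l ^ 3" using l by (simp add: powr_powr flip: powr_numeral)
  finally have "scaled_vol t powr (3 / 2) * scaled_vol t' powr (3 / 2) = ?l ^ 3 * (vol t * vol t') powr (3 / 2)" .
  then have "scaled_vol t powr (- (3 / 2)) * scaled_vol t' powr (- (3 / 2)) = 1 / (?l ^ 3 * (vol t * vol t') powr (3 / 2))"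
    by (simp add: powr_minus_divide)
  moreover have "c / (n * w * ?l\<^sup>2) = c * (?l / n) * (1 / (?l ^ 3 * w))" for c w :: real
    using l by (simp add: power2_eq_square power3_eq_cube)
  ultimately show "162036 * sb\<^sup>2 / fl ^ 3 / (n * (vol t * vol t') powr (3 / 2) * ?l\<^sup>2) \<le>
    (162036 * sb\<^sup>2 / fl ^ 3 * (?l / n)) * (scaled_vol t powr (- (3 / 2)) * scaled_vol t' powr (- (3 / 2)))"
    by simp
  have "(bias_const * scaled_overlap t t' * (radius t + radius t'))\<^sup>2 = bias_const\<^sup>2 * ((scaled_overlap t t')\<^sup>2 * (radius t + radius t')\<^sup>2)"
    by (simp add: power_mult_distrib)
  also have "\<dots> \<le> bias_const\<^sup>2 * ((1 / scaled_vol t * (1 / scaled_vol t')) * (2 * (radius t)\<^sup>2 + 2 * (radius t')\<^sup>2))"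
  proof (intro mult_left_mono mult_mono scaled_overlap_square)
    show "(radius t + radius t')\<^sup>2 \<le> 2 * (radius t)\<^sup>2 + 2 * (radius t')\<^sup>2"
      using zero_le_power2[of "radius t - radius t'"] by (simp add: power2_eq_square algebra_simps)
  qed (use scaled_vol_pos[of t] scaled_vol_pos[of t'] in auto)
  finally show "2 * (bias_const * scaled_overlap t t' * (radius t + radius t'))\<^sup>2 \<le>
    4 * bias_const\<^sup>2 * ((radius t)\<^sup>2 / scaled_vol t * (1 / scaled_vol t') + 1 / scaled_vol t * ((radius t')\<^sup>2 / scaled_vol t'))"
    by (simp add: algebra_simps add_divide_distrib)
qed

text \<open>The data are integrated first with both trees fixed; the resulting bound is averaged
  over the independent trees, with inverse volumes of order at most 3/2.\<close>

lemma pair_deviation: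
  assumes b: "b \<in> {1..B}" "b' \<in> {1..B}" "b \<noteq> b'"
  shows "(\<integral>\<^sup>+\<omega>. ennreal ((pair_term (T b \<omega>) (T b' \<omega>) \<omega> - sig2 x / f x * scaled_overlap (T b \<omega>) (T b' \<omega>))\<^sup>2) \<partial>M)
    \<le> ennreal (pair_const * (lam ^ CARD('d) / n + lam powr (- 2 * \<gamma>)))"
proof -
  let ?F = "\<lambda>z ts. ennreal ((pair_fn z (ts b) (ts b') - sig2 x / f x * scaled_overlap (ts b) (ts b'))\<^sup>2)"
  let ?m = "moment_const ^ CARD('d)" and ?l = "lam powr (- 2 * \<gamma>)"
  define c1 c2 where "c1 = 162036 * sb\<^sup>2 / fl ^ 3 * (lam ^ CARD('d) / n)" and "c2 = 4 * bias_const\<^sup>2"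
  have c: "0 \<le> c1" "0 \<le> c2" using fl(1) lam_pos by (auto simp: c1_def c2_def)
  have gen: "ennreal (c1 * (a * a') + c2 * (e * d' + d * e')) =
      ennreal c1 * (ennreal a * ennreal a') + ennreal c2 * (ennreal e * ennreal d' + ennreal d * ennreal e')"
    if "0 \<le> a" "0 \<le> a'" "0 \<le> d" "0 \<le> d'" "0 \<le> e" "0 \<le> e'" for a a' d d' e e'
    using c that by (simp add: ennreal_mult ennreal_plus)
  define p q r where "p t = ennreal (scaled_vol t powr (- (3 / 2)))" and "q t = ennreal (1 / scaled_vol t)" and "r t = ennreal ((radius t)\<^sup>2 / scaled_vol t)" for t
  have [measurable]: "p \<in> borel_measurable split_tree_algebra" "q \<in> borel_measurable split_tree_algebra" "r \<in> borel_measurable split_tree_algebra"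
    unfolding p_def[abs_def] q_def[abs_def] r_def[abs_def] by measurable
  have tb: "trees_of \<omega> b = T b \<omega>" "trees_of \<omega> b' = T b' \<omega>" for \<omega> using b by (auto simp: trees_of_def)
  have Fm: "(\<lambda>(z, ts). ?F z ts) \<in> borel_measurable (data_space \<Otimes>\<^sub>M tree_space)"
  proof -
    have "(\<lambda>w. scaled_overlap (snd w b) (snd w b')) \<in> borel_measurable (data_space \<Otimes>\<^sub>M tree_space)"
      using measurable_compose[OF measurable_Pair[OF component_measurable[OF b(1)] component_measurable[OF b(2)]] scaled_overlap_measurable] by simp
    then show ?thesis
      using pair_fn_measurable[OF measurable_fst component_measurable[OF b(1)] component_measurable[OF b(2)]]
      unfolding split_beta' by measurable
  qed
  have "(\<integral>\<^sup>+\<omega>. ennreal ((pair_term (T b \<omega>) (T b' \<omega>) \<omega> - sig2 x / f x * scaled_overlap (T b \<omega>) (T b' \<omega>))\<^sup>2) \<partial>M) =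
    (\<integral>\<^sup>+\<omega>'. \<integral>\<^sup>+\<omega>. ennreal ((pair_term (T b \<omega>') (T b' \<omega>') \<omega> - sig2 x / f x * scaled_overlap (T b \<omega>') (T b' \<omega>'))\<^sup>2) \<partial>M \<partial>M)"
    using nn_integral_data_trees[OF Fm] by (simp only: tb pair_term_eq)
  also have "\<dots> \<le> (\<integral>\<^sup>+\<omega>'. ennreal c1 * (p (T b \<omega>') * p (T b' \<omega>')) + ennreal c2 * (r (T b \<omega>') * q (T b' \<omega>') + q (T b \<omega>') * r (T b' \<omega>')) \<partial>M)"
  proof (rule nn_integral_mono)
    fix \<omega>'
    let ?t = "T b \<omega>'" and ?t' = "T b' \<omega>'"
    have "(\<integral>\<^sup>+\<omega>. ennreal ((pair_term ?t ?t' \<omega> - sig2 x / f x * scaled_overlap ?t ?t')\<^sup>2) \<partial>M) \<le>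
      ennreal (c1 * (scaled_vol ?t powr (- (3 / 2)) * scaled_vol ?t' powr (- (3 / 2)))
     + c2 * ((radius ?t)\<^sup>2 / scaled_vol ?t * (1 / scaled_vol ?t') + 1 / scaled_vol ?t * ((radius ?t')\<^sup>2 / scaled_vol ?t')))"
      using order_trans[OF pair_term_deviation[of ?t ?t', folded scaled_overlap_def] ennreal_leI[OF pair_bound_le[of ?t ?t']]]
      by (simp only: c1_def c2_def)
    also have "\<dots> = ennreal c1 * (p ?t * p ?t') + ennreal c2 * (r ?t * q ?t' + q ?t * r ?t')"
    proof -
      show ?thesis
        unfolding p_def q_def r_def
        by (rule gen) (use scaled_vol_pos[of ?t] scaled_vol_pos[of ?t'] in auto)
    qed
    finally show "(\<integral>\<^sup>+\<omega>. ennreal ((pair_term ?t ?t' \<omega> - sig2 x / f x * scaled_overlap ?t ?t')\<^sup>2) \<partial>M) \<le> \<dots>" .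
  qed
  also have "\<dots> = (\<integral>\<^sup>+t. \<integral>\<^sup>+t'. ennreal c1 * (p t * p t') + ennreal c2 * (r t * q t' + q t * r t') \<partial>mondrian lam \<partial>mondrian lam)"
    by (rule nn_integral_tree_pair[OF b]) measurable
  also have "\<dots> = ennreal c1 * ((\<integral>\<^sup>+t. p t \<partial>mondrian lam) * (\<integral>\<^sup>+t. p t \<partial>mondrian lam)) +
      ennreal c2 * ((\<integral>\<^sup>+t. r t \<partial>mondrian lam) * (\<integral>\<^sup>+t. q t \<partial>mondrian lam) + (\<integral>\<^sup>+t. q t \<partial>mondrian lam) * (\<integral>\<^sup>+t. r t \<partial>mondrian lam))"
    by (simp add: nn_integral_add nn_integral_cmult nn_integral_multc)
  also have "\<dots> \<le> ennreal c1 * (ennreal ?m * ennreal ?m) +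
      ennreal c2 * (ennreal (radius_const * ?l) * ennreal ?m + ennreal ?m * ennreal (radius_const * ?l))"
    unfolding p_def q_def r_def
    by (intro add_mono mult_left_mono mult_mono radius_moment scaled_vol_inverse_moment scaled_vol_powr_moment) auto
  also have "\<dots> = ennreal (c1 * (?m * ?m) + c2 * ((radius_const * ?l) * ?m + ?m * (radius_const * ?l)))"
    by (rule gen[symmetric]) (use const_nonneg in auto)
  also have "\<dots> \<le> ennreal (pair_const * (lam ^ CARD('d) / n + ?l))"
  proof (rule ennreal_leI)
    let ?A = "162036 * sb\<^sup>2 / fl ^ 3 * ?m\<^sup>2" and ?C = "8 * bias_const\<^sup>2 * radius_const * ?m"
    have "0 \<le> ?A * ?l" "0 \<le> ?C * (lam ^ CARD('d) / n)"
      using fl(1) const_nonneg lam_pos by (auto intro!: mult_nonneg_nonneg divide_nonneg_nonneg)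
    moreover have "c1 * (?m * ?m) + c2 * ((radius_const * ?l) * ?m + ?m * (radius_const * ?l)) = ?A * (lam ^ CARD('d) / n) + ?C * ?l"
      by (simp add: c1_def c2_def power2_eq_square)
    moreover have "pair_const * (lam ^ CARD('d) / n + ?l) = (?A * (lam ^ CARD('d) / n) + ?C * ?l) + (?A * ?l + ?C * (lam ^ CARD('d) / n))"
      by (simp only: pair_const_def distrib_left distrib_right add_ac)
    ultimately show "c1 * (?m * ?m) + c2 * ((radius_const * ?l) * ?m + ?m * (radius_const * ?l)) \<le> pair_const * (lam ^ CARD('d) / n + ?l)"
      by linarith
  qed
  finally show ?thesis .
qed

end

lemma nn_integral_sum_square_le:
  fixes Z :: "'i \<Rightarrow> 'w \<Rightarrow> real"
  assumes Z: "\<And>p. p \<in> I \<Longrightarrow> Z p \<in> borel_measurable M" "\<And>p. p \<in> I \<Longrightarrow> (\<integral>\<^sup>+\<omega>. ennreal ((Z p \<omega>)\<^sup>2) \<partial>M) \<le> ennreal v" and "0 \<le> v"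
  shows "(\<integral>\<^sup>+\<omega>. ennreal ((\<Sum>p\<in>I. Z p \<omega>)\<^sup>2) \<partial>M) \<le> ennreal ((real (card I))\<^sup>2 * v)"
proof -
  have "(\<integral>\<^sup>+\<omega>. ennreal ((\<Sum>p\<in>I. Z p \<omega>)\<^sup>2) \<partial>M) \<le> (\<integral>\<^sup>+\<omega>. ennreal (card I) * (\<Sum>p\<in>I. ennreal ((Z p \<omega>)\<^sup>2)) \<partial>M)"
  proof (rule nn_integral_mono)
    fix \<omega>
    have "ennreal ((\<Sum>p\<in>I. Z p \<omega>)\<^sup>2) \<le> ennreal (card I * (\<Sum>p\<in>I. (Z p \<omega>)\<^sup>2))"
      using sum_squared_le_sum_of_squares[of "\<lambda>p. Z p \<omega>" I] by (intro ennreal_leI) (simp add: mult.commute)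
    also have "\<dots> = ennreal (card I) * (\<Sum>p\<in>I. ennreal ((Z p \<omega>)\<^sup>2))"
      by (simp add: ennreal_mult sum_nonneg sum_ennreal)
    finally show "ennreal ((\<Sum>p\<in>I. Z p \<omega>)\<^sup>2) \<le> \<dots>" .
  qed
  also have "\<dots> = ennreal (card I) * (\<Sum>p\<in>I. \<integral>\<^sup>+\<omega>. ennreal ((Z p \<omega>)\<^sup>2) \<partial>M)"
  proof -
    have m: "(\<lambda>\<omega>. ennreal ((Z p \<omega>)\<^sup>2)) \<in> borel_measurable M" if "p \<in> I" for p
      using Z(1)[OF that] by measurable
    then have "(\<lambda>\<omega>. \<Sum>p\<in>I. ennreal ((Z p \<omega>)\<^sup>2)) \<in> borel_measurable M" by (intro borel_measurable_sum)
    then show ?thesis by (simp only: nn_integral_cmult nn_integral_sum[OF m])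
  qed
  also have "\<dots> \<le> ennreal (card I) * (\<Sum>p\<in>I. ennreal v)"
    using Z(2) by (intro mult_left_mono sum_mono) auto
  also have "\<dots> = ennreal ((real (card I))\<^sup>2 * v)"
  proof -
    have "(\<Sum>p\<in>I. ennreal v) = ennreal (card I * v)" using \<open>0 \<le> v\<close> by (simp add: ennreal_mult ennreal_of_nat_eq_real_of_nat)
    then show ?thesis using \<open>0 \<le> v\<close> by (simp add: ennreal_mult[symmetric] power2_eq_square mult_ac)
  qed
  finally show ?thesis .
qed

lemma min_le_powr_mult:
  fixes a b \<theta> :: real
  assumes "0 < a" "0 < b" "0 \<le> \<theta>" "\<theta> \<le> 1"
  shows "min a b \<le> a powr \<theta> * b powr (1 - \<theta>)"
proof -
  have "min a b = min a b powr \<theta> * min a b powr (1 - \<theta>)"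
    using assms by (simp add: powr_add[symmetric])
  also have "\<dots> \<le> a powr \<theta> * b powr (1 - \<theta>)"
    using assms by (intro mult_mono powr_mono2) auto
  finally show ?thesis .
qed

context forest_bounds
begin

text \<open>For \<theta> = 1 / (1 + ln n), \<open>exp 2\<close> bounds the power \<theta> of n^2,
  the factor with \<open>lam0\<close> bounds the leftover power - 2 d \<theta> of
  \<open>lam\<close>, and the last factor is the moment constant of one width without its 1 /
  \<theta>, for each of the d axes.\<close>

definition "diag_const = sb\<^sup>2 * max 1 (204 / fl\<^sup>2) * exp 2 * max 1 (1 / (lam0 ^ CARD('d))\<^sup>2) * (3 + max 1 (\<tau> powr (- 2))) ^ CARD('d)"

text \<open>The inverse square of the volume has no first moment, so the trivial bound
  \<open>n\<^sup>2\<close> is interpolated in with the small exponent \<open>1 / (1 + ln n)\<close>, at the cost of a power of \<open>ln n\<close>.\<close>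

lemma diagonal_deviation:
  assumes b: "b \<in> {1..B}"
  shows "(\<integral>\<^sup>+\<omega>. ennreal ((pair_term (T b \<omega>) (T b \<omega>) \<omega>)\<^sup>2) \<partial>M) \<le> ennreal (diag_const * (1 + ln n) ^ CARD('d))"
proof -
  let ?l = "lam ^ CARD('d)" and ?mx = "max 1 (\<tau> powr (- 2))"
  define \<theta> where "\<theta> = 1 / (1 + ln (real n))"
  have ln: "0 \<le> ln (real n)" using n_ge_1 by simp
  have \<theta>: "0 < \<theta>" "\<theta> \<le> 1" "\<theta> * ln n \<le> 1" "1 / \<theta> = 1 + ln n" using ln by (auto simp: \<theta>_def)
  have l: "0 < ?l" using lam_pos by simp
  have n: "0 < (real n)\<^sup>2" using n_ge_1 by simp
  define C where "C = sb\<^sup>2 * max 1 (204 / fl\<^sup>2) * exp 2 * max 1 (1 / (lam0 ^ CARD('d))\<^sup>2)"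
  have C: "0 \<le> C" unfolding C_def by (intro mult_nonneg_nonneg) auto
  let ?F = "\<lambda>z ts. ennreal ((pair_fn z (ts b) (ts b))\<^sup>2)"
  have tb: "trees_of \<omega> b = T b \<omega>" for \<omega> using b by (auto simp: trees_of_def)
  have Fm: "(\<lambda>(z, ts). ?F z ts) \<in> borel_measurable (data_space \<Otimes>\<^sub>M tree_space)"
    using pair_fn_measurable[OF measurable_fst component_measurable[OF b] component_measurable[OF b]]
    unfolding split_beta' by measurable
  have le: "sb\<^sup>2 / ?l\<^sup>2 * min ((real n)\<^sup>2) (204 / fl\<^sup>2 / (vol t)\<^sup>2) \<le> C * scaled_vol t powr (- (2 * (1 - \<theta>)))" for t
  proof -
    define c where "c = max 1 (204 / fl\<^sup>2)"
    define y where "y = scaled_vol t"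
    have y: "0 < y" unfolding y_def by (rule scaled_vol_pos)
    have c: "1 \<le> c" by (simp add: c_def)
    have v: "1 / (vol t)\<^sup>2 = ?l\<^sup>2 / y\<^sup>2" using lam_pos by (simp add: y_def scaled_vol_eq power_mult_distrib)
    have vp: "0 < 1 / (vol t)\<^sup>2" using vol_pos[of t] by simp
    have "204 / fl\<^sup>2 / (vol t)\<^sup>2 \<le> c * (1 / (vol t)\<^sup>2)"
    proof -
      have "204 / fl\<^sup>2 * (1 / (vol t)\<^sup>2) \<le> c * (1 / (vol t)\<^sup>2)"
        unfolding c_def using vp by (intro mult_right_mono max.cobounded2) auto
      then show ?thesis by (simp only: times_divide_eq_right mult_1_right)
    qed
    moreover have "(real n)\<^sup>2 \<le> c * (real n)\<^sup>2" using c n by simp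
    ultimately have "min ((real n)\<^sup>2) (204 / fl\<^sup>2 / (vol t)\<^sup>2) \<le> min (c * (real n)\<^sup>2) (c * (1 / (vol t)\<^sup>2))"
      by (rule min.mono[rotated])
    also have "\<dots> = c * min ((real n)\<^sup>2) (1 / (vol t)\<^sup>2)" using c by (simp add: min_mult_distrib_left)
    also have "\<dots> \<le> c * (((real n)\<^sup>2) powr \<theta> * (1 / (vol t)\<^sup>2) powr (1 - \<theta>))"
      using c n vp \<theta> by (intro mult_left_mono min_le_powr_mult) auto
    also have "\<dots> \<le> c * (exp 2 * ((?l\<^sup>2) powr (1 - \<theta>) * y powr (- (2 * (1 - \<theta>)))))"
    proof (intro mult_left_mono mult_mono)
      have "((real n)\<^sup>2) powr \<theta> = exp (2 * (\<theta> * ln n))" using n_ge_1 by (simp add: powr_def ln_realpow)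
      then show "((real n)\<^sup>2) powr \<theta> \<le> exp 2" using \<theta>(3) by simp
      have eq: "(y\<^sup>2) powr (1 - \<theta>) = y powr (2 * (1 - \<theta>))" using y by (simp add: powr_powr flip: powr_numeral)
      show "(1 / (vol t)\<^sup>2) powr (1 - \<theta>) \<le> (?l\<^sup>2) powr (1 - \<theta>) * y powr (- (2 * (1 - \<theta>)))"
        unfolding v powr_divide powr_minus_divide eq by simp
    qed (use c in auto)
    finally have "sb\<^sup>2 / ?l\<^sup>2 * min ((real n)\<^sup>2) (204 / fl\<^sup>2 / (vol t)\<^sup>2) \<le>
        sb\<^sup>2 / ?l\<^sup>2 * (c * (exp 2 * ((?l\<^sup>2) powr (1 - \<theta>) * y powr (- (2 * (1 - \<theta>))))))"
      by (rule mult_left_mono) simp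
    also have "\<dots> = (sb\<^sup>2 * c * exp 2 * y powr (- (2 * (1 - \<theta>)))) * ((?l\<^sup>2) powr (1 - \<theta>) / ?l\<^sup>2)"
      by simp
    also have "\<dots> \<le> (sb\<^sup>2 * c * exp 2 * y powr (- (2 * (1 - \<theta>)))) * max 1 (1 / (lam0 ^ CARD('d))\<^sup>2)"
    proof (rule mult_left_mono)
      have eq: "(?l\<^sup>2) powr (1 - \<theta>) / ?l\<^sup>2 = (?l\<^sup>2) powr (- \<theta>)"
        using l by (simp add: powr_diff powr_minus_divide)
      show "(?l\<^sup>2) powr (1 - \<theta>) / ?l\<^sup>2 \<le> max 1 (1 / (lam0 ^ CARD('d))\<^sup>2)"
      \<comment> \<open>A power with exponent between - 1 and 0 is at most 1 for a base above 1; for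
        a smaller base the lower bound \<open>lam0\<close> takes over.\<close>
      proof (cases "?l\<^sup>2 \<le> 1")
        case True
        have "(?l\<^sup>2) powr (- \<theta>) \<le> (?l\<^sup>2) powr (- 1)"
          using True l \<theta> by (intro powr_mono') auto
        also have "\<dots> = 1 / ?l\<^sup>2" using l by (simp add: powr_minus_divide)
        also have "\<dots> \<le> 1 / (lam0 ^ CARD('d))\<^sup>2"
          using lam0 l by (intro divide_left_mono power_mono mult_pos_pos zero_less_power) auto
        finally show ?thesis unfolding eq by simp
      next
        case False
        then have "(?l\<^sup>2) powr (- \<theta>) \<le> (?l\<^sup>2) powr 0" using \<theta> by (intro powr_mono) auto
        also have "\<dots> = 1" using lam_pos by simp
        finally show ?thesis unfolding eq by (rule max.coboundedI1)
      qed
      show "0 \<le> sb\<^sup>2 * c * exp 2 * y powr (- (2 * (1 - \<theta>)))" using c by simp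
    qed
    also have "\<dots> = C * y powr (- (2 * (1 - \<theta>)))" by (simp add: C_def c_def)
    finally show ?thesis by (simp add: y_def)
  qed
  have "(\<integral>\<^sup>+\<omega>. ennreal ((pair_term (T b \<omega>) (T b \<omega>) \<omega>)\<^sup>2) \<partial>M) =
    (\<integral>\<^sup>+\<omega>'. \<integral>\<^sup>+\<omega>. ennreal ((pair_term (T b \<omega>') (T b \<omega>') \<omega>)\<^sup>2) \<partial>M \<partial>M)"
    using nn_integral_data_trees[OF Fm] by (simp only: tb pair_term_eq)
  also have "\<dots> \<le> (\<integral>\<^sup>+\<omega>'. ennreal C * ennreal (scaled_vol (T b \<omega>') powr (- (2 * (1 - \<theta>)))) \<partial>M)"
    unfolding ennreal_mult[OF C powr_ge_zero, symmetric]
    by (intro nn_integral_mono order_trans[OF diagonal_term_bound] ennreal_leI le)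
  also have "\<dots> = (\<integral>\<^sup>+t. ennreal C * ennreal (scaled_vol t powr (- (2 * (1 - \<theta>)))) \<partial>mondrian lam)"
    by (rule nn_integral_tree[OF b]) measurable
  also have "\<dots> = ennreal C * (\<integral>\<^sup>+t. ennreal (scaled_vol t powr (- (2 * (1 - \<theta>)))) \<partial>mondrian lam)"
    by (rule nn_integral_cmult) measurable
  also have "\<dots> \<le> ennreal C * ennreal (((3 + ?mx) * (1 + ln n)) ^ CARD('d))"
    unfolding scaled_vol_def prod_powr_distrib
  proof (intro mult_left_mono scaled_width_moment)
    fix c c' :: real assume cc: "\<tau> \<le> c" "\<tau> \<le> c'"
    \<comment> \<open>The moment has order 2 (1 - \<theta>), and its distance 2 \<theta> from the
      critical order 2 yields a factor 1 / \<theta> = 1 + ln n for each axis.\<close>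
    have "(6 + 2 * ?mx) / (2 - 2 * (1 - \<theta>)) = (3 + ?mx) * (1 + ln n)"
      unfolding \<theta>(4)[symmetric] using \<theta>(1) by (simp add: field_simps)
    then show "(\<integral>\<^sup>+a. \<integral>\<^sup>+b. ennreal ((min c a + min c' b) powr (- (2 * (1 - \<theta>)))) \<partial>exp1 \<partial>exp1) \<le> ennreal ((3 + ?mx) * (1 + ln n))"
      using negative_moment[of "2 * (1 - \<theta>)" \<tau> c c'] \<theta> \<tau>(1) cc by simp
  qed (use ln in auto)
  also have "\<dots> = ennreal (C * ((3 + ?mx) * (1 + ln n)) ^ CARD('d))"
    using C ln by (simp add: ennreal_mult)
  also have "C * ((3 + ?mx) * (1 + ln n)) ^ CARD('d) = diag_const * (1 + ln n) ^ CARD('d)"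
    by (simp add: C_def diag_const_def power_mult_distrib)
  finally show ?thesis .
qed

section \<open>All pairs of trees together\<close>

definition "off_diagonal = {p \<in> {1..B} \<times> {1..B}. fst p \<noteq> snd p}"

lemma off_diagonal_sum: "(\<Sum>b=1..B. \<Sum>b'=1..B. g b b') = (\<Sum>b=1..B. g b b) + (\<Sum>p\<in>off_diagonal. g (fst p) (snd p))"
  for g :: "nat \<Rightarrow> nat \<Rightarrow> real"
proof -
  have "(\<Sum>b=1..B. \<Sum>b'=1..B. g b b') = (\<Sum>b=1..B. g b b + (\<Sum>b'\<in>{1..B} - {b}. g b b'))"
    by (intro sum.cong refl sum.remove) auto
  also have "(\<Sum>b=1..B. g b b + (\<Sum>b'\<in>{1..B} - {b}. g b b')) = (\<Sum>b=1..B. g b b) + (\<Sum>(b, b')\<in>Sigma {1..B} (\<lambda>b. {1..B} - {b}). g b b')"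
    by (simp add: sum.distrib sum.Sigma)
  also have "Sigma {1..B} (\<lambda>b. {1..B} - {b}) = off_diagonal" by (auto simp: off_diagonal_def)
  finally show ?thesis by (simp add: split_beta')
qed

lemma card_off_diagonal: "real (card off_diagonal) \<le> (real B)\<^sup>2"
proof -
  have "card off_diagonal \<le> card ({1..B} \<times> {1..B})" unfolding off_diagonal_def by (intro card_mono) auto
  then show ?thesis by (simp add: power2_eq_square flip: of_nat_mult)
qed

lemma overlap_tree_measurable:
  "b \<in> {1..B} \<Longrightarrow> b' \<in> {1..B} \<Longrightarrow> (\<lambda>\<omega>. scaled_overlap (T b \<omega>) (T b' \<omega>)) \<in> borel_measurable M"
  using measurable_compose[OF tree_pair_measurable scaled_overlap_measurable] by simp

text \<open>Centred overlaps of pairs without a common tree are independent, hence orthogonal, and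
  the variance for one pair is at most its second moment.\<close>

lemma overlap_fluctuation:
  assumes \<theta>: "0 \<le> \<theta>" "(\<integral>\<^sup>+t. \<integral>\<^sup>+t'. ennreal (scaled_overlap t t') \<partial>mondrian lam \<partial>mondrian lam) = ennreal \<theta>"
  shows "(\<integral>\<^sup>+\<omega>. ennreal ((\<Sum>p\<in>off_diagonal. scaled_overlap (T (fst p) \<omega>) (T (snd p) \<omega>) - \<theta>)\<^sup>2) \<partial>M)
    \<le> ennreal (4 * real B ^ 3 * (moment_const ^ CARD('d))\<^sup>2)"
proof -
  let ?m = "moment_const ^ CARD('d)"
  define R where "R p \<omega> = scaled_overlap (T (fst p) \<omega>) (T (snd p) \<omega>)" for p \<omega>
  define Z where "Z p \<omega> = R p \<omega> - \<theta>" for p \<omega>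
  have Rm: "R p \<in> borel_measurable M" if "p \<in> off_diagonal" for p
    using that unfolding R_def[abs_def] off_diagonal_def by (intro overlap_tree_measurable) auto
  have R2: "(\<integral>\<^sup>+\<omega>. ennreal ((R p \<omega>)\<^sup>2) \<partial>M) \<le> ennreal (?m\<^sup>2)" if p: "p \<in> off_diagonal" for p
  proof -
    have "(\<lambda>(t, t'). ennreal ((scaled_overlap t t')\<^sup>2)) \<in> borel_measurable (split_tree_algebra \<Otimes>\<^sub>M split_tree_algebra)"
      using scaled_overlap_measurable unfolding split_beta' by measurable
    then have "(\<integral>\<^sup>+\<omega>. ennreal ((R p \<omega>)\<^sup>2) \<partial>M) = (\<integral>\<^sup>+t. \<integral>\<^sup>+t'. ennreal ((scaled_overlap t t')\<^sup>2) \<partial>mondrian lam \<partial>mondrian lam)"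
      unfolding R_def using p by (intro nn_integral_tree_pair) (auto simp: off_diagonal_def)
    then show ?thesis using scaled_overlap_square_moment by simp
  qed
  have iR2: "integrable M (\<lambda>\<omega>. (R p \<omega>)\<^sup>2)" if p: "p \<in> off_diagonal" for p
    using Rm[OF p] order_le_less_trans[OF R2[OF p] ennreal_less_top] by (intro integrableI_nonneg) auto
  have iR: "integrable M (R p)" if p: "p \<in> off_diagonal" for p
    using square_integrable_imp_integrable[OF Rm[OF p] iR2[OF p]] .
  have ER: "expectation (R p) = \<theta>" if p: "p \<in> off_diagonal" for p
  proof -
    have "(\<lambda>(t, t'). ennreal (scaled_overlap t t')) \<in> borel_measurable (split_tree_algebra \<Otimes>\<^sub>M split_tree_algebra)"
      using scaled_overlap_measurable unfolding split_beta' by measurable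
    then have "(\<integral>\<^sup>+\<omega>. ennreal (R p \<omega>) \<partial>M) = ennreal \<theta>"
      unfolding R_def \<theta>(2)[symmetric] using p by (intro nn_integral_tree_pair) (auto simp: off_diagonal_def)
    then show ?thesis
      using Rm[OF p] \<theta>(1) by (intro integral_eq_nn_integral[THEN trans]) (auto simp: R_def scaled_overlap_nonneg)
  qed
  have iZ: "integrable M (Z p)" "expectation (Z p) = 0" if p: "p \<in> off_diagonal" for p
    unfolding Z_def[abs_def] using iR[OF p] ER[OF p] by (auto simp: prob_space)
  have Z2: "(Z p \<omega>)\<^sup>2 = (R p \<omega>)\<^sup>2 - 2 * \<theta> * R p \<omega> + \<theta>\<^sup>2" for p \<omega>
    by (simp add: Z_def power2_eq_square algebra_simps)
  have iZ2: "integrable M (\<lambda>\<omega>. (Z p \<omega>)\<^sup>2)" if p: "p \<in> off_diagonal" for p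
    unfolding Z2 using iR[OF p] iR2[OF p] by auto
  have EZ2: "expectation (\<lambda>\<omega>. (Z p \<omega>)\<^sup>2) \<le> ?m\<^sup>2" if p: "p \<in> off_diagonal" for p
  proof -
    have "expectation (\<lambda>\<omega>. (Z p \<omega>)\<^sup>2) = expectation (\<lambda>\<omega>. (R p \<omega>)\<^sup>2) - \<theta>\<^sup>2"
      unfolding Z2 using iR[OF p] iR2[OF p] ER[OF p] by (simp add: prob_space power2_eq_square)
    moreover have "expectation (\<lambda>\<omega>. (R p \<omega>)\<^sup>2) \<le> ?m\<^sup>2"
    proof -
      have "ennreal (expectation (\<lambda>\<omega>. (R p \<omega>)\<^sup>2)) \<le> ennreal (?m\<^sup>2)"
        using R2[OF p] nn_integral_eq_integral[OF iR2[OF p]] by simp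
      then show ?thesis by (simp add: ennreal_le_iff)
    qed
    ultimately show ?thesis using zero_le_power2[of \<theta>] by linarith
  qed
  have orth: "expectation (\<lambda>\<omega>. Z p \<omega> * Z q \<omega>) = 0"
    if p: "p \<in> off_diagonal" and q: "q \<in> off_diagonal" and d: "{fst p, snd p} \<inter> {fst q, snd q} = {}" for p q
  proof -
    have F: "(\<lambda>(t, t'). scaled_overlap t t' - \<theta>) \<in> borel_measurable (split_tree_algebra \<Otimes>\<^sub>M split_tree_algebra)"
      using scaled_overlap_measurable unfolding split_beta' by measurable
    have ind: "indep_var borel (Z p) borel (Z q)"
      unfolding Z_def[abs_def] R_def using p q
      by (intro disjoint_tree_pairs_indep[OF _ d F]) (auto simp: off_diagonal_def)
    show ?thesis
      using indep_var_lebesgue_integral[OF ind iZ(1)[OF p] iZ(1)[OF q]] iZ(2)[OF p] by simp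
  qed
  note U = pair_sum_second_moment[of B Z, folded off_diagonal_def, OF _ iZ2 EZ2 _ orth]
  have Zm: "Z p \<in> borel_measurable M" if "p \<in> off_diagonal" for p using iZ(1)[OF that] by simp
  have "(\<integral>\<^sup>+\<omega>. ennreal ((\<Sum>p\<in>off_diagonal. Z p \<omega>)\<^sup>2) \<partial>M) = ennreal (expectation (\<lambda>\<omega>. (\<Sum>p\<in>off_diagonal. Z p \<omega>)\<^sup>2))"
    using U(1)[OF Zm] by (intro nn_integral_eq_integral) auto
  also have "\<dots> \<le> ennreal (4 * real B ^ 3 * ?m\<^sup>2)"
    using U(2)[OF Zm] by (intro ennreal_leI) auto
  finally show ?thesis by (simp add: Z_def R_def)
qed

end

lemma sum4_square_le: "(p + q + r + s)\<^sup>2 \<le> 4 * (p\<^sup>2 + q\<^sup>2 + r\<^sup>2 + s\<^sup>2)" for p q r s :: real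
proof -
  have "0 \<le> (p - q)\<^sup>2 + (p - r)\<^sup>2 + (p - s)\<^sup>2 + (q - r)\<^sup>2 + (q - s)\<^sup>2 + (r - s)\<^sup>2" by simp
  then show ?thesis by (simp add: power2_eq_square algebra_simps)
qed

context forest_bounds
begin

text \<open>The squared weight is a double sum over trees; exchanging the sums collects all
  observations for each pair of trees.\<close>

lemma scaled_variance_eq:
  "n / lam ^ CARD('d) * (\<Sum>i=1..n. (weight i \<omega>)\<^sup>2 * cube_part sig2 (X i \<omega>)) =
    (\<Sum>b=1..B. \<Sum>b'=1..B. pair_term (T b \<omega>) (T b' \<omega>) \<omega>) / (real B)\<^sup>2"
proof -
  define q where "q b i = indicat_real (cell_at (T b \<omega>) x) (X i \<omega>) / iid.hits (cell_at (T b \<omega>) x) \<omega>" for b i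
  let ?s = "\<lambda>i. cube_part sig2 (X i \<omega>)"
  have w: "weight i \<omega> = (\<Sum>b=1..B. q b i) / B" if "i \<in> {1..n}" for i
  proof -
    have "(\<Sum>b=1..B. indicat_real (cell_at (snd (XT \<omega>) b) x) (fst (XT \<omega>) i) / (\<Sum>k=1..n. indicat_real (cell_at (snd (XT \<omega>) b) x) (fst (XT \<omega>) k))) = (\<Sum>b=1..B. q b i)"
      unfolding q_def iid.hits_def using that by (intro sum.cong refl) (simp add: XT_apply)
    then show ?thesis unfolding weight_fn_def by simp
  qed
  have "(\<Sum>i=1..n. (weight i \<omega>)\<^sup>2 * ?s i) = (\<Sum>i=1..n. (\<Sum>b=1..B. \<Sum>b'=1..B. q b i * q b' i * ?s i) / (real B)\<^sup>2)"
  proof (rule sum.cong[OF refl])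
    fix i assume i: "i \<in> {1..n}"
    have "(\<Sum>b=1..B. q b i)\<^sup>2 = (\<Sum>b=1..B. \<Sum>b'=1..B. q b i * q b' i)"
      unfolding power2_eq_square by (rule sum_product)
    then have "(weight i \<omega>)\<^sup>2 = (\<Sum>b=1..B. \<Sum>b'=1..B. q b i * q b' i) / (real B)\<^sup>2"
      unfolding w[OF i] power_divide by (rule arg_cong)
    then show "(weight i \<omega>)\<^sup>2 * ?s i = (\<Sum>b=1..B. \<Sum>b'=1..B. q b i * q b' i * ?s i) / (real B)\<^sup>2"
      by (simp only: times_divide_eq_left sum_distrib_right)
  qed
  also have "\<dots> = (\<Sum>i=1..n. \<Sum>b=1..B. \<Sum>b'=1..B. q b i * q b' i * ?s i) / (real B)\<^sup>2"
    by (rule sum_divide_distrib[symmetric])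
  also have "(\<Sum>i=1..n. \<Sum>b=1..B. \<Sum>b'=1..B. q b i * q b' i * ?s i) = (\<Sum>b=1..B. \<Sum>i=1..n. \<Sum>b'=1..B. q b i * q b' i * ?s i)"
    by (rule sum.swap)
  also have "\<dots> = (\<Sum>b=1..B. \<Sum>b'=1..B. \<Sum>i=1..n. q b i * q b' i * ?s i)"
    by (intro sum.cong refl sum.swap)
  finally have eq: "(\<Sum>i=1..n. (weight i \<omega>)\<^sup>2 * ?s i) = (\<Sum>b=1..B. \<Sum>b'=1..B. \<Sum>i=1..n. q b i * q b' i * ?s i) / (real B)\<^sup>2" .
  have "n / lam ^ CARD('d) * (\<Sum>i=1..n. q b i * q b' i * ?s i) = pair_term (T b \<omega>) (T b' \<omega>) \<omega>" for b b'
    unfolding pair_term_def q_def indicator_inter_arith sum_divide_distrib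
    by (intro arg_cong[of _ _ "\<lambda>z. n / lam ^ CARD('d) * z"] sum.cong refl) simp
  then show ?thesis unfolding eq by (simp add: sum_distrib_left)
qed

text \<open>Summands in order: the diagonal pairs, the limit subtracted from them, the error of
  distinct pairs, the fluctuation of the overlaps, and the error of the mean overlap.
  \<open>c\<close> is a bound for (1 + ln n)^d relative to \<open>B\<close>.\<close>

definition "mse_const c = 8 * diag_const * c + 8 * (Sigma_limit f sig2 x)\<^sup>2 + 4 * pair_const
  + 16 * (sig2 x / f x)\<^sup>2 * (moment_const ^ CARD('d))\<^sup>2
  + 4 * (sig2 x / f x)\<^sup>2 * overlap_const\<^sup>2 * (lam0 powr (2 * \<gamma>) / lam0\<^sup>2)"

lemma consts_nonneg: "0 \<le> diag_const" "0 \<le> pair_const" "0 \<le> overlap_const"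
  using fl(1) \<tau>(1) lam0(1) const_nonneg moment_const_ge
  by (auto simp: diag_const_def pair_const_def overlap_const_def intro!: mult_nonneg_nonneg add_nonneg_nonneg)

text \<open>The deviation is split into the diagonal \<open>D1\<close>, the deviation
  \<open>D2\<close> of distinct pairs from their overlaps, the fluctuation \<open>D3\<close> of the
  overlaps around their mean, and the error \<open>e\<close> of that mean. The second claim is what
  allows passing from the non-negative integral to the expectation.\<close>

lemma scaled_variance_deviation:
  fixes c :: real
  assumes c: "(1 + ln n) ^ CARD('d) \<le> c * B"
  shows "(\<integral>\<^sup>+\<omega>. ennreal ((n / lam ^ CARD('d) * (\<Sum>i=1..n. (weight i \<omega>)\<^sup>2 * cube_part sig2 (X i \<omega>)) - Sigma_limit f sig2 x)\<^sup>2) \<partial>M)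
    \<le> ennreal (mse_const c * (lam ^ CARD('d) / n + 1 / B + lam powr (- 2 * \<gamma>)))"
    and "0 \<le> mse_const c * (lam ^ CARD('d) / n + 1 / B + lam powr (- 2 * \<gamma>))"
proof -
  define k \<kappa> c0 where "k = ((4 - 4 * ln 2) / (3 :: real)) ^ CARD('d)" and "\<kappa> = sig2 x / f x" and "c0 = Sigma_limit f sig2 x"
  have c0: "c0 = \<kappa> * k" by (simp add: c0_def Sigma_limit_def k_def \<kappa>_def)
  obtain \<theta> where \<theta>: "0 \<le> \<theta>" "(\<integral>\<^sup>+t. \<integral>\<^sup>+t'. ennreal (scaled_overlap t t') \<partial>mondrian lam \<partial>mondrian lam) = ennreal \<theta>"
    "\<bar>\<theta> - k\<bar> \<le> overlap_const / lam"
    unfolding k_def by (rule mean_overlap)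
  define A R where "A b b' \<omega> = pair_term (T b \<omega>) (T b' \<omega>) \<omega>" and "R b b' \<omega> = scaled_overlap (T b \<omega>) (T b' \<omega>)" for b b' \<omega>
  define V where "V \<omega> = n / lam ^ CARD('d) * (\<Sum>i=1..n. (weight i \<omega>)\<^sup>2 * cube_part sig2 (X i \<omega>))" for \<omega>
  define D1 D2 D3 where "D1 \<omega> = (\<Sum>b=1..B. A b b \<omega> - c0)"
    and "D2 \<omega> = (\<Sum>p\<in>off_diagonal. A (fst p) (snd p) \<omega> - \<kappa> * R (fst p) (snd p) \<omega>)"
    and "D3 \<omega> = (\<Sum>p\<in>off_diagonal. R (fst p) (snd p) \<omega> - \<theta>)" for \<omega>
  define N e where "N = real (card off_diagonal)" and "e = \<theta> - k"
  define m where "m = moment_const ^ CARD('d)"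
  define r1 where "r1 = lam ^ CARD('d) / n + lam powr (- 2 * \<gamma>)"
  define E where "E = (1 + ln n) ^ CARD('d)"
  have B: "1 \<le> real B" using B_ge_1 by simp
  have N: "0 \<le> N" "N \<le> (real B)\<^sup>2" using card_off_diagonal by (auto simp: N_def)
  have E: "0 \<le> E" using n_ge_1 by (simp add: E_def)
  have r1: "0 \<le> r1" using lam_pos by (simp add: r1_def)
  have c_nonneg: "0 \<le> c"
  proof (rule ccontr)
    assume "\<not> 0 \<le> c"
    then have "c * B < 0" using B by (intro mult_neg_pos) auto
    then show False using c E by (simp add: E_def)
  qed
  have Am [measurable]: "A b b' \<in> borel_measurable M" if "b \<in> {1..B}" "b' \<in> {1..B}" for b b'
    unfolding A_def[abs_def] pair_term_eq using that by (intro pair_fn_measurable data_measurable T_measurable)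
  have Rm [measurable]: "R b b' \<in> borel_measurable M" if "b \<in> {1..B}" "b' \<in> {1..B}" for b b'
    unfolding R_def[abs_def] using that by (rule overlap_tree_measurable)
  have off: "fst p \<in> {1..B}" "snd p \<in> {1..B}" "fst p \<noteq> snd p" if "p \<in> off_diagonal" for p
    using that by (auto simp: off_diagonal_def)
  have D1m: "D1 \<in> borel_measurable M"
    unfolding D1_def[abs_def] by (intro borel_measurable_sum borel_measurable_diff Am) auto
  have D2m: "D2 \<in> borel_measurable M"
    unfolding D2_def[abs_def] by (intro borel_measurable_sum borel_measurable_diff borel_measurable_times Am Rm borel_measurable_const off)
  have D3m: "D3 \<in> borel_measurable M"
    unfolding D3_def[abs_def] by (intro borel_measurable_sum borel_measurable_diff Rm borel_measurable_const off)
  \<comment> \<open>Each of the B^2 pairs is compared with the limit; for distinct pairs the overlap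
    and its mean are inserted in between.\<close>
  have dec: "V \<omega> - c0 = (D1 \<omega> + D2 \<omega> + \<kappa> * D3 \<omega> + N * \<kappa> * e) / (real B)\<^sup>2" for \<omega>
  proof -
    have "V \<omega> - c0 = (\<Sum>b=1..B. \<Sum>b'=1..B. A b b' \<omega> - c0) / (real B)\<^sup>2"
    proof -
      have V: "V \<omega> = (\<Sum>b=1..B. \<Sum>b'=1..B. A b b' \<omega>) / (real B)\<^sup>2"
        unfolding V_def A_def by (rule scaled_variance_eq)
      have c: "(\<Sum>b=1..B. \<Sum>b'=1..B. c0) / (real B)\<^sup>2 = c0" using B by (simp add: power2_eq_square)
      show ?thesis unfolding V sum_subtractf diff_divide_distrib c ..
    qed
    also have "(\<Sum>b=1..B. \<Sum>b'=1..B. A b b' \<omega> - c0) = D1 \<omega> + (\<Sum>p\<in>off_diagonal. A (fst p) (snd p) \<omega> - c0)"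
      unfolding D1_def by (rule off_diagonal_sum)
    also have "(\<Sum>p\<in>off_diagonal. A (fst p) (snd p) \<omega> - c0) =
      (\<Sum>p\<in>off_diagonal. (A (fst p) (snd p) \<omega> - \<kappa> * R (fst p) (snd p) \<omega>) + \<kappa> * (R (fst p) (snd p) \<omega> - \<theta>) + \<kappa> * e)"
      by (intro sum.cong refl) (simp add: c0 e_def algebra_simps)
    also have "\<dots> = D2 \<omega> + \<kappa> * D3 \<omega> + N * \<kappa> * e"
      by (simp add: sum.distrib D2_def D3_def N_def sum_distrib_left)
    finally show ?thesis by (simp add: add.assoc)
  qed
  have sq: "(V \<omega> - c0)\<^sup>2 \<le> 4 / real B ^ 4 * (D1 \<omega>)\<^sup>2 + 4 / real B ^ 4 * (D2 \<omega>)\<^sup>2 + 4 * \<kappa>\<^sup>2 / real B ^ 4 * (D3 \<omega>)\<^sup>2 + 4 * \<kappa>\<^sup>2 * e\<^sup>2" for \<omega>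
  proof -
    have B4: "0 < real B ^ 4" "((real B)\<^sup>2)\<^sup>2 = real B ^ 4" using B by simp_all
    have N2: "(N * \<kappa> * e)\<^sup>2 \<le> real B ^ 4 * (\<kappa>\<^sup>2 * e\<^sup>2)"
    proof -
      have "N\<^sup>2 \<le> ((real B)\<^sup>2)\<^sup>2" using N by (intro power_mono)
      then have "N\<^sup>2 * (\<kappa>\<^sup>2 * e\<^sup>2) \<le> real B ^ 4 * (\<kappa>\<^sup>2 * e\<^sup>2)" unfolding B4(2) by (intro mult_right_mono) auto
      then show ?thesis by (simp add: power_mult_distrib)
    qed
    have "(V \<omega> - c0)\<^sup>2 = (D1 \<omega> + D2 \<omega> + \<kappa> * D3 \<omega> + N * \<kappa> * e)\<^sup>2 / real B ^ 4"
      unfolding dec power_divide B4(2) ..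
    also have "\<dots> \<le> 4 * ((D1 \<omega>)\<^sup>2 + (D2 \<omega>)\<^sup>2 + (\<kappa> * D3 \<omega>)\<^sup>2 + (N * \<kappa> * e)\<^sup>2) / real B ^ 4"
      using B4(1) by (intro divide_right_mono sum4_square_le) auto
    also have "\<dots> \<le> 4 * ((D1 \<omega>)\<^sup>2 + (D2 \<omega>)\<^sup>2 + (\<kappa> * D3 \<omega>)\<^sup>2 + real B ^ 4 * (\<kappa>\<^sup>2 * e\<^sup>2)) / real B ^ 4"
      using B4(1) N2 by (intro divide_right_mono mult_left_mono add_left_mono) auto
    also have "\<dots> = 4 / real B ^ 4 * (D1 \<omega>)\<^sup>2 + 4 / real B ^ 4 * (D2 \<omega>)\<^sup>2 + 4 * \<kappa>\<^sup>2 / real B ^ 4 * (D3 \<omega>)\<^sup>2 + 4 * \<kappa>\<^sup>2 * e\<^sup>2"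
      using B4(1) by (simp add: power_mult_distrib distrib_left add_divide_distrib)
    finally show ?thesis .
  qed
  \<comment> \<open>For the B diagonal pairs Cauchy-Schwarz is enough: B^2 times one second moment,
    divided by B^4, has order (1 + ln n)^d / B^2.\<close>
  have I1: "(\<integral>\<^sup>+\<omega>. ennreal ((D1 \<omega>)\<^sup>2) \<partial>M) \<le> ennreal ((real B)\<^sup>2 * (2 * diag_const * E + 2 * c0\<^sup>2))"
  proof -
    have "(\<integral>\<^sup>+\<omega>. ennreal ((A b b \<omega> - c0)\<^sup>2) \<partial>M) \<le> ennreal (2 * diag_const * E + 2 * c0\<^sup>2)" if b: "b \<in> {1..B}" for b
    proof -
      have "(\<integral>\<^sup>+\<omega>. ennreal ((A b b \<omega> - c0)\<^sup>2) \<partial>M) \<le> (\<integral>\<^sup>+\<omega>. ennreal 2 * ennreal ((A b b \<omega>)\<^sup>2) + ennreal (2 * c0\<^sup>2) \<partial>M)"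
      proof (rule nn_integral_mono)
        fix \<omega>
        have "(A b b \<omega> - c0)\<^sup>2 \<le> 2 * (A b b \<omega>)\<^sup>2 + 2 * c0\<^sup>2"
          using zero_le_power2[of "A b b \<omega> + c0"] by (simp add: power2_eq_square algebra_simps)
        then have "ennreal ((A b b \<omega> - c0)\<^sup>2) \<le> ennreal (2 * (A b b \<omega>)\<^sup>2 + 2 * c0\<^sup>2)" by (rule ennreal_leI)
        also have "\<dots> = ennreal 2 * ennreal ((A b b \<omega>)\<^sup>2) + ennreal (2 * c0\<^sup>2)"
          by (subst ennreal_mult[symmetric]) (auto simp flip: ennreal_plus)
        finally show "ennreal ((A b b \<omega> - c0)\<^sup>2) \<le> \<dots>" .
      qed
      also have "\<dots> = ennreal 2 * (\<integral>\<^sup>+\<omega>. ennreal ((A b b \<omega>)\<^sup>2) \<partial>M) + ennreal (2 * c0\<^sup>2)"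
        using Am[OF b b] by (subst nn_integral_add) (auto simp: nn_integral_cmult emeasure_space_1)
      also have "\<dots> \<le> ennreal 2 * ennreal (diag_const * E) + ennreal (2 * c0\<^sup>2)"
        unfolding A_def E_def by (intro add_right_mono mult_left_mono diagonal_deviation[OF b]) auto
      also have "\<dots> = ennreal (2 * (diag_const * E) + 2 * c0\<^sup>2)"
        using consts_nonneg E by (subst ennreal_mult[symmetric]) (auto simp flip: ennreal_plus)
      finally show ?thesis by (simp add: mult.assoc)
    qed
    moreover have "0 \<le> 2 * diag_const * E + 2 * c0\<^sup>2" using consts_nonneg E by simp
    ultimately show ?thesis
      unfolding D1_def using nn_integral_sum_square_le[of "{1..B}" "\<lambda>b \<omega>. A b b \<omega> - c0" M "2 * diag_const * E + 2 * c0\<^sup>2"] Am by simp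
  qed
  \<comment> \<open>The errors of distinct pairs are dependent through the data, so they are added
    by Cauchy-Schwarz; after division by B^4 the average is no worse than a single pair.\<close>
  have I2: "(\<integral>\<^sup>+\<omega>. ennreal ((D2 \<omega>)\<^sup>2) \<partial>M) \<le> ennreal (real B ^ 4 * (pair_const * r1))"
  proof -
    have "(\<integral>\<^sup>+\<omega>. ennreal ((D2 \<omega>)\<^sup>2) \<partial>M) \<le> ennreal (N\<^sup>2 * (pair_const * r1))"
      unfolding D2_def N_def
    proof (rule nn_integral_sum_square_le)
      fix p assume p: "p \<in> off_diagonal"
      show "(\<lambda>\<omega>. A (fst p) (snd p) \<omega> - \<kappa> * R (fst p) (snd p) \<omega>) \<in> borel_measurable M"
        by (intro borel_measurable_diff borel_measurable_times Am Rm borel_measurable_const off[OF p])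
      show "(\<integral>\<^sup>+\<omega>. ennreal ((A (fst p) (snd p) \<omega> - \<kappa> * R (fst p) (snd p) \<omega>)\<^sup>2) \<partial>M) \<le> ennreal (pair_const * r1)"
        unfolding A_def R_def \<kappa>_def r1_def by (rule pair_deviation[OF off[OF p]])
    qed (use consts_nonneg r1 in auto)
    also have "\<dots> \<le> ennreal (real B ^ 4 * (pair_const * r1))"
    proof (intro ennreal_leI mult_right_mono)
      have "N\<^sup>2 \<le> ((real B)\<^sup>2)\<^sup>2" using N by (intro power_mono)
      then show "N\<^sup>2 \<le> real B ^ 4" by simp
    qed (use consts_nonneg r1 in auto)
    finally show ?thesis .
  qed
  have I3: "(\<integral>\<^sup>+\<omega>. ennreal ((D3 \<omega>)\<^sup>2) \<partial>M) \<le> ennreal (4 * real B ^ 3 * m\<^sup>2)"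
    unfolding D3_def R_def m_def by (rule overlap_fluctuation[OF \<theta>(1,2)])
  have B4: "0 \<le> 4 / real B ^ 4" "0 \<le> 4 * \<kappa>\<^sup>2 / real B ^ 4" "0 \<le> 4 * \<kappa>\<^sup>2 * e\<^sup>2" by auto
  have "(\<integral>\<^sup>+\<omega>. ennreal ((V \<omega> - c0)\<^sup>2) \<partial>M) \<le> (\<integral>\<^sup>+\<omega>. ennreal (4 / real B ^ 4) * ennreal ((D1 \<omega>)\<^sup>2) + ennreal (4 / real B ^ 4) * ennreal ((D2 \<omega>)\<^sup>2)
      + ennreal (4 * \<kappa>\<^sup>2 / real B ^ 4) * ennreal ((D3 \<omega>)\<^sup>2) + ennreal (4 * \<kappa>\<^sup>2 * e\<^sup>2) \<partial>M)"
  proof (rule nn_integral_mono)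
    fix \<omega>
    have gen: "ennreal (a * b + a * b' + a'' * b'' + z) = ennreal a * ennreal b + ennreal a * ennreal b' + ennreal a'' * ennreal b'' + ennreal z"
      if "0 \<le> a" "0 \<le> b" "0 \<le> b'" "0 \<le> a''" "0 \<le> b''" "0 \<le> z" for a b b' a'' b'' z
      using that by (simp add: ennreal_mult ennreal_plus)
    show "ennreal ((V \<omega> - c0)\<^sup>2) \<le> ennreal (4 / real B ^ 4) * ennreal ((D1 \<omega>)\<^sup>2) + ennreal (4 / real B ^ 4) * ennreal ((D2 \<omega>)\<^sup>2)
      + ennreal (4 * \<kappa>\<^sup>2 / real B ^ 4) * ennreal ((D3 \<omega>)\<^sup>2) + ennreal (4 * \<kappa>\<^sup>2 * e\<^sup>2)"
      unfolding gen[OF B4(1) zero_le_power2 zero_le_power2 B4(2) zero_le_power2 B4(3), symmetric]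
      by (rule ennreal_leI[OF sq])
  qed
  also have "\<dots> = ennreal (4 / real B ^ 4) * (\<integral>\<^sup>+\<omega>. ennreal ((D1 \<omega>)\<^sup>2) \<partial>M) + ennreal (4 / real B ^ 4) * (\<integral>\<^sup>+\<omega>. ennreal ((D2 \<omega>)\<^sup>2) \<partial>M)
      + ennreal (4 * \<kappa>\<^sup>2 / real B ^ 4) * (\<integral>\<^sup>+\<omega>. ennreal ((D3 \<omega>)\<^sup>2) \<partial>M) + ennreal (4 * \<kappa>\<^sup>2 * e\<^sup>2)"
    using D1m D2m D3m by (simp add: nn_integral_add nn_integral_cmult emeasure_space_1)
  also have "\<dots> \<le> ennreal (4 / real B ^ 4) * ennreal ((real B)\<^sup>2 * (2 * diag_const * E + 2 * c0\<^sup>2)) + ennreal (4 / real B ^ 4) * ennreal (real B ^ 4 * (pair_const * r1))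
      + ennreal (4 * \<kappa>\<^sup>2 / real B ^ 4) * ennreal (4 * real B ^ 3 * m\<^sup>2) + ennreal (4 * \<kappa>\<^sup>2 * e\<^sup>2)"
    by (intro add_mono mult_left_mono I1 I2 I3) auto
  also have "\<dots> = ennreal (4 / real B ^ 4 * ((real B)\<^sup>2 * (2 * diag_const * E + 2 * c0\<^sup>2)) + 4 / real B ^ 4 * (real B ^ 4 * (pair_const * r1))
      + 4 * \<kappa>\<^sup>2 / real B ^ 4 * (4 * real B ^ 3 * m\<^sup>2) + 4 * \<kappa>\<^sup>2 * e\<^sup>2)"
  proof -
    have "0 \<le> (real B)\<^sup>2 * (2 * diag_const * E + 2 * c0\<^sup>2)" "0 \<le> real B ^ 4 * (pair_const * r1)" "0 \<le> 4 * real B ^ 3 * m\<^sup>2"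
      using consts_nonneg E r1 by (auto intro!: mult_nonneg_nonneg add_nonneg_nonneg)
    with B4 show ?thesis by (simp only: ennreal_mult[symmetric] ennreal_plus[symmetric] mult_nonneg_nonneg add_nonneg_nonneg)
  qed
  finally have total: "(\<integral>\<^sup>+\<omega>. ennreal ((V \<omega> - c0)\<^sup>2) \<partial>M) \<le> \<dots>" .
  define a1 a2 a3 a4 a5 where "a1 = 8 * diag_const * c" and "a2 = 8 * c0\<^sup>2" and "a3 = 4 * pair_const"
    and "a4 = 16 * \<kappa>\<^sup>2 * m\<^sup>2" and "a5 = 4 * \<kappa>\<^sup>2 * overlap_const\<^sup>2 * (lam0 powr (2 * \<gamma>) / lam0\<^sup>2)"
  define u w z where "u = lam ^ CARD('d) / n" and "w = 1 / real B" and "z = lam powr (- 2 * \<gamma>)"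
  have a: "0 \<le> a1" "0 \<le> a2" "0 \<le> a3" "0 \<le> a4" "0 \<le> a5"
    using consts_nonneg c_nonneg lam0(1) by (auto simp: a1_def a2_def a3_def a4_def a5_def)
  have u: "0 \<le> u" "0 \<le> w" "0 \<le> z" using lam_pos by (auto simp: u_def w_def z_def)
  \<comment> \<open>Here the growth of \<open>B\<close> enters: (1 + ln n)^d / B^2 is at most c /
    B.\<close>
  have t1: "4 / real B ^ 4 * ((real B)\<^sup>2 * (2 * diag_const * E + 2 * c0\<^sup>2)) \<le> (a1 + a2) * w"
  proof -
    have "4 / real B ^ 4 * ((real B)\<^sup>2 * (2 * diag_const * E + 2 * c0\<^sup>2)) = 8 * diag_const * E / (real B)\<^sup>2 + 8 * c0\<^sup>2 / (real B)\<^sup>2"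
      using B by (simp add: field_simps power4_eq_xxxx power2_eq_square)
    also have "\<dots> \<le> 8 * diag_const * (c * B) / (real B)\<^sup>2 + 8 * c0\<^sup>2 / real B"
    proof (intro add_mono divide_right_mono mult_left_mono divide_left_mono)
      show "E \<le> c * B" using c by (simp add: E_def)
      show "real B \<le> (real B)\<^sup>2" using B by (simp add: power2_eq_square)
    qed (use B consts_nonneg in auto)
    also have "\<dots> = (a1 + a2) * w" using B by (simp add: a1_def a2_def w_def power2_eq_square add_divide_distrib)
    finally show ?thesis .
  qed
  have t2: "4 / real B ^ 4 * (real B ^ 4 * (pair_const * r1)) = a3 * (u + z)"
    using B by (simp add: a3_def u_def z_def r1_def)
  have t3: "4 * \<kappa>\<^sup>2 / real B ^ 4 * (4 * real B ^ 3 * m\<^sup>2) = a4 * w"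
    using B by (simp add: a4_def w_def power4_eq_xxxx power3_eq_cube)
  \<comment> \<open>The squared error is of order 1 / lam^2. Since lam0 / lam and
    \<open>\<gamma>\<close> are at most 1, it is at most a constant times the power - 2 \<gamma> of
    \<open>lam\<close>.\<close>
  have t4: "4 * \<kappa>\<^sup>2 * e\<^sup>2 \<le> a5 * z"
  proof -
    have "e\<^sup>2 \<le> (overlap_const / lam)\<^sup>2"
      using \<theta>(3) by (metis e_def abs_ge_zero power2_abs power_mono)
    also have "\<dots> = overlap_const\<^sup>2 / lam0\<^sup>2 * (lam0 / lam)\<^sup>2" using lam0(1) by (simp add: power_divide)
    also have "\<dots> \<le> overlap_const\<^sup>2 / lam0\<^sup>2 * (lam0 powr (2 * \<gamma>) * lam powr (- 2 * \<gamma>))"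
    proof (rule mult_left_mono)
      have "(lam0 / lam)\<^sup>2 = (lam0 / lam) powr 2" using lam0 lam_pos by (simp add: powr_numeral)
      also have "\<dots> \<le> (lam0 / lam) powr (2 * \<gamma>)" using lam0 lam_pos \<gamma> by (intro powr_mono') auto
      also have "\<dots> = lam0 powr (2 * \<gamma>) * lam powr (- 2 * \<gamma>)" by (simp add: powr_divide powr_minus_divide)
      finally show "(lam0 / lam)\<^sup>2 \<le> lam0 powr (2 * \<gamma>) * lam powr (- 2 * \<gamma>)" .
    qed simp
    finally have "4 * \<kappa>\<^sup>2 * e\<^sup>2 \<le> 4 * \<kappa>\<^sup>2 * (overlap_const\<^sup>2 / lam0\<^sup>2 * (lam0 powr (2 * \<gamma>) * lam powr (- 2 * \<gamma>)))"
      by (rule mult_left_mono) simp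
    then show ?thesis by (simp add: a5_def z_def mult_ac)
  qed
  have mse: "mse_const c = a1 + a2 + a3 + a4 + a5"
    by (simp add: mse_const_def a1_def a2_def a3_def a4_def a5_def c0_def \<kappa>_def m_def)
  have "(a1 + a2) * w \<le> (a1 + a2) * (u + w + z)" "a3 * (u + z) \<le> a3 * (u + w + z)" "a4 * w \<le> a4 * (u + w + z)" "a5 * z \<le> a5 * (u + w + z)"
    using a u by (auto intro!: mult_left_mono)
  then have "(a1 + a2) * w + a3 * (u + z) + a4 * w + a5 * z \<le> mse_const c * (u + w + z)"
    unfolding mse by (simp add: distrib_right)
  then have "4 / real B ^ 4 * ((real B)\<^sup>2 * (2 * diag_const * E + 2 * c0\<^sup>2)) + 4 / real B ^ 4 * (real B ^ 4 * (pair_const * r1))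
      + 4 * \<kappa>\<^sup>2 / real B ^ 4 * (4 * real B ^ 3 * m\<^sup>2) + 4 * \<kappa>\<^sup>2 * e\<^sup>2 \<le> mse_const c * (u + w + z)"
    using t1 t2 t3 t4 by linarith
  from order_trans[OF total ennreal_leI[OF this]]
  show "(\<integral>\<^sup>+\<omega>. ennreal ((n / lam ^ CARD('d) * (\<Sum>i=1..n. (weight i \<omega>)\<^sup>2 * cube_part sig2 (X i \<omega>)) - Sigma_limit f sig2 x)\<^sup>2) \<partial>M)
    \<le> ennreal (mse_const c * (lam ^ CARD('d) / n + 1 / B + lam powr (- 2 * \<gamma>)))"
    by (simp add: V_def c0_def u_def w_def z_def)
  have "0 \<le> mse_const c * (u + w + z)" unfolding mse using a u by (intro mult_nonneg_nonneg add_nonneg_nonneg)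
  then show "0 \<le> mse_const c * (lam ^ CARD('d) / n + 1 / B + lam powr (- 2 * \<gamma>))" by (simp add: u_def w_def z_def)
qed

text \<open>The formula for the conditional variance holds almost everywhere, which suffices under
  the integral; the finite bound on the non-negative integral also gives integrability.\<close>

lemma Sigma_tilde_mse:
  fixes c :: real
  assumes c: "(1 + ln n) ^ CARD('d) \<le> c * B"
  shows "integrable M (\<lambda>\<omega>. (Sigma_tilde M n B lam X Y T x \<omega> - Sigma_limit f sig2 x)\<^sup>2)"
    and "expectation (\<lambda>\<omega>. (Sigma_tilde M n B lam X Y T x \<omega> - Sigma_limit f sig2 x)\<^sup>2)
      \<le> mse_const c * (lam ^ CARD('d) / n + 1 / B + lam powr (- 2 * \<gamma>))"
proof -
  let ?S = "\<lambda>\<omega>. (Sigma_tilde M n B lam X Y T x \<omega> - Sigma_limit f sig2 x)\<^sup>2"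
  let ?K = "mse_const c * (lam ^ CARD('d) / n + 1 / B + lam powr (- 2 * \<gamma>))"
  have "AE \<omega> in M. Sigma_tilde M n B lam X Y T x \<omega> = n / lam ^ CARD('d) * (\<Sum>i=1..n. (weight i \<omega>)\<^sup>2 * cube_part sig2 (X i \<omega>))"
    using cond_var_estimate by eventually_elim (simp add: Sigma_tilde_def)
  then have "(\<integral>\<^sup>+\<omega>. ennreal (?S \<omega>) \<partial>M) = (\<integral>\<^sup>+\<omega>. ennreal ((n / lam ^ CARD('d) * (\<Sum>i=1..n. (weight i \<omega>)\<^sup>2 * cube_part sig2 (X i \<omega>)) - Sigma_limit f sig2 x)\<^sup>2) \<partial>M)"
    by (intro nn_integral_cong_AE) (auto elim!: eventually_mono)
  also have "\<dots> \<le> ennreal ?K" by (rule scaled_variance_deviation(1)[OF c])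
  finally have le: "(\<integral>\<^sup>+\<omega>. ennreal (?S \<omega>) \<partial>M) \<le> ennreal ?K" .
  have "?S \<in> borel_measurable M"
    unfolding Sigma_tilde_def cond_var_def by measurable
  then show "integrable M ?S"
    using order_le_less_trans[OF le ennreal_less_top] by (intro integrableI_nonneg) auto
  show "expectation ?S \<le> ?K"
    by (rule integral_real_bounded[OF scaled_variance_deviation(2)[OF c] le])
qed

end

section \<open>Constants that do not depend on n\<close>

lemma powr_exponent_le:
  fixes s D :: real
  assumes "0 \<le> s" "s \<le> D" "1 \<le> D" "\<gamma> \<le> \<delta>" "\<delta> \<le> 1" "0 < \<gamma>"
  shows "s powr \<delta> \<le> D * s powr \<gamma>"
proof (cases "s = 0")
  case False
  have "s powr \<delta> = s powr (\<delta> - \<gamma>) * s powr \<gamma>" using False assms by (simp add: powr_add[symmetric])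
  also have "\<dots> \<le> D powr (\<delta> - \<gamma>) * s powr \<gamma>" using assms by (intro mult_right_mono powr_mono2) auto
  also have "\<dots> \<le> D powr 1 * s powr \<gamma>" using assms by (intro mult_right_mono powr_mono) auto
  finally show ?thesis using assms by simp
qed (use assms in simp)

lemma cube_distance_le:
  fixes u x :: "real ^ 'd::finite"
  assumes "u \<in> unit_cube" "x \<in> unit_cube"
  shows "norm (u - x) \<le> real CARD('d)"
proof -
  have "norm (u - x) \<le> (\<Sum>j\<in>UNIV. \<bar>(u - x) $ j\<bar>)" by (rule norm_le_l1_cart)
  also have "\<dots> \<le> (\<Sum>j\<in>(UNIV :: 'd set). 1)"
  proof (rule sum_mono)
    fix j
    have "0 \<le> u $ j" "u $ j \<le> 1" "0 \<le> x $ j" "x $ j \<le> 1" using assms by (auto simp: mem_box_cart)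
    then show "\<bar>(u - x) $ j\<bar> \<le> 1" by simp
  qed
  finally show ?thesis by simp
qed

text \<open>\<open>f\<close> and \<open>sig2\<close> are to share one exponent. Distances in the
  cube are at most d, so lowering the exponent costs at most a factor d.\<close>

lemma holder_class_lower_exponent:
  fixes g :: "real ^ 'd::finite \<Rightarrow> real"
  assumes g: "g \<in> holder_class \<beta>" "\<beta> > 0" and \<gamma>: "0 < \<gamma>" "\<gamma> \<le> min 1 \<beta>" and x: "x \<in> unit_cube"
  obtains L where "0 \<le> L" "\<And>u. u \<in> unit_cube \<Longrightarrow> \<bar>g u - g x\<bar> \<le> L * norm (u - x) powr \<gamma>"
proof -
  obtain C where C: "C \<ge> 0" "\<And>y z. y \<in> unit_cube \<Longrightarrow> z \<in> unit_cube \<Longrightarrow> \<bar>g y - g z\<bar> \<le> C * norm (y - z) powr min 1 \<beta>"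
    using holder_class_lipschitz[OF g] by metis
  have d: "1 \<le> real CARD('d)" by (simp add: Suc_leI)
  show ?thesis
  proof (rule that)
    show "0 \<le> C * real CARD('d)" using C by simp
    fix u :: "real ^ 'd" assume u: "u \<in> unit_cube"
    have "\<bar>g u - g x\<bar> \<le> C * norm (u - x) powr min 1 \<beta>" by (rule C(2)[OF u x])
    also have "\<dots> \<le> C * (real CARD('d) * norm (u - x) powr \<gamma>)"
      using \<gamma> d by (intro mult_left_mono powr_exponent_le cube_distance_le u x C) auto
    finally show "\<bar>g u - g x\<bar> \<le> C * real CARD('d) * norm (u - x) powr \<gamma>" by (simp add: mult.assoc)
  qed
qed

text \<open>At n = 1 the logarithm vanishes and gives nothing, so \<open>lam 1\<close> itself enters
  the minimum; from n = 2 on the cube of ln 2 bounds the lifetimes from below.\<close>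

lemma log_power_lower_bound:
  assumes pos: "\<And>n. n \<ge> 1 \<Longrightarrow> lam n > 0" and g: "lesssim (\<lambda>n. (ln (real n)) ^ 3) lam"
  obtains lam0 where "0 < lam0" "\<And>n. n \<ge> 1 \<Longrightarrow> lam0 \<le> lam n"
proof -
  obtain C where C: "\<And>n. n \<ge> 1 \<Longrightarrow> (ln (real n)) ^ 3 \<le> C * lam n"
    using g unfolding lesssim_def by blast
  define D where "D = max C 1"
  have D: "0 < D" by (simp add: D_def)
  have l2: "0 < (ln 2 :: real) ^ 3" by simp
  show ?thesis
  proof (rule that)
    show "0 < min (lam 1) ((ln 2) ^ 3 / D)" using pos[of 1] D l2 by simp
    fix n :: nat assume n: "n \<ge> 1"
    show "min (lam 1) ((ln 2) ^ 3 / D) \<le> lam n"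
    proof (cases "n = 1")
      case False
      then have "(ln 2 :: real) ^ 3 \<le> (ln (real n)) ^ 3" using n by (intro power_mono) auto
      also have "\<dots> \<le> C * lam n" by (rule C[OF n])
      also have "\<dots> \<le> D * lam n" using pos[OF n] by (intro mult_right_mono) (auto simp: D_def)
      finally have "(ln 2) ^ 3 / D \<le> lam n" using D by (simp add: pos_divide_le_eq mult.commute)
      then show ?thesis by (rule min.coboundedI2)
    qed simp
  qed
qed

text \<open>1 + ln n is at most twice the maximum of 1 and ln n, and the value 1 is covered by B
  being at least 1.\<close>

lemma log_power_shift:
  assumes pos: "\<And>n. n \<ge> 1 \<Longrightarrow> B n \<ge> 1" and g: "lesssim (\<lambda>n. (ln (real n)) ^ d) (\<lambda>n. real (B n))"
  obtains c where "\<And>n. n \<ge> 1 \<Longrightarrow> (1 + ln (real n)) ^ d \<le> c * real (B n)"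
proof -
  obtain C where C: "\<And>n. n \<ge> 1 \<Longrightarrow> (ln (real n)) ^ d \<le> C * real (B n)"
    using g unfolding lesssim_def by blast
  show ?thesis
  proof (rule that)
    fix n :: nat assume n: "n \<ge> 1"
    have ln: "0 \<le> ln (real n)" using n by simp
    have B: "1 \<le> real (B n)" using pos[OF n] by simp
    have M: "max 1 C * 1 \<le> max 1 C * real (B n)" using B by (intro mult_left_mono) auto
    have "(1 + ln (real n)) ^ d \<le> (2 * max 1 (ln (real n))) ^ d" using ln by (intro power_mono) auto
    also have "\<dots> = 2 ^ d * (max 1 (ln (real n))) ^ d" by (rule power_mult_distrib)
    also have "(max 1 (ln (real n))) ^ d \<le> max 1 C * real (B n)"
    proof (cases "ln (real n) \<le> 1")
      case True
      then have "(max 1 (ln (real n))) ^ d \<le> max 1 C * 1" by (simp add: max.absorb1)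
      then show ?thesis using M by linarith
    next
      case False
      then have "(max 1 (ln (real n))) ^ d \<le> C * real (B n)" using C[OF n] by (simp add: max_def)
      also have "\<dots> \<le> max 1 C * real (B n)" using B by (intro mult_right_mono) auto
      finally show ?thesis .
    qed
    finally show "(1 + ln (real n)) ^ d \<le> 2 ^ d * max 1 C * real (B n)" by (simp add: mult.assoc)
  qed
qed

theorem lemma2:
  fixes P :: "((real ^ 'd::finite) \<times> real) measure"
    and f mu sig2 :: "real ^ 'd \<Rightarrow> real" and beta_f beta_mu beta_sig :: real
    and x :: "real ^ 'd"
    and lam :: "nat \<Rightarrow> real" and B :: "nat \<Rightarrow> nat"
    and M :: "nat \<Rightarrow> 'w measure"
    and X :: "nat \<Rightarrow> nat \<Rightarrow> 'w \<Rightarrow> real ^ 'd"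
    and Y :: "nat \<Rightarrow> nat \<Rightarrow> 'w \<Rightarrow> real"
    and T :: "nat \<Rightarrow> nat \<Rightarrow> 'w \<Rightarrow> 'd split_tree"
  assumes law: "regression_law P f mu sig2 beta_f beta_mu beta_sig"
    and sample: "\<And>n. n \<ge> 1 \<Longrightarrow> forest_sample (M n) P n (B n) (lam n) (X n) (Y n) (T n)"
    and x: "x \<in> box 0 1"
    and lam_pos: "\<And>n. n \<ge> 1 \<Longrightarrow> lam n > 0"
    and B_pos: "\<And>n. n \<ge> 1 \<Longrightarrow> B n \<ge> 1"
    and lam_growth: "lesssim (\<lambda>n. (ln (real n)) ^ 3) lam"
    and eff_sample: "filterlim (\<lambda>n. real n / lam n ^ CARD('d)) at_top sequentially"
    and B_growth: "lesssim (\<lambda>n. (ln (real n)) ^ CARD('d)) (\<lambda>n. real (B n))"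
  shows "(\<forall>n\<ge>1. integrable (M n)
            (\<lambda>\<omega>. (Sigma_tilde (M n) n (B n) (lam n) (X n) (Y n) (T n) x \<omega> - Sigma_limit f sig2 x)\<^sup>2)) \<and>
         lesssim
            (\<lambda>n. \<integral>\<omega>. (Sigma_tilde (M n) n (B n) (lam n) (X n) (Y n) (T n) x \<omega>
                       - Sigma_limit f sig2 x)\<^sup>2 \<partial>M n)
            (\<lambda>n. lam n ^ CARD('d) / real n + 1 / real (B n)
                 + 1 / lam n powr (2 * min 1 (min beta_f beta_sig)))"
proof -
  interpret law: regression_law P f mu sig2 beta_f beta_mu beta_sig by (rule law)
  have xc: "x \<in> unit_cube" using x box_subset_cbox by blast
  define \<gamma> where "\<gamma> = min 1 (min beta_f beta_sig)"
  have \<gamma>: "0 < \<gamma>" "\<gamma> \<le> 1" "\<gamma> \<le> min 1 beta_f" "\<gamma> \<le> min 1 beta_sig"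
    using law.f_holder(1) law.sig2_holder(1) by (auto simp: \<gamma>_def)
  obtain fl where fl: "0 < fl" "\<And>u. u \<in> unit_cube \<Longrightarrow> fl \<le> f u" using law.f_bounded_below by blast
  obtain fb where fb: "\<And>u. u \<in> unit_cube \<Longrightarrow> \<bar>f u\<bar> \<le> fb"
    using holder_class_bounded[OF law.f_holder(2,1)] by metis
  obtain sb where sb: "\<And>u. u \<in> unit_cube \<Longrightarrow> \<bar>sig2 u\<bar> \<le> sb"
    using holder_class_bounded[OF law.sig2_holder(2,1)] by metis
  obtain Lf where Lf: "0 \<le> Lf" "\<And>u. u \<in> unit_cube \<Longrightarrow> \<bar>f u - f x\<bar> \<le> Lf * norm (u - x) powr \<gamma>"
    using holder_class_lower_exponent[OF law.f_holder(2,1) \<gamma>(1,3) xc] by metis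
  obtain Ls where Ls: "0 \<le> Ls" "\<And>u. u \<in> unit_cube \<Longrightarrow> \<bar>sig2 u - sig2 x\<bar> \<le> Ls * norm (u - x) powr \<gamma>"
    using holder_class_lower_exponent[OF law.sig2_holder(2,1) \<gamma>(1,4) xc] by metis
  obtain lam0 where lam0: "0 < lam0" "\<And>n. n \<ge> 1 \<Longrightarrow> lam0 \<le> lam n"
    using log_power_lower_bound[OF lam_pos lam_growth] by metis
  obtain c where c: "\<And>n. n \<ge> 1 \<Longrightarrow> (1 + ln (real n)) ^ CARD('d) \<le> c * real (B n)"
    using log_power_shift[OF B_pos B_growth] by metis
  \<comment> \<open>One constant serves both Hoelder bounds; \<open>\<tau>\<close> takes the nearest
    of the 2d faces of the cube, scaled by the lower bound \<open>lam0\<close> of the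
    lifetimes.\<close>
  define L \<tau> where "L = Lf + Ls" and "\<tau> = lam0 * Min (range (gap_max x))"
  have L: "\<bar>f u - f x\<bar> \<le> L * norm (u - x) powr \<gamma>" "\<bar>sig2 u - sig2 x\<bar> \<le> L * norm (u - x) powr \<gamma>" if "u \<in> unit_cube" for u
  proof -
    have "0 \<le> Lf * norm (u - x) powr \<gamma>" "0 \<le> Ls * norm (u - x) powr \<gamma>" using Lf(1) Ls(1) by auto
    then show "\<bar>f u - f x\<bar> \<le> L * norm (u - x) powr \<gamma>" "\<bar>sig2 u - sig2 x\<bar> \<le> L * norm (u - x) powr \<gamma>"
      using Lf(2)[OF that] Ls(2)[OF that] by (simp_all add: L_def distrib_right)
  qed
  have "Min (range (gap_max x)) \<in> range (gap_max x)" by (intro Min_in) auto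
  then have \<tau>: "0 < \<tau>" "\<tau> \<le> lam0 * gap_max x i" for i
    using gap_max_pos[OF x] lam0(1) by (auto simp: \<tau>_def)
  have bounds: "forest_bounds (M n) P f mu sig2 beta_f beta_mu beta_sig n (B n) (lam n) (X n) (Y n) (T n) x fl fb sb L \<gamma> \<tau> lam0"
    if n: "n \<ge> 1" for n
  proof (intro forest_bounds.intro mondrian_forest.intro law sample[OF n] mondrian_forest_axioms.intro forest_bounds_axioms.intro)
    show "0 \<le> L" using Lf Ls by (simp add: L_def)
    show "f u \<le> fb" if "u \<in> unit_cube" for u using fb[OF that] by linarith
    show "sig2 u \<le> sb" if "u \<in> unit_cube" for u using sb[OF that] by linarith
  qed (use x n B_pos lam_pos fl L \<gamma> \<tau> lam0 in auto)
  \<comment> \<open>\<open>mse_const\<close> is built only from parameters that are the same for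
    every n, so the interpretation at n = 1 provides a name for the common constant.\<close>
  interpret one: forest_bounds "M 1" P f mu sig2 beta_f beta_mu beta_sig 1 "B 1" "lam 1" "X 1" "Y 1" "T 1" x fl fb sb L \<gamma> \<tau> lam0
    by (rule bounds) simp
  have main: "integrable (M n) (\<lambda>\<omega>. (Sigma_tilde (M n) n (B n) (lam n) (X n) (Y n) (T n) x \<omega> - Sigma_limit f sig2 x)\<^sup>2) \<and>
    (\<integral>\<omega>. (Sigma_tilde (M n) n (B n) (lam n) (X n) (Y n) (T n) x \<omega> - Sigma_limit f sig2 x)\<^sup>2 \<partial>M n)
      \<le> one.mse_const c * (lam n ^ CARD('d) / real n + 1 / real (B n) + 1 / lam n powr (2 * min 1 (min beta_f beta_sig)))"
    if n: "n \<ge> 1" for n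
  proof -
    interpret fb: forest_bounds "M n" P f mu sig2 beta_f beta_mu beta_sig n "B n" "lam n" "X n" "Y n" "T n" x fl fb sb L \<gamma> \<tau> lam0
      by (rule bounds[OF n])
    have "lam n powr (- 2 * \<gamma>) = 1 / lam n powr (2 * min 1 (min beta_f beta_sig))"
      by (simp add: \<gamma>_def powr_minus_divide)
    then show ?thesis using fb.Sigma_tilde_mse[OF c[OF n]] by simp
  qed
  then show ?thesis unfolding lesssim_def by blast
qed

end
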